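(* Grant the Standing Assumption and let $f_0\in C^3(\mathbb{R})$. Let $X$ be the solution of the SPDE with reaction function $f=f_0$ on $\Lambda=\lambda\bar\Lambda$, under $P_{f_0}$. (a) For every $\bar y\in\bar\Lambda$ and $0\le t\le T$, $X_t(\lambda\bar y)\to Z^{\bar y}_t(0)$ in distribution as $\lambda\to\infty$. (b) For every $g\in L^1(\mathbb{R})$, $$\mathcal G_\lambda(g):=\int_0^T\frac1\lambda\int_{\lambda\bar\Lambda}g(X_t(y))\,dy\,dt-\int_0^T\int_{\bar\Lambda}E_{f_0}\big[g(Z^{\bar y}_t(0))\big]\,d\bar y\,dt\longrightarrow 0$$ in $P_{f_0}$-probability as $\lambda\to\infty$.
   Context: Fix $T>0$ and an open interval $\bar\Lambda\subset\mathbb{R}$ of length $1$; for $\lambda\ge1$ set $\Lambda=\lambda\bar\Lambda$. Let $\Delta$ be the Neumann Laplacian on $\Lambda$, $G^\lambda_t(y,\eta)$ ($t>0$, $y,\eta\in\Lambda$) the Neumann heat kernel on $\Lambda$, and $\mathcal W$ space-time white noise, i.e. an isonormal Gaussian process on $L^2([0,T],L^2(\Lambda))$ (with associated cylindrical Wiener process $W$ on $L^2(\Lambda)$). For Lipschitz $f:\mathbb{R}\to\mathbb{R}$ and a deterministic continuous initial condition $X_0$, $X=(X_t(y))_{t\in[0,T],y\in\Lambda}$ is the random field (mild) solution of $dX_t=\Delta X_t\,dt+f(X_t)\,dt+dW_t$ with homogeneous Neumann boundary conditions: $X_t(y)=\int_\Lambda G^\lambda_t(y,\eta)X_0(\eta)d\eta+\int_0^t\int_\Lambda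 G^\lambda_{t-s}(y,\eta)\mathcal W(d\eta,ds)+\int_0^t\int_\Lambda G^\lambda_{t-s}(y,\eta)f(X_s(\eta))\,d\eta\,ds$. $P_f$, $E_f$ denote its law and expectation. Convention: for $s\ge0$, $C^s(\mathbb{R})$ is the space of functions with finite Hölder norm $\|f\|_{C^s}=\max_{k\le\lfloor s\rfloor}\|f^{(k)}\|_\infty+\sup_{x\ne y}|f^{(\lfloor s\rfloor)}(x)-f^{(\lfloor s\rfloor)}(y)|/|x-y|^{s-\lfloor s\rfloor}$ (all derivatives up to order $\lfloor s\rfloor$ are bounded). Standing Assumption: $\Xi\subset\mathbb{R}$ is a fixed compact interval, $\Theta=\{f\in C^3(\mathbb{R}):\operatorname{supp}f\subset\Xi\}$, and there is $\chi\in H^{\tilde s}(\bar\Lambda)$ for some $\tilde s>3/2$ (independent of $\lambda$) such that $X_0(y)=\chi(y/\lambda)$ for all $y\in\Lambda$. Limit process: for $\bar y\in\bar\Lambda$, $Z^{\bar y}=(Z^{\bar y}_t(y))_{t\in[0,T],y\in\mathbb{R}}$ is the random field solution on the whole line $\mathbb{R}$ of $dZ_t=\Delta Z_t\,dt+f_0(Z_t)\,dt+dW_t$ ($W$ cylindrical on $L^2(\mathbb R)$) with spatially constant initial condition $Z^{\bar y}_0\equiv\chi(\bar y)$. *)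

theory Defs
  imports "HOL-Probability.Probability"
begin

text \<open>C^3(R) in the paper's Hoelder convention: f three times differentiable with continuous
  third derivative, and f, f', f'', f''' all bounded (the Hoelder seminorm of order 0 of f'''
  is then automatically finite).\<close>
definition C3 :: "(real \<Rightarrow> real) \<Rightarrow> bool" where
  "C3 f \<longleftrightarrow> (\<exists>f1 f2 f3.
      (\<forall>x. (f has_real_derivative f1 x) (at x)) \<and>
      (\<forall>x. (f1 has_real_derivative f2 x) (at x)) \<and>
      (\<forall>x. (f2 has_real_derivative f3 x) (at x)) \<and>
      continuous_on UNIV f3 \<and>
      bounded (range f) \<and> bounded (range f1) \<and> bounded (range f2) \<and> bounded (range f3))"

text \<open>Sobolev(-Slobodeckij) space H^s on the open interval (a,b), s \<ge> 0:
  with m = floor s and sigma = s - m, chi has derivatives d 1, ..., d m in the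
  absolutely continuous sense (d k is the indefinite integral of d (k+1)), all d k in L^2(a,b),
  and if sigma > 0 the Gagliardo seminorm of d m of order sigma is finite.\<close>
definition sobolev_H :: "real \<Rightarrow> real \<Rightarrow> real \<Rightarrow> (real \<Rightarrow> real) \<Rightarrow> bool" where
  "sobolev_H s a b chi \<longleftrightarrow> 0 \<le> s \<and> a < b \<and>
    (let m = nat \<lfloor>s\<rfloor>; \<sigma> = s - real m; c = (a + b) / 2 in
     \<exists>d :: nat \<Rightarrow> real \<Rightarrow> real.
        (\<forall>x\<in>{a<..<b}. d 0 x = chi x) \<and>
        (\<forall>k\<le>m. set_borel_measurable lborel {a<..<b} (d k) \<and>
                 set_integrable lborel {a<..<b} (\<lambda>x. (d k x)^2)) \<and>
        (\<forall>k<m. \<forall>x\<in>{a<..<b}. d k x = d k c + (LBINT y=c..x. d (Suc k) y)) \<and>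
        (\<sigma> > 0 \<longrightarrow> set_integrable lborel ({a<..<b} \<times> {a<..<b})
              (\<lambda>p. (d m (fst p) - d m (snd p))^2 / \<bar>fst p - snd p\<bar> powr (1 + 2 * \<sigma>))))"

text \<open>Neumann heat kernel of the Laplacian d^2/dy^2 on (a,b), via its eigenfunction expansion;
  set to 0 for t \<le> 0.\<close>
definition neumann_kernel :: "real \<Rightarrow> real \<Rightarrow> real \<Rightarrow> real \<Rightarrow> real \<Rightarrow> real" where
  "neumann_kernel a b t y \<eta> =
    (if t \<le> 0 then 0 else
      1 / (b - a) + 2 / (b - a) *
        (\<Sum>k. exp (- t * (real (Suc k) * pi / (b - a))^2) *
              cos (real (Suc k) * pi * (y - a) / (b - a)) *
              cos (real (Suc k) * pi * (\<eta> - a) / (b - a))))"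

definition heat_kernel :: "real \<Rightarrow> real \<Rightarrow> real \<Rightarrow> real" where
  "heat_kernel t y \<eta> =
    (if t \<le> 0 then 0 else exp (- ((y - \<eta>)^2) / (4 * t)) / sqrt (4 * pi * t))"

definition square_int :: "(real \<times> real) set \<Rightarrow> (real \<times> real \<Rightarrow> real) \<Rightarrow> bool" where
  "square_int S h \<longleftrightarrow> set_borel_measurable lborel S h \<and> set_integrable lborel S (\<lambda>p. (h p)^2)"

text \<open>Isonormal Gaussian process on L^2(S), S \<subseteq> time \<times> space: W assigns to every
  square integrable h on S a random variable W h, and the family is centred jointly Gaussian
  with covariance the L^2(S) inner product; i.e. every finite linear combination
  sum c_i W h_i has characteristic function exp(-u^2 ||sum c_i h_i||^2 / 2).\<close>
definition isonormal :: "'a measure \<Rightarrow> (real \<times> real) set \<Rightarrow> ((real \<times> real \<Rightarrow> real) \<Rightarrow> 'a \<Rightarrow> real) \<Rightarrow> bool" where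
  "isonormal M S W \<longleftrightarrow>
    (\<forall>h. square_int S h \<longrightarrow> W h \<in> borel_measurable M) \<and>
    (\<forall>(hs :: (real \<times> real \<Rightarrow> real) list) (cs :: real list).
       length cs = length hs \<and> (\<forall>h\<in>set hs. square_int S h) \<longrightarrow>
       (\<forall>u. char (distr M borel (\<lambda>\<omega>. \<Sum>i<length hs. cs ! i * W (hs ! i) \<omega>)) u =
            complex_of_real (exp (- (u^2 *
               set_lebesgue_integral lborel S (\<lambda>p. (\<Sum>i<length hs. cs ! i * (hs ! i) p)^2)) / 2))))"

text \<open>X is a mild solution on [0,T] \<times> I of dX = Delta X dt + f(X) dt + dW with heat kernel K,
  initial condition X0 and noise W (isonormal on L^2([0,T] \<times> I)): X is jointly measurable,
  has uniformly bounded second moments (the standard uniqueness class), and for every (t,y)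
  the mild equation holds almost surely.  The stochastic integral of the deterministic
  integrand (s,eta) \<mapsto> 1_{s<t} K_{t-s}(y,eta) is W applied to it.\<close>
definition mild_solution ::
  "'a measure \<Rightarrow> real \<Rightarrow> real set \<Rightarrow> (real \<Rightarrow> real \<Rightarrow> real \<Rightarrow> real) \<Rightarrow> (real \<Rightarrow> real) \<Rightarrow>
   (real \<Rightarrow> real) \<Rightarrow> ((real \<times> real \<Rightarrow> real) \<Rightarrow> 'a \<Rightarrow> real) \<Rightarrow> (real \<Rightarrow> real \<Rightarrow> 'a \<Rightarrow> real) \<Rightarrow> bool" where
  "mild_solution M T I K X0 f W X \<longleftrightarrow>
    (\<lambda>z. X (fst (fst z)) (snd (fst z)) (snd z)) \<in> borel_measurable ((lborel :: (real \<times> real) measure) \<Otimes>\<^sub>M M) \<and>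
    (\<exists>C. \<forall>t\<in>{0..T}. \<forall>y\<in>I. integrable M (\<lambda>\<omega>. (X t y \<omega>)^2) \<and> (\<integral>\<omega>. (X t y \<omega>)^2 \<partial>M) \<le> C) \<and>
    (\<forall>y\<in>I. AE \<omega> in M. X 0 y \<omega> = X0 y) \<and>
    (\<forall>t\<in>{0<..T}. \<forall>y\<in>I. AE \<omega> in M.
       X t y \<omega> =
         set_lebesgue_integral lborel I (\<lambda>\<eta>. K t y \<eta> * X0 \<eta>)
         + W (\<lambda>p. if fst p < t then K (t - fst p) y (snd p) else 0) \<omega>
         + set_lebesgue_integral lborel {0..t} (\<lambda>s.
              set_lebesgue_integral lborel I (\<lambda>\<eta>. K (t - s) y \<eta> * f (X s \<eta> \<omega>))))"

end

theory Submission
  imports Defs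
begin

text \<open>
  The Neumann kernel on an interval of length \<open>\<lambda>\<close> dominates the heat kernel (both have mass one), so
  the \<open>L\<^sup>1\<close> distance of the two kernels on the interval is the heat mass lost outside it.  Hence,
  around a point \<open>\<lambda> yb\<close>, the covariances of the stochastic convolutions converge to those on the line, and
  they decorrelate at two points \<open>\<lambda> y \<noteq> \<lambda> y'\<close>.  A solution is the limit of Picard iterates, uniformly in
  \<open>\<lambda>\<close> and in the noise, and each iterate is built from the Gaussian forcing by bounded Lipschitz functions and
  integration against the kernel.  Such operations preserve convergence of the pairing with every character of the
  Gaussian family, so \<open>X t (\<lambda> y)\<close> and \<open>X t' (\<lambda> y')\<close> converge jointly to independent copies of the
  limits; this yields (a), and (b) for Lipschitz \<open>g\<close> by computing the second moment of the average.

  For \<open>g\<close> only in \<open>L\<^sup>1\<close> one needs that the laws of the solutions at a time \<open>t\<close> have a density bounded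
  uniformly in \<open>\<lambda>\<close> and integrably in \<open>t\<close>.  The noise on the last stretch of length \<open>\<tau>\<close> before
  \<open>t\<close> contains a Gaussian coordinate along which the solution is strictly increasing, with slope at least of order
  \<open>\<tau>\<^bsup>1/4\<^esup>\<close>, because over a short time the Lipschitz drift cannot compensate the linear part.
\<close>

section \<open>The Neumann heat kernel\<close>

text \<open>The spaces \<open>M lam\<close> for different \<open>lam\<close>, and
  \<open>N yb\<close> for different \<open>yb\<close>, are unrelated, and a mild solution comes with
  joint measurability and second moments but without regularity of paths. Hence only laws can be
  compared, through Gaussian variables at single space-time points; coupling or tightness in a path
  space has nothing to work on. The calculus of multipliers answers this and serves twice: along a
  sequence of \<open>lam\<close> tending to infinity, and for a constant sequence, where convergence
  is equality. The second use shows that the law of a Picard iterate is unchanged when one Gaussian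
  coordinate is resampled. The exponent 1/4: the squared kernel integrated over the last stretch is
  of order \<open>sqrt \<tau>\<close>. This is the variance of the noise from that stretch, so the
  standard deviation \<sigma> is of order \<tau>^(1/4). A unit change of the coordinate moves the
  noise anywhere by at most order \<open>sqrt \<tau> / \<sigma>\<close>, and the drift integrates
  this over a time \<tau>, which is smaller than \<sigma> by a factor of order \<tau>. The density
  bound 1/\<sigma> explodes as t tends to 0, but integrably.\<close>

context
  notes of_nat_Suc [simp del]
begin

text \<open>This is the heat kernel on the circle of length \<open>2 * L\<close>, written as a
  Fourier series. The Neumann kernel on an interval of length \<open>L\<close> arises from it by
  reflection at an endpoint, so all estimates can be made for a function of one spatial
  variable.\<close>

definition cos_series :: "real \<Rightarrow> real \<Rightarrow> real \<Rightarrow> real" where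
  "cos_series L t x = 1 / (2 * L) + 1 / L *
     (\<Sum>k. exp (- t * (real (Suc k) * pi / L)^2) * cos (real (Suc k) * pi * x / L))"

lemma summable_gauss:
  fixes t L :: real
  assumes "t > 0" "L > 0"
  shows "summable (\<lambda>k. exp (- t * (real (Suc k) * pi / L)^2))"
proof (rule summable_comparison_test')
  let ?r = "exp (- t * (pi / L)^2)"
  have "?r < 1" using assms by simp
  then show "summable (\<lambda>k. ?r ^ k)" by (simp add: summable_geometric)
  fix k :: nat
  have "real k \<le> (real (Suc k))^2" by (simp add: power2_eq_square of_nat_Suc algebra_simps)
  then have "real k * (t * (pi / L)^2) \<le> (real (Suc k))^2 * (t * (pi / L)^2)"
    using assms by (intro mult_right_mono) auto
  then show "norm (exp (- t * (real (Suc k) * pi / L)^2)) \<le> ?r ^ k"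
    by (simp add: exp_of_nat_mult[symmetric] power_mult_distrib power_divide mult_ac del: of_nat_Suc)
qed

lemma summable_gauss_mult:
  fixes t L :: real and g :: "nat \<Rightarrow> real"
  assumes "t > 0" "L > 0" "\<And>k. \<bar>g k\<bar> \<le> 1"
  shows "summable (\<lambda>k. exp (- t * (real (Suc k) * pi / L)^2) * g k)"
proof (rule summable_comparison_test'[OF summable_gauss[OF assms(1,2)]])
  fix k show "norm (exp (- t * (real (Suc k) * pi / L)^2) * g k) \<le> exp (- t * (real (Suc k) * pi / L)^2)"
    using assms(3)[of k] by (simp add: abs_mult mult_left_le)
qed

text \<open>The product formula for cosines splits the eigenfunction expansion into a direct term
  and a term reflected at the endpoint \<open>a\<close>.\<close>

lemma neumann_kernel_cos_series:
  assumes "t > 0" "a < b"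
  shows "neumann_kernel a b t y \<eta> = cos_series (b - a) t (y - \<eta>) + cos_series (b - a) t (y + \<eta> - 2 * a)"
proof -
  let ?L = "b - a"
  let ?e = "\<lambda>k. exp (- t * (real (Suc k) * pi / ?L)^2)"
  have *: "?e k * cos (real (Suc k) * pi * (y - a) / ?L) * cos (real (Suc k) * pi * (\<eta> - a) / ?L)
     = (?e k * cos (real (Suc k) * pi * (y - \<eta>) / ?L) + ?e k * cos (real (Suc k) * pi * (y + \<eta> - 2 * a) / ?L)) / 2" for k
  proof -
    define A where "A = real (Suc k) * pi * (y - a) / ?L"
    define B where "B = real (Suc k) * pi * (\<eta> - a) / ?L"
    have 1: "real (Suc k) * pi * (y - \<eta>) / ?L = A - B" unfolding A_def B_def
      by (simp add: algebra_simps add_divide_distrib[symmetric] diff_divide_distrib[symmetric])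
    have 2: "real (Suc k) * pi * (y + \<eta> - 2 * a) / ?L = A + B" unfolding A_def B_def
      by (simp add: algebra_simps add_divide_distrib[symmetric] diff_divide_distrib[symmetric])
    show ?thesis unfolding 1 2 unfolding A_def[symmetric] B_def[symmetric]
      by (simp add: cos_add cos_diff algebra_simps)
  qed
  have s1: "summable (\<lambda>k. ?e k * cos (real (Suc k) * pi * (y - \<eta>) / ?L))"
    using assms by (intro summable_gauss_mult) auto
  have s2: "summable (\<lambda>k. ?e k * cos (real (Suc k) * pi * (y + \<eta> - 2 * a) / ?L))"
    using assms by (intro summable_gauss_mult) auto
  have "neumann_kernel a b t y \<eta> = 1 / ?L + 2 / ?L * (((\<Sum>k. ?e k * cos (real (Suc k) * pi * (y - \<eta>) / ?L))
     + (\<Sum>k. ?e k * cos (real (Suc k) * pi * (y + \<eta> - 2 * a) / ?L))) / 2)"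
    unfolding neumann_kernel_def *
    using assms by (simp only: suminf_divide[OF summable_add[OF s1 s2]] suminf_add[OF s1 s2, symmetric]) simp
  moreover have "1 / l + 2 / l * ((p + q) / 2) = 1 / (2 * l) + 1 / l * p + (1 / (2 * l) + 1 / l * q)" for l p q :: real
    by (simp add: add_divide_distrib)
  ultimately show ?thesis unfolding cos_series_def by metis
qed

lemma cos_series_minus [simp]: "cos_series L t (- x) = cos_series L t x"
  by (simp add: cos_series_def)

lemma cos_series_abs: "cos_series L t \<bar>x\<bar> = cos_series L t x"
  by (cases "x \<ge> 0") auto

lemma cos_series_periodic:
  assumes "L > 0" shows "cos_series L t (x - 2 * L) = cos_series L t x"
proof -
  have "cos (real (Suc k) * pi * (x - 2 * L) / L) = cos (real (Suc k) * pi * x / L)" for k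
  proof -
    have "real (Suc k) * pi * (x - 2 * L) / L = real (Suc k) * pi * x / L - 2 * pi * real (Suc k)"
      using assms by (simp add: field_simps)
    moreover have "sin (2 * pi * real (Suc k)) = 0" "cos (2 * pi * real (Suc k)) = 1"
      using cos_2npi[of "Suc k"] sin_2npi[of "Suc k"] by (simp_all add: mult_ac)
    ultimately show ?thesis by (simp add: cos_diff)
  qed
  then show ?thesis by (simp add: cos_series_def)
qed

lemma continuous_on_cos_series:
  assumes "t > 0" "L > 0" shows "continuous_on A (cos_series L t)"
proof -
  let ?f = "\<lambda>k x. exp (- t * (real (Suc k) * pi / L)^2) * cos (real (Suc k) * pi * x / L)"
  have "uniform_limit UNIV (\<lambda>n x. \<Sum>i<n. ?f i x) (\<lambda>x. suminf (\<lambda>i. ?f i x)) sequentially"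
    using summable_gauss[OF assms] by (intro Weierstrass_m_test) (auto simp: abs_mult mult_left_le)
  then have "continuous_on UNIV (\<lambda>x. suminf (\<lambda>i. ?f i x))"
    by (rule uniform_limit_theorem[rotated]) (use assms in \<open>auto intro!: always_eventually continuous_intros\<close>)
  then have "continuous_on UNIV (cos_series L t)" unfolding cos_series_def
    by (intro continuous_intros)
  then show ?thesis by (rule continuous_on_subset) auto
qed

text \<open>Since \<open>exp x \<ge> 1 + x\<close>, a term is at most \<open>1 / (1 + z^2)\<close>
  for every \<open>z\<close> between 0 and \<open>sqrt \<beta> * Suc k\<close>. With
  \<open>z\<close> from the mean value theorem this is an increment of arctan divided by
  \<open>sqrt \<beta>\<close>, and the increments telescope to at most
  \<open>pi / 2\<close>.\<close>

lemma suminf_inverse_square_le: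
  fixes \<beta> :: real
  assumes "\<beta> > 0"
  shows "(\<Sum>k<n. exp (- \<beta> * (real (Suc k))^2)) \<le> pi / 2 / sqrt \<beta>"
proof -
  have s: "sqrt \<beta> > 0" using assms by simp
  have le: "exp (- \<beta> * (real (Suc k))^2) \<le> (arctan (sqrt \<beta> * real (Suc k)) - arctan (sqrt \<beta> * real k)) / sqrt \<beta>" for k
  proof -
    have "sqrt \<beta> * real k < sqrt \<beta> * real (Suc k)" using s by simp
    from MVT2[OF this, of arctan "\<lambda>x. inverse (1 + x^2)"]
    obtain z where z: "sqrt \<beta> * real k < z" "z < sqrt \<beta> * real (Suc k)"
      "arctan (sqrt \<beta> * real (Suc k)) - arctan (sqrt \<beta> * real k) = (sqrt \<beta> * real (Suc k) - sqrt \<beta> * real k) * inverse (1 + z^2)"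
      using DERIV_arctan by blast
    have z0: "z \<ge> 0" using z(1) s by (smt (verit) mult_nonneg_nonneg of_nat_0_le_iff)
    have "z^2 \<le> (sqrt \<beta> * real (Suc k))^2" using z(2) z0 by (intro power_mono) auto
    also have "\<dots> = \<beta> * (real (Suc k))^2" using assms by (simp add: power_mult_distrib)
    finally have z2: "z^2 \<le> \<beta> * (real (Suc k))^2" .
    have "1 + z^2 \<le> exp (z^2)" by simp
    also have "\<dots> \<le> exp (\<beta> * (real (Suc k))^2)" using z2 by simp
    finally have 1: "1 + z^2 \<le> exp (\<beta> * (real (Suc k))^2)" .
    have "exp (- \<beta> * (real (Suc k))^2) = inverse (exp (\<beta> * (real (Suc k))^2))" by (simp add: exp_minus)
    also have "\<dots> \<le> inverse (1 + z^2)" using 1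
      by (intro le_imp_inverse_le) (auto intro: add_pos_nonneg)
    also have "\<dots> = (arctan (sqrt \<beta> * real (Suc k)) - arctan (sqrt \<beta> * real k)) / sqrt \<beta>"
      unfolding z(3) using s by (simp add: right_diff_distrib[symmetric])
    finally show ?thesis .
  qed
  have "(\<Sum>k<n. exp (- \<beta> * (real (Suc k))^2)) \<le> (\<Sum>k<n. (arctan (sqrt \<beta> * real (Suc k)) - arctan (sqrt \<beta> * real k)) / sqrt \<beta>)"
    by (intro sum_mono le)
  also have "\<dots> = arctan (sqrt \<beta> * real n) / sqrt \<beta>"
    by (simp only: sum_divide_distrib[symmetric] sum_lessThan_telescope[of "\<lambda>k. arctan (sqrt \<beta> * real k)"]) simp
  also have "\<dots> \<le> pi / 2 / sqrt \<beta>" using arctan_ubound[of "sqrt \<beta> * real n"] s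
    by (intro divide_right_mono) auto
  finally show ?thesis .
qed

lemma cos_series_le:
  assumes "t > 0" "L > 0"
  shows "cos_series L t x \<le> 1 / (2 * L) + 1 / (2 * sqrt t)"
proof -
  let ?e = "\<lambda>k. exp (- t * (real (Suc k) * pi / L)^2)"
  have eq: "?e k = exp (- (t * (pi / L)^2) * (real (Suc k))^2)" for k
    by (simp add: power_mult_distrib power_divide mult_ac del: of_nat_Suc)
  have "(\<Sum>k. ?e k * cos (real (Suc k) * pi * x / L)) \<le> (\<Sum>k. ?e k)"
    using assms by (intro suminf_le summable_gauss summable_gauss_mult) (auto simp: mult_left_le)
  also have "\<dots> \<le> pi / 2 / sqrt (t * (pi / L)^2)"
    unfolding eq using assms
    by (intro suminf_le_const summable_gauss[OF assms, unfolded eq] suminf_inverse_square_le) auto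
  also have "\<dots> = L / (2 * sqrt t)" using assms by (simp add: real_sqrt_mult real_sqrt_divide power_divide field_simps)
  finally have "1 / L * (\<Sum>k. ?e k * cos (real (Suc k) * pi * x / L)) \<le> 1 / L * (L / (2 * sqrt t))"
    using assms by (intro mult_left_mono) auto
  then show ?thesis unfolding cos_series_def using assms by simp
qed

text \<open>On intervals of length at least one the constant mode is at most 1, and
  \<open>1 \<le> sqrt T / sqrt t\<close> absorbs it into the singularity. The resulting constant
  does not depend on the length of the interval.\<close>

lemma neumann_kernel_le:
  assumes "t > 0" "t \<le> T" "b - a \<ge> 1"
  shows "neumann_kernel a b t y \<eta> \<le> (sqrt T + 1) / sqrt t"
proof -
  define l where "l = b - a"
  have "neumann_kernel a b t y \<eta> \<le> 2 * (1 / (2 * l) + 1 / (2 * sqrt t))"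
    using neumann_kernel_cos_series[of t a b y \<eta>] cos_series_le[of t "b - a"] assms unfolding l_def by (smt (verit))
  also have "\<dots> = 1 / l + 1 / sqrt t" by (simp add: distrib_left)
  also have "\<dots> \<le> sqrt T / sqrt t + 1 / sqrt t"
  proof -
    have "1 / l \<le> 1" using assms by (simp add: l_def)
    also have "1 \<le> sqrt T / sqrt t" using assms by simp
    finally show ?thesis by simp
  qed
  finally show ?thesis by (simp add: add_divide_distrib)
qed

section \<open>Cosine coefficients of the circle kernel and of the Gaussian on the line\<close>

lemma set_integral_suminf:
  fixes c :: "nat \<Rightarrow> real" and g :: "nat \<Rightarrow> real \<Rightarrow> real"
  assumes S: "S \<in> sets borel" "emeasure lborel S < \<infinity>"
    and c: "summable c" "\<And>k. c k \<ge> 0" and g: "\<And>k. g k \<in> borel_measurable borel" "\<And>k x. \<bar>g k x\<bar> \<le> 1"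
  shows "set_integrable lborel S (\<lambda>x. \<Sum>k. c k * g k x)"
    and "(\<lambda>k. c k * (LBINT x:S. g k x)) sums (LBINT x:S. (\<Sum>k. c k * g k x))"
proof -
  note [measurable] = S(1) g(1)
  have ii: "integrable lborel (\<lambda>x. indicator S x * c k :: real)" for k
    using S by (intro integrable_mult_left integrable_real_indicator) auto
  have int: "integrable lborel (\<lambda>x. indicator S x * (c k * g k x))" for k
    by (rule Bochner_Integration.integrable_bound[OF ii[of k]])
      (auto simp: abs_mult mult_left_le c g split: split_indicator)
  have summ: "summable (\<lambda>k. norm (indicator S x * (c k * g k x) :: real))" for x
    by (rule summable_comparison_test'[OF c(1), of 0])
      (auto simp: abs_mult mult_left_le c g split: split_indicator)
  have le: "(LBINT x. norm (indicator S x * (c k * g k x))) \<le> (LBINT x. indicator S x * c k)" for k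
    using int[of k] ii[of k] by (intro integral_mono integrable_norm) (auto simp: abs_mult mult_left_le c g split: split_indicator)
  have summ2: "summable (\<lambda>k. (LBINT x. norm (indicator S x * (c k * g k x))))"
  proof (rule summable_comparison_test'[of "\<lambda>k. c k * measure lborel S" 0])
    show "summable (\<lambda>k. c k * measure lborel S)" using c by (intro summable_mult2)
    show "norm (LBINT x. norm (indicator S x * (c k * g k x))) \<le> c k * measure lborel S" for k
      using le[of k] S by (simp add: mult.commute)
  qed
  have eq: "(\<Sum>k. indicator S x * (c k * g k x)) = indicator S x * (\<Sum>k. c k * g k x)" for x
    by (auto split: split_indicator)
  show "set_integrable lborel S (\<lambda>x. \<Sum>k. c k * g k x)"
    unfolding set_integrable_def using integrable_suminf[OF int _ summ2] summ by (simp add: eq)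
  have "(\<lambda>k. LBINT x. indicator S x * (c k * g k x)) sums (LBINT x. (\<Sum>k. indicator S x * (c k * g k x)))"
    using sums_integral[OF int _ summ2] summ by simp
  moreover have "(LBINT x. indicator S x * (c k * g k x)) = c k * (LBINT x:S. g k x)" for k
    unfolding set_lebesgue_integral_def by (simp add: mult.left_commute)
  ultimately show "(\<lambda>k. c k * (LBINT x:S. g k x)) sums (LBINT x:S. (\<Sum>k. c k * g k x))"
    unfolding set_lebesgue_integral_def by (simp add: eq)
qed

lemma set_integral_cos:
  fixes p q w v :: real
  assumes "p \<le> q" "w \<noteq> 0"
  shows "(LBINT x:{p..q}. cos (w * x + v)) = (sin (w * q + v) - sin (w * p + v)) / w"
proof -
  have "(LBINT x=p..q. cos (w * x + v)) = sin (w * q + v) / w - sin (w * p + v) / w"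
    using assms by (intro interval_integral_FTC_finite)
      (auto intro!: continuous_intros derivative_eq_intros simp: has_real_derivative_iff_has_vector_derivative[symmetric])
  then show ?thesis using assms by (simp add: interval_integral_Icc diff_divide_distrib)
qed

lemma heat_kernel_normal:
  assumes "t > 0" shows "heat_kernel t y \<eta> = normal_density y (sqrt (2 * t)) \<eta>"
proof -
  have "4 * pi * t = 2 * pi * (2 * t)" by simp
  then show ?thesis using assms
    by (simp add: heat_kernel_def normal_density_def power2_commute)
qed

lemma integral_std_normal_cos: "(LBINT x. std_normal_density x * cos (u * x)) = exp (- (u^2) / 2)"
proof -
  have "complex_of_real (exp (- (u^2) / 2)) = (CLINT x|std_normal_distribution. iexp (u * x))"
    using fun_cong[OF char_std_normal_distribution, of u] unfolding char_def by simp
  also have "\<dots> = (CLINT x|lborel. std_normal_density x *\<^sub>R iexp (u * x))"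
    by (subst integral_density) auto
  finally have eq: "complex_of_real (exp (- (u^2) / 2)) = (CLINT x|lborel. std_normal_density x *\<^sub>R iexp (u * x))" .
  have int: "integrable lborel (\<lambda>x. std_normal_density x *\<^sub>R iexp (u * x))"
    by (rule Bochner_Integration.integrable_bound[OF integrable_normal_density[of 1 0]]) auto
  have "(LBINT x. std_normal_density x * cos (u * x)) = (LBINT x. Re (std_normal_density x *\<^sub>R iexp (u * x)))"
    by (simp add: Re_exp)
  also have "\<dots> = Re (CLINT x|lborel. std_normal_density x *\<^sub>R iexp (u * x))"
    using int by (rule integral_Re)
  also have "\<dots> = exp (- (u^2) / 2)" unfolding eq[symmetric] by simp
  finally show ?thesis .
qed

lemma integral_normal_cos:
  assumes "\<sigma> > 0"
  shows "(LBINT x. normal_density 0 \<sigma> x * cos (u * x)) = exp (- (\<sigma>^2 * u^2) / 2)"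
proof -
  have "(LBINT x. normal_density 0 \<sigma> x * cos (u * x)) = \<bar>\<sigma>\<bar> *\<^sub>R (LBINT x. normal_density 0 \<sigma> (0 + \<sigma> * x) * cos (u * (0 + \<sigma> * x)))"
    using assms by (intro lborel_integral_real_affine) auto
  also have "\<dots> = (LBINT x. std_normal_density x * cos ((u * \<sigma>) * x))"
  proof -
    have "\<sigma> * normal_density 0 \<sigma> (\<sigma> * x) = std_normal_density x" for x
      using assms by (simp add: normal_density_def std_normal_density_def real_sqrt_mult power_mult_distrib)
    then have "\<sigma> * (normal_density 0 \<sigma> (0 + \<sigma> * x) * cos (u * (0 + \<sigma> * x))) = std_normal_density x * cos ((u * \<sigma>) * x)" for x
      by (metis (no_types, lifting) add_0 mult.assoc)
    then show ?thesis using assms by (simp only: integral_mult_right_zero[symmetric] real_scaleR_def abs_of_pos)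
  qed
  finally show ?thesis unfolding integral_std_normal_cos by (simp add: power_mult_distrib mult_ac)
qed

lemma set_integral_cos_period:
  assumes "L > 0"
  shows "(LBINT x:{-L..L}. cos (real_of_int m * pi * x / L)) = (if m = 0 then 2 * L else 0)"
proof (cases "m = 0")
  case True
  then show ?thesis using assms by (simp add: set_lebesgue_integral_def)
next
  case False
  have "(LBINT x:{-L..L}. cos ((real_of_int m * pi / L) * x + 0)) =
     (sin ((real_of_int m * pi / L) * L + 0) - sin ((real_of_int m * pi / L) * (-L) + 0)) / (real_of_int m * pi / L)"
    using assms False by (intro set_integral_cos) auto
  then show ?thesis using assms False by (simp add: mult.commute[of _ pi])
qed

lemma set_integral_cos_series:
  assumes "t > 0" "L > 0"
  shows "(LBINT x:{-L..L}. cos_series L t x * cos (real n * pi * x / L)) = exp (- t * (real n * pi / L)^2)"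
proof -
  let ?e = "\<lambda>k. exp (- t * (real (Suc k) * pi / L)^2)"
  let ?g = "\<lambda>k x. cos (real (Suc k) * pi * x / L) * cos (real n * pi * x / L)"
  have gle: "\<bar>?g k x\<bar> \<le> 1" for k x
    using mult_mono[of "\<bar>cos (real (Suc k) * pi * x / L)\<bar>" 1 "\<bar>cos (real n * pi * x / L)\<bar>" 1]
    by (simp add: abs_mult)
  note A = set_integral_suminf[of "{-L..L}" ?e ?g, OF _ _ summable_gauss[OF assms] _ _ gle]
  have eq: "cos_series L t x * cos (real n * pi * x / L) =
     1 / (2 * L) * cos (real_of_int (int n) * pi * x / L) + 1 / L * (\<Sum>k. ?e k * ?g k x)" for x
  proof -
    have "(\<Sum>k. ?e k * ?g k x) = (\<Sum>k. ?e k * cos (real (Suc k) * pi * x / L)) * cos (real n * pi * x / L)"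
      using summable_gauss_mult[OF assms, of "\<lambda>k. cos (real (Suc k) * pi * x / L)"]
      by (simp add: suminf_mult2 mult.assoc)
    then show ?thesis by (simp add: cos_series_def algebra_simps)
  qed
  have intg: "(LBINT x:{-L..L}. ?g k x) = (if Suc k = n then L else 0)" for k
  proof -
    have split: "?g k x = 1 / 2 * cos (real_of_int (int (Suc k) - int n) * pi * x / L) + 1 / 2 * cos (real_of_int (int (Suc k) + int n) * pi * x / L)" for x
    proof -
      define A where "A = real (Suc k) * pi * x / L"
      define B where "B = real n * pi * x / L"
      have 1: "real_of_int (int (Suc k) - int n) * pi * x / L = A - B" 
        "real_of_int (int (Suc k) + int n) * pi * x / L = A + B" unfolding A_def B_def
        by (simp_all add: algebra_simps add_divide_distrib diff_divide_distrib)
      show ?thesis unfolding 1 unfolding A_def[symmetric] B_def[symmetric] by (simp add: cos_add cos_diff add_divide_distrib diff_divide_distrib)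
    qed
    have i: "set_integrable lborel {-L..L} (\<lambda>x. cos (real_of_int m * pi * x / L))" for m
      by (intro borel_integrable_atLeastAtMost') (use assms in \<open>auto intro!: continuous_intros\<close>)
    have nz: "int (Suc k) + int n \<noteq> 0" by simp
    show ?thesis unfolding split
      apply (subst set_integral_add(2))
      using i assms nz by (auto simp: set_integral_cos_period simp del: of_int_add of_int_diff)
  qed
  have i1: "set_integrable lborel {-L..L} (\<lambda>x. 1 / (2 * L) * cos (real_of_int (int n) * pi * x / L))"
    by (intro borel_integrable_atLeastAtMost') (use assms in \<open>auto intro!: continuous_intros\<close>)
  have i2: "set_integrable lborel {-L..L} (\<lambda>x. 1 / L * (\<Sum>k. ?e k * ?g k x))"
    using A(1) assms by (intro set_integrable_mult_right) auto
  have "(LBINT x:{-L..L}. cos_series L t x * cos (real n * pi * x / L)) =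
     1 / (2 * L) * (if n = 0 then 2 * L else 0) + 1 / L * (LBINT x:{-L..L}. (\<Sum>k. ?e k * ?g k x))"
    unfolding eq using i1 i2 by (subst set_integral_add(2)) (simp_all add: set_integral_cos_period[OF assms(2), of "int n", simplified])
  also have "(LBINT x:{-L..L}. (\<Sum>k. ?e k * ?g k x)) = (\<Sum>k. ?e k * (if Suc k = n then L else 0))"
    using sums_unique[OF A(2)] assms unfolding intg by simp
  also have "(\<Sum>k. ?e k * (if Suc k = n then L else 0)) = (if n = 0 then 0 else L * exp (- t * (real n * pi / L)^2))"
  proof (cases n)
    case (Suc m)
    then have "(\<lambda>k. ?e k * (if Suc k = n then L else 0)) = (\<lambda>k. if k = m then ?e k * L else 0)" by auto
    then show ?thesis using Suc sums_single[of m "\<lambda>k. ?e k * L"] by (simp add: sums_iff)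
  qed simp
  finally show ?thesis using assms by (simp split: if_splits)
qed

text \<open>The circle kernel over one period and the Gaussian over the line have the same cosine
  coefficients \<open>exp (- t * (n * pi / L)^2)\<close>. One more factor
  \<open>cos (pi * x / L)\<close> only averages the integrals with the two neighbouring indices, so
  the agreement passes to all powers; the extra cosine of index \<open>n\<close> is what makes the
  induction work.\<close>

lemma integral_cos_power:
  assumes "t > 0" "L > 0"
  shows "(LBINT x:{-L..L}. cos_series L t x * (cos (pi * x / L) ^ j * cos (real n * pi * x / L))) =
         (LBINT x. normal_density 0 (sqrt (2 * t)) x * (cos (pi * x / L) ^ j * cos (real n * pi * x / L)))"
proof (induction j arbitrary: n)
  case 0
  have "(LBINT x. normal_density 0 (sqrt (2 * t)) x * cos (real n * pi / L * x)) = exp (- t * (real n * pi / L)^2)"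
    using assms by (subst integral_normal_cos) auto
  then show ?case using set_integral_cos_series[OF assms, of n] by simp
next
  case (Suc j)
  let ?c = "\<lambda>x. cos (pi * x / L)"
  let ?N = "normal_density 0 (sqrt (2 * t))"
  \<comment> \<open>The lower neighbour of index 0 is -1, and its cosine is that of index 1.\<close>
  define n' where "n' = (if n = 0 then 1 else n - 1)"
  have eq: "?c x ^ Suc j * cos (real n * pi * x / L) =
      1 / 2 * (?c x ^ j * cos (real (Suc n) * pi * x / L)) + 1 / 2 * (?c x ^ j * cos (real n' * pi * x / L))" for x
  proof -
    define A where "A = pi * x / L"
    have 1: "real (Suc n) * pi * x / L = real n * A + A" "real n * pi * x / L = real n * A" 
      unfolding A_def by (simp_all add: algebra_simps add_divide_distrib of_nat_Suc)
    have 2: "cos (real n' * pi * x / L) = cos (real n * A - A)"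
    proof (cases n)
      case 0 then show ?thesis by (simp add: n'_def A_def of_nat_Suc)
    next
      case (Suc m)
      then have "real n' * pi * x / L = real n * A - A"
        unfolding A_def by (simp add: n'_def algebra_simps add_divide_distrib of_nat_Suc)
      then show ?thesis by simp
    qed
    show ?thesis unfolding 2 unfolding 1 unfolding A_def[symmetric]
      by (simp add: cos_add cos_diff algebra_simps add_divide_distrib diff_divide_distrib)
  qed
  have i1: "set_integrable lborel {-L..L} (\<lambda>x. cos_series L t x * (?c x ^ j * cos (real m * pi * x / L)))" for m
    by (intro borel_integrable_atLeastAtMost') (use assms in \<open>auto intro!: continuous_intros continuous_on_cos_series\<close>)
  have i2: "integrable lborel (\<lambda>x. ?N x * (?c x ^ j * cos (real m * pi * x / L)))" for m
  proof (rule Bochner_Integration.integrable_bound[OF integrable_normal_density[of "sqrt (2 * t)" 0]])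
    have "\<bar>?c x ^ j * cos (real m * pi * x / L)\<bar> \<le> 1" for x
      using mult_mono[of "\<bar>?c x ^ j\<bar>" 1 "\<bar>cos (real m * pi * x / L)\<bar>" 1]
      by (simp add: abs_mult power_abs power_le_one)
    then show "AE x in lborel. norm (?N x * (?c x ^ j * cos (real m * pi * x / L))) \<le> norm (?N x)"
      by (simp add: abs_mult mult_left_le)
  qed (use assms in auto)
  have "(LBINT x:{-L..L}. cos_series L t x * (?c x ^ Suc j * cos (real n * pi * x / L))) =
      1 / 2 * (LBINT x:{-L..L}. cos_series L t x * (?c x ^ j * cos (real (Suc n) * pi * x / L)))
      + 1 / 2 * (LBINT x:{-L..L}. cos_series L t x * (?c x ^ j * cos (real n' * pi * x / L)))"
    unfolding eq distrib_left mult.left_commute[of "cos_series L t _" "1/2"] using i1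
    by (subst set_integral_add(2)) auto
  moreover have "(LBINT x. ?N x * (?c x ^ Suc j * cos (real n * pi * x / L))) =
      1 / 2 * (LBINT x. ?N x * (?c x ^ j * cos (real (Suc n) * pi * x / L)))
      + 1 / 2 * (LBINT x. ?N x * (?c x ^ j * cos (real n' * pi * x / L)))"
    unfolding eq distrib_left mult.left_commute[of "?N _" "1/2"] using i2
    by (subst Bochner_Integration.integral_add) auto
  ultimately show ?case unfolding Suc.IH by simp
qed

text \<open>The continuous even functions of period \<open>2 * L\<close> are exactly the functions
  \<open>q (cos (pi * x / L))\<close> with continuous \<open>q\<close>, so Weierstrass approximation
  of \<open>q\<close> lifts the agreement from powers to all of them. In effect the circle kernel is
  the periodised Gaussian when tested against even functions, which takes the place of Poisson
  summation.\<close>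

lemma integral_cos_continuous:
  fixes q :: "real \<Rightarrow> real"
  assumes "t > 0" "L > 0" and q: "continuous_on {-1..1} q"
  shows "(LBINT x:{-L..L}. cos_series L t x * q (cos (pi * x / L))) =
         (LBINT x. normal_density 0 (sqrt (2 * t)) x * q (cos (pi * x / L)))"
proof -
  let ?c = "\<lambda>x. cos (pi * x / L)"
  let ?N = "normal_density 0 (sqrt (2 * t))"
  have cIn: "?c x \<in> {-1..1}" for x by auto
  have q': "continuous_on A (\<lambda>x. p (?c x))" if "continuous_on {-1..1} p" for p :: "real \<Rightarrow> real" and A
    by (rule continuous_on_compose2[OF that]) (use assms in \<open>auto intro!: continuous_intros\<close>)
  have i1: "set_integrable lborel {-L..L} (\<lambda>x. cos_series L t x * p (?c x))" if "continuous_on {-1..1} p" for p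
    by (intro borel_integrable_atLeastAtMost') (use assms in \<open>auto intro!: continuous_intros continuous_on_cos_series q'[OF that]\<close>)
  have i2: "integrable lborel (\<lambda>x. ?N x * p (?c x))" if p: "continuous_on {-1..1} p" for p
  proof -
    have "bounded (p ` {-1..1})" by (intro compact_imp_bounded compact_continuous_image p) auto
    then obtain K where "\<forall>x\<in>{-1..1}. \<bar>p x\<bar> \<le> K" unfolding bounded_iff by auto
    then have K: "\<And>y. y \<in> {-1..1} \<Longrightarrow> \<bar>p y\<bar> \<le> K" by blast
    have [measurable]: "(\<lambda>x. p (?c x)) \<in> borel_measurable borel"
      by (intro borel_measurable_continuous_onI q' p)
    show ?thesis
    proof (rule Bochner_Integration.integrable_bound)
      show "integrable lborel (\<lambda>x. K * ?N x)" using assms by (intro integrable_mult_right integrable_normal_density) auto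
      show "AE x in lborel. norm (?N x * p (?c x)) \<le> norm (K * ?N x)"
      proof (intro always_eventually allI)
        fix x show "norm (?N x * p (?c x)) \<le> norm (K * ?N x)"
          using mult_left_mono[OF K[OF cIn[of x]], of "?N x"]
          by (simp add: abs_mult mult.commute) (meson abs_ge_self normal_density_nonneg mult_right_mono order_trans)
      qed
    qed auto
  qed
  have poly: "(LBINT x:{-L..L}. cos_series L t x * r (?c x)) = (LBINT x. ?N x * r (?c x))"
    if rp: "real_polynomial_function r" for r
  proof -
    obtain a n where r: "r = (\<lambda>x. \<Sum>i\<le>n. a i * x^i)" using rp unfolding real_polynomial_function_iff_sum by blast
    have e: "A * r (?c x) = (\<Sum>i\<le>n. a i * (A * ?c x ^ i))" for A x
      by (simp add: r sum_distrib_left mult_ac)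
    have cc: "continuous_on {-1..1} (\<lambda>x::real. x^i)" for i by (intro continuous_intros)
    have "(LBINT x:{-L..L}. cos_series L t x * r (?c x)) = (\<Sum>i\<le>n. a i * (LBINT x:{-L..L}. cos_series L t x * ?c x ^ i))"
      unfolding e set_lebesgue_integral_def scaleR_sum_right using i1[OF cc, unfolded set_integrable_def]
      by (subst Bochner_Integration.integral_sum) (auto simp: mult.left_commute)
    moreover have "(LBINT x. ?N x * r (?c x)) = (\<Sum>i\<le>n. a i * (LBINT x. ?N x * ?c x ^ i))"
      unfolding e using i2[OF cc]
      by (subst Bochner_Integration.integral_sum) auto
    moreover have "(LBINT x:{-L..L}. cos_series L t x * ?c x ^ i) = (LBINT x. ?N x * ?c x ^ i)" for i
      using integral_cos_power[OF assms(1,2), of i 0] by simp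
    ultimately show ?thesis by simp
  qed
  \<comment> \<open>Positivity of the series is not yet available, so its mass enters through the
    absolute value.\<close>
  define A where "A = (LBINT x:{-L..L}. \<bar>cos_series L t x\<bar>)"
  have A0: "A \<ge> 0" unfolding A_def set_lebesgue_integral_def by (intro integral_nonneg_AE) auto
  have bound: "\<bar>(LBINT x:{-L..L}. cos_series L t x * q (?c x)) - (LBINT x. ?N x * q (?c x))\<bar> \<le> e * (A + 1)" if "e > 0" for e
  proof -
    obtain r where r: "real_polynomial_function r" "\<And>x. x \<in> {-1..1} \<Longrightarrow> \<bar>q x - r x\<bar> < e"
      using Stone_Weierstrass_real_polynomial_function[OF _ q \<open>e > 0\<close>] by auto
    have rc: "continuous_on {-1..1} r" using r(1)
      using continuous_on_polymonial_function real_polynomial_function_eq by blast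
    have iA: "set_integrable lborel {-L..L} (\<lambda>x. \<bar>cos_series L t x\<bar>)"
      using i1[of "\<lambda>_. 1"] by (simp add: set_integrable_abs)
    have "(LBINT x:{-L..L}. cos_series L t x * q (?c x)) - (LBINT x:{-L..L}. cos_series L t x * r (?c x))
       = (LBINT x:{-L..L}. cos_series L t x * q (?c x) - cos_series L t x * r (?c x))"
      using i1[OF q] i1[OF rc] by (simp add: set_integral_diff)
    also have "\<bar>\<dots>\<bar> \<le> (LBINT x:{-L..L}. e * \<bar>cos_series L t x\<bar>)"
      unfolding set_lebesgue_integral_def
    proof (rule integral_abs_bound_integral)
      show "integrable lborel (\<lambda>x. indicat_real {- L..L} x *\<^sub>R (cos_series L t x * q (?c x) - cos_series L t x * r (?c x)))"
        using set_integral_diff(1)[OF i1[OF q] i1[OF rc]] by (simp add: set_integrable_def)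
      show "integrable lborel (\<lambda>x. indicat_real {- L..L} x *\<^sub>R (e * \<bar>cos_series L t x\<bar>))"
        using set_integrable_mult_right[of e lborel, OF iA] by (simp add: set_integrable_def)
      fix x :: real
      have "\<bar>cos_series L t x\<bar> * \<bar>q (?c x) - r (?c x)\<bar> \<le> \<bar>cos_series L t x\<bar> * e"
        using r(2)[OF cIn[of x]] by (intro mult_left_mono) auto
      then show "\<bar>indicat_real {- L..L} x *\<^sub>R (cos_series L t x * q (?c x) - cos_series L t x * r (?c x))\<bar> \<le> indicat_real {- L..L} x *\<^sub>R (e * \<bar>cos_series L t x\<bar>)"
        by (auto simp: right_diff_distrib[symmetric] abs_mult mult.commute split: split_indicator)
    qed
    also have "\<dots> = e * A" unfolding A_def by simp
    finally have 1: "\<bar>(LBINT x:{-L..L}. cos_series L t x * q (?c x)) - (LBINT x:{-L..L}. cos_series L t x * r (?c x))\<bar> \<le> e * A" .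
    have "(LBINT x. ?N x * q (?c x)) - (LBINT x. ?N x * r (?c x)) = (LBINT x. ?N x * q (?c x) - ?N x * r (?c x))"
      using i2[OF q] i2[OF rc] by simp
    also have "\<bar>\<dots>\<bar> \<le> (LBINT x. e * ?N x)"
    proof (rule integral_abs_bound_integral)
      fix x :: real
      have "?N x * \<bar>q (?c x) - r (?c x)\<bar> \<le> ?N x * e"
        using r(2)[OF cIn[of x]] by (intro mult_left_mono) auto
      then show "\<bar>?N x * q (?c x) - ?N x * r (?c x)\<bar> \<le> e * ?N x"
        unfolding right_diff_distrib[symmetric] abs_mult by (simp add: mult.commute)
    qed (use i2[OF q] i2[OF rc] assms in auto)
    also have "\<dots> = e" using assms by simp
    finally have 2: "\<bar>(LBINT x. ?N x * q (?c x)) - (LBINT x. ?N x * r (?c x))\<bar> \<le> e" .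
    show ?thesis using 1 2 poly[OF r(1)] by (simp add: distrib_left)
  qed
  have "\<bar>(LBINT x:{-L..L}. cos_series L t x * q (?c x)) - (LBINT x. ?N x * q (?c x))\<bar> \<le> 0"
  proof (rule field_le_epsilon)
    fix e :: real assume "e > 0"
    then have "e / (A + 1) > 0" using A0 by simp
    note bound[OF this]
    also have "e / (A + 1) * (A + 1) = e" using A0 by simp
    finally show "\<bar>(LBINT x:{-L..L}. cos_series L t x * q (?c x)) - (LBINT x. ?N x * q (?c x))\<bar> \<le> 0 + e" by simp
  qed
  then show ?thesis by simp
qed

text \<open>Test the previous identity against the positive part of the difference itself.\<close>
lemma normal_density_le_cos_series:
  assumes "t > 0" "L > 0" "x \<in> {-L..L}"
  shows "normal_density 0 (sqrt (2 * t)) x \<le> cos_series L t x"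
proof -
  let ?N = "normal_density 0 (sqrt (2 * t))"
  have contN: "continuous_on A ?N" for A unfolding normal_density_def using assms by (intro continuous_intros) auto
  have contF: "continuous_on A (cos_series L t)" for A using assms by (intro continuous_on_cos_series)
  define D where "D = (\<lambda>x. max 0 (?N x - cos_series L t x))"
  \<comment> \<open>\<open>D\<close> is even, hence on one period a function of
    \<open>cos (pi * x / L)\<close>, and \<open>arccos\<close> recovers the modulus of
    \<open>x\<close>. Outside \<open>{-L..L}\<close> the composition is the periodic extension of
    \<open>D\<close> from that interval, not \<open>D\<close> itself.\<close>
  define q where "q = (\<lambda>v. D (L * arccos v / pi))"
  have contD: "continuous_on A D" for A unfolding D_def by (intro continuous_intros contN contF)
  have q: "continuous_on {-1..1} q" unfolding q_def
    by (rule continuous_on_compose2[OF contD[of UNIV]]) (auto intro!: continuous_intros)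
  have Dabs: "D \<bar>x\<bar> = D x" for x by (simp add: D_def cos_series_abs normal_density_def)
  have qc: "q (cos (pi * x / L)) = D x" if "x \<in> {-L..L}" for x
  proof -
    have le: "pi * \<bar>x\<bar> / L \<le> pi" using that assms by (auto simp: field_simps abs_le_iff)
    have "cos (pi * x / L) = cos (pi * \<bar>x\<bar> / L)" by (cases "x \<ge> 0") auto
    then have "arccos (cos (pi * x / L)) = pi * \<bar>x\<bar> / L" using le assms by (simp add: arccos_cos)
    then show ?thesis using assms Dabs[of x] by (simp add: q_def)
  qed
  have q0: "q v \<ge> 0" for v by (simp add: q_def D_def)
  have i1: "set_integrable lborel {-L..L} (\<lambda>x. cos_series L t x * D x)"
    by (intro borel_integrable_atLeastAtMost' continuous_intros contF contD)
  have i2: "set_integrable lborel {-L..L} (\<lambda>x. ?N x * D x)"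
    by (intro borel_integrable_atLeastAtMost' continuous_intros contN contD)
  have int: "integrable lborel (\<lambda>x. ?N x * q (cos (pi * x / L)))"
  proof -
    have "bounded (q ` {-1..1})" by (intro compact_imp_bounded compact_continuous_image q) auto
    then obtain K where "\<forall>x\<in>{-1..1}. \<bar>q x\<bar> \<le> K" unfolding bounded_iff by auto
    then have K: "\<And>y. y \<in> {-1..1} \<Longrightarrow> \<bar>q y\<bar> \<le> K" by blast
    have [measurable]: "(\<lambda>x. q (cos (pi * x / L))) \<in> borel_measurable borel"
      by (intro borel_measurable_continuous_onI continuous_on_compose2[OF q]) (use assms in \<open>auto intro!: continuous_intros\<close>)
    show ?thesis
    proof (rule Bochner_Integration.integrable_bound)
      show "integrable lborel (\<lambda>x. K * ?N x)" using assms by (intro integrable_mult_right integrable_normal_density) auto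
      show "AE x in lborel. norm (?N x * q (cos (pi * x / L))) \<le> norm (K * ?N x)"
      proof (intro always_eventually allI)
        fix x show "norm (?N x * q (cos (pi * x / L))) \<le> norm (K * ?N x)"
          using mult_left_mono[OF K[of "cos (pi * x / L)"], of "?N x"]
          by (simp add: abs_mult mult.commute) (meson abs_ge_self normal_density_nonneg mult_right_mono order_trans)
      qed
    qed auto
  qed
  have "(LBINT x:{-L..L}. cos_series L t x * D x) = (LBINT x:{-L..L}. cos_series L t x * q (cos (pi * x / L)))"
    by (intro set_lebesgue_integral_cong) (auto simp: qc)
  also have "\<dots> = (LBINT x. ?N x * q (cos (pi * x / L)))"
    using assms(1,2) q by (rule integral_cos_continuous)
  \<comment> \<open>Passing from the line to one period only discards a nonnegative part of the
    Gaussian integral.\<close>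
  also have "\<dots> \<ge> (LBINT x:{-L..L}. ?N x * D x)"
    unfolding set_lebesgue_integral_def using i2[unfolded set_integrable_def] int
    by (intro integral_mono) (auto simp: qc q0 split: split_indicator)
  finally have le: "(LBINT x:{-L..L}. ?N x * D x) \<le> (LBINT x:{-L..L}. cos_series L t x * D x)" .
  have eq: "(D x)^2 = ?N x * D x - cos_series L t x * D x" for x
    by (auto simp: D_def power2_eq_square max_def algebra_simps)
  have "(LBINT x:{-L..L}. (D x)^2) = (LBINT x:{-L..L}. ?N x * D x) - (LBINT x:{-L..L}. cos_series L t x * D x)"
    unfolding eq using i1 i2 by (simp add: set_integral_diff)
  then have "(LBINT x:{-L..L}. (D x)^2) \<le> 0" using le by simp
  moreover have "(LBINT x:{-L..L}. (D x)^2) \<ge> 0"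
    unfolding set_lebesgue_integral_def by (intro integral_nonneg_AE) auto
  moreover have "set_integrable lborel {-L..L} (\<lambda>x. (D x)^2)"
    by (intro borel_integrable_atLeastAtMost' continuous_intros contD)
  ultimately have "integral {-L..L} (\<lambda>x. (D x)^2) = 0"
    by (subst set_borel_integral_eq_integral(2)[symmetric]) auto
  then have "\<forall>x\<in>{-L..L}. (D x)^2 = 0"
    using assms by (subst integral_eq_0_iff[symmetric]) (auto intro!: continuous_intros contD)
  then have "D x = 0" using assms by auto
  then show ?thesis unfolding D_def by linarith
qed

text \<open>The range extends beyond one period on the right because the reflected argument
  \<open>y + \<eta> - 2 * a\<close> runs through \<open>{0..2 * L}\<close>; points beyond
  \<open>L\<close> are brought back by one period.\<close>

lemma cos_series_nonneg:
  assumes "t > 0" "L > 0" "x \<in> {-L..3 * L}" shows "cos_series L t x \<ge> 0"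
proof (cases "x \<le> L")
  case True
  then show ?thesis using normal_density_le_cos_series[OF assms(1,2), of x] assms
    by (smt (verit) atLeastAtMost_iff normal_density_nonneg)
next
  case False
  then show ?thesis using normal_density_le_cos_series[OF assms(1,2), of "x - 2 * L"] assms cos_series_periodic[OF assms(2), of t x]
    by (smt (verit) atLeastAtMost_iff normal_density_nonneg)
qed

text \<open>The direct term alone dominates the Gaussian, and the reflected term is
  nonnegative.\<close>

lemma heat_kernel_le_neumann_kernel:
  assumes "y \<in> {a<..<b}" "\<eta> \<in> {a<..<b}"
  shows "heat_kernel t y \<eta> \<le> neumann_kernel a b t y \<eta>"
proof (cases "t > 0")
  case True
  have "heat_kernel t y \<eta> = normal_density 0 (sqrt (2 * t)) (y - \<eta>)"
    using True by (simp add: heat_kernel_normal normal_density_def power2_commute)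
  also have "\<dots> \<le> cos_series (b - a) t (y - \<eta>)"
    using assms True by (intro normal_density_le_cos_series) auto
  also have "\<dots> \<le> \<dots> + cos_series (b - a) t (y + \<eta> - 2 * a)"
    using assms True by (simp add: cos_series_nonneg)
  also have "\<dots> = neumann_kernel a b t y \<eta>" using assms True by (subst neumann_kernel_cos_series) auto
  finally show ?thesis .
qed (simp add: heat_kernel_def neumann_kernel_def)

lemma heat_kernel_nonneg: "heat_kernel t y \<eta> \<ge> 0"
  by (simp add: heat_kernel_def)

text \<open>Every nonconstant cosine mode has integral zero over the interval, which leaves the
  normalised constant mode.\<close>

lemma set_integral_neumann_kernel:
  assumes "t > 0" "a < b"
  shows "set_integrable lborel {a<..<b} (neumann_kernel a b t y)"
    and "(LBINT \<eta>:{a<..<b}. neumann_kernel a b t y \<eta>) = 1"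
proof -
  let ?L = "b - a"
  let ?e = "\<lambda>k. exp (- t * (real (Suc k) * pi / ?L)^2)"
  let ?g = "\<lambda>k \<eta>. cos (real (Suc k) * pi * (y - a) / ?L) * cos (real (Suc k) * pi * (\<eta> - a) / ?L)"
  have gle: "\<bar>?g k x\<bar> \<le> 1" for k x
    using mult_mono[of "\<bar>cos (real (Suc k) * pi * (y - a) / ?L)\<bar>" 1 "\<bar>cos (real (Suc k) * pi * (x - a) / ?L)\<bar>" 1]
    by (simp add: abs_mult)
  have L: "?L > 0" using assms by simp
  have meas: "?g k \<in> borel_measurable borel" for k by measurable
  note A = set_integral_suminf[of "{a<..<b}" ?e ?g, OF _ _ summable_gauss[OF assms(1) L] _ meas gle]
  have nk: "neumann_kernel a b t y \<eta> = 1 / ?L + 2 / ?L * (\<Sum>k. ?e k * ?g k \<eta>)" for \<eta>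
    using assms by (simp add: neumann_kernel_def mult.assoc)
  have g0: "(LBINT \<eta>:{a<..<b}. ?g k \<eta>) = 0" for k
  proof -
    let ?w = "real (Suc k) * pi / ?L"
    have w: "?w \<noteq> 0" using assms by (simp add: of_nat_Suc add_nonneg_eq_0_iff)
    have "real (Suc k) * pi * (\<eta> - a) / ?L = ?w * \<eta> + (- ?w * a)" for \<eta>
      by (simp add: right_diff_distrib diff_divide_distrib)
    then have "(LBINT \<eta>:{a<..<b}. cos (real (Suc k) * pi * (\<eta> - a) / ?L)) = (LBINT \<eta>:{a<..<b}. cos (?w * \<eta> + (- ?w * a)))"
      by simp
    also have "\<dots> = (LBINT \<eta>:{a..b}. cos (?w * \<eta> + (- ?w * a)))"
      by (rule set_integral_discrete_difference[where X="{a,b}"]) auto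
    also have "\<dots> = (sin (?w * b + (- ?w * a)) - sin (?w * a + (- ?w * a))) / ?w"
      using assms w by (intro set_integral_cos) auto
    also have "?w * b + (- ?w * a) = real (Suc k) * pi" 
    proof -
      have "?w * b + (- ?w * a) = ?w * ?L" by (simp only: right_diff_distrib minus_mult_left[symmetric] add_uminus_conv_diff)
      then show ?thesis using L by simp
    qed
    finally have "(LBINT \<eta>:{a<..<b}. cos (real (Suc k) * pi * (\<eta> - a) / ?L)) = 0" by simp
    then show ?thesis by simp
  qed
  have s0: "(LBINT x:{a<..<b}. (\<Sum>k. ?e k * ?g k x)) = 0"
    using sums_unique[OF A(2)] assms unfolding g0 by simp
  have i1: "set_integrable lborel {a<..<b} (\<lambda>\<eta>. 1 / ?L)" 
    unfolding set_integrable_def by (intro integrable_scaleR_left integrable_real_indicator) (use assms in auto)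
  have i2: "set_integrable lborel {a<..<b} (\<lambda>\<eta>. 2 / ?L * (\<Sum>k. ?e k * ?g k \<eta>))" using A(1) assms by simp
  show "set_integrable lborel {a<..<b} (neumann_kernel a b t y)"
    unfolding nk using i1 i2 by (rule set_integral_add)
  show "(LBINT \<eta>:{a<..<b}. neumann_kernel a b t y \<eta>) = 1"
  proof -
    have "(LBINT \<eta>:{a<..<b}. neumann_kernel a b t y \<eta>) =
        (LBINT \<eta>:{a<..<b}. 1 / ?L) + (LBINT \<eta>:{a<..<b}. 2 / ?L * (\<Sum>k. ?e k * ?g k \<eta>))"
      unfolding nk by (rule set_integral_add(2)[OF i1 i2])
    also have "(LBINT \<eta>:{a<..<b}. 2 / ?L * (\<Sum>k. ?e k * ?g k \<eta>)) = 2 / ?L * (LBINT \<eta>:{a<..<b}. (\<Sum>k. ?e k * ?g k \<eta>))"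
      by (rule set_integral_mult_right)
    also have "\<dots> = 0" by (simp only: s0 mult_zero_right)
    also have "(LBINT \<eta>:{a<..<b}. 1 / ?L) = 1" using assms by (simp add: set_lebesgue_integral_def)
    finally show ?thesis by simp
  qed
qed

lemma borel_measurable_neumann_kernel [measurable]:
  "(\<lambda>p. neumann_kernel a b (fst p) (fst (snd p)) (snd (snd p))) \<in> borel_measurable borel"
  unfolding neumann_kernel_def borel_prod[symmetric] by measurable

lemma borel_measurable_heat_kernel [measurable]:
  "(\<lambda>p. heat_kernel (fst p) (fst (snd p)) (snd (snd p))) \<in> borel_measurable borel"
  unfolding heat_kernel_def borel_prod[symmetric] by measurable

end

section \<open>Limits in law through multipliers of characters\<close>

lemma (in pair_sigma_finite) integrable_kernel_mult:
  fixes \<kappa> :: "'a \<Rightarrow> real" and g :: "'a \<times> 'b \<Rightarrow> 'c::{banach, second_countable_topology}"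
  assumes \<kappa>: "integrable M1 \<kappa>" and M2: "finite_measure M2"
    and g: "g \<in> borel_measurable (M1 \<Otimes>\<^sub>M M2)"
    and K: "\<And>p. p \<in> space (M1 \<Otimes>\<^sub>M M2) \<Longrightarrow> norm (g p) \<le> K"
  shows "integrable (M1 \<Otimes>\<^sub>M M2) (\<lambda>p. \<kappa> (fst p) *\<^sub>R g p)"
proof (rule Bochner_Integration.integrable_bound)
  interpret M2: finite_measure M2 by fact
  note [measurable] = borel_measurable_integrable[OF \<kappa>] g
  show "integrable (M1 \<Otimes>\<^sub>M M2) (\<lambda>p. K * \<kappa> (fst p))"
  proof (rule Fubini_integrable)
    have "(\<lambda>x. \<integral>y. norm (K * \<kappa> (fst (x, y))) \<partial>M2) = (\<lambda>x. measure M2 (space M2) * (\<bar>K\<bar> * \<bar>\<kappa> x\<bar>))"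
      by (simp add: abs_mult mult_ac)
    then show "integrable M1 (\<lambda>x. \<integral>y. norm (K * \<kappa> (fst (x, y))) \<partial>M2)"
      using \<kappa> by simp
  qed auto
  show "AE p in M1 \<Otimes>\<^sub>M M2. norm (\<kappa> (fst p) *\<^sub>R g p) \<le> norm (K * \<kappa> (fst p))"
  proof (rule AE_I2)
    fix p assume "p \<in> space (M1 \<Otimes>\<^sub>M M2)"
    then have "norm (g p) \<le> \<bar>K\<bar>" using K[of p] by linarith
    then show "norm (\<kappa> (fst p) *\<^sub>R g p) \<le> norm (K * \<kappa> (fst p))"
      by (simp add: abs_mult mult.commute mult_right_mono)
  qed
qed (use g borel_measurable_integrable[OF \<kappa>] in measurable)

lemma integral_norm_bound_le:
  fixes f :: "'a \<Rightarrow> 'b::{banach, second_countable_topology}"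
  assumes "integrable M f" "integrable M g" "\<And>x. x \<in> space M \<Longrightarrow> norm (f x) \<le> g x"
  shows "norm (\<integral>x. f x \<partial>M) \<le> (\<integral>x. g x \<partial>M)"
  using integral_norm_bound[of M f] integral_mono[OF integrable_norm[OF assms(1)] assms(2,3)]
  by (rule order_trans)

lemma norm_diff_chain:
  fixes w x y z :: "'a::real_normed_vector"
  assumes "norm (x - y) \<le> a" "norm (y - z) < b" "norm (w - z) \<le> c"
  shows "norm (x - w) < a + b + c"
  using assms dist_triangle[of x w y] dist_triangle[of y w z] unfolding dist_norm[symmetric]
  by (simp add: dist_commute)

text \<open>Linear combinations are lists of pairs in which an index may occur repeatedly. Adding a
  term is then \<open>Cons\<close>, with no distinction whether its index is already
  present.\<close>

definition lincomb :: "('k \<Rightarrow> 'a \<Rightarrow> real) \<Rightarrow> (real \<times> 'k) list \<Rightarrow> 'a \<Rightarrow> real" where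
  "lincomb A c \<omega> = (\<Sum>(r, k)\<leftarrow>c. r * A k \<omega>)"

lemma lincomb_simps [simp]:
  "lincomb A [] \<omega> = 0"
  "lincomb A ((r, k) # c) \<omega> = r * A k \<omega> + lincomb A c \<omega>"
  by (simp_all add: lincomb_def)

lemma borel_measurable_lincomb:
  assumes "\<And>k. k \<in> snd ` set c \<Longrightarrow> A k \<in> borel_measurable M"
  shows "lincomb A c \<in> borel_measurable M"
  using assms
proof (induction c)
  case (Cons a c)
  obtain r k where a: "a = (r, k)" by force
  have [measurable]: "A k \<in> borel_measurable M" "lincomb A c \<in> borel_measurable M"
    using Cons by (auto simp: a)
  have "lincomb A (a # c) = (\<lambda>\<omega>. r * A k \<omega> + lincomb A c \<omega>)" by (auto simp: a)
  then show ?case by simp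
qed (auto simp: lincomb_def[abs_def])

text \<open>\<open>A n\<close> and \<open>B\<close> will be the Gaussian variables before and after
  the limit. They live on unrelated probability spaces, and convergence of all joint characteristic
  functions is the only link between the two sides.\<close>

locale limit_law =
  fixes M :: "nat \<Rightarrow> 'a measure" and N :: "'b measure"
    and A :: "nat \<Rightarrow> 'k \<Rightarrow> 'a \<Rightarrow> real" and B :: "'k \<Rightarrow> 'b \<Rightarrow> real" and KS :: "'k set"
  assumes prob_M: "\<And>n. prob_space (M n)" and prob_N: "prob_space N"
    and measurable_A: "\<And>n k. k \<in> KS \<Longrightarrow> A n k \<in> borel_measurable (M n)"
    and measurable_B: "\<And>k. k \<in> KS \<Longrightarrow> B k \<in> borel_measurable N"
    and tendsto_char: "\<And>c. snd ` set c \<subseteq> KS \<Longrightarrow>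
      (\<lambda>n. \<integral>\<omega>. cis (lincomb (A n) c \<omega>) \<partial>M n) \<longlonglongrightarrow> (\<integral>\<omega>. cis (lincomb B c \<omega>) \<partial>N)"
begin

text \<open>A family is tested against all characters of the Gaussian variables.  Multipliers of the
  convergent families form an algebra that is also closed under integration in a parameter,
  which avoids any discretisation of the space-time integrals.\<close>

definition bounded_family :: "(nat \<Rightarrow> 'a \<Rightarrow> complex) \<Rightarrow> ('b \<Rightarrow> complex) \<Rightarrow> bool" where
  "bounded_family Q Q' \<longleftrightarrow> (\<exists>K. (\<forall>n. Q n \<in> borel_measurable (M n) \<and> (\<forall>\<omega>\<in>space (M n). norm (Q n \<omega>) \<le> K)) \<and>
     Q' \<in> borel_measurable N \<and> (\<forall>\<omega>\<in>space N. norm (Q' \<omega>) \<le> K))"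

definition convergent_family :: "(nat \<Rightarrow> 'a \<Rightarrow> complex) \<Rightarrow> ('b \<Rightarrow> complex) \<Rightarrow> bool" where
  "convergent_family Q Q' \<longleftrightarrow> bounded_family Q Q' \<and> (\<forall>c. snd ` set c \<subseteq> KS \<longrightarrow>
     (\<lambda>n. \<integral>\<omega>. cis (lincomb (A n) c \<omega>) * Q n \<omega> \<partial>M n) \<longlonglongrightarrow> (\<integral>\<omega>. cis (lincomb B c \<omega>) * Q' \<omega> \<partial>N))"

text \<open>Products of two convergent families need not converge to the product of the limits, as
  for a weakly but not strongly convergent sequence multiplied by itself. Asking for convergence
  after multiplication by every convergent family makes the notion stable under products.\<close>

definition multiplier :: "(nat \<Rightarrow> 'a \<Rightarrow> complex) \<Rightarrow> ('b \<Rightarrow> complex) \<Rightarrow> bool" where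
  "multiplier Q Q' \<longleftrightarrow> bounded_family Q Q' \<and> (\<forall>H H'. convergent_family H H' \<longrightarrow>
     convergent_family (\<lambda>n \<omega>. Q n \<omega> * H n \<omega>) (\<lambda>\<omega>. Q' \<omega> * H' \<omega>))"

section \<open>The algebra of multipliers\<close>

lemma measurable_lincomb_A [measurable]:
  "snd ` set c \<subseteq> KS \<Longrightarrow> lincomb (A n) c \<in> borel_measurable (M n)"
  by (rule borel_measurable_lincomb) (auto intro: measurable_A)

lemma measurable_lincomb_B [measurable]:
  "snd ` set c \<subseteq> KS \<Longrightarrow> lincomb B c \<in> borel_measurable N"
  by (rule borel_measurable_lincomb) (auto intro: measurable_B)

lemma measurable_cis [measurable (raw)]:
  "f \<in> borel_measurable L \<Longrightarrow> (\<lambda>x. cis (f x)) \<in> borel_measurable L"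
  by (rule borel_measurable_continuous_on[OF continuous_on_cis[OF continuous_on_id]])

lemma bounded_familyD:
  assumes "bounded_family Q Q'"
  shows "\<exists>K\<ge>0. (\<forall>n. Q n \<in> borel_measurable (M n)) \<and> (\<forall>n. \<forall>\<omega>\<in>space (M n). norm (Q n \<omega>) \<le> K) \<and>
    Q' \<in> borel_measurable N \<and> (\<forall>\<omega>\<in>space N. norm (Q' \<omega>) \<le> K)"
proof -
  obtain K where K: "\<forall>n. Q n \<in> borel_measurable (M n) \<and> (\<forall>\<omega>\<in>space (M n). norm (Q n \<omega>) \<le> K)"
    "Q' \<in> borel_measurable N" "\<forall>\<omega>\<in>space N. norm (Q' \<omega>) \<le> K"
    using assms unfolding bounded_family_def by blast
  obtain \<omega> where "\<omega> \<in> space N" using prob_space.not_empty[OF prob_N] by blast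
  then have "K \<ge> 0" using K(3) norm_ge_zero order_trans by blast
  then show ?thesis using K by blast
qed

lemma bounded_familyI:
  assumes "\<And>n. Q n \<in> borel_measurable (M n)" "\<And>n \<omega>. \<omega> \<in> space (M n) \<Longrightarrow> norm (Q n \<omega>) \<le> K"
    "Q' \<in> borel_measurable N" "\<And>\<omega>. \<omega> \<in> space N \<Longrightarrow> norm (Q' \<omega>) \<le> K"
  shows "bounded_family Q Q'"
  using assms unfolding bounded_family_def by blast

lemma bounded_family_mult:
  assumes "bounded_family Q Q'" "bounded_family P P'"
  shows "bounded_family (\<lambda>n \<omega>. Q n \<omega> * P n \<omega>) (\<lambda>\<omega>. Q' \<omega> * P' \<omega>)"
proof -
  obtain K where K0: "K \<ge> 0" "\<forall>n. Q n \<in> borel_measurable (M n)" "\<forall>n. \<forall>\<omega>\<in>space (M n). norm (Q n \<omega>) \<le> K"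
    "Q' \<in> borel_measurable N" "\<forall>\<omega>\<in>space N. norm (Q' \<omega>) \<le> K" using bounded_familyD[OF assms(1)] by blast
  have K: "K \<ge> 0" "\<And>n. Q n \<in> borel_measurable (M n)" "\<And>n \<omega>. \<omega> \<in> space (M n) \<Longrightarrow> norm (Q n \<omega>) \<le> K"
    "Q' \<in> borel_measurable N" "\<And>\<omega>. \<omega> \<in> space N \<Longrightarrow> norm (Q' \<omega>) \<le> K" using K0 by simp_all
  obtain L where L0: "L \<ge> 0" "\<forall>n. P n \<in> borel_measurable (M n)" "\<forall>n. \<forall>\<omega>\<in>space (M n). norm (P n \<omega>) \<le> L"
    "P' \<in> borel_measurable N" "\<forall>\<omega>\<in>space N. norm (P' \<omega>) \<le> L" using bounded_familyD[OF assms(2)] by blast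
  have L: "L \<ge> 0" "\<And>n. P n \<in> borel_measurable (M n)" "\<And>n \<omega>. \<omega> \<in> space (M n) \<Longrightarrow> norm (P n \<omega>) \<le> L"
    "P' \<in> borel_measurable N" "\<And>\<omega>. \<omega> \<in> space N \<Longrightarrow> norm (P' \<omega>) \<le> L" using L0 by simp_all
  note [measurable] = K(2,4) L(2,4)
  show ?thesis
    by (rule bounded_familyI[where K="K * L"]) (auto simp: norm_mult intro!: mult_mono K L)
qed

lemma bounded_family_add:
  assumes "bounded_family Q Q'" "bounded_family P P'"
  shows "bounded_family (\<lambda>n \<omega>. Q n \<omega> + P n \<omega>) (\<lambda>\<omega>. Q' \<omega> + P' \<omega>)"
proof -
  obtain K where K0: "K \<ge> 0" "\<forall>n. Q n \<in> borel_measurable (M n)" "\<forall>n. \<forall>\<omega>\<in>space (M n). norm (Q n \<omega>) \<le> K"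
    "Q' \<in> borel_measurable N" "\<forall>\<omega>\<in>space N. norm (Q' \<omega>) \<le> K" using bounded_familyD[OF assms(1)] by blast
  have K: "K \<ge> 0" "\<And>n. Q n \<in> borel_measurable (M n)" "\<And>n \<omega>. \<omega> \<in> space (M n) \<Longrightarrow> norm (Q n \<omega>) \<le> K"
    "Q' \<in> borel_measurable N" "\<And>\<omega>. \<omega> \<in> space N \<Longrightarrow> norm (Q' \<omega>) \<le> K" using K0 by simp_all
  obtain L where L0: "L \<ge> 0" "\<forall>n. P n \<in> borel_measurable (M n)" "\<forall>n. \<forall>\<omega>\<in>space (M n). norm (P n \<omega>) \<le> L"
    "P' \<in> borel_measurable N" "\<forall>\<omega>\<in>space N. norm (P' \<omega>) \<le> L" using bounded_familyD[OF assms(2)] by blast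
  have L: "L \<ge> 0" "\<And>n. P n \<in> borel_measurable (M n)" "\<And>n \<omega>. \<omega> \<in> space (M n) \<Longrightarrow> norm (P n \<omega>) \<le> L"
    "P' \<in> borel_measurable N" "\<And>\<omega>. \<omega> \<in> space N \<Longrightarrow> norm (P' \<omega>) \<le> L" using L0 by simp_all
  note [measurable] = K(2,4) L(2,4)
  show ?thesis
    by (rule bounded_familyI[where K="K + L"]) (auto intro!: norm_triangle_mono K L)
qed

lemma bounded_family_cis:
  assumes "snd ` set c \<subseteq> KS"
  shows "bounded_family (\<lambda>n \<omega>. cis (lincomb (A n) c \<omega>)) (\<lambda>\<omega>. cis (lincomb B c \<omega>))"
  using assms by (intro bounded_familyI[where K=1]) auto

lemma bounded_family_integrable:
  assumes "bounded_family Q Q'"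
  shows "integrable (M n) (Q n)" "integrable N Q'"
proof -
  interpret N: prob_space N by (rule prob_N)
  interpret M: prob_space "M n" by (rule prob_M)
  obtain K where K0: "K \<ge> 0" "\<forall>n. Q n \<in> borel_measurable (M n)" "\<forall>n. \<forall>\<omega>\<in>space (M n). norm (Q n \<omega>) \<le> K"
    "Q' \<in> borel_measurable N" "\<forall>\<omega>\<in>space N. norm (Q' \<omega>) \<le> K" using bounded_familyD[OF assms(1)] by blast
  have K: "K \<ge> 0" "\<And>n. Q n \<in> borel_measurable (M n)" "\<And>n \<omega>. \<omega> \<in> space (M n) \<Longrightarrow> norm (Q n \<omega>) \<le> K"
    "Q' \<in> borel_measurable N" "\<And>\<omega>. \<omega> \<in> space N \<Longrightarrow> norm (Q' \<omega>) \<le> K" using K0 by simp_all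
  show "integrable (M n) (Q n)" by (rule M.integrable_const_bound[where B=K]) (use K in auto)
  show "integrable N Q'" by (rule N.integrable_const_bound[where B=K]) (use K in auto)
qed

lemma convergent_family_one: "convergent_family (\<lambda>_ _. 1) (\<lambda>_. 1)"
  unfolding convergent_family_def using tendsto_char by (auto intro!: bounded_familyI[where K=1])

lemma multiplier_bounded: "multiplier Q Q' \<Longrightarrow> bounded_family Q Q'"
  by (simp add: multiplier_def)

lemma multiplierD:
  assumes "multiplier Q Q'" "convergent_family H H'"
  shows "convergent_family (\<lambda>n \<omega>. Q n \<omega> * H n \<omega>) (\<lambda>\<omega>. Q' \<omega> * H' \<omega>)"
  using assms unfolding multiplier_def by blast

lemma convergent_familyD:
  assumes "convergent_family H H'"
  shows "bounded_family H H'"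
    and "snd ` set c \<subseteq> KS \<Longrightarrow>
     (\<lambda>n. \<integral>\<omega>. cis (lincomb (A n) c \<omega>) * H n \<omega> \<partial>M n) \<longlonglongrightarrow> (\<integral>\<omega>. cis (lincomb B c \<omega>) * H' \<omega> \<partial>N)"
  using assms unfolding convergent_family_def by blast+

lemma multiplier_tendsto:
  assumes "multiplier Q Q'"
  shows "(\<lambda>n. \<integral>\<omega>. Q n \<omega> \<partial>M n) \<longlonglongrightarrow> (\<integral>\<omega>. Q' \<omega> \<partial>N)"
proof -
  show ?thesis
    using convergent_familyD(2)[OF multiplierD[OF assms convergent_family_one], of "[]"] by simp
qed

lemma multiplier_mult:
  assumes "multiplier Q Q'" "multiplier P P'"
  shows "multiplier (\<lambda>n \<omega>. Q n \<omega> * P n \<omega>) (\<lambda>\<omega>. Q' \<omega> * P' \<omega>)"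
  unfolding multiplier_def
proof (intro conjI allI impI)
  show "bounded_family (\<lambda>n \<omega>. Q n \<omega> * P n \<omega>) (\<lambda>\<omega>. Q' \<omega> * P' \<omega>)"
    using assms by (intro bounded_family_mult multiplier_bounded)
  fix H H' assume "convergent_family H H'"
  then have "convergent_family (\<lambda>n \<omega>. P n \<omega> * H n \<omega>) (\<lambda>\<omega>. P' \<omega> * H' \<omega>)"
    by (rule multiplierD[OF assms(2)])
  then have "convergent_family (\<lambda>n \<omega>. Q n \<omega> * (P n \<omega> * H n \<omega>)) (\<lambda>\<omega>. Q' \<omega> * (P' \<omega> * H' \<omega>))"
    by (rule multiplierD[OF assms(1)])
  then show "convergent_family (\<lambda>n \<omega>. Q n \<omega> * P n \<omega> * H n \<omega>) (\<lambda>\<omega>. Q' \<omega> * P' \<omega> * H' \<omega>)"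
    by (simp add: mult.assoc)
qed

lemma multiplier_add:
  assumes "multiplier Q Q'" "multiplier P P'"
  shows "multiplier (\<lambda>n \<omega>. Q n \<omega> + P n \<omega>) (\<lambda>\<omega>. Q' \<omega> + P' \<omega>)"
  unfolding multiplier_def
proof (intro conjI allI impI)
  show b: "bounded_family (\<lambda>n \<omega>. Q n \<omega> + P n \<omega>) (\<lambda>\<omega>. Q' \<omega> + P' \<omega>)"
    using assms by (intro bounded_family_add multiplier_bounded)
  fix H H' assume H: "convergent_family H H'"
  have QH: "convergent_family (\<lambda>n \<omega>. Q n \<omega> * H n \<omega>) (\<lambda>\<omega>. Q' \<omega> * H' \<omega>)"
    and PH: "convergent_family (\<lambda>n \<omega>. P n \<omega> * H n \<omega>) (\<lambda>\<omega>. P' \<omega> * H' \<omega>)"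
    by (rule multiplierD[OF assms(1) H], rule multiplierD[OF assms(2) H])
  show "convergent_family (\<lambda>n \<omega>. (Q n \<omega> + P n \<omega>) * H n \<omega>) (\<lambda>\<omega>. (Q' \<omega> + P' \<omega>) * H' \<omega>)"
    unfolding convergent_family_def
  proof (intro conjI allI impI)
    show "bounded_family (\<lambda>n \<omega>. (Q n \<omega> + P n \<omega>) * H n \<omega>) (\<lambda>\<omega>. (Q' \<omega> + P' \<omega>) * H' \<omega>)"
      by (rule bounded_family_mult[OF b convergent_familyD(1)[OF H]])
    fix c :: "(real \<times> 'k) list" assume c: "snd ` set c \<subseteq> KS"
    note iQ = bounded_family_integrable[OF bounded_family_mult[OF bounded_family_cis[OF c] convergent_familyD(1)[OF QH]]]
    note iP = bounded_family_integrable[OF bounded_family_mult[OF bounded_family_cis[OF c] convergent_familyD(1)[OF PH]]]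
    have "(\<lambda>n. (\<integral>\<omega>. cis (lincomb (A n) c \<omega>) * (Q n \<omega> * H n \<omega>) \<partial>M n) + (\<integral>\<omega>. cis (lincomb (A n) c \<omega>) * (P n \<omega> * H n \<omega>) \<partial>M n)) \<longlonglongrightarrow>
      (\<integral>\<omega>. cis (lincomb B c \<omega>) * (Q' \<omega> * H' \<omega>) \<partial>N) + (\<integral>\<omega>. cis (lincomb B c \<omega>) * (P' \<omega> * H' \<omega>) \<partial>N)"
      by (intro tendsto_add convergent_familyD(2)[OF QH c] convergent_familyD(2)[OF PH c])
    then show "(\<lambda>n. \<integral>\<omega>. cis (lincomb (A n) c \<omega>) * ((Q n \<omega> + P n \<omega>) * H n \<omega>) \<partial>M n) \<longlonglongrightarrow>
       (\<integral>\<omega>. cis (lincomb B c \<omega>) * ((Q' \<omega> + P' \<omega>) * H' \<omega>) \<partial>N)"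
      using iQ iP by (simp add: distrib_left distrib_right)
  qed
qed

lemma multiplier_const:
  assumes "c \<longlonglongrightarrow> c'"
  shows "multiplier (\<lambda>n _. c n) (\<lambda>_. c')"
  unfolding multiplier_def
proof (intro conjI allI impI)
  obtain K where K: "\<And>n. norm (c n) \<le> K"
    using convergent_imp_bounded[OF assms] unfolding bounded_iff by auto
  show b: "bounded_family (\<lambda>n _. c n) (\<lambda>_. c')"
    by (rule bounded_familyI[where K="max K (norm c')"]) (use K in \<open>auto simp: le_max_iff_disj\<close>)
  fix H H' assume H: "convergent_family H H'"
  show "convergent_family (\<lambda>n \<omega>. c n * H n \<omega>) (\<lambda>\<omega>. c' * H' \<omega>)"
    unfolding convergent_family_def
  proof (intro conjI allI impI)
    show "bounded_family (\<lambda>n \<omega>. c n * H n \<omega>) (\<lambda>\<omega>. c' * H' \<omega>)"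
      by (rule bounded_family_mult[OF b convergent_familyD(1)[OF H]])
    fix d :: "(real \<times> 'k) list" assume d: "snd ` set d \<subseteq> KS"
    have "(\<lambda>n. c n * (\<integral>\<omega>. cis (lincomb (A n) d \<omega>) * H n \<omega> \<partial>M n)) \<longlonglongrightarrow> c' * (\<integral>\<omega>. cis (lincomb B d \<omega>) * H' \<omega> \<partial>N)"
      by (intro tendsto_mult assms convergent_familyD(2)[OF H d])
    then show "(\<lambda>n. \<integral>\<omega>. cis (lincomb (A n) d \<omega>) * (c n * H n \<omega>) \<partial>M n) \<longlonglongrightarrow> (\<integral>\<omega>. cis (lincomb B d \<omega>) * (c' * H' \<omega>) \<partial>N)"
      by (simp add: mult.left_commute)
  qed
qed

lemma multiplier_cis:
  assumes k: "k \<in> KS"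
  shows "multiplier (\<lambda>n \<omega>. cis (r * A n k \<omega>)) (\<lambda>\<omega>. cis (r * B k \<omega>))"
  unfolding multiplier_def
proof (intro conjI allI impI)
  show b: "bounded_family (\<lambda>n \<omega>. cis (r * A n k \<omega>)) (\<lambda>\<omega>. cis (r * B k \<omega>))"
    using bounded_family_cis[of "[(r, k)]"] k by simp
  fix H H' assume H: "convergent_family H H'"
  show "convergent_family (\<lambda>n \<omega>. cis (r * A n k \<omega>) * H n \<omega>) (\<lambda>\<omega>. cis (r * B k \<omega>) * H' \<omega>)"
    unfolding convergent_family_def
  proof (intro conjI allI impI)
    show "bounded_family (\<lambda>n \<omega>. cis (r * A n k \<omega>) * H n \<omega>) (\<lambda>\<omega>. cis (r * B k \<omega>) * H' \<omega>)"
      by (rule bounded_family_mult[OF b convergent_familyD(1)[OF H]])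
    fix d :: "(real \<times> 'k) list" assume d: "snd ` set d \<subseteq> KS"
    have "(\<lambda>n. \<integral>\<omega>. cis (lincomb (A n) ((r, k) # d) \<omega>) * H n \<omega> \<partial>M n) \<longlonglongrightarrow> (\<integral>\<omega>. cis (lincomb B ((r, k) # d) \<omega>) * H' \<omega> \<partial>N)"
      using d k by (intro convergent_familyD(2)[OF H]) simp
    then show "(\<lambda>n. \<integral>\<omega>. cis (lincomb (A n) d \<omega>) * (cis (r * A n k \<omega>) * H n \<omega>) \<partial>M n) \<longlonglongrightarrow>
       (\<integral>\<omega>. cis (lincomb B d \<omega>) * (cis (r * B k \<omega>) * H' \<omega>) \<partial>N)"
      by (simp add: cis_mult[symmetric] mult_ac)
  qed
qed

text \<open>A convergent family is bounded uniformly in \<open>n\<close>, so replacing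
  \<open>Q\<close> by an approximating multiplier changes every pairing by at most that bound times
  the error in mean. The approximation is asked for large \<open>n\<close> only, but with one
  approximant for all of them.\<close>

lemma multiplier_L1_approx:
  assumes b: "bounded_family Q Q'"
    and approx: "\<And>e. e > 0 \<Longrightarrow> \<exists>P P'. multiplier P P' \<and>
      (\<forall>\<^sub>F n in sequentially. (\<integral>\<omega>. norm (Q n \<omega> - P n \<omega>) \<partial>M n) \<le> e) \<and> (\<integral>\<omega>. norm (Q' \<omega> - P' \<omega>) \<partial>N) \<le> e"
  shows "multiplier Q Q'"
  unfolding multiplier_def
proof (intro conjI allI impI b)
  fix H H' assume H: "convergent_family H H'"
  then have bH: "bounded_family H H'" by (simp add: convergent_family_def)
  obtain K where K0: "K \<ge> 0" "\<forall>n. H n \<in> borel_measurable (M n)" "\<forall>n. \<forall>\<omega>\<in>space (M n). norm (H n \<omega>) \<le> K"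
    "H' \<in> borel_measurable N" "\<forall>\<omega>\<in>space N. norm (H' \<omega>) \<le> K" using bounded_familyD[OF bH] by blast
  have K: "K \<ge> 0" "\<And>n. H n \<in> borel_measurable (M n)" "\<And>n \<omega>. \<omega> \<in> space (M n) \<Longrightarrow> norm (H n \<omega>) \<le> K"
    "H' \<in> borel_measurable N" "\<And>\<omega>. \<omega> \<in> space N \<Longrightarrow> norm (H' \<omega>) \<le> K" using K0 by simp_all
  show "convergent_family (\<lambda>n \<omega>. Q n \<omega> * H n \<omega>) (\<lambda>\<omega>. Q' \<omega> * H' \<omega>)"
    unfolding convergent_family_def
  proof (intro conjI allI impI)
    show "bounded_family (\<lambda>n \<omega>. Q n \<omega> * H n \<omega>) (\<lambda>\<omega>. Q' \<omega> * H' \<omega>)"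
      using b bH by (rule bounded_family_mult)
    fix c :: "(real \<times> 'k) list" assume c: "snd ` set c \<subseteq> KS"
    let ?I = "\<lambda>F n. \<integral>\<omega>. cis (lincomb (A n) c \<omega>) * (F n \<omega> * H n \<omega>) \<partial>M n"
    let ?J = "\<lambda>F. \<integral>\<omega>. cis (lincomb B c \<omega>) * (F \<omega> * H' \<omega>) \<partial>N"
    show "?I Q \<longlonglongrightarrow> ?J Q'"
    proof (rule LIMSEQ_I)
      fix r :: real assume r: "r > 0"
      \<comment> \<open>With this choice each of the two replacements costs at most
        \<open>r / 4\<close>; the \<open>+ 1\<close> guards against \<open>K = 0\<close>.\<close>
      define e where "e = r / (4 * (K + 1))"
      have e: "e > 0" using r K by (simp add: e_def)
      obtain P P' where P: "multiplier P P'" "\<forall>\<^sub>F n in sequentially. (\<integral>\<omega>. norm (Q n \<omega> - P n \<omega>) \<partial>M n) \<le> e"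
        "(\<integral>\<omega>. norm (Q' \<omega> - P' \<omega>) \<partial>N) \<le> e" using approx[OF e] by blast
      note bP = multiplier_bounded[OF P(1)]
      have eK: "e * K \<le> r / 4"
        using K(1) r by (auto simp: e_def field_simps)
      note iQ = bounded_family_integrable[OF bounded_family_mult[OF bounded_family_cis[OF c] bounded_family_mult[OF b bH]]]
      note iP = bounded_family_integrable[OF bounded_family_mult[OF bounded_family_cis[OF c] bounded_family_mult[OF bP bH]]]
      have 1: "norm (?I Q n - ?I P n) \<le> K * (\<integral>\<omega>. norm (Q n \<omega> - P n \<omega>) \<partial>M n)" for n
      proof -
        have "?I Q n - ?I P n = (\<integral>\<omega>. cis (lincomb (A n) c \<omega>) * ((Q n \<omega> - P n \<omega>) * H n \<omega>) \<partial>M n)"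
          using iQ(1)[of n] iP(1)[of n] by (simp add: algebra_simps)
        also have "norm \<dots> \<le> (\<integral>\<omega>. K * norm (Q n \<omega> - P n \<omega>) \<partial>M n)"
        proof (rule integral_norm_bound_le)
          show "integrable (M n) (\<lambda>\<omega>. cis (lincomb (A n) c \<omega>) * ((Q n \<omega> - P n \<omega>) * H n \<omega>))"
            using Bochner_Integration.integrable_diff[OF iQ(1)[of n] iP(1)[of n]] by (simp add: algebra_simps)
          show "integrable (M n) (\<lambda>\<omega>. K * norm (Q n \<omega> - P n \<omega>))"
            using bounded_family_integrable(1)[OF b, of n] bounded_family_integrable(1)[OF bP, of n]
            by (intro integrable_mult_right integrable_norm Bochner_Integration.integrable_diff)
        qed (simp add: norm_mult mult.commute mult_right_mono K(3))
        finally show ?thesis by simp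
      qed
      have 2: "norm (?J Q' - ?J P') \<le> K * (\<integral>\<omega>. norm (Q' \<omega> - P' \<omega>) \<partial>N)"
      proof -
        have "?J Q' - ?J P' = (\<integral>\<omega>. cis (lincomb B c \<omega>) * ((Q' \<omega> - P' \<omega>) * H' \<omega>) \<partial>N)"
          using iQ(2) iP(2) by (simp add: algebra_simps)
        also have "norm \<dots> \<le> (\<integral>\<omega>. K * norm (Q' \<omega> - P' \<omega>) \<partial>N)"
        proof (rule integral_norm_bound_le)
          show "integrable N (\<lambda>\<omega>. cis (lincomb B c \<omega>) * ((Q' \<omega> - P' \<omega>) * H' \<omega>))"
            using Bochner_Integration.integrable_diff[OF iQ(2) iP(2)] by (simp add: algebra_simps)
          show "integrable N (\<lambda>\<omega>. K * norm (Q' \<omega> - P' \<omega>))"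
            using bounded_family_integrable(2)[OF b] bounded_family_integrable(2)[OF bP]
            by (intro integrable_mult_right integrable_norm Bochner_Integration.integrable_diff)
        qed (simp add: norm_mult mult.commute mult_right_mono K(5))
        finally show ?thesis by simp
      qed
      have "convergent_family (\<lambda>n \<omega>. P n \<omega> * H n \<omega>) (\<lambda>\<omega>. P' \<omega> * H' \<omega>)"
        by (rule multiplierD[OF P(1) H])
      then have "?I P \<longlonglongrightarrow> ?J P'" by (rule convergent_familyD(2)[OF _ c])
      then have "\<forall>\<^sub>F n in sequentially. norm (?I P n - ?J P') < r / 4"
        using r by (auto dest!: tendstoD[of _ _ _ "r / 4"] simp: dist_norm)
      then have "\<forall>\<^sub>F n in sequentially. norm (?I Q n - ?J Q') < r"
        using P(2)
      proof eventually_elim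
        case (elim n)
        have "norm (?I Q n - ?I P n) \<le> r / 4"
          using 1[of n] mult_left_mono[OF elim(2) K(1)] eK by (simp add: mult.commute)
        moreover have "norm (?J Q' - ?J P') \<le> r / 4"
          using 2 mult_left_mono[OF P(3) K(1)] eK by (simp add: mult.commute)
        ultimately have "norm (?I Q n - ?J Q') < r / 4 + r / 4 + r / 4"
          using elim(1) by (intro norm_diff_chain) auto
        then show ?case using r by simp
      qed
      then show "\<exists>no. \<forall>n\<ge>no. norm (?I Q n - ?J Q') < r" by (simp add: eventually_sequentially)
    qed
  qed
qed

lemma multiplier_uminus:
  assumes "multiplier Q Q'" shows "multiplier (\<lambda>n \<omega>. - Q n \<omega>) (\<lambda>\<omega>. - Q' \<omega>)"
  using multiplier_mult[OF multiplier_const[OF tendsto_const[of "-1"]] assms] by simp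

lemma multiplier_power:
  assumes "multiplier Q Q'" shows "multiplier (\<lambda>n \<omega>. Q n \<omega> ^ i) (\<lambda>\<omega>. Q' \<omega> ^ i)"
proof (induction i)
  case 0
  then show ?case using multiplier_const[OF tendsto_const[of 1]] by simp
next
  case (Suc i)
  then show ?case using multiplier_mult[OF assms Suc] by simp
qed

lemma multiplier_sum:
  assumes "finite I" "\<And>i. i \<in> I \<Longrightarrow> multiplier (Q i) (Q' i)"
  shows "multiplier (\<lambda>n \<omega>. \<Sum>i\<in>I. Q i n \<omega>) (\<lambda>\<omega>. \<Sum>i\<in>I. Q' i \<omega>)"
  using assms
proof (induction I)
  case empty
  then show ?case using multiplier_const[OF tendsto_const[of 0]] by simp
next
  case (insert i I)
  then show ?case using multiplier_add[of "Q i" "Q' i" "\<lambda>n \<omega>. \<Sum>i\<in>I. Q i n \<omega>" "\<lambda>\<omega>. \<Sum>i\<in>I. Q' i \<omega>"] by simp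
qed

text \<open>By Fubini the pairing with a character becomes an integral over \<open>z\<close> of
  pairings. Since these are bounded, kernels that converge in L1 may be replaced by their limit, and
  the rest is dominated convergence in \<open>z\<close>. Points with \<open>\<kappa>' z = 0\<close>
  carry no weight in the limit, so nothing is asked of them.\<close>

lemma multiplier_integral:
  fixes \<kappa> :: "nat \<Rightarrow> 'z::euclidean_space \<Rightarrow> real" and Q :: "nat \<Rightarrow> 'z \<Rightarrow> 'a \<Rightarrow> complex"
  assumes \<kappa>: "\<And>n. integrable lborel (\<kappa> n)" "integrable lborel \<kappa>'" "(\<lambda>n. \<integral>z. \<bar>\<kappa> n z - \<kappa>' z\<bar> \<partial>lborel) \<longlonglongrightarrow> 0"
    and Q: "\<And>n. (\<lambda>p. Q n (fst p) (snd p)) \<in> borel_measurable (lborel \<Otimes>\<^sub>M M n)"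
      "\<And>n z \<omega>. \<omega> \<in> space (M n) \<Longrightarrow> norm (Q n z \<omega>) \<le> K"
    and Q': "(\<lambda>p. Q' (fst p) (snd p)) \<in> borel_measurable (lborel \<Otimes>\<^sub>M N)"
      "\<And>z \<omega>. \<omega> \<in> space N \<Longrightarrow> norm (Q' z \<omega>) \<le> K"
    and mult: "AE z in lborel. \<kappa>' z \<noteq> 0 \<longrightarrow> multiplier (\<lambda>n. Q n z) (Q' z)"
  shows "multiplier (\<lambda>n \<omega>. \<integral>z. \<kappa> n z *\<^sub>R Q n z \<omega> \<partial>lborel) (\<lambda>\<omega>. \<integral>z. \<kappa>' z *\<^sub>R Q' z \<omega> \<partial>lborel)"
proof -
  interpret N: prob_space N by (rule prob_N)
  interpret M: prob_space "M n" for n by (rule prob_M)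
  interpret PN: pair_sigma_finite "lborel :: 'z measure" N ..
  interpret PM: pair_sigma_finite "lborel :: 'z measure" "M n" for n ..
  note [measurable] = Q(1) Q'(1) borel_measurable_integrable[OF \<kappa>(1)] borel_measurable_integrable[OF \<kappa>(2)]
  obtain \<omega>0 where "\<omega>0 \<in> space N" using N.not_empty by blast
  then have K: "K \<ge> 0" using Q'(2)[of \<omega>0] norm_ge_zero order_trans by blast
  have Qsec: "Q n z \<in> borel_measurable (M n)" for n z
    using measurable_compose[OF measurable_Pair1'[of z lborel "M n"] Q(1)[of n]] by simp
  have Q'sec: "Q' z \<in> borel_measurable N" for z
    using measurable_compose[OF measurable_Pair1'[of z lborel N] Q'(1)] by simp
  have Qsw: "(\<lambda>p. Q n (snd p) (fst p)) \<in> borel_measurable (M n \<Otimes>\<^sub>M lborel)" for n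
    using measurable_compose[OF measurable_pair_swap' Q(1)[of n]] by (simp add: case_prod_beta)
  have Q'sw: "(\<lambda>p. Q' (snd p) (fst p)) \<in> borel_measurable (N \<Otimes>\<^sub>M lborel)"
    using measurable_compose[OF measurable_pair_swap' Q'(1)] by (simp add: case_prod_beta)
  note [measurable] = Qsec Q'sec Qsw Q'sw
  define C where "C = (\<lambda>n. \<integral>z. \<bar>\<kappa> n z\<bar> \<partial>lborel)"
  define C' where "C' = (\<integral>z. \<bar>\<kappa>' z\<bar> \<partial>lborel)"
  have C: "\<bar>C n - C'\<bar> \<le> (\<integral>z. \<bar>\<kappa> n z - \<kappa>' z\<bar> \<partial>lborel)" for n
  proof -
    have "C n - C' = (\<integral>z. \<bar>\<kappa> n z\<bar> - \<bar>\<kappa>' z\<bar> \<partial>lborel)" unfolding C_def C'_def using \<kappa>(1)[of n] \<kappa>(2) by simp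
    also have "norm \<dots> \<le> (\<integral>z. \<bar>\<kappa> n z - \<kappa>' z\<bar> \<partial>lborel)"
      using \<kappa>(1)[of n] \<kappa>(2) by (intro integral_norm_bound_le) auto
    finally show ?thesis by simp
  qed
  have "(\<lambda>n. C n - C') \<longlonglongrightarrow> 0"
    by (rule tendsto_rabs_zero_cancel, rule tendsto_sandwich[OF _ _ tendsto_const \<kappa>(3)]) (use C in auto)
  then have "C \<longlonglongrightarrow> C'" by (simp add: LIM_zero_iff)
  then obtain D where D: "\<And>n. \<bar>C n\<bar> \<le> D" using convergent_imp_bounded[of C] unfolding bounded_iff by auto
  have bd: "norm (\<integral>z. \<kappa> n z *\<^sub>R Q n z \<omega> \<partial>lborel) \<le> C n * K" if "\<omega> \<in> space (M n)" for n \<omega>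
  proof -
    have "(\<integral>z. norm (\<kappa> n z *\<^sub>R Q n z \<omega>) \<partial>lborel) \<le> (\<integral>z. \<bar>\<kappa> n z\<bar> * K \<partial>lborel)"
      using \<kappa>(1)[of n] Q(2)[OF that] by (intro integral_mono') (auto intro!: mult_left_mono mult_nonneg_nonneg K)
    then show ?thesis using integral_norm_bound[of lborel "\<lambda>z. \<kappa> n z *\<^sub>R Q n z \<omega>"] by (simp add: C_def)
  qed
  have bd': "norm (\<integral>z. \<kappa>' z *\<^sub>R Q' z \<omega> \<partial>lborel) \<le> C' * K" if "\<omega> \<in> space N" for \<omega>
  proof -
    have "(\<integral>z. norm (\<kappa>' z *\<^sub>R Q' z \<omega>) \<partial>lborel) \<le> (\<integral>z. \<bar>\<kappa>' z\<bar> * K \<partial>lborel)"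
      using \<kappa>(2) Q'(2)[OF that] by (intro integral_mono') (auto intro!: mult_left_mono mult_nonneg_nonneg K)
    then show ?thesis using integral_norm_bound[of lborel "\<lambda>z. \<kappa>' z *\<^sub>R Q' z \<omega>"] by (simp add: C'_def)
  qed
  have bfam: "bounded_family (\<lambda>n \<omega>. \<integral>z. \<kappa> n z *\<^sub>R Q n z \<omega> \<partial>lborel) (\<lambda>\<omega>. \<integral>z. \<kappa>' z *\<^sub>R Q' z \<omega> \<partial>lborel)"
  proof (rule bounded_familyI[where K="max D \<bar>C'\<bar> * K"])
    show "(\<lambda>\<omega>. \<integral>z. \<kappa> n z *\<^sub>R Q n z \<omega> \<partial>lborel) \<in> borel_measurable (M n)" for n by measurable
    show "(\<lambda>\<omega>. \<integral>z. \<kappa>' z *\<^sub>R Q' z \<omega> \<partial>lborel) \<in> borel_measurable N" by measurable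
    show "norm (\<integral>z. \<kappa> n z *\<^sub>R Q n z \<omega> \<partial>lborel) \<le> max D \<bar>C'\<bar> * K" if "\<omega> \<in> space (M n)" for n \<omega>
      using bd[OF that] D[of n] K by (elim order_trans, intro mult_right_mono) auto
    show "norm (\<integral>z. \<kappa>' z *\<^sub>R Q' z \<omega> \<partial>lborel) \<le> max D \<bar>C'\<bar> * K" if "\<omega> \<in> space N" for \<omega>
      using bd'[OF that] K by (elim order_trans, intro mult_right_mono) auto
  qed
  show ?thesis
    unfolding multiplier_def
  proof (intro conjI allI impI bfam)
    fix H H' assume H: "convergent_family H H'"
    note bH = convergent_familyD(1)[OF H]
    obtain L where L0: "L \<ge> 0" "\<forall>n. H n \<in> borel_measurable (M n)" "\<forall>n. \<forall>\<omega>\<in>space (M n). norm (H n \<omega>) \<le> L"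
      "H' \<in> borel_measurable N" "\<forall>\<omega>\<in>space N. norm (H' \<omega>) \<le> L" using bounded_familyD[OF bH] by blast
    have [measurable]: "H n \<in> borel_measurable (M n)" "H' \<in> borel_measurable N" for n using L0 by auto
    show "convergent_family (\<lambda>n \<omega>. (\<integral>z. \<kappa> n z *\<^sub>R Q n z \<omega> \<partial>lborel) * H n \<omega>) (\<lambda>\<omega>. (\<integral>z. \<kappa>' z *\<^sub>R Q' z \<omega> \<partial>lborel) * H' \<omega>)"
      unfolding convergent_family_def
    proof (intro conjI allI impI)
      show "bounded_family (\<lambda>n \<omega>. (\<integral>z. \<kappa> n z *\<^sub>R Q n z \<omega> \<partial>lborel) * H n \<omega>) (\<lambda>\<omega>. (\<integral>z. \<kappa>' z *\<^sub>R Q' z \<omega> \<partial>lborel) * H' \<omega>)"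
        by (rule bounded_family_mult[OF bfam bH])
      fix c :: "(real \<times> 'k) list" assume c: "snd ` set c \<subseteq> KS"
      note [measurable] = measurable_lincomb_A[OF c] measurable_lincomb_B[OF c]
      define G where "G n z \<omega> = cis (lincomb (A n) c \<omega>) * (Q n z \<omega> * H n \<omega>)" for n z \<omega>
      define G' where "G' z \<omega> = cis (lincomb B c \<omega>) * (Q' z \<omega> * H' \<omega>)" for z \<omega>
      define g where "g n z = (\<integral>\<omega>. G n z \<omega> \<partial>M n)" for n z
      define g' where "g' z = (\<integral>\<omega>. G' z \<omega> \<partial>N)" for z
      have Gm[measurable]: "(\<lambda>p. G n (fst p) (snd p)) \<in> borel_measurable (lborel \<Otimes>\<^sub>M M n)" for n
        unfolding G_def by measurable
      have G'm[measurable]: "(\<lambda>p. G' (fst p) (snd p)) \<in> borel_measurable (lborel \<Otimes>\<^sub>M N)"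
        unfolding G'_def by measurable
      have Gb: "norm (G n z \<omega>) \<le> K * L" if "\<omega> \<in> space (M n)" for n z \<omega>
        unfolding G_def using that Q(2) L0 K by (auto simp: norm_mult intro!: mult_mono)
      have G'b: "norm (G' z \<omega>) \<le> K * L" if "\<omega> \<in> space N" for z \<omega>
        unfolding G'_def using that Q'(2) L0 K by (auto simp: norm_mult intro!: mult_mono)
      have gm[measurable]: "g n \<in> borel_measurable lborel" for n
        unfolding g_def using Gm[of n] by (intro M.borel_measurable_lebesgue_integral) (simp add: case_prod_beta)
      have g'm[measurable]: "g' \<in> borel_measurable lborel"
        unfolding g'_def using G'm by (intro N.borel_measurable_lebesgue_integral) (simp add: case_prod_beta)
      have KL: "K * L \<ge> 0" using K L0(1) by simp
      have gb: "norm (g n z) \<le> K * L" for n z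
      proof -
        have "(\<integral>\<omega>. norm (G n z \<omega>) \<partial>M n) \<le> (\<integral>\<omega>. K * L \<partial>M n)"
          using Gb KL by (intro integral_mono') auto
        then show ?thesis unfolding g_def by (intro order_trans[OF integral_norm_bound]) (simp add: M.prob_space)
      qed
      have fub: "(\<integral>\<omega>. cis (lincomb (A n) c \<omega>) * ((\<integral>z. \<kappa> n z *\<^sub>R Q n z \<omega> \<partial>lborel) * H n \<omega>) \<partial>M n) = (\<integral>z. \<kappa> n z *\<^sub>R g n z \<partial>lborel)" for n
      proof -
        have int: "integrable (lborel \<Otimes>\<^sub>M M n) (\<lambda>p. \<kappa> n (fst p) *\<^sub>R G n (fst p) (snd p))"
          by (rule PM.integrable_kernel_mult[OF \<kappa>(1) M.finite_measure Gm, where K="K * L"])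
            (auto simp: space_pair_measure intro: Gb)
        have "cis (lincomb (A n) c \<omega>) * ((\<integral>z. \<kappa> n z *\<^sub>R Q n z \<omega> \<partial>lborel) * H n \<omega>) = (\<integral>z. \<kappa> n z *\<^sub>R G n z \<omega> \<partial>lborel)" for \<omega>
          unfolding G_def by (simp add: scaleR_conv_of_real mult_ac
            integral_mult_right_zero[symmetric] integral_mult_left_zero[symmetric] del: integral_mult_right_zero integral_mult_left_zero)
        then show ?thesis using PM.Fubini_integral[of n "\<lambda>z \<omega>. \<kappa> n z *\<^sub>R G n z \<omega>"] int
          by (simp add: g_def case_prod_unfold)
      qed
      have fub': "(\<integral>\<omega>. cis (lincomb B c \<omega>) * ((\<integral>z. \<kappa>' z *\<^sub>R Q' z \<omega> \<partial>lborel) * H' \<omega>) \<partial>N) = (\<integral>z. \<kappa>' z *\<^sub>R g' z \<partial>lborel)"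
      proof -
        have int: "integrable (lborel \<Otimes>\<^sub>M N) (\<lambda>p. \<kappa>' (fst p) *\<^sub>R G' (fst p) (snd p))"
          by (rule PN.integrable_kernel_mult[OF \<kappa>(2) N.finite_measure G'm, where K="K * L"])
            (auto simp: space_pair_measure intro: G'b)
        have "cis (lincomb B c \<omega>) * ((\<integral>z. \<kappa>' z *\<^sub>R Q' z \<omega> \<partial>lborel) * H' \<omega>) = (\<integral>z. \<kappa>' z *\<^sub>R G' z \<omega> \<partial>lborel)" for \<omega>
          unfolding G'_def by (simp add: scaleR_conv_of_real mult_ac
            integral_mult_right_zero[symmetric] integral_mult_left_zero[symmetric] del: integral_mult_right_zero integral_mult_left_zero)
        then show ?thesis using PN.Fubini_integral[of "\<lambda>z \<omega>. \<kappa>' z *\<^sub>R G' z \<omega>"] int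
          by (simp add: g'_def case_prod_unfold)
      qed
      have intk: "integrable lborel (\<lambda>z. k z *\<^sub>R g n z)" if "integrable lborel k" for k n
      proof (rule Bochner_Integration.integrable_bound[OF integrable_mult_left[OF that, of "K * L"]])
        have "norm (k z *\<^sub>R g n z) \<le> norm (k z * (K * L))" for z
          using mult_left_mono[OF gb[of n z], of "\<bar>k z\<bar>"] abs_of_nonneg[OF KL] by (simp only: norm_scaleR real_norm_def abs_mult[of "k z"])
        then show "AE z in lborel. norm (k z *\<^sub>R g n z) \<le> norm (k z * (K * L))" by simp
        show "(\<lambda>z. k z *\<^sub>R g n z) \<in> borel_measurable lborel" using borel_measurable_integrable[OF that] by measurable
      qed
      have 1: "(\<lambda>n. (\<integral>z. \<kappa> n z *\<^sub>R g n z \<partial>lborel) - (\<integral>z. \<kappa>' z *\<^sub>R g n z \<partial>lborel)) \<longlonglongrightarrow> 0"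
      proof (rule Lim_null_comparison)
        show "(\<lambda>n. (K * L) * (\<integral>z. \<bar>\<kappa> n z - \<kappa>' z\<bar> \<partial>lborel)) \<longlonglongrightarrow> 0"
          using tendsto_mult_left[OF \<kappa>(3), of "K * L"] by simp
        have "norm ((\<integral>z. \<kappa> n z *\<^sub>R g n z \<partial>lborel) - (\<integral>z. \<kappa>' z *\<^sub>R g n z \<partial>lborel)) \<le> (K * L) * (\<integral>z. \<bar>\<kappa> n z - \<kappa>' z\<bar> \<partial>lborel)" for n
        proof -
          have "(\<integral>z. \<kappa> n z *\<^sub>R g n z \<partial>lborel) - (\<integral>z. \<kappa>' z *\<^sub>R g n z \<partial>lborel) = (\<integral>z. (\<kappa> n z - \<kappa>' z) *\<^sub>R g n z \<partial>lborel)"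
            using intk[OF \<kappa>(1)] intk[OF \<kappa>(2)] by (simp add: scaleR_diff_left)
          also have "norm \<dots> \<le> (\<integral>z. (K * L) * \<bar>\<kappa> n z - \<kappa>' z\<bar> \<partial>lborel)"
          proof (rule integral_norm_bound_le)
            show "integrable lborel (\<lambda>z. (\<kappa> n z - \<kappa>' z) *\<^sub>R g n z)" using \<kappa>(1,2) by (intro intk) auto
            show "integrable lborel (\<lambda>z. (K * L) * \<bar>\<kappa> n z - \<kappa>' z\<bar>)" using \<kappa>(1,2) by (intro integrable_mult_right integrable_abs) auto
            show "norm ((\<kappa> n z - \<kappa>' z) *\<^sub>R g n z) \<le> (K * L) * \<bar>\<kappa> n z - \<kappa>' z\<bar>" for z
              using mult_left_mono[OF gb[of n z], of "\<bar>\<kappa> n z - \<kappa>' z\<bar>"] by (simp add: mult.commute)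
          qed
          finally show ?thesis by simp
        qed
        then show "\<forall>\<^sub>F n in sequentially. norm ((\<integral>z. \<kappa> n z *\<^sub>R g n z \<partial>lborel) - (\<integral>z. \<kappa>' z *\<^sub>R g n z \<partial>lborel)) \<le> (K * L) * (\<integral>z. \<bar>\<kappa> n z - \<kappa>' z\<bar> \<partial>lborel)"
          by simp
      qed
      have 2: "(\<lambda>n. \<integral>z. \<kappa>' z *\<^sub>R g n z \<partial>lborel) \<longlonglongrightarrow> (\<integral>z. \<kappa>' z *\<^sub>R g' z \<partial>lborel)"
      proof (rule integral_dominated_convergence[where w="\<lambda>z. \<bar>\<kappa>' z\<bar> * (K * L)"])
        show "integrable lborel (\<lambda>z. \<bar>\<kappa>' z\<bar> * (K * L))" using \<kappa>(2) by auto
        show "AE z in lborel. (\<lambda>n. \<kappa>' z *\<^sub>R g n z) \<longlonglongrightarrow> \<kappa>' z *\<^sub>R g' z"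
          using mult
        proof eventually_elim
          case (elim z)
          show ?case
          proof (cases "\<kappa>' z = 0")
            case False
            then have "multiplier (\<lambda>n. Q n z) (Q' z)" using elim by simp
            from convergent_familyD(2)[OF multiplierD[OF this H] c]
            show ?thesis unfolding g_def g'_def G_def G'_def by (intro tendsto_scaleR tendsto_const)
          qed simp
        qed
        show "AE z in lborel. norm (\<kappa>' z *\<^sub>R g n z) \<le> \<bar>\<kappa>' z\<bar> * (K * L)" for n
          using gb by (auto intro!: mult_left_mono)
      qed measurable
      show "(\<lambda>n. \<integral>\<omega>. cis (lincomb (A n) c \<omega>) * ((\<integral>z. \<kappa> n z *\<^sub>R Q n z \<omega> \<partial>lborel) * H n \<omega>) \<partial>M n) \<longlonglongrightarrow>
         (\<integral>\<omega>. cis (lincomb B c \<omega>) * ((\<integral>z. \<kappa>' z *\<^sub>R Q' z \<omega> \<partial>lborel) * H' \<omega>) \<partial>N)"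
        unfolding fub fub' using tendsto_add[OF 1 2] by simp
    qed
  qed
qed

section \<open>Continuous and Lipschitz functions of multipliers\<close>

lemma multiplier_compose:
  fixes R :: "nat \<Rightarrow> 'a \<Rightarrow> real" and \<phi> :: "real \<Rightarrow> real"
  assumes R: "multiplier (\<lambda>n \<omega>. complex_of_real (R n \<omega>)) (\<lambda>\<omega>. complex_of_real (R' \<omega>))"
    and \<phi>: "continuous_on UNIV \<phi>"
  shows "multiplier (\<lambda>n \<omega>. complex_of_real (\<phi> (R n \<omega>))) (\<lambda>\<omega>. complex_of_real (\<phi> (R' \<omega>)))"
proof -
  interpret N: prob_space N by (rule prob_N)
  interpret M: prob_space "M n" for n by (rule prob_M)
  obtain K where K: "K \<ge> 0" "\<forall>n. (\<lambda>\<omega>. complex_of_real (R n \<omega>)) \<in> borel_measurable (M n)" "\<forall>n. \<forall>\<omega>\<in>space (M n). \<bar>R n \<omega>\<bar> \<le> K"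
    "(\<lambda>\<omega>. complex_of_real (R' \<omega>)) \<in> borel_measurable N" "\<forall>\<omega>\<in>space N. \<bar>R' \<omega>\<bar> \<le> K"
    using bounded_familyD[OF multiplier_bounded[OF R]] by auto
  have [measurable]: "R n \<in> borel_measurable (M n)" "R' \<in> borel_measurable N" for n
    using measurable_compose[OF K(2)[rule_format, of n], of Re borel] measurable_compose[OF K(4), of Re borel] by simp_all
  have [measurable]: "\<phi> \<in> borel_measurable borel" using \<phi> by (rule borel_measurable_continuous_onI)
  have c: "continuous_on {-K..K} \<phi>" using \<phi> by (rule continuous_on_subset) auto
  have "bounded (\<phi> ` {-K..K})" by (intro compact_imp_bounded compact_continuous_image c) auto
  then obtain C where C: "\<forall>x\<in>{-K..K}. \<bar>\<phi> x\<bar> \<le> C" unfolding bounded_iff by auto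
  have RK: "R n \<omega> \<in> {-K..K}" if "\<omega> \<in> space (M n)" for n \<omega> using K(3) that by (auto simp: abs_le_iff minus_le_iff)
  have R'K: "R' \<omega> \<in> {-K..K}" if "\<omega> \<in> space N" for \<omega> using K(5) that by (auto simp: abs_le_iff minus_le_iff)
  show ?thesis
  proof (rule multiplier_L1_approx)
    show "bounded_family (\<lambda>n \<omega>. complex_of_real (\<phi> (R n \<omega>))) (\<lambda>\<omega>. complex_of_real (\<phi> (R' \<omega>)))"
      by (rule bounded_familyI[where K=C]) (use C RK R'K in auto)
    fix e :: real assume e: "e > 0"
    \<comment> \<open>All values lie in the common range \<open>{-K..K}\<close>, and polynomials in
      a multiplier are multipliers by the algebra, so uniform approximation on this range is
      enough.\<close>
    obtain p where p: "real_polynomial_function p" "\<And>x. x \<in> {-K..K} \<Longrightarrow> \<bar>\<phi> x - p x\<bar> < e"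
      using Stone_Weierstrass_real_polynomial_function[OF _ c e] by auto
    obtain a d where pd: "p = (\<lambda>x. \<Sum>i\<le>d. a i * x ^ i)" using p(1) unfolding real_polynomial_function_iff_sum by blast
    have [measurable]: "p \<in> borel_measurable borel" unfolding pd by measurable
    have "multiplier (\<lambda>n \<omega>. \<Sum>i\<le>d. complex_of_real (a i) * complex_of_real (R n \<omega>) ^ i) (\<lambda>\<omega>. \<Sum>i\<le>d. complex_of_real (a i) * complex_of_real (R' \<omega>) ^ i)"
      by (intro multiplier_sum multiplier_mult multiplier_power R multiplier_const tendsto_const) auto
    then have mp: "multiplier (\<lambda>n \<omega>. complex_of_real (p (R n \<omega>))) (\<lambda>\<omega>. complex_of_real (p (R' \<omega>)))"
      by (simp add: pd)
    have 1: "(\<integral>\<omega>. norm (complex_of_real (\<phi> (R n \<omega>)) - complex_of_real (p (R n \<omega>))) \<partial>M n) \<le> e" for n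
    proof -
      have le: "norm (complex_of_real (\<phi> (R n \<omega>)) - complex_of_real (p (R n \<omega>))) \<le> e" if "\<omega> \<in> space (M n)" for \<omega>
        unfolding of_real_diff[symmetric] norm_of_real using p(2)[OF RK[OF that]] by simp
      show ?thesis
        by (intro M.integral_le_const M.integrable_const_bound[where B=e]) (use le in auto)
    qed
    have 2: "(\<integral>\<omega>. norm (complex_of_real (\<phi> (R' \<omega>)) - complex_of_real (p (R' \<omega>))) \<partial>N) \<le> e"
    proof -
      have le: "norm (complex_of_real (\<phi> (R' \<omega>)) - complex_of_real (p (R' \<omega>))) \<le> e" if "\<omega> \<in> space N" for \<omega>
        unfolding of_real_diff[symmetric] norm_of_real using p(2)[OF R'K[OF that]] by simp
      show ?thesis
        by (intro N.integral_le_const N.integrable_const_bound[where B=e]) (use le in auto)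
    qed
    show "\<exists>P P'. multiplier P P' \<and>
      (\<forall>\<^sub>F n in sequentially. (\<integral>\<omega>. norm (complex_of_real (\<phi> (R n \<omega>)) - P n \<omega>) \<partial>M n) \<le> e) \<and>
      (\<integral>\<omega>. norm (complex_of_real (\<phi> (R' \<omega>)) - P' \<omega>) \<partial>N) \<le> e"
      using mp 1 2 by (intro exI conjI) auto
  qed
qed

lemma multiplier_cis_of_real:
  assumes R: "multiplier (\<lambda>n \<omega>. complex_of_real (R n \<omega>)) (\<lambda>\<omega>. complex_of_real (R' \<omega>))"
  shows "multiplier (\<lambda>n \<omega>. cis (u * R n \<omega>)) (\<lambda>\<omega>. cis (u * R' \<omega>))"
proof -
  have "multiplier (\<lambda>n \<omega>. complex_of_real (cos (u * R n \<omega>)) + \<i> * complex_of_real (sin (u * R n \<omega>)))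
     (\<lambda>\<omega>. complex_of_real (cos (u * R' \<omega>)) + \<i> * complex_of_real (sin (u * R' \<omega>)))"
    by (intro multiplier_add multiplier_mult multiplier_const tendsto_const
        multiplier_compose[OF R, of "\<lambda>x. cos (u * x)"] multiplier_compose[OF R, of "\<lambda>x. sin (u * x)"] continuous_intros)
  moreover have "complex_of_real (cos x) + \<i> * complex_of_real (sin x) = cis x" for x
    by (simp add: complex_eq_iff)
  ultimately show ?thesis by simp
qed

lemma multiplier_sin:
  assumes "\<And>u. multiplier (\<lambda>n \<omega>. cis (u * R n \<omega>)) (\<lambda>\<omega>. cis (u * R' \<omega>))"
  shows "multiplier (\<lambda>n \<omega>. complex_of_real (sin (u * R n \<omega>))) (\<lambda>\<omega>. complex_of_real (sin (u * R' \<omega>)))"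
proof -
  have "complex_of_real (sin x) = - (\<i> / 2) * (cis x + - cis (- x))" for x
    by (simp add: complex_eq_iff)
  then show ?thesis
    using multiplier_mult[OF multiplier_const[OF tendsto_const[of "- (\<i> / 2)"]]
      multiplier_add[OF assms[of u] multiplier_uminus[OF assms[of "- u"]]]] by simp
qed

end

text \<open>A quadratic error bound that is valid for all \<open>x\<close> allows truncation by the
  sine to be controlled by second moments alone.\<close>

lemma abs_diff_sin_le: "\<bar>x - sin x\<bar> \<le> x\<^sup>2" for x :: real
proof (cases "x = 0")
  case False
  have "\<exists>z. \<bar>z\<bar> \<le> \<bar>x\<bar> \<and> sin x = x * cos z"
  proof (cases "x > 0")
    case True
    from MVT2[OF this, of sin cos] show ?thesis by (auto intro!: derivative_eq_intros) (smt (verit))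
  next
    case False
    then have "x < 0" using \<open>x \<noteq> 0\<close> by simp
    from MVT2[OF this, of sin cos] show ?thesis by (auto intro!: derivative_eq_intros) (smt (verit))
  qed
  then obtain z where z: "\<bar>z\<bar> \<le> \<bar>x\<bar>" "sin x = x * cos z" by blast
  have "1 - cos z = 2 * (sin (z / 2))\<^sup>2" using cos_double_sin[of "z / 2"] by simp
  also have "\<dots> \<le> 2 * \<bar>sin (z / 2)\<bar>"
    using mult_left_le[of "\<bar>sin (z / 2)\<bar>" "\<bar>sin (z / 2)\<bar>"] by (simp add: power2_eq_square)
  also have "\<dots> \<le> \<bar>z\<bar>" using abs_sin_x_le_abs_x[of "z / 2"] by simp
  finally have "\<bar>1 - cos z\<bar> \<le> \<bar>x\<bar>" using z(1) by (simp add: abs_of_nonneg)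
  then have "\<bar>x\<bar> * \<bar>1 - cos z\<bar> \<le> \<bar>x\<bar> * \<bar>x\<bar>" by (intro mult_left_mono) auto
  moreover have "x - sin x = x * (1 - cos z)" using z(2) by (simp add: right_diff_distrib)
  ultimately show ?thesis by (simp only: abs_mult) (simp add: power2_eq_square)
qed simp

context limit_law
begin

text \<open>\<open>R\<close> may be unbounded, so polynomials in \<open>R\<close> are out of reach.
  Its substitute is \<open>sin (r * R) / r\<close>, a bounded multiplier built from characters; for
  a Lipschitz function the error in mean is at most \<open>r * L\<close> times the second moment of
  \<open>R\<close>, and \<open>r\<close> is chosen small.\<close>

lemma multiplier_lipschitz:
  fixes R :: "nat \<Rightarrow> 'a \<Rightarrow> real" and \<phi> :: "real \<Rightarrow> real"
  assumes R: "\<And>u. multiplier (\<lambda>n \<omega>. cis (u * R n \<omega>)) (\<lambda>\<omega>. cis (u * R' \<omega>))"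
    and meas[measurable]: "\<And>n. R n \<in> borel_measurable (M n)" "R' \<in> borel_measurable N"
    and sq: "\<forall>\<^sub>F n in sequentially. integrable (M n) (\<lambda>\<omega>. (R n \<omega>)\<^sup>2) \<and> (\<integral>\<omega>. (R n \<omega>)\<^sup>2 \<partial>M n) \<le> C"
    and sq': "integrable N (\<lambda>\<omega>. (R' \<omega>)\<^sup>2)"
    and \<phi>: "\<And>x. \<bar>\<phi> x\<bar> \<le> F" "\<And>x y. \<bar>\<phi> x - \<phi> y\<bar> \<le> L * \<bar>x - y\<bar>"
  shows "multiplier (\<lambda>n \<omega>. complex_of_real (\<phi> (R n \<omega>))) (\<lambda>\<omega>. complex_of_real (\<phi> (R' \<omega>)))"
proof -
  interpret N: prob_space N by (rule prob_N)
  interpret M: prob_space "M n" for n by (rule prob_M)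
  have L: "L \<ge> 0" using \<phi>(2)[of 0 1] by simp
  have cont: "continuous_on UNIV \<phi>"
    by (rule lipschitz_on_continuous_on[where L=L]) (use \<phi>(2) L in \<open>auto simp: lipschitz_on_def dist_real_def\<close>)
  have [measurable]: "\<phi> \<in> borel_measurable borel" using cont by (rule borel_measurable_continuous_onI)
  define C' where "C' = (\<integral>\<omega>. (R' \<omega>)\<^sup>2 \<partial>N)"
  define B where "B = max C C'"
  have B0: "B \<ge> 0" unfolding B_def C'_def by (rule order_trans[OF integral_nonneg_AE max.cobounded2]) auto
  show ?thesis
  proof (rule multiplier_L1_approx)
    show "bounded_family (\<lambda>n \<omega>. complex_of_real (\<phi> (R n \<omega>))) (\<lambda>\<omega>. complex_of_real (\<phi> (R' \<omega>)))"
      by (rule bounded_familyI[where K=F]) (use \<phi>(1) in auto)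
    fix e :: real assume e: "e > 0"
    define r where "r = e / (L * B + 1)"
    have LB: "L * B \<ge> 0" using L B0 by simp
    have r: "r > 0" unfolding r_def using e LB by simp
    have rLB: "r * L * B \<le> e" unfolding r_def using e LB by (simp add: field_simps)
    define \<psi> where "\<psi> = (\<lambda>x. \<phi> (inverse r * x))"
    have c\<psi>: "continuous_on UNIV \<psi>" unfolding \<psi>_def
      by (rule continuous_on_compose2[OF cont]) (auto intro!: continuous_intros)
    have [measurable]: "\<psi> \<in> borel_measurable borel" using c\<psi> by (rule borel_measurable_continuous_onI)
    have mp: "multiplier (\<lambda>n \<omega>. complex_of_real (\<psi> (sin (r * R n \<omega>)))) (\<lambda>\<omega>. complex_of_real (\<psi> (sin (r * R' \<omega>))))"
      by (rule multiplier_compose[OF multiplier_sin[OF R] c\<psi>])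
    have le: "\<bar>\<phi> x - \<psi> (sin (r * x))\<bar> \<le> r * L * x\<^sup>2" for x
    proof -
      have "\<bar>\<phi> x - \<psi> (sin (r * x))\<bar> \<le> L * \<bar>x - inverse r * sin (r * x)\<bar>" unfolding \<psi>_def by (rule \<phi>(2))
      also have "\<bar>x - inverse r * sin (r * x)\<bar> = inverse r * \<bar>r * x - sin (r * x)\<bar>"
      proof -
        have "x - inverse r * sin (r * x) = inverse r * (r * x - sin (r * x))" using r by (simp add: right_diff_distrib)
        then show ?thesis using r by (simp only: abs_mult) simp
      qed
      also have "L * (inverse r * \<bar>r * x - sin (r * x)\<bar>) \<le> L * (inverse r * (r * x)\<^sup>2)"
        using r L by (intro mult_left_mono abs_diff_sin_le) auto
      also have "\<dots> = r * L * x\<^sup>2" using r by (simp add: power2_eq_square)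
      finally show ?thesis .
    qed
    have 1: "(\<integral>\<omega>. norm (complex_of_real (\<phi> (R n \<omega>)) - complex_of_real (\<psi> (sin (r * R n \<omega>)))) \<partial>M n) \<le> e"
      if "integrable (M n) (\<lambda>\<omega>. (R n \<omega>)\<^sup>2)" "(\<integral>\<omega>. (R n \<omega>)\<^sup>2 \<partial>M n) \<le> C" for n
    proof -
      have "(\<integral>\<omega>. norm (complex_of_real (\<phi> (R n \<omega>)) - complex_of_real (\<psi> (sin (r * R n \<omega>)))) \<partial>M n) \<le> (\<integral>\<omega>. r * L * (R n \<omega>)\<^sup>2 \<partial>M n)"
        using that le r L by (intro integral_mono') (auto simp del: of_real_diff simp flip: of_real_diff)
      also have "\<dots> = r * L * (\<integral>\<omega>. (R n \<omega>)\<^sup>2 \<partial>M n)" by simp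
      also have "\<dots> \<le> r * L * B" using that r L by (intro mult_left_mono) (auto simp: B_def)
      finally show ?thesis using rLB by simp
    qed
    have 2: "(\<integral>\<omega>. norm (complex_of_real (\<phi> (R' \<omega>)) - complex_of_real (\<psi> (sin (r * R' \<omega>)))) \<partial>N) \<le> e"
    proof -
      have "(\<integral>\<omega>. norm (complex_of_real (\<phi> (R' \<omega>)) - complex_of_real (\<psi> (sin (r * R' \<omega>)))) \<partial>N) \<le> (\<integral>\<omega>. r * L * (R' \<omega>)\<^sup>2 \<partial>N)"
        using sq' le r L by (intro integral_mono') (auto simp del: of_real_diff simp flip: of_real_diff)
      also have "\<dots> = r * L * C'" by (simp add: C'_def)
      also have "\<dots> \<le> r * L * B" using r L by (intro mult_left_mono) (auto simp: B_def)
      finally show ?thesis using rLB by simp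
    qed
    have "\<forall>\<^sub>F n in sequentially. (\<integral>\<omega>. norm (complex_of_real (\<phi> (R n \<omega>)) - complex_of_real (\<psi> (sin (r * R n \<omega>)))) \<partial>M n) \<le> e"
      using sq by eventually_elim (use 1 in blast)
    then show "\<exists>P P'. multiplier P P' \<and>
      (\<forall>\<^sub>F n in sequentially. (\<integral>\<omega>. norm (complex_of_real (\<phi> (R n \<omega>)) - P n \<omega>) \<partial>M n) \<le> e) \<and>
      (\<integral>\<omega>. norm (complex_of_real (\<phi> (R' \<omega>)) - P' \<omega>) \<partial>N) \<le> e"
      using mp 2 by (intro exI conjI)
  qed
qed

end

section \<open>Picard iteration with random forcing\<close>

text \<open>\<open>V\<close> will collect the initial datum and the noise. An index \<open>z\<close>
  stands for a space-time point and the time integration is part of the kernel, so that one step of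
  the iteration is a single integral over the plane.\<close>

primrec picard :: "('z::euclidean_space \<Rightarrow> 'z \<Rightarrow> real) \<Rightarrow> (real \<Rightarrow> real) \<Rightarrow> ('z \<Rightarrow> 'a \<Rightarrow> real) \<Rightarrow> nat \<Rightarrow> 'z \<Rightarrow> 'a \<Rightarrow> real" where
  "picard \<kappa> f V 0 = V"
| "picard \<kappa> f V (Suc m) = (\<lambda>z \<omega>. V z \<omega> + (\<integral>z'. \<kappa> z z' * f (picard \<kappa> f V m z' \<omega>) \<partial>lborel))"

lemma measurable_section:
  assumes "(\<lambda>p. X (fst p) (snd p)) \<in> borel_measurable (L \<Otimes>\<^sub>M M)" "z \<in> space L"
  shows "X z \<in> borel_measurable M"
  using measurable_compose[OF measurable_Pair1'[OF assms(2), of M] assms(1)] by simp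

lemma measurable_kernel_integral:
  fixes \<kappa> :: "'z::euclidean_space \<Rightarrow> 'z \<Rightarrow> real" and X :: "'z \<Rightarrow> 'a \<Rightarrow> real"
  assumes \<kappa>: "(\<lambda>p. \<kappa> (fst p) (snd p)) \<in> borel_measurable (lborel \<Otimes>\<^sub>M lborel)"
    and f[measurable]: "f \<in> borel_measurable borel"
    and X: "(\<lambda>p. X (fst p) (snd p)) \<in> borel_measurable (lborel \<Otimes>\<^sub>M M)"
  shows "(\<lambda>p. \<integral>z'. \<kappa> (fst p) z' * f (X z' (snd p)) \<partial>lborel) \<in> borel_measurable (lborel \<Otimes>\<^sub>M M)"
proof -
  have [measurable]: "(\<lambda>q. \<kappa> (fst (fst q)) (snd q)) \<in> borel_measurable ((lborel \<Otimes>\<^sub>M M) \<Otimes>\<^sub>M lborel)"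
    using measurable_compose[of "\<lambda>q. (fst (fst q), snd q)" "(lborel \<Otimes>\<^sub>M M) \<Otimes>\<^sub>M lborel" "lborel \<Otimes>\<^sub>M lborel", OF _ \<kappa>] by simp
  have [measurable]: "(\<lambda>q. X (snd q) (snd (fst q))) \<in> borel_measurable ((lborel \<Otimes>\<^sub>M M) \<Otimes>\<^sub>M lborel)"
    using measurable_compose[of "\<lambda>q. (snd q, snd (fst q))" "(lborel \<Otimes>\<^sub>M M) \<Otimes>\<^sub>M lborel" "lborel \<Otimes>\<^sub>M M", OF _ X] by simp
  show ?thesis by measurable
qed

lemma kernel_integral_abs_le:
  fixes \<kappa> :: "'z::euclidean_space \<Rightarrow> real"
  assumes "integrable lborel \<kappa>" "\<And>z. \<bar>g z\<bar> \<le> F" "(\<integral>z. \<bar>\<kappa> z\<bar> \<partial>lborel) \<le> T"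
  shows "\<bar>\<integral>z. \<kappa> z * g z \<partial>lborel\<bar> \<le> T * F"
proof -
  have F: "F \<ge> 0" using assms(2)[of undefined] by linarith
  have "(\<integral>z. \<bar>\<kappa> z * g z\<bar> \<partial>lborel) \<le> (\<integral>z. \<bar>\<kappa> z\<bar> * F \<partial>lborel)"
    using assms(1,2) F by (intro integral_mono') (auto simp: abs_mult intro!: mult_left_mono)
  also have "\<dots> \<le> T * F" using assms(3) F by (simp add: mult_right_mono)
  finally show ?thesis by (rule order_trans[OF integral_abs_bound])
qed

lemma measurable_picard:
  assumes \<kappa>: "(\<lambda>p. \<kappa> (fst p) (snd p)) \<in> borel_measurable (lborel \<Otimes>\<^sub>M lborel)"
    and f[measurable]: "f \<in> borel_measurable borel"
    and V[measurable]: "(\<lambda>p. V (fst p) (snd p)) \<in> borel_measurable (lborel \<Otimes>\<^sub>M M)"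
  shows "(\<lambda>p. picard \<kappa> f V m (fst p) (snd p)) \<in> borel_measurable (lborel \<Otimes>\<^sub>M M)"
proof (induction m)
  case (Suc m)
  have [measurable]: "(\<lambda>p. \<integral>z'. \<kappa> (fst p) z' * f (picard \<kappa> f V m z' (snd p)) \<partial>lborel) \<in> borel_measurable (lborel \<Otimes>\<^sub>M M)"
    by (rule measurable_kernel_integral[OF \<kappa> f Suc])
  show ?case by simp
qed (simp add: V)

lemma (in prob_space) second_moment_add_bounded:
  fixes V Y :: "'a \<Rightarrow> real"
  assumes [measurable]: "V \<in> borel_measurable M" "Y \<in> borel_measurable M"
    and V: "integrable M (\<lambda>\<omega>. (V \<omega>)\<^sup>2)" "(\<integral>\<omega>. (V \<omega>)\<^sup>2 \<partial>M) \<le> C" and Y: "\<And>\<omega>. \<bar>Y \<omega>\<bar> \<le> B"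
  shows "integrable M (\<lambda>\<omega>. (V \<omega> + Y \<omega>)\<^sup>2)" "(\<integral>\<omega>. (V \<omega> + Y \<omega>)\<^sup>2 \<partial>M) \<le> 2 * C + 2 * B\<^sup>2"
proof -
  have le: "(V \<omega> + Y \<omega>)\<^sup>2 \<le> 2 * (V \<omega>)\<^sup>2 + 2 * B\<^sup>2" for \<omega>
  proof -
    have "(Y \<omega>)\<^sup>2 \<le> B\<^sup>2" 
      using Y[of \<omega>] abs_le_square_iff[of "Y \<omega>" B] by linarith
    moreover have "(V \<omega> + Y \<omega>)\<^sup>2 \<le> 2 * (V \<omega>)\<^sup>2 + 2 * (Y \<omega>)\<^sup>2"
      using sum_squares_bound[of "V \<omega>" "Y \<omega>"] by (simp add: power2_sum)
    ultimately show ?thesis by linarith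
  qed
  have i: "integrable M (\<lambda>\<omega>. 2 * (V \<omega>)\<^sup>2 + 2 * B\<^sup>2)" using V(1) by auto
  show "integrable M (\<lambda>\<omega>. (V \<omega> + Y \<omega>)\<^sup>2)"
  proof (rule Bochner_Integration.integrable_bound[OF i])
    have "norm ((V \<omega> + Y \<omega>)\<^sup>2) \<le> norm (2 * (V \<omega>)\<^sup>2 + 2 * B\<^sup>2)" for \<omega>
      unfolding real_norm_def abs_of_nonneg[OF zero_le_power2] by (rule order_trans[OF le abs_ge_self])
    then show "AE \<omega> in M. norm ((V \<omega> + Y \<omega>)\<^sup>2) \<le> norm (2 * (V \<omega>)\<^sup>2 + 2 * B\<^sup>2)" by simp
  qed measurable
  then have "(\<integral>\<omega>. (V \<omega> + Y \<omega>)\<^sup>2 \<partial>M) \<le> (\<integral>\<omega>. 2 * (V \<omega>)\<^sup>2 + 2 * B\<^sup>2 \<partial>M)"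
    using i le by (intro integral_mono)
  then show "(\<integral>\<omega>. (V \<omega> + Y \<omega>)\<^sup>2 \<partial>M) \<le> 2 * C + 2 * B\<^sup>2" using V by (simp add: prob_space)
qed

lemma bounded_lipschitz_measurable:
  fixes f :: "real \<Rightarrow> real"
  assumes "\<And>x y. \<bar>f x - f y\<bar> \<le> L * \<bar>x - y\<bar>"
  shows "continuous_on A f" "f \<in> borel_measurable borel"
proof -
  have L: "L \<ge> 0" using assms[of 0 1] by simp
  have c: "continuous_on UNIV f"
    by (rule lipschitz_on_continuous_on[where L=L]) (use assms L in \<open>auto simp: lipschitz_on_def dist_real_def\<close>)
  then show "f \<in> borel_measurable borel" by (rule borel_measurable_continuous_onI)
  show "continuous_on A f" using c by (rule continuous_on_subset) auto
qed

context limit_law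
begin

text \<open>By induction on \<open>m\<close>: \<open>f\<close> of an iterate is a multiplier since
  \<open>f\<close> is bounded and Lipschitz, its kernel integral is one by closure under
  integration, and the character of the next iterate factors into that of the forcing and that of
  the integral. The induction covers all points of \<open>D\<close> at once because the integral
  evaluates the iterate elsewhere; \<open>supp\<close> keeps these points inside
  \<open>D\<close>.\<close>

lemma multiplier_picard:
  fixes \<kappa> :: "nat \<Rightarrow> 'z::euclidean_space \<Rightarrow> 'z \<Rightarrow> real" and V :: "nat \<Rightarrow> 'z \<Rightarrow> 'a \<Rightarrow> real"
  assumes f: "\<And>x. \<bar>f x\<bar> \<le> F" "\<And>x y. \<bar>f x - f y\<bar> \<le> L * \<bar>x - y\<bar>"
    and \<kappa>: "\<And>n z. integrable lborel (\<kappa> n z)" "\<And>n z. (\<integral>z'. \<bar>\<kappa> n z z'\<bar> \<partial>lborel) \<le> T"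
      "\<And>n. (\<lambda>p. \<kappa> n (fst p) (snd p)) \<in> borel_measurable (lborel \<Otimes>\<^sub>M lborel)"
    and \<kappa>': "\<And>z. integrable lborel (\<kappa>' z)" "\<And>z. (\<integral>z'. \<bar>\<kappa>' z z'\<bar> \<partial>lborel) \<le> T"
      "(\<lambda>p. \<kappa>' (fst p) (snd p)) \<in> borel_measurable (lborel \<Otimes>\<^sub>M lborel)"
    and conv: "\<And>z. z \<in> D \<Longrightarrow> (\<lambda>n. \<integral>z'. \<bar>\<kappa> n z z' - \<kappa>' z z'\<bar> \<partial>lborel) \<longlonglongrightarrow> 0"
    and supp: "\<And>z. z \<in> D \<Longrightarrow> AE z' in lborel. \<kappa>' z z' \<noteq> 0 \<longrightarrow> z' \<in> D"
    and V: "\<And>n. (\<lambda>p. V n (fst p) (snd p)) \<in> borel_measurable (lborel \<Otimes>\<^sub>M M n)"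
    and V': "(\<lambda>p. V' (fst p) (snd p)) \<in> borel_measurable (lborel \<Otimes>\<^sub>M N)"
    and mult: "\<And>z u. z \<in> D \<Longrightarrow> multiplier (\<lambda>n \<omega>. cis (u * V n z \<omega>)) (\<lambda>\<omega>. cis (u * V' z \<omega>))"
    and sq: "\<And>z. z \<in> D \<Longrightarrow> \<exists>C. \<forall>\<^sub>F n in sequentially. integrable (M n) (\<lambda>\<omega>. (V n z \<omega>)\<^sup>2) \<and> (\<integral>\<omega>. (V n z \<omega>)\<^sup>2 \<partial>M n) \<le> C"
    and sq': "\<And>z. z \<in> D \<Longrightarrow> integrable N (\<lambda>\<omega>. (V' z \<omega>)\<^sup>2)"
    and z: "z \<in> D"
  shows "multiplier (\<lambda>n \<omega>. cis (u * picard (\<kappa> n) f (V n) m z \<omega>)) (\<lambda>\<omega>. cis (u * picard \<kappa>' f V' m z \<omega>))"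
  using z
proof (induction m arbitrary: z u)
  case 0
  then show ?case by (simp add: mult)
next
  case (Suc m)
  interpret N: prob_space N by (rule prob_N)
  interpret M: prob_space "M n" for n by (rule prob_M)
  note fm[measurable] = bounded_lipschitz_measurable(2)[OF f(2)]
  let ?P = "\<lambda>n. picard (\<kappa> n) f (V n)" and ?P' = "picard \<kappa>' f V'"
  have Pm: "(\<lambda>p. ?P n k (fst p) (snd p)) \<in> borel_measurable (lborel \<Otimes>\<^sub>M M n)" for n k
    by (rule measurable_picard[OF \<kappa>(3) fm V])
  have P'm: "(\<lambda>p. ?P' k (fst p) (snd p)) \<in> borel_measurable (lborel \<Otimes>\<^sub>M N)" for k
    by (rule measurable_picard[OF \<kappa>'(3) fm V'])
  have Ps[measurable]: "?P n k z \<in> borel_measurable (M n)" "V n z \<in> borel_measurable (M n)" for n k z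
    using measurable_section[OF Pm, of z] measurable_section[OF V, of z] by auto
  have P's[measurable]: "?P' k z \<in> borel_measurable N" "V' z \<in> borel_measurable N" for k z
    using measurable_section[OF P'm, of z] measurable_section[OF V', of z] by auto
  define Y where "Y n k z \<omega> = (\<integral>z'. \<kappa> n z z' * f (?P n k z' \<omega>) \<partial>lborel)" for n k z \<omega>
  define Y' where "Y' k z \<omega> = (\<integral>z'. \<kappa>' z z' * f (?P' k z' \<omega>) \<partial>lborel)" for k z \<omega>
  have Pdec: "?P n (Suc k) z \<omega> = V n z \<omega> + Y n k z \<omega>" for n k z \<omega> by (simp add: Y_def)
  have P'dec: "?P' (Suc k) z \<omega> = V' z \<omega> + Y' k z \<omega>" for k z \<omega> by (simp add: Y'_def)
  have Yb: "\<bar>Y n k z \<omega>\<bar> \<le> T * F" for n k z \<omega>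
    unfolding Y_def by (rule kernel_integral_abs_le[OF \<kappa>(1) f(1) \<kappa>(2)])
  have Y'b: "\<bar>Y' k z \<omega>\<bar> \<le> T * F" for k z \<omega>
    unfolding Y'_def by (rule kernel_integral_abs_le[OF \<kappa>'(1) f(1) \<kappa>'(2)])
  have Ym[measurable]: "Y n k z \<in> borel_measurable (M n)" for n k z
    unfolding Y_def using measurable_section[OF measurable_kernel_integral[OF \<kappa>(3) fm Pm], of z] by simp
  have Y'm[measurable]: "Y' k z \<in> borel_measurable N" for k z
    unfolding Y'_def using measurable_section[OF measurable_kernel_integral[OF \<kappa>'(3) fm P'm], of z] by simp
  have mf: "multiplier (\<lambda>n \<omega>. complex_of_real (f (?P n m w \<omega>))) (\<lambda>\<omega>. complex_of_real (f (?P' m w \<omega>)))" if w: "w \<in> D" for w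
  proof -
    obtain C where C: "\<forall>\<^sub>F n in sequentially. integrable (M n) (\<lambda>\<omega>. (V n w \<omega>)\<^sup>2) \<and> (\<integral>\<omega>. (V n w \<omega>)\<^sup>2 \<partial>M n) \<le> C"
      using sq[OF w] by blast
    \<comment> \<open>An iterate is the forcing plus a term bounded by \<open>T * F\<close>,
      whatever \<open>m\<close> is, so the second moments do not deteriorate along the
      iteration.\<close>
    have 1: "\<forall>\<^sub>F n in sequentially. integrable (M n) (\<lambda>\<omega>. (?P n m w \<omega>)\<^sup>2) \<and> (\<integral>\<omega>. (?P n m w \<omega>)\<^sup>2 \<partial>M n) \<le> max C (2 * C + 2 * (T * F)\<^sup>2)"
      using C
    proof eventually_elim
      case (elim n)
      show ?case
      proof (cases m)
        case 0
        then show ?thesis using elim by auto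
      next
        case (Suc k)
        show ?thesis unfolding Suc Pdec
          using M.second_moment_add_bounded[of "V n w" n "Y n k w" C "T * F"] elim Yb by (auto simp: le_max_iff_disj)
      qed
    qed
    have 2: "integrable N (\<lambda>\<omega>. (?P' m w \<omega>)\<^sup>2)"
    proof (cases m)
      case 0
      then show ?thesis using sq'[OF w] by simp
    next
      case (Suc k)
      show ?thesis unfolding Suc P'dec
        using N.second_moment_add_bounded(1)[of "V' w" "Y' k w" "\<integral>\<omega>. (V' w \<omega>)\<^sup>2 \<partial>N" "T * F"] sq'[OF w] Y'b by auto
    qed
    show ?thesis by (rule multiplier_lipschitz[OF Suc.IH[OF w] _ _ 1 2 f]) auto
  qed
  have "multiplier (\<lambda>n \<omega>. \<integral>z'. \<kappa> n z z' *\<^sub>R complex_of_real (f (?P n m z' \<omega>)) \<partial>lborel) (\<lambda>\<omega>. \<integral>z'. \<kappa>' z z' *\<^sub>R complex_of_real (f (?P' m z' \<omega>)) \<partial>lborel)"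
  proof (rule multiplier_integral[where K=F])
    show "(\<lambda>p. complex_of_real (f (?P n m (fst p) (snd p)))) \<in> borel_measurable (lborel \<Otimes>\<^sub>M M n)" for n
      using Pm[of n m] by measurable
    show "(\<lambda>p. complex_of_real (f (?P' m (fst p) (snd p)))) \<in> borel_measurable (lborel \<Otimes>\<^sub>M N)"
      using P'm[of m] by measurable
    show "AE z' in lborel. \<kappa>' z z' \<noteq> 0 \<longrightarrow> multiplier (\<lambda>n \<omega>. complex_of_real (f (?P n m z' \<omega>))) (\<lambda>\<omega>. complex_of_real (f (?P' m z' \<omega>)))"
      using supp[OF Suc.prems] by eventually_elim (use mf in auto)
  qed (use \<kappa> \<kappa>' conv[OF Suc.prems] f in auto)
  moreover have "(\<integral>z'. k z' *\<^sub>R complex_of_real (g z') \<partial>lborel) = complex_of_real (\<integral>z'. k z' * g z' \<partial>lborel)" for k g :: "'z \<Rightarrow> real"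
    by (simp add: scaleR_conv_of_real flip: of_real_mult)
  ultimately have "multiplier (\<lambda>n \<omega>. complex_of_real (Y n m z \<omega>)) (\<lambda>\<omega>. complex_of_real (Y' m z \<omega>))"
    unfolding Y_def Y'_def by simp
  from multiplier_mult[OF mult[OF Suc.prems, of u] multiplier_cis_of_real[OF this, of u]]
  show ?case unfolding Pdec P'dec by (simp add: cis_mult distrib_left)
qed

text \<open>Characters are Lipschitz, so a uniform error of the variables is an L1 error of the
  characters. For each \<open>m\<close> one bound \<open>\<epsilon> m\<close> has to serve all large
  \<open>n\<close>, which is what the contraction estimate for the iteration will supply.\<close>

lemma multiplier_uniform_limit:
  fixes X :: "nat \<Rightarrow> 'a \<Rightarrow> real" and P :: "nat \<Rightarrow> nat \<Rightarrow> 'a \<Rightarrow> real"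
  assumes P: "\<And>m. multiplier (\<lambda>n \<omega>. cis (u * P m n \<omega>)) (\<lambda>\<omega>. cis (u * P' m \<omega>))"
    and [measurable]: "\<And>n. X n \<in> borel_measurable (M n)" "X' \<in> borel_measurable N"
      "\<And>n m. P m n \<in> borel_measurable (M n)" "\<And>m. P' m \<in> borel_measurable N"
    and \<epsilon>: "\<epsilon> \<longlonglongrightarrow> 0" "\<And>m. \<forall>\<^sub>F n in sequentially. \<forall>\<omega>\<in>space (M n). \<bar>X n \<omega> - P m n \<omega>\<bar> \<le> \<epsilon> m"
      "\<And>m \<omega>. \<omega> \<in> space N \<Longrightarrow> \<bar>X' \<omega> - P' m \<omega>\<bar> \<le> \<epsilon> m"
  shows "multiplier (\<lambda>n \<omega>. cis (u * X n \<omega>)) (\<lambda>\<omega>. cis (u * X' \<omega>))"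
proof (rule multiplier_L1_approx)
  interpret N: prob_space N by (rule prob_N)
  interpret M: prob_space "M n" for n by (rule prob_M)
  show "bounded_family (\<lambda>n \<omega>. cis (u * X n \<omega>)) (\<lambda>\<omega>. cis (u * X' \<omega>))"
    by (rule bounded_familyI[where K=1]) auto
  fix e :: real assume e: "e > 0"
  have "(\<lambda>m. \<bar>u\<bar> * \<epsilon> m) \<longlonglongrightarrow> 0" using tendsto_mult_left[OF \<epsilon>(1), of "\<bar>u\<bar>"] by simp
  then obtain m where m: "\<bar>u\<bar> * \<epsilon> m < e"
    using order_tendstoD(2)[OF _ e] eventually_happens[of _ sequentially] by force
  have cis_le: "norm (cis (u * x) - cis (u * y)) \<le> e" if "\<bar>x - y\<bar> \<le> \<epsilon> m" for x y
  proof -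
    have "cis (u * x) - cis (u * y) = cis (u * y) * (cis (u * x - u * y) - 1)"
      by (simp add: algebra_simps cis_mult)
    then have "norm (cis (u * x) - cis (u * y)) = norm (cis (u * (x - y)) - 1)"
      by (simp only: norm_mult norm_cis mult_1 right_diff_distrib[symmetric, of u])
    also have "\<dots> \<le> \<bar>u * (x - y)\<bar>"
      using iexp_approx1[of "u * (x - y)" 0] by (simp add: cis_conv_exp)
    also have "\<dots> \<le> \<bar>u\<bar> * \<epsilon> m" using that by (simp add: abs_mult mult_left_mono)
    finally show ?thesis using m by simp
  qed
  have "\<forall>\<^sub>F n in sequentially. (\<integral>\<omega>. norm (cis (u * X n \<omega>) - cis (u * P m n \<omega>)) \<partial>M n) \<le> e"
    using \<epsilon>(2)[of m]
  proof eventually_elim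
    case (elim n)
    show ?case
      by (intro M.integral_le_const M.integrable_const_bound[where B=e]) (use cis_le elim in auto)
  qed
  moreover have "(\<integral>\<omega>. norm (cis (u * X' \<omega>) - cis (u * P' m \<omega>)) \<partial>N) \<le> e"
    by (intro N.integral_le_const N.integrable_const_bound[where B=e]) (use cis_le \<epsilon>(3) in auto)
  ultimately show "\<exists>Q Q'. multiplier Q Q' \<and>
      (\<forall>\<^sub>F n in sequentially. (\<integral>\<omega>. norm (cis (u * X n \<omega>) - Q n \<omega>) \<partial>M n) \<le> e) \<and>
      (\<integral>\<omega>. norm (cis (u * X' \<omega>) - Q' \<omega>) \<partial>N) \<le> e"
    using P[of m] by (intro exI conjI)
qed

end

section \<open>Kernels comparable to the heat kernel\<close>

text \<open>Causality, time horizon and spatial domain are built in by extension with zero. The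
  kernels of all intervals and of the line are then functions on the same plane and can be compared
  in L1.\<close>

definition kap :: "real \<Rightarrow> real set \<Rightarrow> (real \<Rightarrow> real \<Rightarrow> real \<Rightarrow> real) \<Rightarrow> real \<times> real \<Rightarrow> real \<times> real \<Rightarrow> real" where
  "kap T I K z z' = (if 0 \<le> fst z' \<and> fst z' < fst z \<and> fst z \<le> T \<and> snd z \<in> I \<and> snd z' \<in> I
     then K (fst z - fst z') (snd z) (snd z') else 0)"

lemma inverse_sqrt_integral:
  fixes p t :: real
  assumes "p \<le> t"
  shows "set_integrable lborel {p..<t} (\<lambda>s. 1 / sqrt (t - s))"
    and "(LBINT s:{p..<t}. 1 / sqrt (t - s)) = 2 * sqrt (t - p)"
proof -
  let ?f = "\<lambda>s. 1 / sqrt (t - s)"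
  have 1: "set_integrable lborel {p..<t} ?f \<and> (LBINT s:{p..<t}. ?f s) = 2 * sqrt (t - p)"
  proof (cases "p = t")
    case True
    then show ?thesis by (simp add: set_integrable_def set_lebesgue_integral_def)
  next
    case False
    then have pt: "ereal p < ereal t" using assms by simp
    have lim: "((\<lambda>s. - 2 * sqrt (t - s)) \<longlongrightarrow> - 2 * sqrt (t - x)) F" if "F \<le> at x" for x F
      by (rule tendsto_mono[OF that]) (intro tendsto_intros)
    have lim1: "(((\<lambda>s. - 2 * sqrt (t - s)) \<circ> real_of_ereal) \<longlongrightarrow> - 2 * sqrt (t - p)) (at_right (ereal p))"
      unfolding ereal_tendsto_simps by (rule lim) (rule at_le, simp)
    have lim2: "(((\<lambda>s. - 2 * sqrt (t - s)) \<circ> real_of_ereal) \<longlongrightarrow> - 2 * sqrt (t - t)) (at_left (ereal t))"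
      unfolding ereal_tendsto_simps by (rule lim) (rule at_le, simp)
    have der: "DERIV (\<lambda>s. - 2 * sqrt (t - s)) x :> ?f x" if "x < t" for x
      using that by (auto intro!: derivative_eq_intros simp: field_simps)
    have cont: "isCont ?f x" if "x < t" for x
      using that by (auto intro!: continuous_intros)
    note A = interval_integral_FTC_nonneg[OF pt, of "\<lambda>s. - 2 * sqrt (t - s)" ?f, OF _ _ _ lim1 lim2]
    have P: "DERIV (\<lambda>s. - 2 * sqrt (t - s)) x :> ?f x" "isCont ?f x" if "ereal x < ereal t" for x
      by (rule der, use that in simp) (rule cont, use that in simp)
    have Q: "AE x in lborel. ereal p < ereal x \<longrightarrow> ereal x < ereal t \<longrightarrow> 0 \<le> ?f x" by auto
    have B: "set_integrable lborel (einterval p t) ?f" "(LBINT x=p..t. ?f x) = - 2 * sqrt (t - t) - (- 2 * sqrt (t - p))"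
      by (rule A[OF P(1) P(2) Q]; assumption)+
    have C: "set_integrable lborel {p..<t} ?f \<longleftrightarrow> set_integrable lborel (einterval p t) ?f"
      by (rule set_integrable_discrete_difference[where X="{p}"]) (auto simp: einterval_iff)
    have "(LBINT s:{p..<t}. ?f s) = (LBINT s:einterval p t. ?f s)"
      by (rule set_integral_discrete_difference[where X="{p}"]) (auto simp: einterval_iff)
    also have "\<dots> = (LBINT x=p..t. ?f x)" using assms by (simp add: interval_lebesgue_integral_def)
    finally show ?thesis using B C by simp
  qed
  then show "set_integrable lborel {p..<t} ?f" "(LBINT s:{p..<t}. ?f s) = 2 * sqrt (t - p)" by auto
qed

lemma measurable_fst_snd_borel [measurable]:
  "(fst :: real \<times> real \<Rightarrow> real) \<in> borel_measurable borel"
  "(snd :: real \<times> real \<Rightarrow> real) \<in> borel_measurable borel"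
  by (simp_all add: borel_prod[symmetric])

lemma integrable_indicator_Ico:
  fixes p q :: real shows "integrable lborel (indicat_real {p..<q})"
  by (cases "p \<le> q") (auto intro!: integrable_real_indicator)

lemma lborel_translate:
  fixes f :: "'a::euclidean_space \<Rightarrow> 'b::{banach, second_countable_topology}"
  assumes [measurable]: "f \<in> borel_measurable borel"
  shows "(\<integral>z. f (c + z) \<partial>lborel) = (\<integral>z. f z \<partial>lborel)"
    and "integrable lborel (\<lambda>z. f (c + z)) \<longleftrightarrow> integrable lborel f"
proof -
  have "(\<integral>z. f z \<partial>lborel) = (\<integral>z. f z \<partial>distr lborel borel ((+) c))" by (simp add: lborel_distr_plus)
  also have "\<dots> = (\<integral>z. f (c + z) \<partial>lborel)" by (rule integral_distr) auto
  finally show "(\<integral>z. f (c + z) \<partial>lborel) = (\<integral>z. f z \<partial>lborel)" by simp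
  have "integrable lborel f \<longleftrightarrow> integrable (distr lborel borel ((+) c)) f" by (simp add: lborel_distr_plus)
  also have "\<dots> \<longleftrightarrow> integrable lborel (\<lambda>z. f (c + z))" by (rule integrable_distr_eq) auto
  finally show "integrable lborel (\<lambda>z. f (c + z)) \<longleftrightarrow> integrable lborel f" by simp
qed

text \<open>The time singularity common to the heat kernels in dimension one, cut off before
  \<open>p\<close>. It serves as an integrable weight that dominates one of the two kernels in a
  product.\<close>

definition sing :: "real \<Rightarrow> real \<Rightarrow> real \<Rightarrow> real \<Rightarrow> real" where
  "sing C p t s = (if p \<le> s \<and> s < t then C / sqrt (t - s) else 0)"

lemma measurable_sing [measurable]: "sing C p t \<in> borel_measurable borel"
  unfolding sing_def by measurable

lemma sing_nonneg: "C \<ge> 0 \<Longrightarrow> sing C p t s \<ge> 0" by (simp add: sing_def)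

lemma integral_sing:
  assumes C: "C \<ge> 0" and pt: "p \<le> t" and "A \<in> sets borel"
  shows "set_integrable lborel A (sing C p t)" "(LBINT s:A. sing C p t s) \<le> C * (2 * sqrt (t - p))"
proof -
  have eq: "sing C p t s = indicator {p..<t} s *\<^sub>R (C * (1 / sqrt (t - s)))" for s by (auto simp: sing_def)
  have i: "integrable lborel (sing C p t)"
    unfolding eq using inverse_sqrt_integral(1)[OF pt]
    by (simp only: set_integrable_def[symmetric]) (rule set_integrable_mult_right, simp)
  then show "set_integrable lborel A (sing C p t)" unfolding set_integrable_def using assms by (intro integrable_mult_indicator) auto
  then have "(LBINT s:A. sing C p t s) \<le> (LBINT s. sing C p t s)"
    unfolding set_lebesgue_integral_def set_integrable_def using i
    by (intro integral_mono) (auto simp: sing_nonneg C split: split_indicator)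
  also have "\<dots> = (LBINT s:{p..<t}. C * (1 / sqrt (t - s)))" unfolding eq set_lebesgue_integral_def ..
  also have "\<dots> = C * (LBINT s:{p..<t}. 1 / sqrt (t - s))" by (rule set_integral_mult_right)
  also have "\<dots> = C * (2 * sqrt (t - p))" by (simp only: inverse_sqrt_integral(2)[OF pt])
  finally show "(LBINT s:A. sing C p t s) \<le> C * (2 * sqrt (t - p))" .
qed

text \<open>The properties shared by the Neumann kernel on an interval and the heat kernel on the
  line. For the Neumann kernels \<open>C\<close> depends on \<open>T\<close> only, so whatever is
  derived here is uniform in \<open>lam\<close>.\<close>

locale heat_like =
  fixes T C :: real and I :: "real set" and K :: "real \<Rightarrow> real \<Rightarrow> real \<Rightarrow> real"
  assumes C_nonneg: "C \<ge> 0"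
    and I_borel [measurable]: "I \<in> sets borel"
    and K_meas: "(\<lambda>p. K (fst p) (fst (snd p)) (snd (snd p))) \<in> borel_measurable borel"
    and K_nonneg: "\<And>t y \<eta>. y \<in> I \<Longrightarrow> \<eta> \<in> I \<Longrightarrow> 0 \<le> K t y \<eta>"
    and K_le: "\<And>t y \<eta>. 0 < t \<Longrightarrow> t \<le> T \<Longrightarrow> y \<in> I \<Longrightarrow> \<eta> \<in> I \<Longrightarrow> K t y \<eta> \<le> C / sqrt t"
    and K_zero: "\<And>t y \<eta>. t \<le> 0 \<Longrightarrow> K t y \<eta> = 0"
    and K_int: "\<And>t y. 0 < t \<Longrightarrow> y \<in> I \<Longrightarrow> set_integrable lborel I (K t y)"
      "\<And>t y. 0 < t \<Longrightarrow> y \<in> I \<Longrightarrow> (LBINT \<eta>:I. K t y \<eta>) = 1"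
begin

abbreviation "k \<equiv> kap T I K"

lemma kap_nonneg: "0 \<le> k z z'"
  by (auto simp: kap_def intro: K_nonneg)

lemma kap_le: "k z z' \<le> C / sqrt (fst z - fst z')" if "fst z' < fst z"
  using that C_nonneg by (auto simp: kap_def intro!: K_le)

lemma measurable_K [measurable (raw)]:
  assumes [measurable]: "f \<in> borel_measurable M" "g \<in> borel_measurable M" "h \<in> borel_measurable M"
  shows "(\<lambda>x. K (f x) (g x) (h x)) \<in> borel_measurable M"
  using measurable_compose[OF _ K_meas, of "\<lambda>x. (f x, g x, h x)" M] by (simp add: borel_prod[symmetric])

lemma measurable_kap [measurable (raw)]:
  assumes [measurable]: "f \<in> borel_measurable M" "g \<in> borel_measurable M"
  shows "(\<lambda>x. k (f x) (g x)) \<in> borel_measurable M"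
proof -
  have [measurable]: "(\<lambda>x. fst (f x)) \<in> borel_measurable M" "(\<lambda>x. snd (f x)) \<in> borel_measurable M"
    "(\<lambda>x. fst (g x)) \<in> borel_measurable M" "(\<lambda>x. snd (g x)) \<in> borel_measurable M"
    using measurable_compose[OF assms(1), of fst borel] measurable_compose[OF assms(1), of snd borel]
      measurable_compose[OF assms(2), of fst borel] measurable_compose[OF assms(2), of snd borel]
    by (simp_all add: borel_prod[symmetric])
  show ?thesis unfolding kap_def by measurable
qed

text \<open>Spatial mass one collapses the integral of the kernel against a function of time to an
  integral over the elapsed time.\<close>

lemma nn_integral_kap:
  assumes z: "fst z \<le> T" "snd z \<in> I" and [measurable]: "w \<in> borel_measurable borel"
  shows "(\<integral>\<^sup>+z'. ennreal (k z z') * w (fst z') \<partial>lborel) = (\<integral>\<^sup>+s. indicator {0..<fst z} s * w s \<partial>lborel)"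
proof -
  have "(\<integral>\<^sup>+z'. ennreal (k z z') * w (fst z') \<partial>lborel) = (\<integral>\<^sup>+z'. ennreal (k z z') * w (fst z') \<partial>(lborel \<Otimes>\<^sub>M lborel))"
    by (simp add: lborel_prod)
  also have "\<dots> = (\<integral>\<^sup>+s. \<integral>\<^sup>+\<eta>. ennreal (k z (s, \<eta>)) * w s \<partial>lborel \<partial>lborel)"
    by (subst lborel.nn_integral_fst[symmetric]) (simp_all add: lborel_prod)
  also have "\<dots> = (\<integral>\<^sup>+s. indicator {0..<fst z} s * w s \<partial>lborel)"
  proof (rule nn_integral_cong)
    fix s :: real
    have "(\<integral>\<^sup>+\<eta>. ennreal (k z (s, \<eta>)) \<partial>lborel) = indicator {0..<fst z} s"
    proof (cases "0 \<le> s \<and> s < fst z")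
      case True
      then have "(\<integral>\<^sup>+\<eta>. ennreal (k z (s, \<eta>)) \<partial>lborel) = (\<integral>\<^sup>+\<eta>. ennreal (indicator I \<eta> *\<^sub>R K (fst z - s) (snd z) \<eta>) \<partial>lborel)"
        using z by (intro nn_integral_cong) (auto simp: kap_def)
      also have "\<dots> = ennreal (LBINT \<eta>:I. K (fst z - s) (snd z) \<eta>)"
        unfolding set_lebesgue_integral_def using K_int[of "fst z - s" "snd z"] True z
        by (intro nn_integral_eq_integral) (auto simp: set_integrable_def intro!: AE_I2 K_nonneg mult_nonneg_nonneg split: split_indicator)
      also have "\<dots> = indicator {0..<fst z} s" using K_int(2)[of "fst z - s" "snd z"] True z by simp
      finally show ?thesis .
    next
      case False
      then have "k z (s, \<eta>) = 0" for \<eta> by (auto simp: kap_def)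
      then show ?thesis using False by auto
    qed
    then show "(\<integral>\<^sup>+\<eta>. ennreal (k z (s, \<eta>)) * w s \<partial>lborel) = indicator {0..<fst z} s * w s"
      by (simp add: nn_integral_multc)
  qed
  finally show ?thesis .
qed

lemma integral_kap_weight:
  assumes z: "fst z \<le> T" "snd z \<in> I" and [measurable]: "w \<in> borel_measurable borel" and w: "\<And>s. w s \<ge> 0"
    and i: "set_integrable lborel {0..<fst z} w"
  shows "integrable lborel (\<lambda>z'. k z z' * w (fst z'))"
    and "(\<integral>z'. k z z' * w (fst z') \<partial>lborel) = (LBINT s:{0..<fst z}. w s)"
proof -
  have "(\<integral>\<^sup>+z'. ennreal (k z z' * w (fst z')) \<partial>lborel) = (\<integral>\<^sup>+z'. ennreal (k z z') * ennreal (w (fst z')) \<partial>lborel)"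
    by (intro nn_integral_cong) (auto simp: ennreal_mult kap_nonneg w)
  also have "\<dots> = (\<integral>\<^sup>+s. indicator {0..<fst z} s * ennreal (w s) \<partial>lborel)"
    by (rule nn_integral_kap[OF z]) measurable
  also have "\<dots> = (\<integral>\<^sup>+s. ennreal (indicator {0..<fst z} s *\<^sub>R w s) \<partial>lborel)"
    by (intro nn_integral_cong) (auto split: split_indicator)
  also have "\<dots> = ennreal (LBINT s:{0..<fst z}. w s)"
    unfolding set_lebesgue_integral_def
    using i w by (intro nn_integral_eq_integral) (auto simp: set_integrable_def)
  finally have eq: "(\<integral>\<^sup>+z'. ennreal (k z z' * w (fst z')) \<partial>lborel) = ennreal (LBINT s:{0..<fst z}. w s)" .
  have n: "(LBINT s:{0..<fst z}. w s) \<ge> 0" unfolding set_lebesgue_integral_def using w by (intro integral_nonneg_AE) auto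
  show int: "integrable lborel (\<lambda>z'. k z z' * w (fst z'))"
    by (rule integrableI_nonneg) (auto simp: eq kap_nonneg w)
  show "(\<integral>z'. k z z' * w (fst z') \<partial>lborel) = (LBINT s:{0..<fst z}. w s)"
    by (subst integral_eq_nn_integral) (auto simp: eq n kap_nonneg w)
qed

lemma kap_outside: "\<not> (fst z \<le> T \<and> snd z \<in> I) \<Longrightarrow> k z = (\<lambda>_. 0)"
  by (auto simp: kap_def)

lemma integrable_kap: "integrable lborel (k z)"
proof (cases "fst z \<le> T \<and> snd z \<in> I")
  case True
  then show ?thesis using integral_kap_weight(1)[of z "\<lambda>_. 1"] by (simp add: set_integrable_def integrable_indicator_Ico)
qed (simp add: kap_outside)

lemma integral_kap: "fst z \<le> T \<Longrightarrow> snd z \<in> I \<Longrightarrow> (\<integral>z'. k z z' \<partial>lborel) = max 0 (fst z)"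
  using integral_kap_weight(2)[of z "\<lambda>_. 1"] by (simp add: set_integrable_def set_lebesgue_integral_def max_def integrable_indicator_Ico)

lemma integral_kap_le:
  assumes "T \<ge> 0" shows "(\<integral>z'. \<bar>k z z'\<bar> \<partial>lborel) \<le> T"
proof (cases "fst z \<le> T \<and> snd z \<in> I")
  case True
  then show ?thesis using integral_kap[of z] assms by (simp add: abs_of_nonneg[OF kap_nonneg])
qed (use assms in \<open>simp add: kap_outside\<close>)

lemma kap_le_sing: "k z z' \<le> sing C 0 (fst z) (fst z')"
  using kap_le[of z' z] sing_nonneg[OF C_nonneg, of 0 "fst z" "fst z'"] by (auto simp: sing_def kap_def)

text \<open>One factor is bounded by its time singularity, the other has spatial mass one, and the
  remaining \<open>1 / sqrt\<close> is integrable in time. This is what makes stochastic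
  convolutions with space-time white noise random variables in dimension one.\<close>

lemma integrable_kap_mult: "integrable lborel (\<lambda>p. k z p * k z' p)"
proof (cases "fst z \<le> T \<and> snd z \<in> I \<and> 0 \<le> fst z'")
  case True
  have "integrable lborel (\<lambda>p. k z p * sing C 0 (fst z') (fst p))"
    by (rule integral_kap_weight(1)) (use True integral_sing(1)[OF C_nonneg] sing_nonneg[OF C_nonneg] in auto)
  then show ?thesis
    by (rule Bochner_Integration.integrable_bound)
      (auto simp: abs_mult kap_nonneg sing_nonneg C_nonneg intro!: mult_left_mono kap_le_sing)
next
  case False
  then have "(\<lambda>p. k z p * k z' p) = (\<lambda>_. 0)" by (auto simp: kap_def)
  then show ?thesis by simp
qed

text \<open>Bounding one factor by the singularity and using mass one for the other leaves the
  square root of the elapsed time. It is an upper bound for the variance of the noise that enters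
  after time \<open>p\<close>.\<close>

lemma integral_kap_sq_le:
  assumes "p \<ge> 0" "p \<le> fst z" 
  shows "(\<integral>q. indicator {p..} (fst q) * (k z q)\<^sup>2 \<partial>lborel) \<le> C * (2 * sqrt (fst z - p))"
proof (cases "fst z \<le> T \<and> snd z \<in> I")
  case True
  have i: "integrable lborel (\<lambda>q. k z q * sing C p (fst z) (fst q))"
    "(\<integral>q. k z q * sing C p (fst z) (fst q) \<partial>lborel) = (LBINT s:{0..<fst z}. sing C p (fst z) s)"
    using True assms integral_sing(1)[OF C_nonneg] sing_nonneg[OF C_nonneg] by (auto intro!: integral_kap_weight)
  have le: "indicator {p..} (fst q) * (k z q)\<^sup>2 \<le> k z q * sing C p (fst z) (fst q)" for q
    using mult_left_mono[OF kap_le_sing[of z q] kap_nonneg[of z q]] sing_nonneg[OF C_nonneg, of p "fst z" "fst q"] kap_nonneg[of z q] assms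
    by (auto simp: power2_eq_square sing_def split: split_indicator)
  have "(\<integral>q. indicator {p..} (fst q) * (k z q)\<^sup>2 \<partial>lborel) \<le> (\<integral>q. k z q * sing C p (fst z) (fst q) \<partial>lborel)"
    using i(1) le by (intro integral_mono') (auto intro!: mult_nonneg_nonneg kap_nonneg sing_nonneg C_nonneg)
  also have "\<dots> \<le> C * (2 * sqrt (fst z - p))" unfolding i(2) using assms by (intro integral_sing C_nonneg) auto
  finally show ?thesis .
qed (use assms C_nonneg in \<open>simp add: kap_outside\<close>)

end

lemma heat_like_neumann:
  assumes "q - p \<ge> 1" "T > 0"
  shows "heat_like T (sqrt T + 1) {p<..<q} (neumann_kernel p q)"
proof
  show "0 \<le> neumann_kernel p q t y \<eta>" if "y \<in> {p<..<q}" "\<eta> \<in> {p<..<q}" for t y \<eta>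
    using order_trans[OF heat_kernel_nonneg heat_kernel_le_neumann_kernel[OF that]] .
qed (use assms in \<open>auto intro!: neumann_kernel_le borel_measurable_neumann_kernel set_integral_neumann_kernel, auto simp: neumann_kernel_def\<close>)

lemma heat_like_heat: "heat_like T 1 UNIV heat_kernel"
proof
  fix t y :: real assume t: "0 < t"
  have eq: "heat_kernel t y = normal_density y (sqrt (2 * t))" using heat_kernel_normal[OF t] by auto
  show "set_integrable lborel UNIV (heat_kernel t y)" "(LBINT \<eta>:UNIV. heat_kernel t y \<eta>) = 1"
    using t by (auto simp: eq set_integrable_def set_lebesgue_integral_def)
next
  fix t y \<eta> :: real assume t: "0 < t" "t \<le> T"
  have "heat_kernel t y \<eta> \<le> 1 / sqrt (4 * pi * t)"
    using t by (simp add: heat_kernel_def divide_right_mono)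
  also have "\<dots> \<le> 1 / sqrt t"
  proof (intro divide_left_mono)
    have "1 * t \<le> 4 * pi * t" using t pi_gt3 by (intro mult_right_mono) auto
    then show "sqrt t \<le> sqrt (4 * pi * t)" by simp
  qed (use t in auto)
  finally show "heat_kernel t y \<eta> \<le> 1 / sqrt t" .
qed (auto simp: heat_kernel_nonneg borel_measurable_heat_kernel, auto simp: heat_kernel_def)

section \<open>Convergence of kernels and covariances far from the boundary\<close>

lemma heat_kernel_translate: "heat_kernel t (c + y) (c + \<eta>) = heat_kernel t y \<eta>"
  by (simp add: heat_kernel_def)

lemma kap_heat_translate: "kap T UNIV heat_kernel (t, c + y) ((0, c) + p) = kap T UNIV heat_kernel (t, y) p"
  by (simp add: kap_def heat_kernel_translate)

text \<open>On the interval the kernel \<open>K n\<close> is the larger one, outside its extension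
  vanishes; so the modulus of the difference is the difference plus twice the heat kernel outside.
  Both kernels have the same weighted mass, hence only the last term survives, and after translation
  of the centre to the origin it is bounded by a Gaussian tail beyond radius \<open>R n\<close>. The
  weight \<open>w\<close> is there for the covariances, where a second kernel is replaced by its
  singularity.\<close>

lemma kap_weighted_conv:
  fixes x R :: "nat \<Rightarrow> real"
  assumes H: "\<And>n. heat_like T C (J n) (K n)"
    and ge: "\<And>n t y \<eta>. y \<in> J n \<Longrightarrow> \<eta> \<in> J n \<Longrightarrow> heat_kernel t y \<eta> \<le> K n t y \<eta>"
    and R: "filterlim R at_top sequentially" and sub: "\<And>n. {x n - R n<..<x n + R n} \<subseteq> J n"
    and t: "t \<le> T" and w[measurable]: "w \<in> borel_measurable borel" "\<And>s. w s \<ge> 0" "set_integrable lborel {0..<t} w"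
  shows "\<forall>\<^sub>F n in sequentially. integrable lborel (\<lambda>p. \<bar>kap T (J n) (K n) (t, x n) p - kap T UNIV heat_kernel (t, x n) p\<bar> * w (fst p))"
    and "(\<lambda>n. \<integral>p. \<bar>kap T (J n) (K n) (t, x n) p - kap T UNIV heat_kernel (t, x n) p\<bar> * w (fst p) \<partial>lborel) \<longlonglongrightarrow> 0"
proof -
  interpret H: heat_like T 1 UNIV heat_kernel by (rule heat_like_heat)
  let ?h = "kap T UNIV heat_kernel"
  let ?g = "\<lambda>n p. \<bar>kap T (J n) (K n) (t, x n) p - ?h (t, x n) p\<bar> * w (fst p)"
  let ?I = "\<lambda>n. \<integral>p. ?h (t, x n) p * (indicator (- J n) (snd p) * w (fst p)) \<partial>lborel"
  have ih: "integrable lborel (\<lambda>p. ?h (t, y) p * w (fst p))" for y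
    by (rule H.integral_kap_weight(1)) (use t w in auto)
  have J[measurable]: "J n \<in> sets borel" for n using H by (simp add: heat_like_def)
  have ihJ: "integrable lborel (\<lambda>p. ?h (t, y) p * (indicator A (snd p) * w (fst p)))" if [measurable]: "A \<in> sets borel" for y A
    by (rule Bochner_Integration.integrable_bound[OF ih[of y]]) (auto simp: abs_mult split: split_indicator)
  have main: "integrable lborel (?g n) \<and> (\<integral>p. ?g n p \<partial>lborel) = 2 * ?I n" if "R n > 0" for n
  proof -
    interpret Hn: heat_like T C "J n" "K n" by (rule H)
    have xJ: "x n \<in> J n" using sub[of n] that by auto
    have ik: "integrable lborel (\<lambda>p. kap T (J n) (K n) (t, x n) p * w (fst p))"
      "(\<integral>p. kap T (J n) (K n) (t, x n) p * w (fst p) \<partial>lborel) = (LBINT s:{0..<t}. w s)"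
      using Hn.integral_kap_weight[of "(t, x n)" w] t w xJ by auto
    have hk: "(\<integral>p. ?h (t, x n) p * w (fst p) \<partial>lborel) = (LBINT s:{0..<t}. w s)"
      using H.integral_kap_weight(2)[of "(t, x n)" w] t w by auto
    have eq: "?g n p = kap T (J n) (K n) (t, x n) p * w (fst p) - ?h (t, x n) p * w (fst p) + 2 * (?h (t, x n) p * (indicator (- J n) (snd p) * w (fst p)))" for p
    proof (cases "snd p \<in> J n")
      case True
      have "?h (t, x n) p \<le> kap T (J n) (K n) (t, x n) p" using True xJ ge by (auto simp: kap_def)
      then show ?thesis using True by (simp add: left_diff_distrib)
    next
      case False
      then have "kap T (J n) (K n) (t, x n) p = 0" by (simp add: kap_def)
      then show ?thesis using False H.kap_nonneg[of "(t, x n)" p] by simp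
    qed
    show ?thesis unfolding eq using ik ih[of "x n"] ihJ[of "- J n" "x n"] hk by simp
  qed
  have ev: "\<forall>\<^sub>F n in sequentially. R n > 0" using R by (simp add: filterlim_at_top_dense)
  show "\<forall>\<^sub>F n in sequentially. integrable lborel (?g n)"
    using ev by eventually_elim (use main in blast)
  let ?T = "\<lambda>n. \<integral>p. ?h (t, 0) p * (indicator {u. R n \<le> \<bar>u\<bar>} (snd p) * w (fst p)) \<partial>lborel"
  have Tm[measurable]: "{u. r \<le> \<bar>u\<bar>} \<in> sets borel" for r :: real by measurable
  have le: "?I n \<le> ?T n" for n
  proof -
    have "?I n = (\<integral>p. ?h (t, x n) ((0, x n) + p) * (indicator (- J n) (snd ((0, x n) + p)) * w (fst ((0, x n) + p))) \<partial>lborel)"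
      by (rule lborel_translate(1)[symmetric]) measurable
    also have "\<dots> = (\<integral>p. ?h (t, 0) p * (indicator (- J n) (x n + snd p) * w (fst p)) \<partial>lborel)"
      using kap_heat_translate[of T t "x n" 0] by simp
    also have "\<dots> \<le> ?T n"
    proof (rule integral_mono')
      show "integrable lborel (\<lambda>p. ?h (t, 0) p * (indicator {u. R n \<le> \<bar>u\<bar>} (snd p) * w (fst p)))" by (rule ihJ) measurable
      fix p :: "real \<times> real"
      have "x n + snd p \<in> J n" if "\<not> R n \<le> \<bar>snd p\<bar>" using sub[of n] that by (intro subsetD[OF sub[of n]]) auto
      then show "?h (t, 0) p * (indicator (- J n) (x n + snd p) * w (fst p)) \<le> ?h (t, 0) p * (indicator {u. R n \<le> \<bar>u\<bar>} (snd p) * w (fst p))"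
        using w(2) H.kap_nonneg[of "(t, 0)" p] by (intro mult_left_mono mult_right_mono) (auto split: split_indicator)
      show "0 \<le> ?h (t, 0) p * (indicator {u. R n \<le> \<bar>u\<bar>} (snd p) * w (fst p))"
        using w(2) H.kap_nonneg by (intro mult_nonneg_nonneg) auto
    qed
    finally show ?thesis .
  qed
  have "?T \<longlonglongrightarrow> (\<integral>p. (0::real) \<partial>(lborel :: (real \<times> real) measure))"
  proof (rule integral_dominated_convergence[where w="\<lambda>p. ?h (t, 0) p * w (fst p)"])
    show "AE p in lborel. (\<lambda>n. ?h (t, 0) p * (indicator {u. R n \<le> \<bar>u\<bar>} (snd p) * w (fst p))) \<longlonglongrightarrow> 0"
    proof (intro AE_I2 tendsto_eventually)
      fix p :: "real \<times> real"
      have "\<forall>\<^sub>F n in sequentially. R n > \<bar>snd p\<bar>" using R by (simp add: filterlim_at_top_dense)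
      then show "\<forall>\<^sub>F n in sequentially. ?h (t, 0) p * (indicator {u. R n \<le> \<bar>u\<bar>} (snd p) * w (fst p)) = 0"
        by eventually_elim simp
    qed
    show "AE p in lborel. norm (?h (t, 0) p * (indicator {u. R n \<le> \<bar>u\<bar>} (snd p) * w (fst p))) \<le> ?h (t, 0) p * w (fst p)" for n
      using w(2) H.kap_nonneg by (auto simp: abs_mult split: split_indicator)
    show "integrable lborel (\<lambda>p. ?h (t, 0) p * w (fst p))" by (rule ih)
  qed measurable
  then have T0: "(\<lambda>n. 2 * ?T n) \<longlonglongrightarrow> 0" by (auto intro: tendsto_mult_right_zero)
  show "(\<lambda>n. \<integral>p. ?g n p \<partial>lborel) \<longlonglongrightarrow> 0"
  proof (rule Lim_null_comparison[OF _ T0])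
    show "\<forall>\<^sub>F n in sequentially. norm (\<integral>p. ?g n p \<partial>lborel) \<le> 2 * ?T n"
      using ev
    proof eventually_elim
      case (elim n)
      have "(\<integral>p. ?g n p \<partial>lborel) \<ge> 0" using w(2) by (intro integral_nonneg_AE) auto
      then show ?case using main[OF elim] le[of n] by simp
    qed
  qed
qed

text \<open>By the isometry for stochastic integrals this is the covariance of the stochastic
  convolutions at \<open>z\<close> and \<open>z'\<close>.\<close>

definition kcov :: "real \<Rightarrow> real set \<Rightarrow> (real \<Rightarrow> real \<Rightarrow> real \<Rightarrow> real) \<Rightarrow> real \<times> real \<Rightarrow> real \<times> real \<Rightarrow> real" where
  "kcov T I K z z' = (\<integral>p. kap T I K z p * kap T I K z' p \<partial>lborel)"

text \<open>The difference of the products is split so that one factor changes at a time. The factor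
  that is kept is bounded by its time singularity, and the other becomes a weighted L1 distance of
  kernels.\<close>

lemma kcov_conv:
  fixes x R :: "nat \<Rightarrow> real"
  assumes H: "\<And>n. heat_like T C (J n) (K n)"
    and ge: "\<And>n t y \<eta>. y \<in> J n \<Longrightarrow> \<eta> \<in> J n \<Longrightarrow> heat_kernel t y \<eta> \<le> K n t y \<eta>"
    and R: "filterlim R at_top sequentially" and sub: "\<And>n. {x n - R n<..<x n + R n} \<subseteq> J n"
    and R': "filterlim R' at_top sequentially" and sub': "\<And>n. {x' n - R' n<..<x' n + R' n} \<subseteq> J n"
    and t: "0 \<le> t" "t \<le> T" "0 \<le> t'" "t' \<le> T"
  shows "(\<lambda>n. kcov T (J n) (K n) (t, x n) (t', x' n) - kcov T UNIV heat_kernel (t, x n) (t', x' n)) \<longlonglongrightarrow> 0"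
proof -
  interpret H: heat_like T 1 UNIV heat_kernel by (rule heat_like_heat)
  let ?h = "kap T UNIV heat_kernel"
  let ?k = "\<lambda>n. kap T (J n) (K n)"
  have C: "C \<ge> 0" using H[of 0] by (simp add: heat_like_def)
  let ?A = "\<lambda>n p. \<bar>?k n (t, x n) p - ?h (t, x n) p\<bar> * sing C 0 t' (fst p)"
  let ?B = "\<lambda>n p. \<bar>?k n (t', x' n) p - ?h (t', x' n) p\<bar> * sing 1 0 t (fst p)"
  have A1: "\<forall>\<^sub>F n in sequentially. integrable lborel (?A n)"
    by (rule kap_weighted_conv(1)[where w="sing C 0 t'", OF H _ R sub t(2) measurable_sing sing_nonneg[OF C] integral_sing(1)[OF C t(3)]])
      (auto intro: ge)
  have A2: "(\<lambda>n. \<integral>p. ?A n p \<partial>lborel) \<longlonglongrightarrow> 0"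
    by (rule kap_weighted_conv(2)[where w="sing C 0 t'", OF H _ R sub t(2) measurable_sing sing_nonneg[OF C] integral_sing(1)[OF C t(3)]])
      (auto intro: ge)
  have B1: "\<forall>\<^sub>F n in sequentially. integrable lborel (?B n)"
    by (rule kap_weighted_conv(1)[where w="sing 1 0 t", OF H _ R' sub' t(4) measurable_sing sing_nonneg[OF zero_le_one] integral_sing(1)[OF zero_le_one t(1)]])
      (auto intro: ge)
  have B2: "(\<lambda>n. \<integral>p. ?B n p \<partial>lborel) \<longlonglongrightarrow> 0"
    by (rule kap_weighted_conv(2)[where w="sing 1 0 t", OF H _ R' sub' t(4) measurable_sing sing_nonneg[OF zero_le_one] integral_sing(1)[OF zero_le_one t(1)]])
      (auto intro: ge)
  have lim: "(\<lambda>n. (\<integral>p. ?A n p \<partial>lborel) + (\<integral>p. ?B n p \<partial>lborel)) \<longlonglongrightarrow> 0"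
    using tendsto_add[OF A2 B2] by simp
  show ?thesis
  proof (rule Lim_null_comparison[OF _ lim])
    show "\<forall>\<^sub>F n in sequentially. norm (kcov T (J n) (K n) (t, x n) (t', x' n) - kcov T UNIV heat_kernel (t, x n) (t', x' n))
        \<le> (\<integral>p. ?A n p \<partial>lborel) + (\<integral>p. ?B n p \<partial>lborel)"
      using A1 B1
    proof eventually_elim
      case (elim n)
      interpret Hn: heat_like T C "J n" "K n" by (rule H)
      have eq: "kcov T (J n) (K n) (t, x n) (t', x' n) - kcov T UNIV heat_kernel (t, x n) (t', x' n)
        = (\<integral>p. ?k n (t, x n) p * ?k n (t', x' n) p - ?h (t, x n) p * ?h (t', x' n) p \<partial>lborel)"
        unfolding kcov_def using Hn.integrable_kap_mult H.integrable_kap_mult by simp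
      have "norm (\<integral>p. ?k n (t, x n) p * ?k n (t', x' n) p - ?h (t, x n) p * ?h (t', x' n) p \<partial>lborel) \<le> (\<integral>p. ?A n p + ?B n p \<partial>lborel)"
      proof (rule integral_norm_bound_le)
        show "integrable lborel (\<lambda>p. ?k n (t, x n) p * ?k n (t', x' n) p - ?h (t, x n) p * ?h (t', x' n) p)"
          using Hn.integrable_kap_mult H.integrable_kap_mult by simp
        show "integrable lborel (\<lambda>p. ?A n p + ?B n p)" by (rule Bochner_Integration.integrable_add[OF elim])
        fix p
        let ?a = "?k n (t, x n) p" and ?b = "?k n (t', x' n) p" and ?c = "?h (t, x n) p" and ?d = "?h (t', x' n) p"
        have "?a * ?b - ?c * ?d = (?a - ?c) * ?b + (?b - ?d) * ?c" by (simp add: algebra_simps)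
        then have "norm (?a * ?b - ?c * ?d) \<le> \<bar>?a - ?c\<bar> * \<bar>?b\<bar> + \<bar>?b - ?d\<bar> * \<bar>?c\<bar>"
          using abs_triangle_ineq[of "(?a - ?c) * ?b" "(?b - ?d) * ?c"] by (simp add: abs_mult)
        also have "\<dots> \<le> ?A n p + ?B n p"
          using Hn.kap_le_sing[of "(t', x' n)" p] H.kap_le_sing[of "(t, x n)" p]
          by (intro add_mono mult_left_mono) (auto simp: Hn.kap_nonneg H.kap_nonneg)
        finally show "norm (?a * ?b - ?c * ?d) \<le> ?A n p + ?B n p" .
      qed
      also have "\<dots> = (\<integral>p. ?A n p \<partial>lborel) + (\<integral>p. ?B n p \<partial>lborel)" by (rule Bochner_Integration.integral_add[OF elim])
      finally show ?case unfolding eq .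
    qed
  qed
qed

lemma kcov_heat_translate:
  "kcov T UNIV heat_kernel (t, c + y) (t', c + y') = kcov T UNIV heat_kernel (t, y) (t', y')"
proof -
  interpret H: heat_like T 1 UNIV heat_kernel by (rule heat_like_heat)
  let ?h = "kap T UNIV heat_kernel"
  have "kcov T UNIV heat_kernel (t, c + y) (t', c + y') = (\<integral>p. ?h (t, c + y) ((0, c) + p) * ?h (t', c + y') ((0, c) + p) \<partial>lborel)"
    unfolding kcov_def by (rule lborel_translate(1)[symmetric]) measurable
  then show ?thesis unfolding kap_heat_translate kcov_def .
qed

text \<open>At every fixed noise point the kernel centred at \<open>d n\<close> tends to zero, and
  its time singularity times the kernel centred at the origin is an integrable majorant.\<close>

lemma kcov_heat_decorrelate:
  assumes d: "filterlim (\<lambda>n. \<bar>d n\<bar>) at_top sequentially" and t: "t \<le> T" "0 \<le> t'"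
  shows "(\<lambda>n. kcov T UNIV heat_kernel (t, 0) (t', d n)) \<longlonglongrightarrow> 0"
proof -
  interpret H: heat_like T 1 UNIV heat_kernel by (rule heat_like_heat)
  let ?h = "kap T UNIV heat_kernel"
  have "(\<lambda>n. kcov T UNIV heat_kernel (t, 0) (t', d n)) \<longlonglongrightarrow> (\<integral>p. (0::real) \<partial>(lborel :: (real \<times> real) measure))"
    unfolding kcov_def
  proof (rule integral_dominated_convergence[where w="\<lambda>p. ?h (t, 0) p * sing 1 0 t' (fst p)"])
    show "integrable lborel (\<lambda>p. ?h (t, 0) p * sing 1 0 t' (fst p))"
      by (rule H.integral_kap_weight(1)) (use t integral_sing(1)[of 1 0 t'] sing_nonneg in auto)
    show "AE p in lborel. norm (?h (t, 0) p * ?h (t', d n) p) \<le> ?h (t, 0) p * sing 1 0 t' (fst p)" for n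
      using H.kap_le_sing[of "(t', d n)"] by (auto simp: abs_mult H.kap_nonneg intro!: mult_left_mono)
    show "AE p in lborel. (\<lambda>n. ?h (t, 0) p * ?h (t', d n) p) \<longlonglongrightarrow> 0"
    proof (rule AE_I2)
      fix p :: "real \<times> real"
      have "(\<lambda>n. ?h (t', d n) p) \<longlonglongrightarrow> 0"
      proof (cases "0 \<le> fst p \<and> fst p < t' \<and> t' \<le> T")
        case True
        define r where "r = t' - fst p"
        have r: "r > 0" using True by (simp add: r_def)
        have "filterlim (\<lambda>n. \<bar>d n\<bar> - \<bar>snd p\<bar>) at_top sequentially"
          using filterlim_tendsto_add_at_top[OF tendsto_const d, of "- \<bar>snd p\<bar>"] by (simp add: add.commute)
        then have f1: "filterlim (\<lambda>n. \<bar>d n - snd p\<bar>) at_top sequentially"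
          by (rule filterlim_at_top_mono) (auto intro!: always_eventually)
        have "filterlim (\<lambda>n. \<bar>d n - snd p\<bar>\<^sup>2) at_top sequentially"
          by (rule filterlim_pow_at_top[OF _ f1]) simp
        then have "filterlim (\<lambda>n. 1 / (4 * r) * (d n - snd p)\<^sup>2) at_top sequentially"
          using r by (intro filterlim_tendsto_pos_mult_at_top[OF tendsto_const]) auto
        then have "filterlim (\<lambda>n. - (1 / (4 * r) * (d n - snd p)\<^sup>2)) at_bot sequentially"
          by (simp add: filterlim_uminus_at_top)
        then have "(\<lambda>n. exp (- (1 / (4 * r) * (d n - snd p)\<^sup>2))) \<longlonglongrightarrow> 0"
          by (rule filterlim_compose[OF exp_at_bot])
        then have "(\<lambda>n. exp (- (1 / (4 * r) * (d n - snd p)\<^sup>2)) / sqrt (4 * pi * r)) \<longlonglongrightarrow> 0"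
          by (rule tendsto_divide_zero)
        moreover have "?h (t', d n) p = exp (- (1 / (4 * r) * (d n - snd p)\<^sup>2)) / sqrt (4 * pi * r)" for n
          using True r by (simp add: kap_def heat_kernel_def r_def[symmetric])
        ultimately show ?thesis by simp
      next
        case False
        then have "?h (t', d n) p = 0" for n by (auto simp: kap_def)
        then show ?thesis by simp
      qed
      then show "(\<lambda>n. ?h (t, 0) p * ?h (t', d n) p) \<longlonglongrightarrow> 0" by (rule tendsto_mult_right_zero)
    qed
  qed measurable
  then show ?thesis by simp
qed

section \<open>Heat averages of slowly varying functions\<close>

lemma heat_tail:
  assumes R: "filterlim R at_top sequentially" and t: "t > 0"
  shows "(\<lambda>n. LBINT u:{u. R n \<le> \<bar>u\<bar>}. heat_kernel t 0 u) \<longlonglongrightarrow> 0"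
proof -
  have i: "integrable lborel (heat_kernel t 0)"
    using heat_like.K_int(1)[OF heat_like_heat t, of 0] by (simp add: set_integrable_def)
  note [measurable] = borel_measurable_integrable[OF i]
  have "(\<lambda>n. \<integral>u. indicator {u. R n \<le> \<bar>u\<bar>} u *\<^sub>R heat_kernel t 0 u \<partial>lborel) \<longlonglongrightarrow> (\<integral>u. (0::real) \<partial>(lborel :: real measure))"
  proof (rule integral_dominated_convergence[where w="heat_kernel t 0"])
    show "AE u in lborel. (\<lambda>n. indicator {u. R n \<le> \<bar>u\<bar>} u *\<^sub>R heat_kernel t 0 u) \<longlonglongrightarrow> 0"
    proof (intro AE_I2 tendsto_eventually)
      fix u :: real
      have "\<forall>\<^sub>F n in sequentially. R n > \<bar>u\<bar>" using R by (simp add: filterlim_at_top_dense)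
      then show "\<forall>\<^sub>F n in sequentially. indicator {u. R n \<le> \<bar>u\<bar>} u *\<^sub>R heat_kernel t 0 u = 0" by eventually_elim simp
    qed
  qed (use i in \<open>auto simp: heat_kernel_nonneg split: split_indicator\<close>)
  then show ?thesis by (simp add: set_lebesgue_integral_def)
qed

text \<open>Meant for initial data that vary on the large scale only. Within distance
  \<open>R n\<close> of the centre they are nearly constant; beyond it \<open>K n\<close> has at
  most the mass of the Gaussian tail, because it dominates the heat kernel inside and both have
  total mass one.\<close>

lemma kernel_average_conv:
  fixes x R :: "nat \<Rightarrow> real" and \<psi> :: "nat \<Rightarrow> real \<Rightarrow> real"
  assumes H: "\<And>n. heat_like T C (J n) (K n)"
    and ge: "\<And>n t y \<eta>. y \<in> J n \<Longrightarrow> \<eta> \<in> J n \<Longrightarrow> heat_kernel t y \<eta> \<le> K n t y \<eta>"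
    and R: "filterlim R at_top sequentially" and sub: "\<forall>\<^sub>F n in sequentially. {x n - R n<..<x n + R n} \<subseteq> J n"
    and t: "0 < t" and \<psi>: "\<And>n. set_borel_measurable lborel (J n) (\<psi> n)" "\<And>n \<eta>. \<eta> \<in> J n \<Longrightarrow> \<bar>\<psi> n \<eta>\<bar> \<le> B"
    and conv: "\<And>e. e > 0 \<Longrightarrow> \<forall>\<^sub>F n in sequentially. \<forall>\<eta>. \<bar>\<eta> - x n\<bar> < R n \<longrightarrow> \<bar>\<psi> n \<eta> - l\<bar> \<le> e"
  shows "(\<lambda>n. LBINT \<eta>:J n. K n t (x n) \<eta> * \<psi> n \<eta>) \<longlonglongrightarrow> l"
proof (rule LIMSEQ_I)
  fix e :: real assume e: "e > 0"
  \<comment> \<open>Bounds \<open>\<bar>\<psi> n \<eta> - l\<bar>\<close> on the far part of the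
    interval; the \<open>+ 1\<close> keeps the divisor positive.\<close>
  define D where "D = \<bar>B\<bar> + \<bar>l\<bar> + 1"
  have D: "D > 0" by (simp add: D_def)
  define tail where "tail n = (LBINT u:{u. R n \<le> \<bar>u\<bar>}. heat_kernel t 0 u)" for n
  have "\<forall>\<^sub>F n in sequentially. tail n < e / (4 * D)"
    using order_tendstoD(2)[OF heat_tail[OF R t], of "e / (4 * D)"] e D by (simp add: tail_def)
  moreover have "\<forall>\<^sub>F n in sequentially. R n > 0" using R by (simp add: filterlim_at_top_dense)
  moreover have "\<forall>\<^sub>F n in sequentially. \<forall>\<eta>. \<bar>\<eta> - x n\<bar> < R n \<longrightarrow> \<bar>\<psi> n \<eta> - l\<bar> \<le> e / 2"
    by (rule conv) (use e in simp)
  ultimately have "\<forall>\<^sub>F n in sequentially. norm ((LBINT \<eta>:J n. K n t (x n) \<eta> * \<psi> n \<eta>) - l) < e"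
    using sub
  proof eventually_elim
    case (elim n)
    interpret Hn: heat_like T C "J n" "K n" by (rule H)
    define b where "b = {x n - R n<..<x n + R n}"
    have bm[measurable]: "b \<in> sets borel" by (simp add: b_def)
    have bJ: "b \<subseteq> J n" using elim by (simp add: b_def)
    have xJ: "x n \<in> J n" using bJ elim by (auto simp: b_def)
    have iK: "integrable lborel (\<lambda>\<eta>. indicator (J n) \<eta> * K n t (x n) \<eta>)"
      "(\<integral>\<eta>. indicator (J n) \<eta> * K n t (x n) \<eta> \<partial>lborel) = 1"
      using Hn.K_int[OF t xJ] by (simp_all add: set_integrable_def set_lebesgue_integral_def)
    have ih: "integrable lborel (heat_kernel t (x n))" "(\<integral>\<eta>. heat_kernel t (x n) \<eta> \<partial>lborel) = 1"
      using heat_like.K_int[OF heat_like_heat t, of "x n"] by (simp_all add: set_integrable_def set_lebesgue_integral_def)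
    note [measurable] = borel_measurable_integrable[OF iK(1)] borel_measurable_integrable[OF ih(1)]
    have \<psi>m[measurable]: "(\<lambda>\<eta>. indicator (J n) \<eta> * \<psi> n \<eta>) \<in> borel_measurable borel"
      using \<psi>(1)[of n] by (simp add: set_borel_measurable_def)
    have iKb: "integrable lborel (\<lambda>\<eta>. indicator b \<eta> * (indicator (J n) \<eta> * K n t (x n) \<eta>))"
      using integrable_mult_indicator[OF _ iK(1), of b] by simp
    have ihb: "integrable lborel (\<lambda>\<eta>. indicator b \<eta> * heat_kernel t (x n) \<eta>)"
      "integrable lborel (\<lambda>\<eta>. indicator (- b) \<eta> * heat_kernel t (x n) \<eta>)"
      using integrable_mult_indicator[OF _ ih(1), of b] integrable_mult_indicator[OF _ ih(1), of "- b"] by simp_all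
    have tl: "tail n = (\<integral>\<eta>. indicator (- b) \<eta> * heat_kernel t (x n) \<eta> \<partial>lborel)"
    proof -
      have "(\<integral>\<eta>. indicator (- b) \<eta> * heat_kernel t (x n) \<eta> \<partial>lborel) = (\<integral>u. indicator (- b) (x n + u) * heat_kernel t (x n) (x n + u) \<partial>lborel)"
        by (rule lborel_translate(1)[symmetric]) measurable
      also have "\<dots> = (\<integral>u. indicator {u. R n \<le> \<bar>u\<bar>} u * heat_kernel t 0 u \<partial>lborel)"
        using heat_kernel_translate[of t "x n" 0]
        by (intro Bochner_Integration.integral_cong) (auto simp: b_def split: split_indicator)
      finally show ?thesis by (simp add: tail_def set_lebesgue_integral_def)
    qed
    have far: "(\<integral>\<eta>. indicator (- b) \<eta> * (indicator (J n) \<eta> * K n t (x n) \<eta>) \<partial>lborel) \<le> tail n"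
    proof -
      have "(\<integral>\<eta>. indicator b \<eta> * heat_kernel t (x n) \<eta> \<partial>lborel) \<le> (\<integral>\<eta>. indicator b \<eta> * (indicator (J n) \<eta> * K n t (x n) \<eta>) \<partial>lborel)"
        using ihb(1) iKb ge[OF xJ] bJ by (intro integral_mono) (auto split: split_indicator)
      moreover have "(\<integral>\<eta>. indicator (- b) \<eta> * (indicator (J n) \<eta> * K n t (x n) \<eta>) \<partial>lborel) = 1 - (\<integral>\<eta>. indicator b \<eta> * (indicator (J n) \<eta> * K n t (x n) \<eta>) \<partial>lborel)"
      proof -
        have "indicator (- b) \<eta> * (indicator (J n) \<eta> * K n t (x n) \<eta>) = indicator (J n) \<eta> * K n t (x n) \<eta> - indicator b \<eta> * (indicator (J n) \<eta> * K n t (x n) \<eta>)" for \<eta>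
          by (auto split: split_indicator)
        then show ?thesis using iK iKb by simp
      qed
      moreover have "tail n = 1 - (\<integral>\<eta>. indicator b \<eta> * heat_kernel t (x n) \<eta> \<partial>lborel)"
      proof -
        have "indicator (- b) \<eta> * heat_kernel t (x n) \<eta> = heat_kernel t (x n) \<eta> - indicator b \<eta> * heat_kernel t (x n) \<eta>" for \<eta>
          by (auto split: split_indicator)
        then show ?thesis unfolding tl using ih ihb by simp
      qed
      ultimately show ?thesis by simp
    qed
    have iKb': "integrable lborel (\<lambda>\<eta>. indicator (- b) \<eta> * (indicator (J n) \<eta> * K n t (x n) \<eta>))"
      using integrable_mult_indicator[OF _ iK(1), of "- b"] by simp
    have i\<psi>: "integrable lborel (\<lambda>\<eta>. indicator (J n) \<eta> * (K n t (x n) \<eta> * \<psi> n \<eta>))"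
    proof (rule Bochner_Integration.integrable_bound[OF integrable_mult_right[OF iK(1), of "\<bar>B\<bar>"]])
      have "(\<lambda>\<eta>. (indicator (J n) \<eta> * K n t (x n) \<eta>) * (indicator (J n) \<eta> * \<psi> n \<eta>)) \<in> borel_measurable lborel" by measurable
      moreover have "(indicator (J n) \<eta> * K n t (x n) \<eta>) * (indicator (J n) \<eta> * \<psi> n \<eta>) = indicator (J n) \<eta> * (K n t (x n) \<eta> * \<psi> n \<eta>)" for \<eta>
        by (auto split: split_indicator)
      ultimately show "(\<lambda>\<eta>. indicator (J n) \<eta> * (K n t (x n) \<eta> * \<psi> n \<eta>)) \<in> borel_measurable lborel" by simp
      show "AE \<eta> in lborel. norm (indicator (J n) \<eta> * (K n t (x n) \<eta> * \<psi> n \<eta>)) \<le> norm (\<bar>B\<bar> * (indicator (J n) \<eta> * K n t (x n) \<eta>))"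
      proof (intro AE_I2)
        fix \<eta> show "norm (indicator (J n) \<eta> * (K n t (x n) \<eta> * \<psi> n \<eta>)) \<le> norm (\<bar>B\<bar> * (indicator (J n) \<eta> * K n t (x n) \<eta>))"
        proof (cases "\<eta> \<in> J n")
          case True
          then have "\<bar>\<psi> n \<eta>\<bar> \<le> \<bar>B\<bar>" using \<psi>(2)[OF True] by linarith
          then have "\<bar>K n t (x n) \<eta>\<bar> * \<bar>\<psi> n \<eta>\<bar> \<le> \<bar>K n t (x n) \<eta>\<bar> * \<bar>B\<bar>" by (intro mult_left_mono) auto
          then show ?thesis using True by (simp add: abs_mult mult.commute)
        qed simp
      qed
    qed
    have il: "integrable lborel (\<lambda>\<eta>. l * (indicator (J n) \<eta> * K n t (x n) \<eta>))" using iK(1) by simp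
    have eq: "(LBINT \<eta>:J n. K n t (x n) \<eta> * \<psi> n \<eta>) - l = (\<integral>\<eta>. indicator (J n) \<eta> * (K n t (x n) \<eta> * \<psi> n \<eta>) - l * (indicator (J n) \<eta> * K n t (x n) \<eta>) \<partial>lborel)"
      using i\<psi> il iK(2) by (simp add: set_lebesgue_integral_def)
    have "norm (\<integral>\<eta>. indicator (J n) \<eta> * (K n t (x n) \<eta> * \<psi> n \<eta>) - l * (indicator (J n) \<eta> * K n t (x n) \<eta>) \<partial>lborel) \<le> (\<integral>\<eta>. e / 2 * (indicator (J n) \<eta> * K n t (x n) \<eta>) + D * (indicator (- b) \<eta> * (indicator (J n) \<eta> * K n t (x n) \<eta>)) \<partial>lborel)"
    proof (rule integral_norm_bound_le)
      fix \<eta> :: real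
      show "norm (indicator (J n) \<eta> * (K n t (x n) \<eta> * \<psi> n \<eta>) - l * (indicator (J n) \<eta> * K n t (x n) \<eta>)) \<le> e / 2 * (indicator (J n) \<eta> * K n t (x n) \<eta>) + D * (indicator (- b) \<eta> * (indicator (J n) \<eta> * K n t (x n) \<eta>))"
      proof (cases "\<eta> \<in> J n")
        case True
        have K0: "K n t (x n) \<eta> \<ge> 0" using Hn.K_nonneg[OF xJ True] .
        have "\<bar>\<psi> n \<eta> - l\<bar> \<le> e / 2 + D * indicator (- b) \<eta>"
        proof (cases "\<eta> \<in> b")
          case True
          then show ?thesis using elim(3) by (auto simp: b_def abs_less_iff)
        next
          case False
          have "\<bar>\<psi> n \<eta> - l\<bar> \<le> D" using \<psi>(2)[OF True] by (simp add: D_def)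
          then show ?thesis using False e by simp
        qed
        then have "K n t (x n) \<eta> * \<bar>\<psi> n \<eta> - l\<bar> \<le> K n t (x n) \<eta> * (e / 2 + D * indicator (- b) \<eta>)" using K0 by (rule mult_left_mono)
        moreover have "norm (K n t (x n) \<eta> * \<psi> n \<eta> - l * K n t (x n) \<eta>) = K n t (x n) \<eta> * \<bar>\<psi> n \<eta> - l\<bar>"
        proof -
          have "K n t (x n) \<eta> * \<psi> n \<eta> - l * K n t (x n) \<eta> = K n t (x n) \<eta> * (\<psi> n \<eta> - l)" by (simp add: algebra_simps)
          then show ?thesis using K0 by (simp add: abs_mult)
        qed
        ultimately show ?thesis using True by (simp add: algebra_simps)
      qed simp
    qed (use i\<psi> il iK(1) iKb' in auto)
    also have "\<dots> = e / 2 + D * (\<integral>\<eta>. indicator (- b) \<eta> * (indicator (J n) \<eta> * K n t (x n) \<eta>) \<partial>lborel)"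
      using iK iKb' by simp
    also have "\<dots> \<le> e / 2 + D * tail n" using far D by (intro add_left_mono mult_left_mono) auto
    also have "\<dots> \<le> e / 2 + D * (e / (4 * D))" using elim(1) D by (intro add_left_mono mult_left_mono) auto
    also have "\<dots> < e" using e D by simp
    finally show ?case unfolding eq .
  qed
  then show "\<exists>no. \<forall>n\<ge>no. norm ((LBINT \<eta>:J n. K n t (x n) \<eta> * \<psi> n \<eta>) - l) < e" by (simp add: eventually_sequentially)
qed

section \<open>Mild solutions driven by an isonormal process\<close>

text \<open>With a covariance kernel for \<open>B\<close> this is the variance of
  \<open>lincomb\<close>, written over list positions in order to match the lists in the definition
  of an isonormal process.\<close>

definition quad :: "('k \<Rightarrow> 'k \<Rightarrow> real) \<Rightarrow> (real \<times> 'k) list \<Rightarrow> real" where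
  "quad B c = (\<Sum>i<length c. \<Sum>j<length c. fst (c ! i) * fst (c ! j) * B (snd (c ! i)) (snd (c ! j)))"

lemma lincomb_nth: "lincomb A c \<omega> = (\<Sum>i<length c. fst (c ! i) * A (snd (c ! i)) \<omega>)"
  unfolding lincomb_def by (simp add: sum_list_sum_nth case_prod_beta atLeast0LessThan)

lemma quad_cong:
  assumes "\<And>k k'. k \<in> snd ` set c \<Longrightarrow> k' \<in> snd ` set c \<Longrightarrow> B k k' = B' k k'"
  shows "quad B c = quad B' c"
  unfolding quad_def by (intro sum.cong refl) (auto simp: assms)

lemma square_int_mult_integrable:
  assumes "square_int S h" "square_int S g"
  shows "set_integrable lborel S (\<lambda>p. h p * g p)"
proof -
  have [measurable]: "(\<lambda>p. indicator S p *\<^sub>R h p) \<in> borel_measurable lborel" "(\<lambda>p. indicator S p *\<^sub>R g p) \<in> borel_measurable lborel"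
    using assms by (simp_all add: square_int_def set_borel_measurable_def)
  have i: "integrable lborel (\<lambda>p. indicator S p * (h p)\<^sup>2 + indicator S p * (g p)\<^sup>2)"
    using assms by (auto simp: square_int_def set_integrable_def)
  show ?thesis unfolding set_integrable_def
  proof (rule Bochner_Integration.integrable_bound[OF i])
    have e: "(\<lambda>p. indicator S p *\<^sub>R (h p * g p)) = (\<lambda>p. (indicator S p *\<^sub>R h p) * (indicator S p *\<^sub>R g p))"
      by (auto split: split_indicator)
    show "(\<lambda>p. indicator S p *\<^sub>R (h p * g p)) \<in> borel_measurable lborel" unfolding e by measurable
    have "\<bar>x * y\<bar> \<le> x\<^sup>2 + y\<^sup>2" for x y :: real
      using sum_squares_bound[of "\<bar>x\<bar>" "\<bar>y\<bar>"] zero_le_power2[of x] zero_le_power2[of y] abs_ge_zero[of "x * y"]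
      unfolding abs_mult power2_abs by linarith
    then show "AE p in lborel. norm (indicator S p *\<^sub>R (h p * g p)) \<le> norm (indicator S p * (h p)\<^sup>2 + indicator S p * (g p)\<^sup>2)"
      by (auto split: split_indicator)
  qed
qed

lemma isonormal_measurable: "isonormal M S W \<Longrightarrow> square_int S h \<Longrightarrow> W h \<in> borel_measurable M"
  by (simp add: isonormal_def)

text \<open>Only the value at frequency 1 is read off, since the coefficients already carry any
  scaling. The variance is expanded into a double sum, for which each product of two integrands has
  to be integrable.\<close>

lemma isonormal_char:
  fixes c :: "(real \<times> 'k) list"
  assumes iso: "isonormal M S W" and h: "\<And>k. k \<in> snd ` set c \<Longrightarrow> square_int S (h k)"
  shows "(\<integral>\<omega>. cis (lincomb (\<lambda>k. W (h k)) c \<omega>) \<partial>M) =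
    complex_of_real (exp (- quad (\<lambda>k k'. LBINT p:S. h k p * h k' p) c / 2))"
proof -
  let ?hs = "map (\<lambda>x. h (snd x)) c" and ?cs = "map fst c"
  have hh: "square_int S (h (snd (c ! i)))" if "i < length c" for i using that h by auto
  have Wm: "W (h (snd (c ! i))) \<in> borel_measurable M" if "i < length c" for i
    using isonormal_measurable[OF iso hh[OF that]] .
  have eq: "lincomb (\<lambda>k. W (h k)) c \<omega> = (\<Sum>i<length ?hs. ?cs ! i * W (?hs ! i) \<omega>)" for \<omega>
    by (simp add: lincomb_nth)
  have m: "(\<lambda>\<omega>. \<Sum>i<length ?hs. ?cs ! i * W (?hs ! i) \<omega>) \<in> borel_measurable M"
    using Wm by (intro borel_measurable_sum borel_measurable_times) auto
  have "\<forall>u. char (distr M borel (\<lambda>\<omega>. \<Sum>i<length ?hs. ?cs ! i * W (?hs ! i) \<omega>)) u =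
      complex_of_real (exp (- (u^2 * (LBINT p:S. (\<Sum>i<length ?hs. ?cs ! i * (?hs ! i) p)^2)) / 2))"
    using iso[unfolded isonormal_def, THEN conjunct2, rule_format, of ?cs ?hs] h by auto
  from this[rule_format, of 1]
  have "(\<integral>\<omega>. cis (lincomb (\<lambda>k. W (h k)) c \<omega>) \<partial>M) = complex_of_real (exp (- (LBINT p:S. (\<Sum>i<length ?hs. ?cs ! i * (?hs ! i) p)^2) / 2))"
    unfolding char_def using m by (subst (asm) integral_distr) (simp_all add: eq cis_conv_exp)
  also have "(LBINT p:S. (\<Sum>i<length ?hs. ?cs ! i * (?hs ! i) p)^2) = quad (\<lambda>k k'. LBINT p:S. h k p * h k' p) c"
  proof -
    have i: "integrable lborel (\<lambda>p. indicator S p * (h (snd (c ! i)) p * h (snd (c ! j)) p))" if "i < length c" "j < length c" for i j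
      using square_int_mult_integrable[OF hh[OF that(1)] hh[OF that(2)]] by (simp add: set_integrable_def)
    have e: "indicator S p *\<^sub>R (\<Sum>i<length ?hs. ?cs ! i * (?hs ! i) p)^2 =
        (\<Sum>i<length c. \<Sum>j<length c. fst (c ! i) * fst (c ! j) * (indicator S p * (h (snd (c ! i)) p * h (snd (c ! j)) p)))" for p
      by (simp add: power2_eq_square sum_product sum_distrib_left mult_ac)
    let ?g = "\<lambda>i j p. fst (c ! i) * fst (c ! j) * (indicator S p * (h (snd (c ! i)) p * h (snd (c ! j)) p))"
    have "(\<integral>p. (\<Sum>i<length c. \<Sum>j<length c. ?g i j p) \<partial>lborel) = (\<Sum>i<length c. \<integral>p. (\<Sum>j<length c. ?g i j p) \<partial>lborel)"
      by (rule Bochner_Integration.integral_sum) (auto intro!: Bochner_Integration.integrable_sum integrable_mult_right i)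
    also have "\<dots> = (\<Sum>i<length c. \<Sum>j<length c. \<integral>p. ?g i j p \<partial>lborel)"
      by (intro sum.cong refl Bochner_Integration.integral_sum) (auto intro!: integrable_mult_right i)
    finally show ?thesis
      unfolding set_lebesgue_integral_def e quad_def by simp
  qed
  finally show ?thesis .
qed

text \<open>The definition of an isonormal process speaks of characteristic functions only. Levy's
  uniqueness theorem identifies the law of \<open>W h\<close> with that of a scaled standard normal
  variable, whose moments are known.\<close>

lemma (in prob_space) isonormal_second_moment:
  assumes iso: "isonormal M S W" and h: "square_int S h"
  shows "integrable M (\<lambda>\<omega>. (W h \<omega>)\<^sup>2)" "(\<integral>\<omega>. (W h \<omega>)\<^sup>2 \<partial>M) = (LBINT p:S. (h p)\<^sup>2)"
proof -
  define v where "v = (LBINT p:S. (h p)\<^sup>2)"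
  have v: "v \<ge> 0" unfolding v_def set_lebesgue_integral_def by (intro integral_nonneg_AE) auto
  have Wm[measurable]: "W h \<in> borel_measurable M" by (rule isonormal_measurable[OF iso h])
  interpret S: prob_space std_normal_distribution by (rule prob_space_normal_density) simp
  have "distr M borel (W h) = distr std_normal_distribution borel (\<lambda>x. sqrt v * x)"
  proof (rule Levy_uniqueness)
    show "real_distribution (distr M borel (W h))" by (rule real_distribution_distr) simp
    show "real_distribution (distr std_normal_distribution borel (\<lambda>x. sqrt v * x))" by (rule S.real_distribution_distr) simp
    show "char (distr M borel (W h)) = char (distr std_normal_distribution borel (\<lambda>x. sqrt v * x))"
    proof
      fix u
      have "char (distr M borel (W h)) u = complex_of_real (exp (- (u^2 * v) / 2))"
        using iso[unfolded isonormal_def, THEN conjunct2, rule_format, of "[1]" "[h]" u] h by (simp add: v_def)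
      also have "\<dots> = char std_normal_distribution (u * sqrt v)"
        using v by (simp add: char_std_normal_distribution power_mult_distrib)
      also have "\<dots> = char (distr std_normal_distribution borel (\<lambda>x. sqrt v * x)) u"
        unfolding char_def by (subst integral_distr) (auto simp: mult_ac)
      finally show "char (distr M borel (W h)) u = char (distr std_normal_distribution borel (\<lambda>x. sqrt v * x)) u" .
    qed
  qed
  note eq = this
  have mom: "has_bochner_integral lborel (\<lambda>x. std_normal_density x * x^2) 1"
    using std_normal_moment_even[of 1] by simp
  have i: "integrable std_normal_distribution (\<lambda>x. (sqrt v * x)\<^sup>2)" "(\<integral>x. (sqrt v * x)\<^sup>2 \<partial>std_normal_distribution) = v"
  proof -
    have "integrable std_normal_distribution (\<lambda>x. x\<^sup>2)" "(\<integral>x. x\<^sup>2 \<partial>std_normal_distribution) = 1"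
      using mom by (auto simp: integrable_density integral_density has_bochner_integral_iff)
    then show "integrable std_normal_distribution (\<lambda>x. (sqrt v * x)\<^sup>2)" "(\<integral>x. (sqrt v * x)\<^sup>2 \<partial>std_normal_distribution) = v"
      using v by (simp_all add: power_mult_distrib)
  qed
  have "integrable (distr M borel (W h)) (\<lambda>x. x\<^sup>2)"
    unfolding eq using i by (subst integrable_distr_eq) auto
  then show "integrable M (\<lambda>\<omega>. (W h \<omega>)\<^sup>2)" by (subst (asm) integrable_distr_eq) auto
  have "(\<integral>\<omega>. (W h \<omega>)\<^sup>2 \<partial>M) = (\<integral>x. x\<^sup>2 \<partial>distr M borel (W h))" by (subst integral_distr) auto
  also have "\<dots> = v" unfolding eq using i by (subst integral_distr) auto
  finally show "(\<integral>\<omega>. (W h \<omega>)\<^sup>2 \<partial>M) = (LBINT p:S. (h p)\<^sup>2)" by (simp add: v_def)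
qed

locale mild_field = heat_like T C I K + prob_space M
  for T C :: real and I K and M :: "'a measure" +
  fixes X0 f :: "real \<Rightarrow> real" and F L :: real and W :: "(real \<times> real \<Rightarrow> real) \<Rightarrow> 'a \<Rightarrow> real"
    and X :: "real \<Rightarrow> real \<Rightarrow> 'a \<Rightarrow> real"
  assumes T_pos: "T > 0" and iso: "isonormal M ({0..T} \<times> I) W" and sol: "mild_solution M T I K X0 f W X"
    and X0_meas: "set_borel_measurable lborel I X0"
    and f_bound: "\<And>x. \<bar>f x\<bar> \<le> F" and f_lip: "\<And>x y. \<bar>f x - f y\<bar> \<le> L * \<bar>x - y\<bar>"
begin

definition "sol_at z \<omega> = X (fst z) (snd z) \<omega>"
definition "drift z \<omega> = (\<integral>z'. k z z' * f (sol_at z' \<omega>) \<partial>lborel)"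
definition "initial z = (LBINT \<eta>:I. K (fst z) (snd z) \<eta> * X0 \<eta>)"

text \<open>The mild equation holds almost surely for each single point only; subtracting the drift
  gives a jointly measurable version of the remaining terms for which it holds identically.\<close>
definition "forcing z \<omega> = sol_at z \<omega> - drift z \<omega>"
definition "noise z \<omega> = forcing z \<omega> - initial z"
text \<open>Time 0 is left out because the mild equation is postulated for positive times.\<close>

definition "pts = {0<..T} \<times> I"
text \<open>Spelled as the integrand in \<open>mild_solution\<close>, because \<open>W\<close> acts
  on functions and not on classes of functions. Unlike \<open>k z\<close> it is not cut off to the
  domain of the noise.\<close>

definition "hfun z p = (if fst p < fst z then K (fst z - fst p) (snd z) (snd p) else 0)"

lemma sol_eq: "sol_at z \<omega> = forcing z \<omega> + (\<integral>z'. k z z' * f (sol_at z' \<omega>) \<partial>lborel)"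
  by (simp add: forcing_def drift_def)

lemma forcing_eq: "forcing z \<omega> = initial z + noise z \<omega>" by (simp add: noise_def)

lemma f_meas [measurable]: "f \<in> borel_measurable borel"
  by (rule bounded_lipschitz_measurable(2)[OF f_lip])

lemma F_nonneg: "F \<ge> 0" using f_bound[of 0] by linarith
lemma L_nonneg: "L \<ge> 0" using f_lip[of 0 1] by simp

section \<open>Measurability, law and moments of the forcing\<close>

lemma measurable_sol: "(\<lambda>p. sol_at (fst p) (snd p)) \<in> borel_measurable (lborel \<Otimes>\<^sub>M M)"
  using sol by (simp add: mild_solution_def sol_at_def)

lemma kap_jm: "(\<lambda>p. k (fst p) (snd p)) \<in> borel_measurable (lborel \<Otimes>\<^sub>M lborel)"
  using measurable_fst[of "lborel :: (real \<times> real) measure" "lborel :: (real \<times> real) measure"]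
    measurable_snd[of "lborel :: (real \<times> real) measure" "lborel :: (real \<times> real) measure"]
  by (intro measurable_kap) simp_all

lemma measurable_drift: "(\<lambda>p. drift (fst p) (snd p)) \<in> borel_measurable (lborel \<Otimes>\<^sub>M M)"
  unfolding drift_def by (rule measurable_kernel_integral[OF kap_jm f_meas measurable_sol])

lemma measurable_forcing: "(\<lambda>p. forcing (fst p) (snd p)) \<in> borel_measurable (lborel \<Otimes>\<^sub>M M)"
  unfolding forcing_def using measurable_sol measurable_drift by simp

lemma measurable_at [measurable]:
  "sol_at z \<in> borel_measurable M" "forcing z \<in> borel_measurable M" "noise z \<in> borel_measurable M"
  using measurable_section[OF measurable_sol, of z] measurable_section[OF measurable_forcing, of z]
  unfolding noise_def[abs_def] by auto

lemma kap_eq_hfun: "z \<in> pts \<Longrightarrow> indicator ({0..T} \<times> I) p *\<^sub>R hfun z p = k z p"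
  by (cases p) (auto simp: pts_def hfun_def kap_def split: split_indicator)

lemma square_int_hfun: assumes "z \<in> pts" shows "square_int ({0..T} \<times> I) (hfun z)"
proof -
  have "indicator ({0..T} \<times> I) p *\<^sub>R (hfun z p)\<^sup>2 = k z p * k z p" for p
    using kap_eq_hfun[OF assms, of p] by (auto simp: power2_eq_square split: split_indicator)
  then show ?thesis unfolding square_int_def set_borel_measurable_def set_integrable_def kap_eq_hfun[OF assms]
    using integrable_kap_mult[of z z] borel_measurable_integrable[OF integrable_kap, of z] by simp
qed

lemma hfun_inner:
  assumes "z \<in> pts" "z' \<in> pts"
  shows "(LBINT p:{0..T} \<times> I. hfun z p * hfun z' p) = kcov T I K z z'"
proof -
  have "indicator ({0..T} \<times> I) p *\<^sub>R (hfun z p * hfun z' p) = k z p * k z' p" for p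
    using kap_eq_hfun[OF assms(1), of p] kap_eq_hfun[OF assms(2), of p] by (auto split: split_indicator)
  then show ?thesis by (simp add: set_lebesgue_integral_def kcov_def)
qed

text \<open>Fubini turns the iterated integral of the mild equation into one integral over the
  plane. The closed time interval adds only the slice \<open>s = fst z\<close>, where the kernel
  vanishes by \<open>K_zero\<close>.\<close>

lemma drift_nested:
  assumes z: "z \<in> pts" and \<omega>: "\<omega> \<in> space M"
  shows "(LBINT s:{0..fst z}. LBINT \<eta>:I. K (fst z - s) (snd z) \<eta> * f (X s \<eta> \<omega>)) = drift z \<omega>"
proof -
  have sm: "(\<lambda>z'. sol_at z' \<omega>) \<in> borel_measurable lborel"
    using measurable_compose[OF measurable_Pair2'[OF \<omega>] measurable_sol] by simp
  note [measurable] = sm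
  have int: "integrable lborel (\<lambda>z'. k z z' * f (sol_at z' \<omega>))"
    by (rule Bochner_Integration.integrable_bound[OF integrable_mult_right[OF integrable_kap[of z], of F]])
      (auto simp: abs_mult kap_nonneg F_nonneg mult.commute intro!: mult_right_mono f_bound)
  have "drift z \<omega> = (\<integral>z'. k z z' * f (sol_at z' \<omega>) \<partial>(lborel \<Otimes>\<^sub>M lborel))" by (simp add: drift_def lborel_prod)
  also have "\<dots> = (\<integral>s. \<integral>\<eta>. k z (s, \<eta>) * f (sol_at (s, \<eta>) \<omega>) \<partial>lborel \<partial>lborel)"
    by (subst lborel_pair.integral_fst'[symmetric]) (use int in \<open>simp_all add: lborel_prod\<close>)
  also have "\<dots> = (LBINT s:{0..fst z}. LBINT \<eta>:I. K (fst z - s) (snd z) \<eta> * f (X s \<eta> \<omega>))"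
    unfolding set_lebesgue_integral_def
  proof (intro Bochner_Integration.integral_cong refl)
    fix s :: real
    have "k z (s, \<eta>) * f (sol_at (s, \<eta>) \<omega>) = indicator {0..fst z} s * (indicator I \<eta> *\<^sub>R (K (fst z - s) (snd z) \<eta> * f (X s \<eta> \<omega>)))" for \<eta>
      using z K_zero[of "fst z - s"] by (cases "s = fst z") (auto simp: kap_def pts_def sol_at_def split: split_indicator)
    then show "(\<integral>\<eta>. k z (s, \<eta>) * f (sol_at (s, \<eta>) \<omega>) \<partial>lborel) = indicator {0..fst z} s *\<^sub>R (\<integral>\<eta>. indicator I \<eta> *\<^sub>R (K (fst z - s) (snd z) \<eta> * f (X s \<eta> \<omega>)) \<partial>lborel)"
      by simp
  qed
  finally show ?thesis by simp
qed

text \<open>Here the mild equation enters: what remains of the solution after drift and initial term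
  are subtracted is the stochastic integral, up to a null set that may depend on
  \<open>z\<close>.\<close>

lemma noise_AE: assumes z: "z \<in> pts" shows "AE \<omega> in M. noise z \<omega> = W (hfun z) \<omega>"
proof -
  have "AE \<omega> in M. X (fst z) (snd z) \<omega> = initial z + W (hfun z) \<omega>
      + (LBINT s:{0..fst z}. LBINT \<eta>:I. K (fst z - s) (snd z) \<eta> * f (X s \<eta> \<omega>))"
  proof -
    have zz: "fst z \<in> {0<..T}" "snd z \<in> I" using z by (auto simp: pts_def)
    from sol have "\<forall>t\<in>{0<..T}. \<forall>y\<in>I. AE \<omega> in M. X t y \<omega> = (LBINT \<eta>:I. K t y \<eta> * X0 \<eta>)
         + W (\<lambda>p. if fst p < t then K (t - fst p) y (snd p) else 0) \<omega>
         + (LBINT s:{0..t}. LBINT \<eta>:I. K (t - s) y \<eta> * f (X s \<eta> \<omega>))"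
      unfolding mild_solution_def by blast
    from this[rule_format, OF zz] show ?thesis unfolding initial_def hfun_def[abs_def] .
  qed
  then show ?thesis
  proof (rule AE_mp, intro AE_I2 impI)
    fix \<omega> assume \<omega>: "\<omega> \<in> space M" and eq: "X (fst z) (snd z) \<omega> = initial z + W (hfun z) \<omega>
      + (LBINT s:{0..fst z}. LBINT \<eta>:I. K (fst z - s) (snd z) \<eta> * f (X s \<eta> \<omega>))"
    show "noise z \<omega> = W (hfun z) \<omega>"
      using eq unfolding drift_nested[OF z \<omega>] by (simp add: noise_def forcing_def sol_at_def)
  qed
qed

text \<open>For a given list only finitely many exceptional null sets occur, so identities that hold
  almost surely at each point are enough to determine the joint law.\<close>

lemma noise_char:
  fixes c :: "(real \<times> (real \<times> real)) list"
  assumes c: "snd ` set c \<subseteq> pts"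
  shows "(\<integral>\<omega>. cis (lincomb noise c \<omega>) \<partial>M) = complex_of_real (exp (- quad (kcov T I K) c / 2))"
proof -
  have Wm[measurable]: "W (hfun z) \<in> borel_measurable M" if "z \<in> pts" for z
    using isonormal_measurable[OF iso square_int_hfun[OF that]] .
  have "AE \<omega> in M. \<forall>z\<in>snd ` set c. noise z \<omega> = W (hfun z) \<omega>"
    using c noise_AE by (intro AE_finite_allI) auto
  then have "AE \<omega> in M. lincomb noise c \<omega> = lincomb (\<lambda>z. W (hfun z)) c \<omega>"
    by eventually_elim (auto simp: lincomb_def intro!: arg_cong[of _ _ sum_list] map_cong)
  moreover have "lincomb noise c \<in> borel_measurable M" by (rule borel_measurable_lincomb) auto
  moreover have "lincomb (\<lambda>z. W (hfun z)) c \<in> borel_measurable M" by (rule borel_measurable_lincomb) (use c Wm in auto)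
  moreover have "cis \<in> borel_measurable borel" by (rule borel_measurable_continuous_onI[OF continuous_on_cis[OF continuous_on_id]])
  ultimately have "(\<integral>\<omega>. cis (lincomb noise c \<omega>) \<partial>M) = (\<integral>\<omega>. cis (lincomb (\<lambda>z. W (hfun z)) c \<omega>) \<partial>M)"
    by (intro integral_cong_AE) (auto intro: measurable_compose)
  also have "\<dots> = complex_of_real (exp (- quad (\<lambda>z z'. LBINT p:{0..T} \<times> I. hfun z p * hfun z' p) c / 2))"
    by (rule isonormal_char[OF iso square_int_hfun]) (use c in auto)
  also have "quad (\<lambda>z z'. LBINT p:{0..T} \<times> I. hfun z p * hfun z' p) c = quad (kcov T I K) c"
    by (rule quad_cong, rule hfun_inner) (use c in blast)+
  finally show ?thesis .
qed

lemma noise_second_moment: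
  assumes z: "z \<in> pts"
  shows "integrable M (\<lambda>\<omega>. (noise z \<omega>)\<^sup>2)" "(\<integral>\<omega>. (noise z \<omega>)\<^sup>2 \<partial>M) \<le> C * (2 * sqrt T)"
proof -
  have Wm[measurable]: "W (hfun z) \<in> borel_measurable M"
    using isonormal_measurable[OF iso square_int_hfun[OF z]] .
  note m = isonormal_second_moment[OF iso square_int_hfun[OF z]]
  have ae: "AE \<omega> in M. (W (hfun z) \<omega>)\<^sup>2 = (noise z \<omega>)\<^sup>2" using noise_AE[OF z] by eventually_elim simp
  show "integrable M (\<lambda>\<omega>. (noise z \<omega>)\<^sup>2)"
    using m(1) by (rule integrable_cong_AE_imp) (use ae in auto)
  have "(\<integral>\<omega>. (noise z \<omega>)\<^sup>2 \<partial>M) = (\<integral>\<omega>. (W (hfun z) \<omega>)\<^sup>2 \<partial>M)" by (rule integral_cong_AE) (use ae in auto)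
  also have "\<dots> = kcov T I K z z" unfolding m(2) using hfun_inner[OF z z] by (simp add: power2_eq_square)
  also have "\<dots> = (\<integral>q. indicator {0..} (fst q) * (k z q)\<^sup>2 \<partial>lborel)"
    unfolding kcov_def by (intro Bochner_Integration.integral_cong refl) (auto simp: power2_eq_square kap_def split: split_indicator)
  also have "\<dots> \<le> C * (2 * sqrt (fst z - 0))" using z by (intro integral_kap_sq_le) (auto simp: pts_def)
  also have "\<dots> \<le> C * (2 * sqrt T)" using z C_nonneg by (intro mult_left_mono) (auto simp: pts_def)
  finally show "(\<integral>\<omega>. (noise z \<omega>)\<^sup>2 \<partial>M) \<le> C * (2 * sqrt T)" .
qed

lemma forcing_second_moment:
  assumes z: "z \<in> pts" and B: "\<bar>initial z\<bar> \<le> B"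
  shows "integrable M (\<lambda>\<omega>. (forcing z \<omega>)\<^sup>2)" "(\<integral>\<omega>. (forcing z \<omega>)\<^sup>2 \<partial>M) \<le> 2 * (C * (2 * sqrt T)) + 2 * B\<^sup>2"
  using second_moment_add_bounded[of "noise z" "\<lambda>_. initial z" "C * (2 * sqrt T)" B] noise_second_moment[OF z] B
  by (auto simp: forcing_eq add.commute)

text \<open>Contraction in a weighted norm: against the weight \<open>exp (2 * (L + 1) * s)\<close>
  the Lipschitz drift gains a factor \<open>L / (2 * (L + 1))\<close>, which is at most one half.
  The iteration therefore contracts on all of \<open>{0..T}\<close> at once.\<close>

lemma abs_kernel_integral_diff_le:
  assumes [measurable]: "g \<in> borel_measurable lborel" "h \<in> borel_measurable lborel"
    and E: "E \<ge> 0" and le: "\<And>z'. 0 \<le> fst z' \<Longrightarrow> \<bar>g z' - h z'\<bar> \<le> E * exp (2 * (L + 1) * fst z')"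
  shows "\<bar>(\<integral>z'. k z z' * f (g z') \<partial>lborel) - (\<integral>z'. k z z' * f (h z') \<partial>lborel)\<bar> \<le> E / 2 * exp (2 * (L + 1) * fst z)"
proof (cases "fst z \<le> T \<and> snd z \<in> I \<and> 0 \<le> fst z")
  case True
  let ?w = "\<lambda>s. exp (2 * (L + 1) * s)"
  have iw: "set_integrable lborel {0..<fst z} ?w"
    by (rule set_integrable_subset[of lborel "{0..fst z}"]) (auto intro!: borel_integrable_atLeastAtMost' continuous_intros)
  note wk = integral_kap_weight[of z ?w, OF _ _ _ _ iw]
  have int: "integrable lborel (\<lambda>z'. k z z' * f (q z'))" if [measurable]: "q \<in> borel_measurable lborel" for q
    by (rule Bochner_Integration.integrable_bound[OF integrable_mult_right[OF integrable_kap[of z], of F]])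
      (auto simp: abs_mult kap_nonneg F_nonneg mult.commute intro!: mult_right_mono f_bound)
  have wint: "(LBINT s:{0..<fst z}. ?w s) \<le> ?w (fst z) / (2 * (L + 1))"
  proof -
    have "(LBINT s:{0..<fst z}. ?w s) = (LBINT s:{0..fst z}. ?w s)"
      by (rule set_integral_discrete_difference[where X="{fst z}"]) auto
    also have "\<dots> = (LBINT s=0..fst z. ?w s)" using True by (simp add: interval_integral_Icc zero_ereal_def)
    also have "\<dots> = ?w (fst z) / (2 * (L + 1)) - ?w 0 / (2 * (L + 1))"
      unfolding zero_ereal_def using L_nonneg by (intro interval_integral_FTC_finite)
        (auto intro!: continuous_intros derivative_eq_intros simp: has_real_derivative_iff_has_vector_derivative[symmetric])
    also have "\<dots> \<le> ?w (fst z) / (2 * (L + 1))" using L_nonneg by simp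
    finally show ?thesis .
  qed
  have eq: "(\<integral>z'. k z z' * f (g z') \<partial>lborel) - (\<integral>z'. k z z' * f (h z') \<partial>lborel) = (\<integral>z'. k z z' * f (g z') - k z z' * f (h z') \<partial>lborel)"
    using int by simp
  have "norm (\<integral>z'. k z z' * f (g z') - k z z' * f (h z') \<partial>lborel) \<le> (\<integral>z'. L * E * (k z z' * ?w (fst z')) \<partial>lborel)"
  proof (rule integral_norm_bound_le)
    show "integrable lborel (\<lambda>z'. k z z' * f (g z') - k z z' * f (h z'))" using int by simp
    show "integrable lborel (\<lambda>z'. L * E * (k z z' * ?w (fst z')))" using wk(1) True by simp
    fix z' :: "real \<times> real"
    show "norm (k z z' * f (g z') - k z z' * f (h z')) \<le> L * E * (k z z' * ?w (fst z'))"
    proof (cases "0 \<le> fst z'")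
      case True
      have "\<bar>f (g z') - f (h z')\<bar> \<le> L * (E * ?w (fst z'))"
        using f_lip[of "g z'" "h z'"] mult_left_mono[OF le[OF True] L_nonneg] by linarith
      then have "k z z' * \<bar>f (g z') - f (h z')\<bar> \<le> k z z' * (L * (E * ?w (fst z')))" by (intro mult_left_mono kap_nonneg)
      then show ?thesis unfolding right_diff_distrib[symmetric] real_norm_def abs_mult
        using kap_nonneg[of z z'] by (simp add: mult_ac)
    qed (simp add: kap_def)
  qed
  also have "\<dots> = L * E * (LBINT s:{0..<fst z}. ?w s)" using wk(2) True by simp
  also have "\<dots> \<le> L * E * (?w (fst z) / (2 * (L + 1)))" using L_nonneg E by (intro mult_left_mono wint) auto
  also have "\<dots> = (L / (L + 1)) * (E / 2 * ?w (fst z))" using L_nonneg by (simp add: field_simps)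
  also have "\<dots> \<le> 1 * (E / 2 * ?w (fst z))" using L_nonneg E by (intro mult_right_mono) auto
  finally show ?thesis unfolding eq by simp
next
  case False
  then have "k z z' = 0" for z' by (auto simp: kap_def)
  then show ?thesis using E by simp
qed

text \<open>By the construction of \<open>forcing\<close> the solution is a fixed point for every
  outcome, so the estimate is deterministic. The bound depends on \<open>T\<close>,
  \<open>F\<close>, \<open>L\<close> and the time, but neither on the domain nor on the noise, and
  is thus uniform in \<open>lam\<close>. The \<open>max\<close> takes care of negative times, where
  the integral vanishes.\<close>

lemma picard_error:
  assumes \<omega>: "\<omega> \<in> space M"
  shows "\<bar>sol_at z \<omega> - picard k f forcing m z \<omega>\<bar> \<le> T * F * (1 / 2) ^ m * exp (2 * (L + 1) * max 0 (fst z))"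
proof (induction m arbitrary: z)
  case 0
  have "\<bar>sol_at z \<omega> - forcing z \<omega>\<bar> \<le> T * F"
    unfolding sol_eq[of z] using T_pos by (auto intro!: kernel_integral_abs_le integrable_kap f_bound integral_kap_le)
  also have "\<dots> \<le> T * F * exp (2 * (L + 1) * max 0 (fst z))"
    using T_pos F_nonneg L_nonneg mult_left_mono[of 1 "exp (2 * (L + 1) * max 0 (fst z))" "T * F"] by simp
  finally show ?case by simp
next
  case (Suc m)
  have pm: "(\<lambda>p. picard k f forcing m (fst p) (snd p)) \<in> borel_measurable (lborel \<Otimes>\<^sub>M M)"
    by (rule measurable_picard[OF kap_jm f_meas measurable_forcing])
  have "\<bar>sol_at z \<omega> - picard k f forcing (Suc m) z \<omega>\<bar> =
    \<bar>(\<integral>z'. k z z' * f (sol_at z' \<omega>) \<partial>lborel) - (\<integral>z'. k z z' * f (picard k f forcing m z' \<omega>) \<partial>lborel)\<bar>"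
    by (subst sol_eq) simp
  also have "\<dots> \<le> (T * F * (1 / 2) ^ m) / 2 * exp (2 * (L + 1) * fst z)"
  proof (rule abs_kernel_integral_diff_le)
    show "(\<lambda>z'. sol_at z' \<omega>) \<in> borel_measurable lborel"
      using measurable_compose[OF measurable_Pair2'[OF \<omega>] measurable_sol] by simp
    show "(\<lambda>z'. picard k f forcing m z' \<omega>) \<in> borel_measurable lborel"
      using measurable_compose[OF measurable_Pair2'[OF \<omega>] pm] by simp
    show "T * F * (1 / 2) ^ m \<ge> 0" using T_pos F_nonneg by simp
    show "\<bar>sol_at z' \<omega> - picard k f forcing m z' \<omega>\<bar> \<le> T * F * (1 / 2) ^ m * exp (2 * (L + 1) * fst z')" if "0 \<le> fst z'" for z'
      using Suc.IH[of z'] that by (simp add: max_def split: if_splits)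
  qed
  also have "\<dots> \<le> T * F * (1 / 2) ^ Suc m * exp (2 * (L + 1) * max 0 (fst z))"
    using T_pos F_nonneg L_nonneg by (auto intro!: mult_left_mono)
  finally show ?case .
qed

lemma initial_bound:
  assumes z: "z \<in> pts" and B: "\<And>\<eta>. \<eta> \<in> I \<Longrightarrow> \<bar>X0 \<eta>\<bar> \<le> B" "B \<ge> 0"
  shows "\<bar>initial z\<bar> \<le> B"
proof -
  have iK: "integrable lborel (\<lambda>\<eta>. indicator I \<eta> * K (fst z) (snd z) \<eta>)"
    "(\<integral>\<eta>. indicator I \<eta> * K (fst z) (snd z) \<eta> \<partial>lborel) = 1"
    using K_int[of "fst z" "snd z"] z by (auto simp: set_integrable_def set_lebesgue_integral_def pts_def)
  have "(\<integral>\<eta>. norm (indicator I \<eta> *\<^sub>R (K (fst z) (snd z) \<eta> * X0 \<eta>)) \<partial>lborel) \<le> (\<integral>\<eta>. indicator I \<eta> * K (fst z) (snd z) \<eta> * B \<partial>lborel)"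
    using iK(1) B z by (intro integral_mono') (auto simp: abs_mult pts_def K_nonneg intro!: mult_left_mono split: split_indicator)
  also have "\<dots> = B" using iK(2) by simp
  finally have le: "(\<integral>\<eta>. norm (indicator I \<eta> *\<^sub>R (K (fst z) (snd z) \<eta> * X0 \<eta>)) \<partial>lborel) \<le> B" .
  show ?thesis unfolding initial_def set_lebesgue_integral_def
    by (rule order_trans[OF integral_abs_bound]) (rule le[unfolded real_norm_def])
qed

end

section \<open>Joint limits at two macroscopically separated points\<close>

lemma integrable_bounded_pair:
  fixes g :: "'a \<times> 'b \<Rightarrow> 'c::{banach, second_countable_topology}"
  assumes "prob_space P" "prob_space Q" "g \<in> borel_measurable (P \<Otimes>\<^sub>M Q)"
    "\<And>p. p \<in> space (P \<Otimes>\<^sub>M Q) \<Longrightarrow> norm (g p) \<le> B"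
  shows "integrable (P \<Otimes>\<^sub>M Q) g"
proof -
  interpret P: prob_space P by fact
  interpret Q: prob_space Q by fact
  interpret PQ: pair_prob_space P Q ..
  show ?thesis by (rule PQ.integrable_const_bound[where B=B]) (use assms in auto)
qed

lemma integral_pair_fst:
  fixes g :: "'a \<Rightarrow> 'c::{banach, second_countable_topology}"
  assumes "prob_space P" "prob_space Q" and [measurable]: "g \<in> borel_measurable P"
  shows "(\<integral>p. g (fst p) \<partial>(P \<Otimes>\<^sub>M Q)) = (\<integral>x. g x \<partial>P)"
    and "integrable (P \<Otimes>\<^sub>M Q) (\<lambda>p. g (fst p)) \<longleftrightarrow> integrable P g"
proof -
  have eq: "P = distr (P \<Otimes>\<^sub>M Q) P fst" by (rule prob_space.distr_pair_fst[OF assms(2), symmetric])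
  show "(\<integral>p. g (fst p) \<partial>(P \<Otimes>\<^sub>M Q)) = (\<integral>x. g x \<partial>P)"
    by (subst (2) eq, subst integral_distr) auto
  show "integrable (P \<Otimes>\<^sub>M Q) (\<lambda>p. g (fst p)) \<longleftrightarrow> integrable P g"
    by (subst (2) eq, subst integrable_distr_eq) auto
qed

lemma integral_pair_snd:
  fixes g :: "'b \<Rightarrow> 'c::{banach, second_countable_topology}"
  assumes "prob_space P" "prob_space Q" and [measurable]: "g \<in> borel_measurable Q"
  shows "(\<integral>p. g (snd p) \<partial>(P \<Otimes>\<^sub>M Q)) = (\<integral>x. g x \<partial>Q)"
    and "integrable (P \<Otimes>\<^sub>M Q) (\<lambda>p. g (snd p)) \<longleftrightarrow> integrable Q g"
proof -
  interpret P: prob_space P by fact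
  interpret Q: prob_space Q by fact
  interpret PQ: pair_prob_space P Q ..
  interpret QP: pair_prob_space Q P ..
  have "distr (P \<Otimes>\<^sub>M Q) Q snd = distr (distr (Q \<Otimes>\<^sub>M P) (P \<Otimes>\<^sub>M Q) (\<lambda>(x, y). (y, x))) Q snd"
    using PQ.distr_pair_swap by simp
  also have "\<dots> = distr (Q \<Otimes>\<^sub>M P) Q fst"
    by (subst distr_distr) (auto simp: comp_def case_prod_beta)
  also have "\<dots> = Q" by (rule P.distr_pair_fst)
  finally have eq: "Q = distr (P \<Otimes>\<^sub>M Q) Q snd" by simp
  show "(\<integral>p. g (snd p) \<partial>(P \<Otimes>\<^sub>M Q)) = (\<integral>x. g x \<partial>Q)"
    by (subst (2) eq, subst integral_distr) auto
  show "integrable (P \<Otimes>\<^sub>M Q) (\<lambda>p. g (snd p)) \<longleftrightarrow> integrable Q g"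
    by (subst (2) eq, subst integrable_distr_eq) auto
qed

lemma integral_pair_mult:
  fixes g :: "'a \<Rightarrow> 'c::{real_normed_field, banach, second_countable_topology}"
  assumes P: "prob_space P" and Q: "prob_space Q"
    and [measurable]: "g \<in> borel_measurable P" "h \<in> borel_measurable Q"
    and B: "\<And>x. norm (g x) \<le> B" "\<And>x. norm (h x) \<le> B'"
  shows "(\<integral>p. g (fst p) * h (snd p) \<partial>(P \<Otimes>\<^sub>M Q)) = (\<integral>x. g x \<partial>P) * (\<integral>y. h y \<partial>Q)"
proof -
  interpret P: prob_space P by fact
  interpret Q: prob_space Q by fact
  interpret PQ: pair_prob_space P Q ..
  have B0: "B \<ge> 0" using B(1)[of undefined] norm_ge_zero order_trans by blast
  have "integrable (P \<Otimes>\<^sub>M Q) (\<lambda>p. g (fst p) * h (snd p))"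
    by (rule integrable_bounded_pair[OF P Q, where B="B * B'"]) (auto simp: norm_mult intro!: mult_mono B B0)
  from PQ.integral_fst'[OF this]
  have "(\<integral>p. g (fst p) * h (snd p) \<partial>(P \<Otimes>\<^sub>M Q)) = (\<integral>x. \<integral>y. g x * h y \<partial>Q \<partial>P)" by simp
  then show ?thesis by simp
qed

lemma lincomb_map: "lincomb A (map (\<lambda>(r, k). (r, g k)) c) \<omega> = lincomb (\<lambda>k. A (g k)) c \<omega>"
  by (induction c) auto

lemma quad_map: "quad B (map (\<lambda>(r, k). (r, g k)) c) = quad (\<lambda>k k'. B (g k) (g k')) c"
  unfolding quad_def by (auto intro!: sum.cong simp: case_prod_beta)

locale setting =
  fixes T a :: real and chi f :: "real \<Rightarrow> real" and F L B :: real
    and M :: "real \<Rightarrow> 'a measure" and W :: "real \<Rightarrow> (real \<times> real \<Rightarrow> real) \<Rightarrow> 'a \<Rightarrow> real"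
    and X :: "real \<Rightarrow> real \<Rightarrow> real \<Rightarrow> 'a \<Rightarrow> real"
    and N :: "real \<Rightarrow> 'b measure" and V :: "real \<Rightarrow> (real \<times> real \<Rightarrow> real) \<Rightarrow> 'b \<Rightarrow> real"
    and Z :: "real \<Rightarrow> real \<Rightarrow> real \<Rightarrow> 'b \<Rightarrow> real"
  assumes T_pos: "T > 0" and f_bound: "\<And>x. \<bar>f x\<bar> \<le> F" and f_lip: "\<And>x y. \<bar>f x - f y\<bar> \<le> L * \<bar>x - y\<bar>"
    and chi_bound: "\<And>y. y \<in> {a<..<a + 1} \<Longrightarrow> \<bar>chi y\<bar> \<le> B" and chi_cont: "continuous_on {a<..<a + 1} chi"
    and X_sol: "\<And>lam. lam \<ge> 1 \<Longrightarrow>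
       prob_space (M lam) \<and>
       isonormal (M lam) ({0..T} \<times> {lam * a<..<lam * a + lam}) (W lam) \<and>
       mild_solution (M lam) T {lam * a<..<lam * a + lam} (neumann_kernel (lam * a) (lam * a + lam))
         (\<lambda>y. chi (y / lam)) f (W lam) (X lam)"
    and Z_sol: "\<And>yb. yb \<in> {a<..<a + 1} \<Longrightarrow>
       prob_space (N yb) \<and>
       isonormal (N yb) ({0..T} \<times> UNIV) (V yb) \<and>
       mild_solution (N yb) T UNIV heat_kernel (\<lambda>_. chi yb) f (V yb) (Z yb)"
begin

lemma chi_scaled_measurable:
  assumes "lam \<ge> 1"
  shows "set_borel_measurable lborel {lam * a<..<lam * a + lam} (\<lambda>y. chi (y / lam))"
proof -
  have "continuous_on {lam * a<..<lam * a + lam} (\<lambda>y. chi (y / lam))"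
  proof (rule continuous_on_compose2[OF chi_cont])
    show "(\<lambda>y. y / lam) ` {lam * a<..<lam * a + lam} \<subseteq> {a<..<a + 1}" using assms by (auto simp: field_simps)
  qed (use assms in \<open>auto intro!: continuous_intros\<close>)
  from borel_measurable_continuous_on_indicator[OF _ this]
  show ?thesis unfolding set_borel_measurable_def by simp
qed

lemma mild_field_X:
  assumes "lam \<ge> 1"
  shows "mild_field T (sqrt T + 1) {lam * a<..<lam * a + lam} (neumann_kernel (lam * a) (lam * a + lam)) (M lam)
     (\<lambda>y. chi (y / lam)) f F L (W lam) (X lam)"
proof -
  interpret H: heat_like T "sqrt T + 1" "{lam * a<..<lam * a + lam}" "neumann_kernel (lam * a) (lam * a + lam)"
    by (rule heat_like_neumann) (use assms T_pos in auto)
  interpret P: prob_space "M lam" using X_sol[OF assms] by simp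
  show ?thesis by unfold_locales (use X_sol[OF assms] T_pos f_bound f_lip chi_scaled_measurable[OF assms] in auto)
qed

lemma mild_field_Z:
  assumes "yb \<in> {a<..<a + 1}"
  shows "mild_field T 1 UNIV heat_kernel (N yb) (\<lambda>_. chi yb) f F L (V yb) (Z yb)"
proof -
  interpret H: heat_like T 1 UNIV heat_kernel by (rule heat_like_heat)
  interpret P: prob_space "N yb" using Z_sol[OF assms] by simp
  show ?thesis by unfold_locales (use Z_sol[OF assms] T_pos f_bound f_lip in \<open>auto simp: set_borel_measurable_def\<close>)
qed

lemma initial_Z:
  assumes "yb \<in> {a<..<a + 1}" "fst z > 0"
  shows "mild_field.initial UNIV heat_kernel (\<lambda>_. chi yb) z = chi yb"
  using mild_field.initial_def[OF mild_field_Z[OF assms(1)], of z] heat_like.K_int(2)[OF heat_like_heat assms(2), of "snd z"]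
  by simp

end

text \<open>Recentring at a point \<open>c\<close> that moves with \<open>lam\<close> makes the
  iterates for different \<open>lam\<close> functions of the same local coordinates, with kernels
  that converge there.\<close>

lemma (in mild_field) picard_shift:
  assumes \<omega>: "\<omega> \<in> space M"
  shows "picard (\<lambda>z z'. k (c + z) (c + z')) f (\<lambda>z. forcing (c + z)) m z \<omega> = picard k f forcing m (c + z) \<omega>"
proof (induction m arbitrary: z)
  case (Suc m)
  have pm: "(\<lambda>p. picard k f forcing m (fst p) (snd p)) \<in> borel_measurable (lborel \<Otimes>\<^sub>M M)"
    by (rule measurable_picard[OF kap_jm f_meas measurable_forcing])
  have [measurable]: "(\<lambda>z'. picard k f forcing m z' \<omega>) \<in> borel_measurable borel"
    using measurable_compose[OF measurable_Pair2'[OF \<omega>] pm] by simp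
  have "(\<integral>z'. k (c + z) (c + z') * f (picard k f forcing m (c + z') \<omega>) \<partial>lborel) = (\<integral>z'. k (c + z) z' * f (picard k f forcing m z' \<omega>) \<partial>lborel)"
    by (rule lborel_translate(1)) measurable
  then show ?case by (simp add: Suc)
qed simp

text \<open>Indexing the two macroscopic points by \<open>bool\<close> gives single and joint
  statements one index set, pairs of a point and a local space-time offset. Independence of the two
  limits then amounts to vanishing covariance between different first components.\<close>

locale two_points = setting +
  fixes l :: "nat \<Rightarrow> real" and ys :: "bool \<Rightarrow> real"
  assumes l_ge: "\<And>n. l n \<ge> 1" and l_lim: "filterlim l at_top sequentially"
    and ys_in: "\<And>b. ys b \<in> {a<..<a + 1}" and ys_neq: "ys False \<noteq> ys True"
begin

sublocale XF: mild_field T "sqrt T + 1" "{l n * a<..<l n * a + l n}" "neumann_kernel (l n * a) (l n * a + l n)" "M (l n)"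
     "\<lambda>y. chi (y / l n)" f F L "W (l n)" "X (l n)" for n
  by (rule mild_field_X[OF l_ge])

sublocale ZF: mild_field T 1 UNIV heat_kernel "N (ys b)" "\<lambda>_. chi (ys b)" f F L "V (ys b)" "Z (ys b)" for b
  by (rule mild_field_Z[OF ys_in])

abbreviation "J n \<equiv> {l n * a<..<l n * a + l n}"
abbreviation "KN n \<equiv> neumann_kernel (l n * a) (l n * a + l n)"
abbreviation "kH \<equiv> kap T UNIV heat_kernel"
abbreviation "kX n \<equiv> kap T (J n) (KN n)"

definition "sh b n = (0::real, l n * ys b)"
text \<open>The limiting covariance \<open>limcov\<close> is block diagonal, so the limit is
  realised by independent copies of the two line solutions on a product space.\<close>

definition "P2 = N (ys False) \<Otimes>\<^sub>M N (ys True)"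
definition "pr b p = (if b then snd p else fst p)" for p :: "'c \<times> 'c"
definition "gap b = min (ys b - a) (a + 1 - ys b)"
text \<open>A lower bound for the distance of \<open>l n * ys b + y\<close> from the boundary of the
  interval. For small \<open>n\<close> it may be negative; the ball is then empty and its inclusion
  trivial.\<close>

definition "rad b y n = gap b * l n - \<bar>y\<bar>"
definition "region = {0<..T} \<times> (UNIV :: real set)"
definition "noiseX n bz \<omega> = XF.noise n (sh (fst bz) n + snd bz) \<omega>"
definition "noiseZ bz p = ZF.noise (fst bz) (snd bz) (pr (fst bz) p)"
definition "limcov bz bz' = (if fst bz = fst bz' then kcov T UNIV heat_kernel (snd bz) (snd bz') else 0)" for bz bz' :: "bool \<times> (real \<times> real)"

lemma prob_P2: "prob_space P2"
proof -
  interpret pair_prob_space "N (ys False)" "N (ys True)" ..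
  show ?thesis unfolding P2_def by unfold_locales
qed

lemma measurable_pr [measurable]: "pr b \<in> measurable P2 (N (ys b))"
  unfolding P2_def pr_def by (cases b) auto

lemma gap_pos: "gap b > 0" using ys_in[of b] by (simp add: gap_def)

lemma rad_lim: "filterlim (rad b y) at_top sequentially"
proof -
  have "filterlim (\<lambda>n. gap b * l n) at_top sequentially"
    by (rule filterlim_tendsto_pos_mult_at_top[OF tendsto_const gap_pos l_lim])
  from filterlim_tendsto_add_at_top[OF tendsto_const this, of "- \<bar>y\<bar>"]
  show ?thesis unfolding rad_def[abs_def] by (simp add: add.commute)
qed

lemma rad_sub: "{l n * ys b + y - rad b y n<..<l n * ys b + y + rad b y n} \<subseteq> J n"
proof -
  have l0: "l n > 0" using l_ge[of n] by simp
  have "gap b * l n \<le> (ys b - a) * l n" "gap b * l n \<le> (a + 1 - ys b) * l n"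
    using l0 by (auto simp: gap_def intro!: mult_right_mono)
  then show ?thesis by (auto simp: rad_def algebra_simps abs_le_iff split: abs_split)
qed

lemma heat_le_KN: "y \<in> J n \<Longrightarrow> \<eta> \<in> J n \<Longrightarrow> heat_kernel t y \<eta> \<le> KN n t y \<eta>"
  by (rule heat_kernel_le_neumann_kernel)

lemma sh_in_pts: assumes "z \<in> region" shows "\<forall>\<^sub>F n in sequentially. sh b n + z \<in> XF.pts n"
proof -
  have "\<forall>\<^sub>F n in sequentially. rad b (snd z) n > 0" using rad_lim by (simp add: filterlim_at_top_dense)
  then show ?thesis
  proof eventually_elim
    case (elim n)
    have "l n * ys b + snd z \<in> J n" by (rule subsetD[OF rad_sub[of n b "snd z"]]) (use elim in auto)
    then show ?case using assms by (cases z) (auto simp: XF.pts_def sh_def region_def)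
  qed
qed

lemma region_pts: "ZF.pts = region" by (simp add: ZF.pts_def region_def)

text \<open>The interval covariance is first replaced by that of the line. For equal macroscopic
  points the latter does not depend on \<open>n\<close>, by translation invariance; for different
  ones the distance grows like \<open>l n\<close> and the covariance vanishes.\<close>

lemma kcov_lim:
  assumes "snd bz \<in> region" "snd bz' \<in> region"
  shows "(\<lambda>n. kcov T (J n) (KN n) (sh (fst bz) n + snd bz) (sh (fst bz') n + snd bz')) \<longlonglongrightarrow> limcov bz bz'"
proof -
  obtain b t y where bz: "bz = (b, (t, y))" by (metis surj_pair)
  obtain b' t' y' where bz': "bz' = (b', (t', y'))" by (metis surj_pair)
  have t: "0 \<le> t" "t \<le> T" "0 \<le> t'" "t' \<le> T" using assms by (auto simp: region_def bz bz')
  let ?H = "\<lambda>n. kcov T UNIV heat_kernel (t, l n * ys b + y) (t', l n * ys b' + y')"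
  have 1: "(\<lambda>n. kcov T (J n) (KN n) (t, l n * ys b + y) (t', l n * ys b' + y') - ?H n) \<longlonglongrightarrow> 0"
    by (rule kcov_conv[where R="rad b y" and R'="rad b' y'", OF XF.heat_like_axioms heat_le_KN rad_lim rad_sub rad_lim rad_sub t])
  have 2: "?H \<longlonglongrightarrow> limcov bz bz'"
  proof (cases "b = b'")
    case True
    then show ?thesis by (simp add: limcov_def bz bz' kcov_heat_translate)
  next
    case False
    define d where "d = ys b' - ys b"
    have d: "d \<noteq> 0" unfolding d_def using False ys_neq by (cases b; cases b') auto
    have eq: "?H n = kcov T UNIV heat_kernel (t, 0) (t', d * l n + (y' - y))" for n
      using kcov_heat_translate[of T t "l n * ys b + y" 0 t' "d * l n + (y' - y)"] by (simp add: d_def algebra_simps)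
    have "filterlim (\<lambda>n. \<bar>d\<bar> * l n) at_top sequentially"
      by (rule filterlim_tendsto_pos_mult_at_top[OF tendsto_const _ l_lim]) (use d in simp)
    then have "filterlim (\<lambda>n. - \<bar>y' - y\<bar> + \<bar>d\<bar> * l n) at_top sequentially"
      by (rule filterlim_tendsto_add_at_top[OF tendsto_const])
    then have "filterlim (\<lambda>n. \<bar>d * l n + (y' - y)\<bar>) at_top sequentially"
    proof (rule filterlim_at_top_mono, intro always_eventually allI)
      fix n
      have "\<bar>d * l n\<bar> = \<bar>d\<bar> * l n" using l_ge[of n] by (simp add: abs_mult)
      then show "- \<bar>y' - y\<bar> + \<bar>d\<bar> * l n \<le> \<bar>d * l n + (y' - y)\<bar>" by linarith
    qed
    then have "?H \<longlonglongrightarrow> 0" unfolding eq by (rule kcov_heat_decorrelate[OF _ t(2,3)])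
    then show ?thesis using False by (simp add: limcov_def bz bz')
  qed
  show ?thesis using tendsto_add[OF 1 2] by (simp add: bz bz' sh_def)
qed

section \<open>Joint characteristic functions of the noise and their limit\<close>

lemma noiseX_measurable: "noiseX n bz \<in> borel_measurable (M (l n))"
  unfolding noiseX_def by measurable

lemma noiseZ_measurable: "noiseZ bz \<in> borel_measurable P2"
  unfolding noiseZ_def by measurable

lemma char_noiseX_lim:
  assumes c: "snd ` set c \<subseteq> UNIV \<times> region"
  shows "(\<lambda>n. \<integral>\<omega>. cis (lincomb (noiseX n) c \<omega>) \<partial>M (l n)) \<longlonglongrightarrow> complex_of_real (exp (- quad limcov c / 2))"
proof -
  let ?C = "\<lambda>n bz bz'. kcov T (J n) (KN n) (sh (fst bz) n + snd bz) (sh (fst bz') n + snd bz')"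
  have "\<forall>\<^sub>F n in sequentially. \<forall>bz\<in>snd ` set c. sh (fst bz) n + snd bz \<in> XF.pts n"
    by (rule eventually_ball_finite) (use c sh_in_pts in auto)
  then have ev: "\<forall>\<^sub>F n in sequentially. complex_of_real (exp (- quad (?C n) c / 2)) = (\<integral>\<omega>. cis (lincomb (noiseX n) c \<omega>) \<partial>M (l n))"
  proof eventually_elim
    case (elim n)
    let ?g = "\<lambda>bz. sh (fst bz) n + snd bz"
    let ?c = "map (\<lambda>(r, bz). (r, ?g bz)) c"
    have "snd ` set ?c \<subseteq> XF.pts n" using elim by (force simp: case_prod_beta)
    from XF.noise_char[OF this] show ?case
      unfolding lincomb_map quad_map noiseX_def[abs_def] by simp
  qed
  have "(\<lambda>n. quad (?C n) c) \<longlonglongrightarrow> quad limcov c"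
    unfolding quad_def
  proof (intro tendsto_sum tendsto_mult tendsto_const kcov_lim)
    fix i assume "i \<in> {..<length c}"
    then have "snd (c ! i) \<in> UNIV \<times> region" using c by (auto dest!: nth_mem)
    then show "snd (snd (c ! i)) \<in> region" by auto
  next
    fix j assume "j \<in> {..<length c}"
    then have "snd (c ! j) \<in> UNIV \<times> region" using c by (auto dest!: nth_mem)
    then show "snd (snd (c ! j)) \<in> region" by auto
  qed
  then have "(\<lambda>n. complex_of_real (exp (- quad (?C n) c / 2))) \<longlonglongrightarrow> complex_of_real (exp (- quad limcov c / 2))"
    by (intro tendsto_intros) auto
  then show ?thesis by (rule Lim_transform_eventually[OF _ ev])
qed

lemma char_noiseZ:
  assumes c: "snd ` set c \<subseteq> UNIV \<times> region"
  shows "(\<integral>p. cis (lincomb noiseZ c p) \<partial>P2) = complex_of_real (exp (- quad limcov c / 2))"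
proof -
  \<comment> \<open>Entries that belong to the other point keep their place with coefficient zero,
    so that \<open>c\<close> and both parts are summed over the same positions.\<close>
  define part where "part b = map (\<lambda>(r, bz). (if fst bz = b then r else 0, snd bz)) c" for b
  have split: "lincomb noiseZ c p = lincomb (ZF.noise False) (part False) (fst p) + lincomb (ZF.noise True) (part True) (snd p)" for p
    unfolding part_def by (induction c) (auto simp: noiseZ_def pr_def)
  have qsplit: "quad limcov c = quad (kcov T UNIV heat_kernel) (part False) + quad (kcov T UNIV heat_kernel) (part True)"
    unfolding quad_def part_def by (auto simp: sum.distrib[symmetric] limcov_def case_prod_beta intro!: sum.cong)
  have sub: "snd ` set (part b) \<subseteq> ZF.pts" for b
    unfolding region_pts using c by (auto simp: part_def)
  have m: "lincomb (ZF.noise b) (part b) \<in> borel_measurable (N (ys b))" for b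
    by (rule borel_measurable_lincomb) measurable
  have mc: "(\<lambda>x. cis (lincomb (ZF.noise b) (part b) x)) \<in> borel_measurable (N (ys b))" for b
    by (rule borel_measurable_continuous_on[OF continuous_on_cis[OF continuous_on_id] m])
  have "(\<integral>p. cis (lincomb noiseZ c p) \<partial>P2) = (\<integral>p. cis (lincomb (ZF.noise False) (part False) (fst p)) * cis (lincomb (ZF.noise True) (part True) (snd p)) \<partial>P2)"
    by (simp add: split cis_mult)
  also have "\<dots> = (\<integral>x. cis (lincomb (ZF.noise False) (part False) x) \<partial>N (ys False)) * (\<integral>x. cis (lincomb (ZF.noise True) (part True) x) \<partial>N (ys True))"
    unfolding P2_def by (rule integral_pair_mult[where B=1 and B'=1]) (auto intro: mc ZF.prob_space_axioms)
  also have "\<dots> = complex_of_real (exp (- quad limcov c / 2))"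
    unfolding ZF.noise_char[OF sub] qsplit of_real_mult[symmetric] exp_add[symmetric] by (simp add: add_divide_distrib)
  finally show ?thesis .
qed

sublocale LL: limit_law "\<lambda>n. M (l n)" P2 noiseX noiseZ "UNIV \<times> region"
proof (rule limit_law.intro)
  show "(\<lambda>n. \<integral>\<omega>. cis (lincomb (noiseX n) c \<omega>) \<partial>M (l n)) \<longlonglongrightarrow> (\<integral>\<omega>. cis (lincomb noiseZ c \<omega>) \<partial>P2)"
    if "snd ` set c \<subseteq> UNIV \<times> region" for c
    unfolding char_noiseZ[OF that] by (rule char_noiseX_lim[OF that])
qed (rule XF.prob_space_axioms prob_P2 noiseX_measurable noiseZ_measurable)+

lemma chi_B: "\<bar>chi (ys b)\<bar> \<le> B" "B \<ge> 0"
  using chi_bound[OF ys_in[of b]] by auto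

text \<open>The radius \<open>sqrt (l n)\<close> tends to infinity, so the heat mass beyond it
  vanishes, but it is small compared with \<open>l n\<close>, so that \<open>\<eta> / l n\<close>
  stays close to \<open>ys b\<close> and continuity of \<open>chi\<close> applies.\<close>

lemma initial_lim:
  assumes z: "z \<in> region"
  shows "(\<lambda>n. XF.initial n (sh b n + z)) \<longlonglongrightarrow> chi (ys b)"
proof -
  obtain t y where tz: "z = (t, y)" by (metis surj_pair)
  have t: "0 < t" using z by (simp add: region_def tz)
  have sq: "filterlim (\<lambda>n. sqrt (l n)) at_top sequentially"
    by (rule filterlim_compose[OF sqrt_at_top l_lim])
  have "(\<lambda>n. LBINT \<eta>:J n. KN n t (l n * ys b + y) \<eta> * chi (\<eta> / l n)) \<longlonglongrightarrow> chi (ys b)"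
  proof (rule kernel_average_conv[where R="\<lambda>n. sqrt (l n)" and B=B, OF XF.heat_like_axioms heat_le_KN sq _ t XF.X0_meas])
    have g: "\<forall>\<^sub>F n in sequentially. sqrt (l n) > (\<bar>y\<bar> + 1) / gap b + 1"
      using sq by (simp add: filterlim_at_top_dense)
    show "\<forall>\<^sub>F n in sequentially. {l n * ys b + y - sqrt (l n)<..<l n * ys b + y + sqrt (l n)} \<subseteq> J n"
    proof -
      have "filterlim (\<lambda>n. sqrt (l n) * (-1 + gap b * sqrt (l n))) at_top sequentially"
        by (intro filterlim_at_top_mult_at_top[OF sq] filterlim_tendsto_add_at_top[OF tendsto_const]
            filterlim_tendsto_pos_mult_at_top[OF tendsto_const gap_pos sq])
      then have "\<forall>\<^sub>F n in sequentially. sqrt (l n) * (-1 + gap b * sqrt (l n)) > \<bar>y\<bar>"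
        by (simp add: filterlim_at_top_dense)
      then show ?thesis
      proof eventually_elim
        case (elim n)
        have "sqrt (l n) * sqrt (l n) = l n" using l_ge[of n] by simp
        then have "sqrt (l n) * (-1 + gap b * sqrt (l n)) = gap b * l n - sqrt (l n)" by (simp add: algebra_simps)
        then have "sqrt (l n) \<le> rad b y n" using elim by (simp add: rad_def)
        then show ?case using rad_sub[of n b y] by (auto simp: subset_iff)
      qed
    qed
    show "\<bar>chi (\<eta> / l n)\<bar> \<le> B" if "\<eta> \<in> J n" for n \<eta>
      using that l_ge[of n] by (intro chi_bound) (auto simp: field_simps)
    fix e :: real assume e: "e > 0"
    have "isCont chi (ys b)" using chi_cont ys_in[of b] by (simp add: continuous_on_eq_continuous_at)
    then obtain d where d: "d > 0" "\<And>v. \<bar>v - ys b\<bar> < d \<Longrightarrow> \<bar>chi v - chi (ys b)\<bar> < e"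
      using e unfolding continuous_at_eps_delta by (metis dist_real_def)
    have "\<forall>\<^sub>F n in sequentially. sqrt (l n) > (\<bar>y\<bar> + 1) / d" using sq by (simp add: filterlim_at_top_dense)
    then show "\<forall>\<^sub>F n in sequentially. \<forall>\<eta>. \<bar>\<eta> - (l n * ys b + y)\<bar> < sqrt (l n) \<longrightarrow> \<bar>chi (\<eta> / l n) - chi (ys b)\<bar> \<le> e"
    proof eventually_elim
      case (elim n)
      show ?case
      proof (intro allI impI)
        fix \<eta> assume \<eta>: "\<bar>\<eta> - (l n * ys b + y)\<bar> < sqrt (l n)"
        have l1: "l n \<ge> 1" "sqrt (l n) \<ge> 1" using l_ge[of n] by auto
        have "\<bar>y\<bar> + 1 < d * sqrt (l n)" using elim d by (simp add: field_simps)
        then have "(\<bar>y\<bar> + 1) * sqrt (l n) < d * sqrt (l n) * sqrt (l n)" using l1 by (intro mult_strict_right_mono) auto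
        also have "\<dots> = d * l n" using l1 by simp
        finally have A: "(\<bar>y\<bar> + 1) * sqrt (l n) < d * l n" .
        have "\<bar>y\<bar> * 1 \<le> \<bar>y\<bar> * sqrt (l n)" using l1 by (intro mult_left_mono) auto
        then have "\<bar>\<eta> - l n * ys b\<bar> < (\<bar>y\<bar> + 1) * sqrt (l n)" using \<eta> by (simp add: distrib_right)
        then have "\<bar>\<eta> - l n * ys b\<bar> < d * l n" using A by simp
        moreover have "\<eta> / l n - ys b = (\<eta> - l n * ys b) / l n" using l1 by (simp add: field_simps)
        ultimately have "\<bar>\<eta> / l n - ys b\<bar> < d" using l1 by (simp add: abs_divide divide_less_eq)
        then show "\<bar>chi (\<eta> / l n) - chi (ys b)\<bar> \<le> e" using d(2) by (simp add: less_imp_le)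
      qed
    qed
  qed
  then show ?thesis by (simp add: XF.initial_def sh_def tz)
qed

lemma forcing_multiplier:
  assumes z: "z \<in> region"
  shows "LL.multiplier (\<lambda>n \<omega>. cis (u * XF.forcing n (sh b n + z) \<omega>)) (\<lambda>p. cis (u * ZF.forcing b z (pr b p)))"
proof -
  have "LL.multiplier (\<lambda>n \<omega>. cis (u * XF.initial n (sh b n + z)) * cis (u * noiseX n (b, z) \<omega>)) (\<lambda>p. cis (u * chi (ys b)) * cis (u * noiseZ (b, z) p))"
  proof (intro LL.multiplier_mult LL.multiplier_const LL.multiplier_cis)
    show "(\<lambda>n. cis (u * XF.initial n (sh b n + z))) \<longlonglongrightarrow> cis (u * chi (ys b))"
      by (intro tendsto_cis tendsto_mult tendsto_const initial_lim z)
  qed (use z in simp)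
  moreover have "ZF.initial b z = chi (ys b)" using initial_Z[OF ys_in[of b], of z] z by (auto simp: region_def)
  ultimately show ?thesis
    by (simp add: XF.forcing_eq ZF.forcing_eq noiseX_def noiseZ_def cis_mult distrib_left)
qed

lemma measurable_pr_pair: "(\<lambda>q. (fst q, pr b (snd q))) \<in> measurable (lborel \<Otimes>\<^sub>M P2) (lborel \<Otimes>\<^sub>M N (ys b))"
  by measurable

lemma measurable_shift_pair: "(\<lambda>q. (sh b n + fst q, snd q)) \<in> measurable (lborel \<Otimes>\<^sub>M Q) (lborel \<Otimes>\<^sub>M Q)"
  by measurable

lemma integrable_pr:
  fixes g :: "'b \<Rightarrow> real"
  assumes [measurable]: "g \<in> borel_measurable (N (ys b))"
  shows "(\<integral>p. g (pr b p) \<partial>P2) = (\<integral>x. g x \<partial>N (ys b))" "integrable P2 (\<lambda>p. g (pr b p)) \<longleftrightarrow> integrable (N (ys b)) g"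
  using integral_pair_fst[OF ZF.prob_space_axioms[of False] ZF.prob_space_axioms[of True], of g]
    integral_pair_snd[OF ZF.prob_space_axioms[of False] ZF.prob_space_axioms[of True], of g] assms
  unfolding P2_def pr_def by (cases b; simp)+

text \<open>The Picard lemma is applied with kernels and forcings recentred at
  \<open>sh b n\<close>, where they converge to those of the line. The deterministic error bound,
  the same for all \<open>n\<close> and for the limit, then carries the result from the iterates to
  the solutions.\<close>

lemma sol_multiplier:
  assumes z: "z \<in> region"
  shows "LL.multiplier (\<lambda>n \<omega>. cis (u * XF.sol_at n (sh b n + z) \<omega>)) (\<lambda>p. cis (u * ZF.sol_at b z (pr b p)))"
proof -
  let ?\<kappa> = "\<lambda>n z z'. kX n (sh b n + z) (sh b n + z')"
  let ?V = "\<lambda>n z. XF.forcing n (sh b n + z)"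
  let ?V' = "\<lambda>z p. ZF.forcing b z (pr b p)"
  have Vm: "(\<lambda>q. ?V n (fst q) (snd q)) \<in> borel_measurable (lborel \<Otimes>\<^sub>M M (l n))" for n
    using measurable_compose[OF measurable_shift_pair XF.measurable_forcing] by simp
  have V'm: "(\<lambda>q. ?V' (fst q) (snd q)) \<in> borel_measurable (lborel \<Otimes>\<^sub>M P2)"
    using measurable_compose[OF measurable_pr_pair ZF.measurable_forcing] by simp
  have \<kappa>m: "(\<lambda>p. ?\<kappa> n (fst p) (snd p)) \<in> borel_measurable (lborel \<Otimes>\<^sub>M lborel)" for n
  proof -
    have "(\<lambda>p. sh b n + fst p) \<in> borel_measurable (lborel \<Otimes>\<^sub>M lborel)" "(\<lambda>p. sh b n + snd p) \<in> borel_measurable (lborel \<Otimes>\<^sub>M lborel)"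
      by measurable
    then show ?thesis by (rule XF.measurable_kap)
  qed
  have kX_borel: "kX n w \<in> borel_measurable borel" for n w
    using borel_measurable_integrable[OF XF.integrable_kap] by simp
  have \<kappa>i: "integrable lborel (?\<kappa> n w)" for n w
    using lborel_translate(2)[OF kX_borel, of n "sh b n + w" "sh b n"] XF.integrable_kap by simp
  have \<kappa>b: "(\<integral>z'. \<bar>?\<kappa> n w z'\<bar> \<partial>lborel) \<le> T" for n w
  proof -
    have "(\<integral>z'. \<bar>?\<kappa> n w z'\<bar> \<partial>lborel) = (\<integral>z'. \<bar>kX n (sh b n + w) z'\<bar> \<partial>lborel)"
      by (rule lborel_translate(1)) (use kX_borel in measurable)
    then show ?thesis using XF.integral_kap_le T_pos by simp
  qed
  have conv: "(\<lambda>n. \<integral>z'. \<bar>?\<kappa> n w z' - kH w z'\<bar> \<partial>lborel) \<longlonglongrightarrow> 0" if w: "w \<in> region" for w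
  proof -
    obtain t y where tw: "w = (t, y)" by (metis surj_pair)
    have t: "t \<le> T" using w by (simp add: region_def tw)
    have "(\<lambda>n. \<integral>p. \<bar>kX n (t, l n * ys b + y) p - kH (t, l n * ys b + y) p\<bar> * 1 \<partial>lborel) \<longlonglongrightarrow> 0"
      by (rule kap_weighted_conv(2)[where w="\<lambda>_. 1" and R="rad b y", OF XF.heat_like_axioms heat_le_KN rad_lim rad_sub t])
        (auto simp: set_integrable_def integrable_indicator_Ico)
    moreover have "(\<integral>p. \<bar>kX n (t, l n * ys b + y) p - kH (t, l n * ys b + y) p\<bar> * 1 \<partial>lborel) = (\<integral>z'. \<bar>?\<kappa> n w z' - kH w z'\<bar> \<partial>lborel)" for n
    proof -
      have "(\<integral>p. \<bar>kX n (t, l n * ys b + y) p - kH (t, l n * ys b + y) p\<bar> \<partial>lborel) =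
          (\<integral>z'. \<bar>kX n (t, l n * ys b + y) (sh b n + z') - kH (t, l n * ys b + y) (sh b n + z')\<bar> \<partial>lborel)"
        by (rule lborel_translate(1)[symmetric])
          (use kX_borel borel_measurable_integrable[OF ZF.integrable_kap] in measurable)
      then show ?thesis by (simp add: sh_def tw kap_heat_translate)
    qed
    ultimately show ?thesis by simp
  qed
  \<comment> \<open>The slice at time 0 is the only part of the support that lies outside
    \<open>region\<close>, and it is a null set.\<close>
  have supp: "AE z' in lborel. kH w z' \<noteq> 0 \<longrightarrow> z' \<in> region" if w: "w \<in> region" for w
  proof -
    have "AE z' in (lborel \<Otimes>\<^sub>M lborel :: (real \<times> real) measure). fst z' \<noteq> 0"
    proof (rule lborel_pair.AE_pair_measure)
      show "AE x in lborel. AE y in lborel. fst (x::real, y::real) \<noteq> 0" using AE_lborel_singleton[of "0::real"] by eventually_elim simp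
    qed measurable
    then have "AE z' in (lborel :: (real \<times> real) measure). fst z' \<noteq> 0" unfolding lborel_prod .
    then show ?thesis by eventually_elim (use w in \<open>auto simp: kap_def region_def split: if_splits\<close>)
  qed
  have sq: "\<exists>C. \<forall>\<^sub>F n in sequentially. integrable (M (l n)) (\<lambda>\<omega>. (?V n w \<omega>)\<^sup>2) \<and> (\<integral>\<omega>. (?V n w \<omega>)\<^sup>2 \<partial>M (l n)) \<le> C"
    if w: "w \<in> region" for w
  proof (intro exI)
    show "\<forall>\<^sub>F n in sequentially. integrable (M (l n)) (\<lambda>\<omega>. (?V n w \<omega>)\<^sup>2) \<and>
      (\<integral>\<omega>. (?V n w \<omega>)\<^sup>2 \<partial>M (l n)) \<le> 2 * ((sqrt T + 1) * (2 * sqrt T)) + 2 * B\<^sup>2"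
      using sh_in_pts[OF w, of b]
    proof eventually_elim
      case (elim n)
      have "\<bar>XF.initial n (sh b n + w)\<bar> \<le> B"
        by (rule XF.initial_bound[OF elim]) (use l_ge[of n] chi_B in \<open>auto intro!: chi_bound simp: field_simps\<close>)
      then show ?case using XF.forcing_second_moment[OF elim] by blast
    qed
  qed
  have sqZ: "integrable (N (ys b)) (\<lambda>\<omega>. (ZF.forcing b w \<omega>)\<^sup>2)" if w: "w \<in> region" for w
    using ZF.forcing_second_moment(1)[of w b "\<bar>ZF.initial b w\<bar>"] w by (simp add: region_pts)
  have sq': "integrable P2 (\<lambda>p. (?V' w p)\<^sup>2)" if w: "w \<in> region" for w
    using sqZ[OF w] integrable_pr(2)[of "\<lambda>\<omega>. (ZF.forcing b w \<omega>)\<^sup>2" b] by simp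
  have pic: "LL.multiplier (\<lambda>n \<omega>. cis (u * picard (?\<kappa> n) f (?V n) m z \<omega>)) (\<lambda>p. cis (u * picard kH f ?V' m z p))" for m
    by (rule LL.multiplier_picard[where D=region and T=T and F=F and L=L])
      (use f_bound f_lip \<kappa>i \<kappa>b \<kappa>m ZF.integrable_kap ZF.integral_kap_le T_pos ZF.kap_jm conv supp Vm V'm forcing_multiplier sq sq' z in auto)
  have pr': "picard kH f ?V' m w p = picard kH f (ZF.forcing b) m w (pr b p)" for m w p
    by (induction m arbitrary: w) auto
  define E where "E m = T * F * (1 / 2) ^ m * exp (2 * (L + 1) * max 0 (fst z))" for m
  have E0: "E \<longlonglongrightarrow> 0"
    unfolding E_def[abs_def] by (intro tendsto_mult_left_zero tendsto_mult_right_zero LIMSEQ_power_zero) auto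
  show ?thesis
  proof (rule LL.multiplier_uniform_limit[OF pic _ _ _ _ E0])
    show "XF.sol_at n (sh b n + z) \<in> borel_measurable (M (l n))" for n by measurable
    show "(\<lambda>p. ZF.sol_at b z (pr b p)) \<in> borel_measurable P2" by measurable
    show "picard (?\<kappa> n) f (?V n) m z \<in> borel_measurable (M (l n))" for n m
      using measurable_section[OF measurable_picard[OF \<kappa>m XF.f_meas Vm], of z] by simp
    show "picard kH f ?V' m z \<in> borel_measurable P2" for m
      using measurable_section[OF measurable_picard[OF ZF.kap_jm XF.f_meas V'm], of z] by simp
    have "\<bar>XF.sol_at n (sh b n + z) \<omega> - picard (?\<kappa> n) f (?V n) m z \<omega>\<bar> \<le> E m" if "\<omega> \<in> space (M (l n))" for n m \<omega>
      using XF.picard_error[OF that, of "sh b n + z" m] XF.picard_shift[OF that, of "sh b n" m z]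
      by (simp add: E_def sh_def)
    then show "\<forall>\<^sub>F n in sequentially. \<forall>\<omega>\<in>space (M (l n)). \<bar>XF.sol_at n (sh b n + z) \<omega> - picard (?\<kappa> n) f (?V n) m z \<omega>\<bar> \<le> E m" for m
      by simp
    show "\<bar>ZF.sol_at b z (pr b p) - picard kH f ?V' m z p\<bar> \<le> E m" if "p \<in> space P2" for m p
      unfolding pr' E_def by (rule ZF.picard_error) (use measurable_space[OF measurable_pr that] in simp)
  qed
qed

lemma sol_second_moment:
  assumes z: "z \<in> region"
  shows "\<exists>C. \<forall>\<^sub>F n in sequentially. integrable (M (l n)) (\<lambda>\<omega>. (XF.sol_at n (sh b n + z) \<omega>)\<^sup>2) \<and>
     (\<integral>\<omega>. (XF.sol_at n (sh b n + z) \<omega>)\<^sup>2 \<partial>M (l n)) \<le> C"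
proof -
  let ?C = "2 * ((sqrt T + 1) * (2 * sqrt T)) + 2 * B\<^sup>2"
  have "\<forall>\<^sub>F n in sequentially. integrable (M (l n)) (\<lambda>\<omega>. (XF.sol_at n (sh b n + z) \<omega>)\<^sup>2) \<and>
     (\<integral>\<omega>. (XF.sol_at n (sh b n + z) \<omega>)\<^sup>2 \<partial>M (l n)) \<le> 2 * ?C + 2 * (T * F)\<^sup>2"
    using sh_in_pts[OF z, of b]
  proof eventually_elim
    case (elim n)
    have i: "\<bar>XF.initial n (sh b n + z)\<bar> \<le> B"
      by (rule XF.initial_bound[OF elim]) (use l_ge[of n] chi_B in \<open>auto intro!: chi_bound simp: field_simps\<close>)
    have d: "\<bar>XF.drift n w \<omega>\<bar> \<le> T * F" for w \<omega>
      unfolding XF.drift_def by (rule kernel_integral_abs_le[OF XF.integrable_kap f_bound XF.integral_kap_le]) (use T_pos in simp)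
    have dm: "XF.drift n w \<in> borel_measurable (M (l n))" for w
      using measurable_section[OF XF.measurable_drift, of w] by simp
    have eq: "XF.sol_at n w \<omega> = XF.forcing n w \<omega> + XF.drift n w \<omega>" for w \<omega> by (simp add: XF.forcing_def)
    show ?case unfolding eq
      using XF.second_moment_add_bounded[OF XF.measurable_at(2) dm XF.forcing_second_moment[OF elim i] d] by blast
  qed
  then show ?thesis by blast
qed

lemma sol_Z_second_moment:
  assumes z: "z \<in> region"
  shows "integrable (N (ys b)) (\<lambda>\<omega>. (ZF.sol_at b z \<omega>)\<^sup>2)"
proof -
  have d: "\<bar>ZF.drift b w \<omega>\<bar> \<le> T * F" for w \<omega>
    unfolding ZF.drift_def by (rule kernel_integral_abs_le[OF ZF.integrable_kap f_bound ZF.integral_kap_le]) (use T_pos in simp)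
  have dm: "ZF.drift b w \<in> borel_measurable (N (ys b))" for w
    using measurable_section[OF ZF.measurable_drift, of w] by simp
  have eq: "ZF.sol_at b w \<omega> = ZF.forcing b w \<omega> + ZF.drift b w \<omega>" for w \<omega> by (simp add: ZF.forcing_def)
  have zp: "z \<in> ZF.pts" using z by (simp add: region_pts)
  show ?thesis unfolding eq
    by (rule ZF.second_moment_add_bounded(1)[OF ZF.measurable_at(2) dm ZF.forcing_second_moment[OF zp order_refl] d])
qed

lemma sol_lipschitz_multiplier:
  assumes z: "z \<in> region" and \<phi>: "\<And>x. \<bar>\<phi> x\<bar> \<le> G" "\<And>x y. \<bar>\<phi> x - \<phi> y\<bar> \<le> H * \<bar>x - y\<bar>"
  shows "LL.multiplier (\<lambda>n \<omega>. complex_of_real (\<phi> (XF.sol_at n (sh b n + z) \<omega>))) (\<lambda>p. complex_of_real (\<phi> (ZF.sol_at b z (pr b p))))"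
proof -
  obtain C where C: "\<forall>\<^sub>F n in sequentially. integrable (M (l n)) (\<lambda>\<omega>. (XF.sol_at n (sh b n + z) \<omega>)\<^sup>2) \<and>
     (\<integral>\<omega>. (XF.sol_at n (sh b n + z) \<omega>)\<^sup>2 \<partial>M (l n)) \<le> C"
    using sol_second_moment[OF z] by blast
  show ?thesis
  proof (rule LL.multiplier_lipschitz[OF sol_multiplier[OF z] _ _ C _ \<phi>])
    show "integrable P2 (\<lambda>p. (ZF.sol_at b z (pr b p))\<^sup>2)"
      using sol_Z_second_moment[OF z, of b] integrable_pr(2)[of "\<lambda>\<omega>. (ZF.sol_at b z \<omega>)\<^sup>2" b] by simp
  qed measurable
qed

text \<open>Products of multipliers are multipliers, so the joint expectation converges to the one
  on \<open>P2\<close>, where it factors.\<close>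

lemma expectation_product_lim:
  assumes t: "t \<in> {0<..T}" "t' \<in> {0<..T}" and \<phi>: "\<And>x. \<bar>\<phi> x\<bar> \<le> G" "\<And>x y. \<bar>\<phi> x - \<phi> y\<bar> \<le> H * \<bar>x - y\<bar>"
  shows "(\<lambda>n. \<integral>\<omega>. \<phi> (X (l n) t (l n * ys False) \<omega>) * \<phi> (X (l n) t' (l n * ys True) \<omega>) \<partial>M (l n)) \<longlonglongrightarrow>
     (\<integral>\<omega>. \<phi> (Z (ys False) t 0 \<omega>) \<partial>N (ys False)) * (\<integral>\<omega>. \<phi> (Z (ys True) t' 0 \<omega>) \<partial>N (ys True))"
proof -
  have z: "(t, 0) \<in> region" "(t', 0) \<in> region" using t by (simp_all add: region_def)
  have fm: "\<phi> \<in> borel_measurable borel" by (rule bounded_lipschitz_measurable(2)[OF \<phi>(2)])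
  have "(\<lambda>n. \<integral>\<omega>. complex_of_real (\<phi> (XF.sol_at n (sh False n + (t, 0)) \<omega>)) * complex_of_real (\<phi> (XF.sol_at n (sh True n + (t', 0)) \<omega>)) \<partial>M (l n)) \<longlonglongrightarrow>
     (\<integral>p. complex_of_real (\<phi> (ZF.sol_at False (t, 0) (pr False p))) * complex_of_real (\<phi> (ZF.sol_at True (t', 0) (pr True p))) \<partial>P2)"
    by (intro LL.multiplier_tendsto LL.multiplier_mult sol_lipschitz_multiplier[OF z(1) \<phi>] sol_lipschitz_multiplier[OF z(2) \<phi>])
  moreover have "(\<integral>p. complex_of_real (\<phi> (ZF.sol_at False (t, 0) (pr False p))) * complex_of_real (\<phi> (ZF.sol_at True (t', 0) (pr True p))) \<partial>P2) =
    complex_of_real ((\<integral>\<omega>. \<phi> (Z (ys False) t 0 \<omega>) \<partial>N (ys False)) * (\<integral>\<omega>. \<phi> (Z (ys True) t' 0 \<omega>) \<partial>N (ys True)))"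
  proof -
    have m: "(\<lambda>x. complex_of_real (\<phi> (ZF.sol_at b w x))) \<in> borel_measurable (N (ys b))" for b w
      using fm by measurable
    have "(\<integral>p. complex_of_real (\<phi> (ZF.sol_at False (t, 0) (fst p))) * complex_of_real (\<phi> (ZF.sol_at True (t', 0) (snd p))) \<partial>P2)
      = (\<integral>x. complex_of_real (\<phi> (ZF.sol_at False (t, 0) x)) \<partial>N (ys False)) * (\<integral>x. complex_of_real (\<phi> (ZF.sol_at True (t', 0) x)) \<partial>N (ys True))"
      unfolding P2_def by (rule integral_pair_mult[where B=G and B'=G]) (use \<phi>(1) m in \<open>auto intro: ZF.prob_space_axioms\<close>)
    then show ?thesis by (simp add: pr_def ZF.sol_at_def)
  qed
  ultimately show ?thesis
    by (simp add: XF.sol_at_def sh_def tendsto_of_real_iff flip: of_real_mult)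
qed

lemma cis_lim:
  assumes t: "t \<in> {0<..T}"
  shows "(\<lambda>n. \<integral>\<omega>. cis (u * X (l n) t (l n * ys b) \<omega>) \<partial>M (l n)) \<longlonglongrightarrow> (\<integral>\<omega>. cis (u * Z (ys b) t 0 \<omega>) \<partial>N (ys b))"
proof -
  have z: "(t, 0) \<in> region" using t by (simp add: region_def)
  have m: "(\<lambda>x. cis (u * ZF.sol_at b (t, 0) x)) \<in> borel_measurable (N (ys b))"
    by (rule borel_measurable_continuous_on[OF continuous_on_cis[OF continuous_on_id]]) measurable
  have "(\<integral>p. cis (u * ZF.sol_at b (t, 0) (pr b p)) \<partial>P2) = (\<integral>\<omega>. cis (u * ZF.sol_at b (t, 0) \<omega>) \<partial>N (ys b))"
    using integral_pair_fst(1)[OF ZF.prob_space_axioms[of False] ZF.prob_space_axioms[of True], of "\<lambda>x. cis (u * ZF.sol_at False (t, 0) x)"]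
      integral_pair_snd(1)[OF ZF.prob_space_axioms[of False] ZF.prob_space_axioms[of True], of "\<lambda>x. cis (u * ZF.sol_at True (t, 0) x)"] m
    unfolding P2_def pr_def by (cases b) simp_all
  then show ?thesis using LL.multiplier_tendsto[OF sol_multiplier[OF z, of u b]]
    by (simp add: XF.sol_at_def ZF.sol_at_def sh_def)
qed

end

section \<open>Bounds on the law of a solution at a point\<close>

text \<open>The interval bound says that \<open>K * x - cdf \<mu> x\<close> is nondecreasing, so
  this function generates a Stieltjes measure \<open>\<nu>\<close>, and \<open>\<mu> + \<nu>\<close>
  is \<open>K\<close> times Lebesgue measure. Domination on all Borel sets is then
  immediate.\<close>

lemma measure_le_of_intervals:
  fixes \<mu> :: "real measure"
  assumes \<mu>: "finite_borel_measure \<mu>" and K: "K \<ge> 0"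
    and int: "\<And>u v. u \<le> v \<Longrightarrow> measure \<mu> {u..v} \<le> K * (v - u)"
    and A: "A \<in> sets borel"
  shows "emeasure \<mu> A \<le> ennreal K * emeasure lborel A"
proof -
  interpret finite_borel_measure \<mu> by fact
  define G where "G = (\<lambda>x. K * x - cdf \<mu> x)"
  have diff: "cdf \<mu> y - cdf \<mu> x = measure \<mu> {x<..y}" if "x \<le> y" for x y
    using cdf_diff_eq[of x y] that by (cases "x = y") auto
  have Gmono: "G x \<le> G y" if "x \<le> y" for x y
  proof -
    have "measure \<mu> {x<..y} \<le> measure \<mu> {x..y}" by (rule finite_measure_mono) (auto simp: M_is_borel)
    also have "\<dots> \<le> K * (y - x)" by (rule int[OF that])
    finally show ?thesis using diff[OF that] by (simp add: G_def algebra_simps)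
  qed
  have Gcont: "continuous (at_right x) G" for x
    unfolding G_def using cdf_is_right_cont[of x] by (intro continuous_intros) auto
  define \<nu> where "\<nu> = interval_measure G"
  define S where "S = measure_of UNIV (sets borel) (\<lambda>A. emeasure \<mu> A + emeasure \<nu> A)"
  have S: "emeasure S A = emeasure \<mu> A + emeasure \<nu> A" if "A \<in> sets borel" for A
    unfolding S_def
  proof (rule emeasure_measure_of_sigma)
    show "sigma_algebra UNIV (sets (borel :: real measure))" using sets.sigma_algebra_axioms[of borel] by simp
    show "positive (sets borel) (\<lambda>A. emeasure \<mu> A + emeasure \<nu> A)" by (simp add: positive_def)
    show "countably_additive (sets borel) (\<lambda>A. emeasure \<mu> A + emeasure \<nu> A)"
    proof (rule countably_additiveI)
      fix D :: "nat \<Rightarrow> real set" assume D: "range D \<subseteq> sets borel" "disjoint_family D" "(\<Union>i. D i) \<in> sets borel"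
      have "(\<Sum>i. emeasure \<mu> (D i) + emeasure \<nu> (D i)) = (\<Sum>i. emeasure \<mu> (D i)) + (\<Sum>i. emeasure \<nu> (D i))"
        by (rule suminf_add[symmetric]) auto
      also have "\<dots> = emeasure \<mu> (\<Union>i. D i) + emeasure \<nu> (\<Union>i. D i)"
        using D by (intro arg_cong2[where f="(+)"] suminf_emeasure) (auto simp: M_is_borel \<nu>_def)
      finally show "(\<Sum>i. emeasure \<mu> (D i) + emeasure \<nu> (D i)) = emeasure \<mu> (\<Union>i. D i) + emeasure \<nu> (\<Union>i. D i)" .
    qed
  qed fact
  have setsS: "sets S = sets borel" unfolding S_def using sets.space_closed[of borel]
    by (simp add: sets_measure_of_conv sets.sigma_sets_eq[of borel, simplified])
  define R where "R = density (lborel :: real measure) (\<lambda>_. ennreal K)"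
  have R: "emeasure R A = ennreal K * emeasure lborel A" if "A \<in> sets borel" for A
    unfolding R_def using that by (simp add: emeasure_density_const)
  have "R = S"
  proof (rule measure_eqI_generator_eq[where E="range (\<lambda>(a, b). {a <.. b::real})" and \<Omega>=UNIV and A="\<lambda>i. {- real i<..real i}"])
    show "Int_stable (range (\<lambda>(a, b). {a <.. b::real}))"
    proof (rule Int_stableI)
      fix x y assume "x \<in> range (\<lambda>(a, b). {a <.. b::real})" "y \<in> range (\<lambda>(a, b). {a <.. b::real})"
      then obtain a b c d where "x = {a<..b}" "y = {c<..d}" by auto
      then have "x \<inter> y = (\<lambda>(a, b). {a <.. b}) (max a c, min b d)" by auto
      then show "x \<inter> y \<in> range (\<lambda>(a, b). {a <.. b::real})" by blast
    qed
    have sb: "sets (borel :: real measure) = sigma_sets UNIV (range (\<lambda>(a, b). {a <.. b}))"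
      by (subst borel_sigma_sets_Ioc) simp
    show "sets R = sigma_sets UNIV (range (\<lambda>(a, b). {a <.. b}))" unfolding sb[symmetric] by (simp add: R_def)
    show "sets S = sigma_sets UNIV (range (\<lambda>(a, b). {a <.. b}))" unfolding sb[symmetric] by (rule setsS)
    show "emeasure R x = emeasure S x" if xr: "x \<in> range (\<lambda>(a, b). {a <.. b::real})" for x
    proof -
      obtain a b where x: "x = {a<..b}" using xr by auto
      show ?thesis
      proof (cases "a \<le> b")
        case True
        have "emeasure S x = ennreal (cdf \<mu> b - cdf \<mu> a) + ennreal (G b - G a)"
          unfolding x diff[OF True] using True Gmono Gcont
          by (subst S) (auto simp: \<nu>_def emeasure_interval_measure_Ioc emeasure_eq_measure)
        also have "\<dots> = ennreal (K * (b - a))"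
          using diff[OF True] Gmono[OF True] by (subst ennreal_plus[symmetric]) (auto simp: G_def algebra_simps)
        also have "\<dots> = emeasure R x" unfolding x using True K by (subst R) (auto simp: ennreal_mult)
        finally show ?thesis by simp
      next
        case False
        then show ?thesis by (simp add: x)
      qed
    qed
    show "(\<Union>i. {- real i<..real i}) = UNIV"
    proof (intro equalityI subsetI UNIV_I)
      fix x :: real
      obtain i :: nat where "\<bar>x\<bar> < real i" using reals_Archimedean2 by blast
      then show "x \<in> (\<Union>i. {- real i<..real i})" by (auto intro!: exI[of _ i])
    qed
    show "emeasure R {- real i<..real i} \<noteq> \<infinity>" for i
      by (subst R) (auto simp: ennreal_mult_eq_top_iff)
  qed auto
  then have "ennreal K * emeasure lborel A = emeasure \<mu> A + emeasure \<nu> A" using R[OF A] S[OF A] by simp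
  then show ?thesis by simp
qed

lemma nn_integral_le_of_intervals:
  fixes Y :: "'a \<Rightarrow> real"
  assumes P: "prob_space P" and Y[measurable]: "Y \<in> borel_measurable P" and K: "K \<ge> 0"
    and int: "\<And>u v. u \<le> v \<Longrightarrow> measure P {\<omega> \<in> space P. u \<le> Y \<omega> \<and> Y \<omega> \<le> v} \<le> K * (v - u)"
    and g[measurable]: "g \<in> borel_measurable borel"
  shows "(\<integral>\<^sup>+\<omega>. g (Y \<omega>) \<partial>P) \<le> ennreal K * (\<integral>\<^sup>+x. g x \<partial>lborel)"
proof -
  interpret prob_space P by fact
  interpret D: prob_space "distr P borel Y" by (rule prob_space_distr) simp
  have fb: "finite_borel_measure (distr P borel Y)" by unfold_locales auto
  have le: "emeasure (distr P borel Y) A \<le> emeasure (density lborel (\<lambda>_. ennreal K)) A" if A: "A \<in> sets borel" for A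
  proof -
    have "measure (distr P borel Y) {u..v} \<le> K * (v - u)" if "u \<le> v" for u v
      using int[OF that] by (subst measure_distr) (auto simp: vimage_def Int_def conj_commute)
    from measure_le_of_intervals[OF fb K this A] show ?thesis using A by (simp add: emeasure_density_const)
  qed
  have "(\<integral>\<^sup>+\<omega>. g (Y \<omega>) \<partial>P) = (\<integral>\<^sup>+x. g x \<partial>distr P borel Y)" by (simp add: nn_integral_distr)
  also have "\<dots> \<le> (\<integral>\<^sup>+x. g x \<partial>density lborel (\<lambda>_. ennreal K))"
  proof (rule nn_integral_mono_measure)
    show "distr P borel Y \<le> density lborel (\<lambda>_. ennreal K)"
      by (subst le_measure) (auto intro: le)
  qed simp
  also have "\<dots> = ennreal K * (\<integral>\<^sup>+x. g x \<partial>lborel)" by (simp add: nn_integral_density nn_integral_cmult)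
  finally show ?thesis .
qed

text \<open>Isolates one coordinate of the quadratic form, so that the variance can be computed
  after a multiple of \<xi> has been subtracted.\<close>

lemma quad_Cons:
  assumes "\<And>k k'. B k k' = B k' k"
  shows "quad B ((r, k) # c) = r\<^sup>2 * B k k + 2 * r * (\<Sum>i<length c. fst (c ! i) * B k (snd (c ! i))) + quad B c"
proof -
  have "quad B ((r, k) # c) = (\<Sum>i<Suc (length c). \<Sum>j<Suc (length c). fst (((r, k) # c) ! i) * fst (((r, k) # c) ! j) * B (snd (((r, k) # c) ! i)) (snd (((r, k) # c) ! j)))"
    by (simp add: quad_def)
  also have "\<dots> = r * r * B k k + (\<Sum>j<length c. r * fst (c ! j) * B k (snd (c ! j))) + (\<Sum>i<length c. fst (c ! i) * r * B (snd (c ! i)) k) + quad B c"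
    unfolding sum.lessThan_Suc_shift quad_def by (simp add: sum.distrib)
  also have "(\<Sum>i<length c. fst (c ! i) * r * B (snd (c ! i)) k) = (\<Sum>j<length c. r * fst (c ! j) * B k (snd (c ! j)))"
    by (intro sum.cong refl) (simp add: assms[of _ k] mult_ac)
  finally show ?thesis by (simp add: power2_eq_square sum_distrib_left mult_ac)
qed

text \<open>In the parabolic window \<open>\<bar>y - \<eta>\<bar> \<le> sqrt r\<close> the heat
  kernel at time \<open>r\<close> is at least \<open>exp (- 1 / 4) / sqrt (4 * pi * r)\<close>, and
  the square of this is \<open>window_const / r\<close>.\<close>

definition window_const :: real where "window_const = exp (- 1 / 2) / (4 * pi)"

lemma window_const_pos: "window_const > 0" by (simp add: window_const_def)

context heat_like
begin

text \<open>Only half of the parabolic window is kept, on a side of the point where the domain has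
  room, since the point may be close to the boundary. A width \<open>sqrt r\<close> times
  \<open>window_const / r\<close> is integrated over the stretch; its length at most 1/4 ensures
  \<open>sqrt r \<le> 1 / 2\<close>, so the half window stays inside the domain.\<close>

lemma integral_kap_sq_ge:
  assumes z: "fst z \<le> T" "snd z \<in> I" and p: "0 \<le> p" "p < fst z" "fst z - p \<le> 1 / 4"
    and ge: "\<And>t y \<eta>. y \<in> I \<Longrightarrow> \<eta> \<in> I \<Longrightarrow> heat_kernel t y \<eta> \<le> K t y \<eta>"
    and half: "{snd z<..<snd z + 1 / 2} \<subseteq> I \<or> {snd z - 1 / 2<..<snd z} \<subseteq> I"
  shows "2 * window_const * sqrt (fst z - p) \<le> (\<integral>q. indicator {p..} (fst q) * (k z q)\<^sup>2 \<partial>lborel)"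
proof -
  obtain t y where tz: "z = (t, y)" by (metis surj_pair)
  \<comment> \<open>\<open>e\<close> is the sign of the side with room, so that both cases share one
    description of the window.\<close>
  obtain e :: real where e: "e = 1 \<and> {y<..<y + 1 / 2} \<subseteq> I \<or> e = -1 \<and> {y - 1 / 2<..<y} \<subseteq> I"
    using half by (auto simp: tz)
  define g where "g q = (if p \<le> fst q \<and> fst q < t \<and> 0 < e * (snd q - y) \<and> e * (snd q - y) < sqrt (t - fst q) then window_const / (t - fst q) else 0)" for q :: "real \<times> real"
  have gm[measurable]: "g \<in> borel_measurable borel" unfolding g_def by measurable
  have gle: "g q \<le> indicator {p..} (fst q) * (k z q)\<^sup>2" for q
  proof (cases "p \<le> fst q \<and> fst q < t \<and> 0 < e * (snd q - y) \<and> e * (snd q - y) < sqrt (t - fst q)")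
    case True
    define r where "r = t - fst q"
    have r: "0 < r" "r \<le> 1 / 4" using True p by (auto simp: r_def tz)
    have sr: "sqrt r \<le> 1 / 2" using real_sqrt_le_mono[OF r(2)] by (simp add: real_sqrt_divide)
    have qI: "snd q \<in> I" using e True sr by (auto simp: r_def[symmetric] subset_iff)
    have kq: "k z q = K r y (snd q)" using True qI z p by (auto simp: kap_def tz r_def)
    have sq: "(y - snd q)\<^sup>2 \<le> r"
    proof -
      have "\<bar>y - snd q\<bar> \<le> sqrt r" using e True by (auto simp: r_def[symmetric] abs_le_iff)
      then have "\<bar>y - snd q\<bar>\<^sup>2 \<le> (sqrt r)\<^sup>2" by (intro power_mono) auto
      then show ?thesis using r by simp
    qed
    have "exp (- 1 / 4) / sqrt (4 * pi * r) \<le> heat_kernel r y (snd q)"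
      unfolding heat_kernel_def using r sq by (auto intro!: divide_right_mono simp: field_simps)
    also have "\<dots> \<le> K r y (snd q)" using z qI by (intro ge) (auto simp: tz)
    finally have "(exp (- 1 / 4) / sqrt (4 * pi * r))\<^sup>2 \<le> (K r y (snd q))\<^sup>2" by (intro power_mono) (use r in auto)
    also have "(exp (- 1 / 4 :: real) / sqrt (4 * pi * r))\<^sup>2 = window_const / r"
      using r by (simp add: window_const_def power_divide exp_double[symmetric])
    finally show ?thesis using True by (simp add: g_def r_def kq)
  qed (auto simp: g_def)
  have i: "integrable lborel (\<lambda>q. indicator {p..} (fst q) * (k z q)\<^sup>2)"
    by (rule Bochner_Integration.integrable_bound[OF integrable_kap_mult[of z z]])
      (auto simp: power2_eq_square split: split_indicator)
  have inner: "(\<integral>\<^sup>+\<eta>. ennreal (g (s, \<eta>)) \<partial>lborel) = ennreal (indicator {p..<t} s *\<^sub>R (window_const * (1 / sqrt (t - s))))" for s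
  proof (cases "p \<le> s \<and> s < t")
    case True
    let ?A = "{\<eta>. 0 < e * (\<eta> - y) \<and> e * (\<eta> - y) < sqrt (t - s)}"
    have A: "?A = {y<..<y + sqrt (t - s)} \<or> ?A = {y - sqrt (t - s)<..<y}" using e by auto
    then have mA: "?A \<in> sets lborel" "emeasure lborel ?A = ennreal (sqrt (t - s))" using True by (auto simp: emeasure_lborel_Ioo)
    have "(\<integral>\<^sup>+\<eta>. ennreal (g (s, \<eta>)) \<partial>lborel) = (\<integral>\<^sup>+\<eta>. ennreal (window_const / (t - s)) * indicator ?A \<eta> \<partial>lborel)"
      using True by (intro nn_integral_cong) (auto simp: g_def split: split_indicator)
    also have "\<dots> = ennreal (window_const / (t - s)) * ennreal (sqrt (t - s))" using mA by (simp add: nn_integral_cmult_indicator)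
    also have "\<dots> = ennreal (window_const / (t - s) * sqrt (t - s))" by (rule ennreal_mult[symmetric]) (use True window_const_pos in auto)
    also have "window_const / (t - s) * sqrt (t - s) = window_const * (1 / sqrt (t - s))" using True by (simp add: field_simps)
    finally show ?thesis using True by simp
  next
    case False
    then have "g (s, \<eta>) = 0" for \<eta> by (auto simp: g_def)
    then show ?thesis using False by simp
  qed
  have "ennreal (2 * window_const * sqrt (fst z - p)) = ennreal (LBINT s:{p..<t}. window_const * (1 / sqrt (t - s)))"
  proof -
    have "(LBINT s:{p..<t}. window_const * (1 / sqrt (t - s))) = window_const * (LBINT s:{p..<t}. 1 / sqrt (t - s))" by (rule set_integral_mult_right)
    also have "\<dots> = window_const * (2 * sqrt (t - p))" using p by (subst inverse_sqrt_integral(2)) (auto simp: tz)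
    finally show ?thesis by (simp add: tz mult_ac)
  qed
  also have "\<dots> = (\<integral>\<^sup>+s. ennreal (indicator {p..<t} s *\<^sub>R (window_const * (1 / sqrt (t - s)))) \<partial>lborel)"
  proof -
    have "set_integrable lborel {p..<t} (\<lambda>s. window_const * (1 / sqrt (t - s)))"
      by (rule set_integrable_mult_right, rule inverse_sqrt_integral(1)) (use p in \<open>auto simp: tz\<close>)
    then show ?thesis unfolding set_lebesgue_integral_def set_integrable_def
      using window_const_pos by (intro nn_integral_eq_integral[symmetric]) (auto split: split_indicator)
  qed
  also have "\<dots> = (\<integral>\<^sup>+q. ennreal (g q) \<partial>(lborel \<Otimes>\<^sub>M lborel))"
    unfolding inner[symmetric] by (subst lborel.nn_integral_fst[symmetric]) (simp_all add: lborel_prod)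
  also have "\<dots> = (\<integral>\<^sup>+q. ennreal (g q) \<partial>lborel)" by (simp add: lborel_prod)
  also have "\<dots> \<le> (\<integral>\<^sup>+q. ennreal (indicator {p..} (fst q) * (k z q)\<^sup>2) \<partial>lborel)"
    by (intro nn_integral_mono ennreal_leI gle)
  also have "\<dots> = ennreal (\<integral>q. indicator {p..} (fst q) * (k z q)\<^sup>2 \<partial>lborel)"
    using i by (intro nn_integral_eq_integral) auto
  finally show ?thesis by (subst (asm) ennreal_le_iff) (auto intro!: integral_nonneg_AE)
qed

end

text \<open>The factor 1/2 comes from \<open>sqrt (2 * pi) \<ge> 2\<close>. It cancels the factor 2
  in the diameter of the sets to which the lemma is applied, a factor due to the slope
  \<open>\<sigma> / 2\<close>.\<close>

lemma std_normal_set_le: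
  assumes A: "A \<in> sets borel" "A \<subseteq> {\<alpha>..\<beta>}" "\<alpha> \<le> \<beta>"
  shows "measure std_normal_distribution A \<le> (\<beta> - \<alpha>) / 2"
proof -
  interpret S: prob_space std_normal_distribution by (rule prob_space_normal_density) simp
  have d: "std_normal_density x \<le> 1 / 2" for x
  proof -
    have "sqrt 4 \<le> sqrt (2 * pi)" using pi_gt3 by (intro real_sqrt_le_mono) simp
    then have "1 / sqrt (2 * pi) \<le> 1 / 2" by (intro divide_left_mono) auto
    then have "1 / sqrt (2 * pi) * exp (- x\<^sup>2 / 2) \<le> 1 / 2 * 1" by (intro mult_mono) auto
    then show ?thesis by (simp add: std_normal_density_def)
  qed
  have "emeasure std_normal_distribution A = (\<integral>\<^sup>+x. ennreal (std_normal_density x) * indicator A x \<partial>lborel)"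
    using A by (simp add: emeasure_density)
  also have "\<dots> \<le> (\<integral>\<^sup>+x. ennreal (1 / 2) * indicator {\<alpha>..\<beta>} x \<partial>lborel)"
    using d A(2) by (intro nn_integral_mono mult_mono ennreal_leI) (auto split: split_indicator)
  also have "\<dots> = ennreal (1 / 2) * ennreal (\<beta> - \<alpha>)" using A(3) by (simp add: nn_integral_cmult_indicator)
  also have "\<dots> = ennreal (1 / 2 * (\<beta> - \<alpha>))" by (rule ennreal_mult[symmetric]) (use A(3) in auto)
  finally show ?thesis using A(3) by (simp add: S.emeasure_eq_measure)
qed

text \<open>Conditioning on everything but one Gaussian coordinate \<open>\<xi>\<close> of the noise, the solution at a point is
  a function of that coordinate with derivative bounded below.  To avoid conditional laws, \<open>\<xi>\<close> is
  replaced by an independent copy, which leaves the law of the noise unchanged.\<close>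

locale density_setup = mild_field +
  fixes z0 :: "real \<times> real" and \<tau> :: real
  assumes z0: "z0 \<in> pts" and \<tau>: "0 < \<tau>" "\<tau> \<le> fst z0" "\<tau> \<le> 1 / 4" "L * \<tau> \<le> 1 / 2" "4 * L * \<tau> * C \<le> window_const"
    and ge: "\<And>t y \<eta>. y \<in> I \<Longrightarrow> \<eta> \<in> I \<Longrightarrow> heat_kernel t y \<eta> \<le> K t y \<eta>"
    and half: "{snd z0<..<snd z0 + 1 / 2} \<subseteq> I \<or> {snd z0 - 1 / 2<..<snd z0} \<subseteq> I"
begin

definition "p0 = fst z0 - \<tau>"
definition "h0 q = (if p0 \<le> fst q then hfun z0 q else 0)"
definition "\<sigma> = sqrt (\<integral>q. indicator {p0..} (fst q) * (k z0 q)\<^sup>2 \<partial>lborel)"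
definition "\<xi> \<omega> = W h0 \<omega> / \<sigma>"
text \<open>The covariance of \<open>noise z\<close> with the standard normal variable \<xi>.
  Subtracting \<open>coef z * \<xi>\<close> from \<open>noise z\<close> leaves a Gaussian family
  that is independent of \<xi>.\<close>

definition "coef z = (\<integral>q. k z q * (indicator {p0..} (fst q) * k z0 q) \<partial>lborel) / \<sigma>"

lemma z0_simps: "fst z0 \<le> T" "snd z0 \<in> I" "0 \<le> p0" "p0 < fst z0" "fst z0 - p0 = \<tau>"
  using z0 \<tau> by (auto simp: pts_def p0_def)

lemma sigma_sq: "\<sigma>\<^sup>2 = (\<integral>q. indicator {p0..} (fst q) * (k z0 q)\<^sup>2 \<partial>lborel)"
  unfolding \<sigma>_def by (rule real_sqrt_pow2) (auto intro!: integral_nonneg_AE)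

lemma sigma_ge: "2 * window_const * sqrt \<tau> \<le> \<sigma>\<^sup>2"
  unfolding sigma_sq using integral_kap_sq_ge[of z0 p0] z0_simps \<tau> ge half by simp

lemma sigma_pos: "\<sigma> > 0"
proof -
  have "\<sigma>\<^sup>2 > 0" using sigma_ge window_const_pos \<tau> by (smt (verit) mult_pos_pos real_sqrt_gt_zero)
  then have "\<sigma> \<noteq> 0" by auto
  moreover have "\<sigma> \<ge> 0" unfolding \<sigma>_def by (intro real_sqrt_ge_zero) (auto intro!: integral_nonneg_AE)
  ultimately show ?thesis by simp
qed

lemma h0_eq: "indicator ({0..T} \<times> I) q *\<^sub>R h0 q = indicator {p0..} (fst q) * k z0 q"
  using kap_eq_hfun[OF z0, of q] by (auto simp: h0_def split: split_indicator)

lemma square_int_h0: "square_int ({0..T} \<times> I) h0"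
proof -
  have "indicator ({0..T} \<times> I) q *\<^sub>R (h0 q)\<^sup>2 = indicator {p0..} (fst q) * (k z0 q * k z0 q)" for q
    using h0_eq[of q] by (auto simp: power2_eq_square split: split_indicator)
  moreover have "integrable lborel (\<lambda>q. indicator {p0..} (fst q) * (k z0 q * k z0 q))"
    by (rule Bochner_Integration.integrable_bound[OF integrable_kap_mult[of z0 z0]]) (auto split: split_indicator)
  ultimately show ?thesis unfolding square_int_def set_borel_measurable_def set_integrable_def h0_eq by simp
qed

lemma measurable_xi [measurable]: "\<xi> \<in> borel_measurable M"
  unfolding \<xi>_def[abs_def] using isonormal_measurable[OF iso square_int_h0] by measurable

lemma measurable_coef: "coef \<in> borel_measurable borel"
proof -
  have [measurable]: "(\<lambda>q. k (fst q) (snd q)) \<in> borel_measurable (borel \<Otimes>\<^sub>M lborel)"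
    by (rule measurable_kap) measurable
  have "(\<lambda>z. \<integral>q. k z q * (indicator {p0..} (fst q) * k z0 q) \<partial>lborel) \<in> borel_measurable borel"
    by measurable
  then show ?thesis unfolding coef_def[abs_def] by measurable
qed

lemma coef_z0: "coef z0 = \<sigma>"
proof -
  have "(\<integral>q. k z0 q * (indicator {p0..} (fst q) * k z0 q) \<partial>lborel) = \<sigma>\<^sup>2"
    unfolding sigma_sq by (simp add: power2_eq_square mult_ac)
  then show ?thesis using sigma_pos by (simp add: coef_def power2_eq_square)
qed

lemma coef_nonneg: "coef z \<ge> 0"
  unfolding coef_def using sigma_pos by (intro divide_nonneg_pos integral_nonneg_AE) (auto intro!: mult_nonneg_nonneg kap_nonneg)

lemma coef_eq_0: "fst z \<le> p0 \<Longrightarrow> coef z = 0"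
proof -
  assume "fst z \<le> p0"
  then have "(\<lambda>q. k z q * (indicator {p0..} (fst q) * k z0 q)) = (\<lambda>_. 0)" by (auto simp: kap_def split: split_indicator)
  then show ?thesis unfolding coef_def by simp
qed

definition "cmax = 2 * C * sqrt \<tau> / \<sigma>"

text \<open>The inequality \<open>a * b \<le> (a^2 + b^2) / 2\<close> reduces the covariance to two
  variances over stretches of length at most \<tau>, each of order
  \<open>sqrt \<tau>\<close>.\<close>

lemma coef_le: assumes "fst z \<le> fst z0" shows "coef z \<le> cmax"
proof (cases "p0 \<le> fst z")
  case True
  have i: "integrable lborel (\<lambda>q. indicator {p0..} (fst q) * (k w q)\<^sup>2)" for w
    by (rule Bochner_Integration.integrable_bound[OF integrable_kap_mult[of w w]]) (auto simp: power2_eq_square split: split_indicator)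
  have "(\<integral>q. k z q * (indicator {p0..} (fst q) * k z0 q) \<partial>lborel) \<le>
      (\<integral>q. 1 / 2 * (indicator {p0..} (fst q) * (k z q)\<^sup>2) + 1 / 2 * (indicator {p0..} (fst q) * (k z0 q)\<^sup>2) \<partial>lborel)"
  proof (rule integral_mono')
    fix q
    show "k z q * (indicator {p0..} (fst q) * k z0 q) \<le> 1 / 2 * (indicator {p0..} (fst q) * (k z q)\<^sup>2) + 1 / 2 * (indicator {p0..} (fst q) * (k z0 q)\<^sup>2)"
      using sum_squares_bound[of "k z q" "k z0 q"] by (auto split: split_indicator)
  qed (use i[of z] i[of z0] in auto)
  also have "\<dots> = 1 / 2 * (\<integral>q. indicator {p0..} (fst q) * (k z q)\<^sup>2 \<partial>lborel) + 1 / 2 * (\<integral>q. indicator {p0..} (fst q) * (k z0 q)\<^sup>2 \<partial>lborel)"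
    using i[of z] i[of z0] by simp
  also have "\<dots> \<le> 1 / 2 * (C * (2 * sqrt (fst z - p0))) + 1 / 2 * (C * (2 * sqrt (fst z0 - p0)))"
    using integral_kap_sq_le[OF z0_simps(3) True] integral_kap_sq_le[of p0 z0] z0_simps by simp
  also have "\<dots> \<le> 1 / 2 * (C * (2 * sqrt \<tau>)) + 1 / 2 * (C * (2 * sqrt \<tau>))"
    using assms z0_simps C_nonneg by (intro add_mono mult_left_mono) auto
  finally show ?thesis unfolding coef_def cmax_def using sigma_pos by (intro divide_right_mono) auto
next
  case False
  then have "coef z = 0" by (intro coef_eq_0) simp
  then show ?thesis using sigma_pos C_nonneg \<tau> by (simp add: cmax_def)
qed

text \<open>The left side bounds the response of the drift at \<open>z0\<close> to a unit change of
  the coordinate: Lipschitz constant, response \<open>2 * cmax\<close> of the iterate, and length of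
  the stretch. The condition \<open>4 * L * \<tau> * C \<le> window_const\<close> is chosen so that
  this is at most half of the direct response \<open>coef z0 = \<sigma>\<close>.\<close>

lemma slope: "L * (2 * cmax) * \<tau> \<le> \<sigma> / 2"
proof -
  have "L * (2 * cmax) * \<tau> = (4 * L * \<tau> * C) * sqrt \<tau> / \<sigma>" by (simp add: cmax_def)
  also have "\<dots> \<le> window_const * sqrt \<tau> / \<sigma>" using \<tau> sigma_pos by (intro divide_right_mono mult_right_mono) auto
  also have "\<dots> \<le> (\<sigma>\<^sup>2 / 2) / \<sigma>" using sigma_ge sigma_pos by (intro divide_right_mono) auto
  also have "\<dots> = \<sigma> / 2" using sigma_pos by (simp add: power2_eq_square)
  finally show ?thesis .
qed

definition "P2 = M \<Otimes>\<^sub>M std_normal_distribution"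
text \<open>The second component of the product space takes over the role of \<xi>. As \<xi> enters
  the forcing linearly, through \<open>coef\<close>, the replacement is a shift by a multiple of
  \<open>coef z\<close>.\<close>

definition "forcing' z p = forcing z (fst p) + (snd p - \<xi> (fst p)) * coef z"
definition "noise' z p = noise z (fst p) + (snd p - \<xi> (fst p)) * coef z"

lemma prob_normal: "prob_space std_normal_distribution"
  by (rule prob_space_normal_density) simp

lemma prob_P2: "prob_space P2"
proof -
  interpret Q: prob_space std_normal_distribution by (rule prob_normal)
  interpret pair_prob_space M std_normal_distribution ..
  show ?thesis unfolding P2_def by unfold_locales
qed

lemma measurable_P2 [measurable]: "fst \<in> measurable P2 M" "snd \<in> borel_measurable P2"
proof -
  show "fst \<in> measurable P2 M" unfolding P2_def by measurable
  have "snd \<in> measurable P2 std_normal_distribution" unfolding P2_def by measurable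
  then show "snd \<in> borel_measurable P2" by simp
qed

lemma noise'_measurable: "noise' z \<in> borel_measurable P2"
  unfolding noise'_def by measurable

lemma measurable_forcing': "(\<lambda>q. forcing' (fst q) (snd q)) \<in> borel_measurable (lborel \<Otimes>\<^sub>M P2)"
proof -
  have [measurable]: "(\<lambda>q. forcing (fst q) (fst (snd q))) \<in> borel_measurable (lborel \<Otimes>\<^sub>M P2)"
    using measurable_compose[of "\<lambda>q. (fst q, fst (snd q))" "lborel \<Otimes>\<^sub>M P2" "lborel \<Otimes>\<^sub>M M", OF _ measurable_forcing] by simp
  have [measurable]: "coef \<in> borel_measurable borel" by (rule measurable_coef)
  show ?thesis unfolding forcing'_def by measurable
qed

text \<open>Let \<open>s\<close> be the coefficient of the combination on \<xi>. Removing \<xi>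
  lowers the variance by \<open>s^2\<close>, and the independent copy adds \<open>s^2\<close>
  again.\<close>

lemma char_noise':
  assumes c: "snd ` set c \<subseteq> pts"
  shows "(\<integral>p. cis (lincomb noise' c p) \<partial>P2) = (\<integral>\<omega>. cis (lincomb noise c \<omega>) \<partial>M)"
proof -
  define s where "s = lincomb (\<lambda>z _. coef z) c ()"
  have lin: "lincomb noise' c p = (lincomb noise c (fst p) - s * \<xi> (fst p)) + snd p * s" for p
    unfolding s_def by (induction c) (auto simp: noise'_def algebra_simps)
  have lm[measurable]: "lincomb noise c \<in> borel_measurable M" by (rule borel_measurable_lincomb) auto
  have cm: "(\<lambda>x. cis (g x)) \<in> borel_measurable Q" if "g \<in> borel_measurable Q" for g :: "'x \<Rightarrow> real" and Q
    by (rule borel_measurable_continuous_on[OF continuous_on_cis[OF continuous_on_id] that])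
  have 1: "(\<integral>p. cis (lincomb noise' c p) \<partial>P2) = (\<integral>\<omega>. cis (lincomb noise c \<omega> - s * \<xi> \<omega>) \<partial>M) * (\<integral>x. cis (x * s) \<partial>std_normal_distribution)"
    unfolding lin cis_mult[symmetric] P2_def
    by (rule integral_pair_mult[where B=1 and B'=1]) (auto intro!: cm prob_normal prob_space_axioms)
  have 2: "(\<integral>x. cis (x * s) \<partial>std_normal_distribution) = complex_of_real (exp (- (s\<^sup>2) / 2))"
    using fun_cong[OF char_std_normal_distribution, of s] by (simp add: char_def cis_conv_exp mult_ac)
  \<comment> \<open>\<open>None\<close> stands for the window function \<open>h0\<close>, so that a
    combination that involves \<xi> is again one list over an isonormal family.\<close>
  define hk where "hk ky = (case ky of None \<Rightarrow> h0 | Some z \<Rightarrow> hfun z)" for ky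
  define d where "d = (- s / \<sigma>, None) # map (\<lambda>(r, z). (r, Some z)) c"
  define Bk where "Bk ky ky' = (LBINT p:{0..T} \<times> I. hk ky p * hk ky' p)" for ky ky'
  have d_pts: "square_int ({0..T} \<times> I) (hk ky)" if "ky \<in> snd ` set d" for ky
    using that c square_int_h0 square_int_hfun by (auto simp: d_def hk_def)
  have Wm[measurable]: "W (hfun z) \<in> borel_measurable M" if "z \<in> pts" for z
    using isonormal_measurable[OF iso square_int_hfun[OF that]] .
  have "AE \<omega> in M. \<forall>z\<in>snd ` set c. noise z \<omega> = W (hfun z) \<omega>"
    using c noise_AE by (intro AE_finite_allI) auto
  then have ae: "AE \<omega> in M. lincomb noise c \<omega> - s * \<xi> \<omega> = lincomb (\<lambda>ky. W (hk ky)) d \<omega>"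
  proof eventually_elim
    case (elim \<omega>)
    have "lincomb noise c \<omega> = lincomb (\<lambda>z. W (hfun z)) c \<omega>"
      using elim by (auto simp: lincomb_def intro!: arg_cong[of _ _ sum_list] map_cong)
    then show ?case by (simp add: d_def lincomb_map hk_def \<xi>_def)
  qed
  have dm: "lincomb (\<lambda>ky. W (hk ky)) d \<in> borel_measurable M"
    by (rule borel_measurable_lincomb) (rule isonormal_measurable[OF iso d_pts])
  have 3: "(\<integral>\<omega>. cis (lincomb noise c \<omega> - s * \<xi> \<omega>) \<partial>M) = (\<integral>\<omega>. cis (lincomb (\<lambda>ky. W (hk ky)) d \<omega>) \<partial>M)"
    by (rule integral_cong_AE) (use ae in \<open>auto intro!: cm dm\<close>)
  have 4: "(\<integral>\<omega>. cis (lincomb (\<lambda>ky. W (hk ky)) d \<omega>) \<partial>M) = complex_of_real (exp (- quad Bk d / 2))"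
    unfolding Bk_def by (rule isonormal_char[OF iso d_pts])
  have B1: "Bk None None = \<sigma>\<^sup>2"
  proof -
    have "indicator ({0..T} \<times> I) p *\<^sub>R (h0 p * h0 p) = indicator {p0..} (fst p) * (k z0 p)\<^sup>2" for p
      using h0_eq[of p] by (auto simp: power2_eq_square split: split_indicator)
    then show ?thesis by (simp add: Bk_def hk_def sigma_sq set_lebesgue_integral_def)
  qed
  have B2: "Bk None (Some z) = \<sigma> * coef z" if "z \<in> pts" for z
  proof -
    have "indicator ({0..T} \<times> I) p *\<^sub>R (h0 p * hfun z p) = k z p * (indicator {p0..} (fst p) * k z0 p)" for p
      using h0_eq[of p] kap_eq_hfun[OF that, of p] by (auto split: split_indicator)
    then show ?thesis using sigma_pos by (simp add: Bk_def hk_def coef_def set_lebesgue_integral_def)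
  qed
  have B3: "quad Bk (map (\<lambda>(r, z). (r, Some z)) c) = quad (kcov T I K) c"
    unfolding quad_map using c by (intro quad_cong) (auto simp: Bk_def hk_def intro!: hfun_inner)
  have cross: "(\<Sum>i<length (map (\<lambda>(r, z). (r, Some z)) c). fst (map (\<lambda>(r, z). (r, Some z)) c ! i) * Bk None (snd (map (\<lambda>(r, z). (r, Some z)) c ! i))) = \<sigma> * s"
  proof -
    have "(\<Sum>i<length c. fst (c ! i) * Bk None (Some (snd (c ! i)))) = (\<Sum>i<length c. fst (c ! i) * (\<sigma> * coef (snd (c ! i))))"
    proof (rule sum.cong[OF refl])
      fix i assume "i \<in> {..<length c}"
      then have "snd (c ! i) \<in> pts" using c by auto
      then show "fst (c ! i) * Bk None (Some (snd (c ! i))) = fst (c ! i) * (\<sigma> * coef (snd (c ! i)))" by (simp add: B2)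
    qed
    also have "\<dots> = \<sigma> * s" unfolding s_def lincomb_nth by (simp add: sum_distrib_left mult_ac)
    finally show ?thesis by (simp add: case_prod_beta)
  qed
  have sym: "Bk ky ky' = Bk ky' ky" for ky ky' by (simp add: Bk_def mult.commute)
  have "quad Bk d = (- s / \<sigma>)\<^sup>2 * \<sigma>\<^sup>2 + 2 * (- s / \<sigma>) * (\<sigma> * s) + quad (kcov T I K) c"
    unfolding d_def quad_Cons[OF sym] B1 B3 cross ..
  also have "\<dots> = quad (kcov T I K) c - s\<^sup>2" using sigma_pos by (simp add: power_divide power2_eq_square)
  finally have "(\<integral>p. cis (lincomb noise' c p) \<partial>P2) = complex_of_real (exp (- (quad (kcov T I K) c - s\<^sup>2) / 2) * exp (- (s\<^sup>2) / 2))"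
    unfolding 1 2 3 4 by simp
  also have "exp (- (quad (kcov T I K) c - s\<^sup>2) / 2) * exp (- (s\<^sup>2) / 2) = exp (- quad (kcov T I K) c / 2)"
    unfolding exp_add[symmetric] by (simp add: diff_divide_distrib)
  finally show ?thesis by (simp add: noise_char[OF c])
qed

text \<open>A constant sequence on the left: convergence of the characters is equality, and the
  multiplier calculus becomes a proof that two families of functionals have the same law.\<close>

sublocale LL: limit_law "\<lambda>_. M" P2 "\<lambda>_. noise" noise' pts
proof (rule limit_law.intro)
  show "(\<lambda>n. \<integral>\<omega>. cis (lincomb noise c \<omega>) \<partial>M) \<longlonglongrightarrow> (\<integral>p. cis (lincomb noise' c p) \<partial>P2)" if "snd ` set c \<subseteq> pts" for c
    unfolding char_noise'[OF that] by simp
qed (rule prob_space_axioms prob_P2 measurable_at noise'_measurable)+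

lemma forcing'_second_moment:
  assumes z: "z \<in> pts" shows "integrable P2 (\<lambda>p. (forcing' z p)\<^sup>2)"
proof -
  have q: "integrable std_normal_distribution (\<lambda>x. x\<^sup>2)"
    using std_normal_moment_even[of 1] by (auto simp: integrable_density has_bochner_integral_iff)
  have fz: "integrable M (\<lambda>\<omega>. (forcing z \<omega>)\<^sup>2)" by (rule forcing_second_moment(1)[OF z order_refl])
  have xz: "integrable M (\<lambda>\<omega>. (\<xi> \<omega>)\<^sup>2)"
    using isonormal_second_moment(1)[OF iso square_int_h0] by (simp add: \<xi>_def power_divide)
  have 1: "integrable P2 (\<lambda>p. (forcing z (fst p))\<^sup>2)" "integrable P2 (\<lambda>p. (\<xi> (fst p))\<^sup>2)"
    using integral_pair_fst(2)[OF prob_space_axioms prob_normal, of "\<lambda>\<omega>. (forcing z \<omega>)\<^sup>2"] integral_pair_fst(2)[OF prob_space_axioms prob_normal, of "\<lambda>\<omega>. (\<xi> \<omega>)\<^sup>2"] fz xz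
    by (simp_all add: P2_def)
  have 2: "integrable P2 (\<lambda>p. (snd p)\<^sup>2)"
    using integral_pair_snd(2)[OF prob_space_axioms prob_normal, of "\<lambda>x. x\<^sup>2"] q by (simp add: P2_def)
  have i: "integrable P2 (\<lambda>p. 4 * (forcing z (fst p))\<^sup>2 + 4 * ((coef z)\<^sup>2 * (snd p)\<^sup>2) + 4 * ((coef z)\<^sup>2 * (\<xi> (fst p))\<^sup>2))"
    using 1 2 by auto
  show ?thesis
  proof (rule Bochner_Integration.integrable_bound[OF i])
    show "(\<lambda>p. (forcing' z p)\<^sup>2) \<in> borel_measurable P2" unfolding forcing'_def by measurable
    have sq: "(u + (v - w) * r)\<^sup>2 \<le> 4 * u\<^sup>2 + 4 * (r\<^sup>2 * v\<^sup>2) + 4 * (r\<^sup>2 * w\<^sup>2)" for u v w r :: real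
    proof -
      have "(u + (v - w) * r)\<^sup>2 \<le> 2 * u\<^sup>2 + 2 * ((v - w) * r)\<^sup>2"
        using sum_squares_bound[of u "(v - w) * r"] by (simp add: power2_sum)
      moreover have "(v - w)\<^sup>2 \<le> 2 * v\<^sup>2 + 2 * w\<^sup>2" using sum_squares_bound[of v "- w"] by (simp add: power2_diff)
      then have "((v - w) * r)\<^sup>2 \<le> (2 * v\<^sup>2 + 2 * w\<^sup>2) * r\<^sup>2" by (simp add: power_mult_distrib mult_right_mono)
      ultimately have A: "(u + (v - w) * r)\<^sup>2 \<le> 2 * u\<^sup>2 + 2 * ((2 * v\<^sup>2 + 2 * w\<^sup>2) * r\<^sup>2)" by simp
      have B: "(2 * v\<^sup>2 + 2 * w\<^sup>2) * r\<^sup>2 = 2 * (r\<^sup>2 * v\<^sup>2) + 2 * (r\<^sup>2 * w\<^sup>2)" by (simp add: algebra_simps)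
      show ?thesis using A B zero_le_power2[of u] by linarith
    qed
    show "AE p in P2. norm ((forcing' z p)\<^sup>2) \<le> norm (4 * (forcing z (fst p))\<^sup>2 + 4 * ((coef z)\<^sup>2 * (snd p)\<^sup>2) + 4 * ((coef z)\<^sup>2 * (\<xi> (fst p))\<^sup>2))"
      unfolding forcing'_def real_norm_def abs_of_nonneg[OF zero_le_power2]
      by (intro AE_I2 order_trans[OF sq abs_ge_self])
  qed
qed

text \<open>The iterates are built from the forcing by operations that the multiplier calculus
  covers, so equality in law is inherited without writing an iterate as a measurable function of the
  noise.\<close>

lemma picard_law_eq:
  shows "distr M borel (picard k f forcing m z0) = distr P2 borel (picard k f forcing' m z0)"
proof (rule Levy_uniqueness)
  interpret P2: prob_space P2 by (rule prob_P2)
  have m1: "picard k f forcing m z0 \<in> borel_measurable M"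
    using measurable_section[OF measurable_picard[OF kap_jm f_meas measurable_forcing], of z0] by simp
  have m2: "picard k f forcing' m z0 \<in> borel_measurable P2"
    using measurable_section[OF measurable_picard[OF kap_jm f_meas measurable_forcing'], of z0] by simp
  show "real_distribution (distr M borel (picard k f forcing m z0))" by (rule real_distribution_distr) (rule m1)
  show "real_distribution (distr P2 borel (picard k f forcing' m z0))" by (rule P2.real_distribution_distr) (rule m2)
  have supp: "AE z' in lborel. k w z' \<noteq> 0 \<longrightarrow> z' \<in> pts" if w: "w \<in> pts" for w
  proof -
    have "AE z' in (lborel \<Otimes>\<^sub>M lborel :: (real \<times> real) measure). fst z' \<noteq> 0"
    proof (rule lborel_pair.AE_pair_measure)
      show "AE x in lborel. AE y in lborel. fst (x::real, y::real) \<noteq> 0" using AE_lborel_singleton[of "0::real"] by eventually_elim simp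
    qed measurable
    then have "AE z' in (lborel :: (real \<times> real) measure). fst z' \<noteq> 0" unfolding lborel_prod .
    then show ?thesis
    proof eventually_elim
      case (elim z')
      then show ?case using w by (cases z') (auto simp: kap_def pts_def split: if_splits)
    qed
  qed
  have mult: "LL.multiplier (\<lambda>n \<omega>. cis (u * forcing w \<omega>)) (\<lambda>p. cis (u * forcing' w p))" if w: "w \<in> pts" for w u
  proof -
    have "LL.multiplier (\<lambda>n \<omega>. cis (u * initial w) * cis (u * noise w \<omega>)) (\<lambda>p. cis (u * initial w) * cis (u * noise' w p))"
      by (intro LL.multiplier_mult LL.multiplier_const LL.multiplier_cis tendsto_const w)
    then show ?thesis by (simp add: forcing_eq forcing'_def noise'_def cis_mult algebra_simps)
  qed
  have M: "LL.multiplier (\<lambda>n \<omega>. cis (u * picard k f forcing m z0 \<omega>)) (\<lambda>p. cis (u * picard k f forcing' m z0 p))" for u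
    by (rule LL.multiplier_picard[where D=pts and T=T and F=F and L=L])
      (use f_bound f_lip integrable_kap integral_kap_le T_pos kap_jm supp measurable_forcing measurable_forcing' mult z0
        forcing_second_moment[OF _ order_refl] forcing'_second_moment in \<open>auto intro!: exI\<close>)
  show "char (distr M borel (picard k f forcing m z0)) = char (distr P2 borel (picard k f forcing' m z0))"
  proof
    fix u
    have "(\<integral>\<omega>. cis (u * picard k f forcing m z0 \<omega>) \<partial>M) = (\<integral>p. cis (u * picard k f forcing' m z0 p) \<partial>P2)"
      using LIMSEQ_unique[OF tendsto_const LL.multiplier_tendsto[OF M[of u]]] .
    then show "char (distr M borel (picard k f forcing m z0)) u = char (distr P2 borel (picard k f forcing' m z0)) u"
      unfolding char_def using m1 m2 by (subst (1 2) integral_distr) (simp_all add: cis_conv_exp)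
  qed
qed

text \<open>Before time \<open>p0\<close> the coordinate has no effect. Afterwards every iterate
  responds by at most \<open>2 * cmax\<close> per unit, by induction with
  \<open>L * \<tau> \<le> 1 / 2\<close>. At \<open>z0\<close> the direct response is \<sigma>, and
  the drift can take away at most half of it.\<close>

lemma picard_slope:
  assumes \<omega>: "\<omega> \<in> space M" and xy: "x \<le> y"
  shows "fst z \<le> fst z0 \<Longrightarrow> \<bar>picard k f forcing' m z (\<omega>, y) - picard k f forcing' m z (\<omega>, x)\<bar> \<le> 2 * cmax * (y - x)"
    and "picard k f forcing' m z0 (\<omega>, y) - picard k f forcing' m z0 (\<omega>, x) \<ge> \<sigma> / 2 * (y - x)"
proof -
  let ?P = "\<lambda>m z x. picard k f forcing' m z (\<omega>, x)"
  have cmax0: "cmax \<ge> 0" using coef_nonneg[of z0] coef_le[of z0] by simp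
  have Pm: "(\<lambda>z'. ?P m z' x) \<in> borel_measurable lborel" for m x
  proof -
    have 1: "(\<lambda>p. picard k f forcing' m (fst p) (snd p)) \<in> borel_measurable (lborel \<Otimes>\<^sub>M P2)"
      by (rule measurable_picard[OF kap_jm f_meas measurable_forcing'])
    have 2: "(\<omega>, x) \<in> space P2" using \<omega> by (simp add: P2_def space_pair_measure)
    show ?thesis using measurable_compose[OF measurable_Pair2'[OF 2] 1] by simp
  qed
  have forc: "forcing' z (\<omega>, y) - forcing' z (\<omega>, x) = (y - x) * coef z" for z
    by (simp add: forcing'_def algebra_simps)
  have int: "integrable lborel (\<lambda>z'. k z z' * f (?P m z' x))" for m z x
  proof -
    note [measurable] = Pm[of m x]
    have "norm (k z z' * f q) \<le> norm (F * k z z')" for z' q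
      using mult_right_mono[OF f_bound[of q] kap_nonneg[of z z']] kap_nonneg[of z z'] F_nonneg by (simp add: abs_mult mult.commute)
    then show ?thesis
      by (intro Bochner_Integration.integrable_bound[OF integrable_mult_right[OF integrable_kap[of z], of F]]) auto
  qed
  \<comment> \<open>Records that nothing changes before \<open>p0\<close>: the response of the drift
    is integrated over a time \<tau> and not over the whole past.\<close>
  define w where "w s = (if p0 \<le> s then (1::real) else 0)" for s
  have wm[measurable]: "w \<in> borel_measurable borel" unfolding w_def by measurable
  have w0: "w s \<ge> 0" for s by (simp add: w_def)
  have wi: "set_integrable lborel {0..<t} w" for t
    unfolding set_integrable_def
    by (rule Bochner_Integration.integrable_bound[OF integrable_indicator_Ico[of 0 t]]) (auto simp: w_def split: split_indicator)
  have wint: "(\<integral>z'. k z z' * w (fst z') \<partial>lborel) \<le> \<tau>" if "fst z \<le> fst z0" for z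
  proof (cases "fst z \<le> T \<and> snd z \<in> I")
    case True
    have "(LBINT s:{0..<fst z}. w s) \<le> (LBINT s:{p0..<fst z0}. (1::real))"
      unfolding set_lebesgue_integral_def
      by (rule integral_mono') (use that integrable_indicator_Ico in \<open>auto simp: w_def split: split_indicator\<close>)
    also have "\<dots> = \<tau>" using z0_simps by (simp add: set_lebesgue_integral_def)
    finally show ?thesis using integral_kap_weight(2)[of z w] True w0 wi by simp
  qed (use \<tau> in \<open>simp add: kap_outside\<close>)
  have wint': "integrable lborel (\<lambda>z'. k z z' * w (fst z'))" for z
    by (rule Bochner_Integration.integrable_bound[OF integrable_kap[of z]]) (auto simp: w_def kap_nonneg)
  have dr: "\<bar>(\<integral>z'. k z z' * f (?P m z' y) \<partial>lborel) - (\<integral>z'. k z z' * f (?P m z' x) \<partial>lborel)\<bar> \<le> L * (2 * cmax) * \<tau> * (y - x)"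
    if z: "fst z \<le> fst z0" and IH: "\<And>z'. fst z' \<le> fst z0 \<Longrightarrow> \<bar>?P m z' y - ?P m z' x\<bar> \<le> 2 * cmax * (y - x) * w (fst z')" for m z
  proof -
    have eq: "(\<integral>z'. k z z' * f (?P m z' y) \<partial>lborel) - (\<integral>z'. k z z' * f (?P m z' x) \<partial>lborel) = (\<integral>z'. k z z' * f (?P m z' y) - k z z' * f (?P m z' x) \<partial>lborel)"
      using int by simp
    have "norm (\<integral>z'. k z z' * f (?P m z' y) - k z z' * f (?P m z' x) \<partial>lborel) \<le> (\<integral>z'. L * (2 * cmax * (y - x)) * (k z z' * w (fst z')) \<partial>lborel)"
    proof (rule integral_norm_bound_le)
      show "integrable lborel (\<lambda>z'. k z z' * f (?P m z' y) - k z z' * f (?P m z' x))" using int by simp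
      show "integrable lborel (\<lambda>z'. L * (2 * cmax * (y - x)) * (k z z' * w (fst z')))" using wint' by simp
      fix z' :: "real \<times> real"
      show "norm (k z z' * f (?P m z' y) - k z z' * f (?P m z' x)) \<le> L * (2 * cmax * (y - x)) * (k z z' * w (fst z'))"
      proof (cases "fst z' \<le> fst z0")
        case True
        have "\<bar>f (?P m z' y) - f (?P m z' x)\<bar> \<le> L * (2 * cmax * (y - x) * w (fst z'))"
          using f_lip[of "?P m z' y" "?P m z' x"] mult_left_mono[OF IH[OF True] L_nonneg] by linarith
        then have "k z z' * \<bar>f (?P m z' y) - f (?P m z' x)\<bar> \<le> k z z' * (L * (2 * cmax * (y - x) * w (fst z')))" by (intro mult_left_mono kap_nonneg)
        then show ?thesis unfolding right_diff_distrib[symmetric] real_norm_def abs_mult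
          using kap_nonneg[of z z'] by (simp add: mult_ac)
      next
        case False
        then have "k z z' = 0" using z by (auto simp: kap_def)
        then show ?thesis by simp
      qed
    qed
    also have "\<dots> = L * (2 * cmax * (y - x)) * (\<integral>z'. k z z' * w (fst z') \<partial>lborel)" by simp
    also have "\<dots> \<le> L * (2 * cmax * (y - x)) * \<tau>" using wint[OF z] L_nonneg cmax0 xy by (intro mult_left_mono) auto
    finally show ?thesis unfolding eq by (simp add: mult_ac)
  qed
  have bound: "\<bar>?P m z y - ?P m z x\<bar> \<le> 2 * cmax * (y - x) * w (fst z)" if "fst z \<le> fst z0" for m z
    using that
  proof (induction m arbitrary: z)
    case 0
    have "(y - x) * coef z \<le> (y - x) * (cmax * w (fst z))"
      using coef_le[OF 0] coef_eq_0[of z] xy by (intro mult_left_mono) (auto simp: w_def)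
    also have "\<dots> \<le> 2 * cmax * (y - x) * w (fst z)" using cmax0 xy w0[of "fst z"] by (simp add: mult_ac)
    finally show ?case using forc[of z] coef_nonneg[of z] xy by (simp add: abs_mult)
  next
    case (Suc m)
    show ?case
    proof (cases "p0 \<le> fst z")
      case True
      have eq: "?P (Suc m) z y - ?P (Suc m) z x = (y - x) * coef z +
          ((\<integral>z'. k z z' * f (?P m z' y) \<partial>lborel) - (\<integral>z'. k z z' * f (?P m z' x) \<partial>lborel))"
        using forc[of z] by simp
      have "\<bar>?P (Suc m) z y - ?P (Suc m) z x\<bar> \<le> (y - x) * cmax + L * (2 * cmax) * \<tau> * (y - x)"
        unfolding eq
      proof (rule order_trans[OF abs_triangle_ineq add_mono[OF _ dr[OF Suc.prems Suc.IH]]])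
        show "\<bar>(y - x) * coef z\<bar> \<le> (y - x) * cmax"
          using coef_le[OF Suc.prems] coef_nonneg[of z] xy by (simp add: abs_mult mult_left_mono)
      qed
      also have "\<dots> = (y - x) * cmax * (1 + 2 * (L * \<tau>))" by (simp add: algebra_simps)
      \<comment> \<open>The bound \<open>2 * cmax\<close> reproduces itself because
        \<open>1 + 2 * (L * \<tau>) \<le> 2\<close>.\<close>
      also have "\<dots> \<le> (y - x) * cmax * 2" using \<tau> xy cmax0 by (intro mult_left_mono) auto
      finally show ?thesis using True by (simp add: w_def mult_ac)
    next
      case False
      have keq: "k z z' * f (?P m z' y) = k z z' * f (?P m z' x)" for z'
      proof (cases "p0 \<le> fst z'")
        case True
        then show ?thesis using False by (simp add: kap_def)
      next
        case False2: False
        show ?thesis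
        proof (cases "fst z' \<le> fst z0")
          case True
          have "\<bar>?P m z' y - ?P m z' x\<bar> \<le> 0" using Suc.IH[OF True] False2 by (simp add: w_def)
          then show ?thesis by simp
        next
          case False
          then show ?thesis using Suc.prems by (simp add: kap_def)
        qed
      qed
      have "?P (Suc m) z y - ?P (Suc m) z x = (y - x) * coef z" unfolding picard.simps keq using forc[of z] by simp
      then show ?thesis using coef_eq_0[of z] False by (simp add: w_def)
    qed
  qed
  show "\<bar>?P m z y - ?P m z x\<bar> \<le> 2 * cmax * (y - x)" if "fst z \<le> fst z0"
    using bound[OF that, of m] cmax0 xy by (auto simp: w_def split: if_splits intro: order_trans[OF _ mult_nonneg_nonneg])
  show "?P m z0 y - ?P m z0 x \<ge> \<sigma> / 2 * (y - x)"
  proof (cases m)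
    case 0
    have "\<sigma> / 2 * (y - x) \<le> \<sigma> * (y - x)" using sigma_pos xy by (intro mult_right_mono) auto
    then show ?thesis using forc[of z0] coef_z0 0 by (simp add: mult.commute)
  next
    case (Suc n)
    have "?P m z0 y - ?P m z0 x = (y - x) * \<sigma> +
          ((\<integral>z'. k z0 z' * f (?P n z' y) \<partial>lborel) - (\<integral>z'. k z0 z' * f (?P n z' x) \<partial>lborel))"
      using forc[of z0] coef_z0 Suc by simp
    moreover have "\<bar>(\<integral>z'. k z0 z' * f (?P n z' y) \<partial>lborel) - (\<integral>z'. k z0 z' * f (?P n z' x) \<partial>lborel)\<bar> \<le> L * (2 * cmax) * \<tau> * (y - x)"
      by (rule dr[OF order_refl bound])
    moreover have "L * (2 * cmax) * \<tau> * (y - x) \<le> \<sigma> / 2 * (y - x)" using slope xy by (intro mult_right_mono) auto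
    moreover have "(y - x) * \<sigma> = \<sigma> / 2 * (y - x) + \<sigma> / 2 * (y - x)" by (simp add: field_simps)
    ultimately show ?thesis by linarith
  qed
qed

text \<open>For a fixed outcome in \<open>M\<close>, the values of the independent coordinate that
  put the iterate between \<open>u\<close> and \<open>v\<close> have diameter at most
  \<open>2 * (v - u) / \<sigma>\<close>, by the lower bound on the slope. The coordinate is standard
  normal, so each section has probability at most \<open>(v - u) / \<sigma>\<close>, and Fubini
  concludes.\<close>

lemma picard_prob_le:
  assumes uv: "u \<le> v"
  shows "measure M {\<omega> \<in> space M. u \<le> picard k f forcing m z0 \<omega> \<and> picard k f forcing m z0 \<omega> \<le> v} \<le> (v - u) / \<sigma>"
proof -
  interpret Q: prob_space std_normal_distribution by (rule prob_normal)
  interpret PQ: pair_prob_space M std_normal_distribution ..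
  let ?P = "picard k f forcing' m z0"
  have m1: "picard k f forcing m z0 \<in> borel_measurable M"
    using measurable_section[OF measurable_picard[OF kap_jm f_meas measurable_forcing], of z0] by simp
  have m2[measurable]: "?P \<in> borel_measurable P2"
    using measurable_section[OF measurable_picard[OF kap_jm f_meas measurable_forcing'], of z0] by simp
  have "emeasure M {\<omega> \<in> space M. u \<le> picard k f forcing m z0 \<omega> \<and> picard k f forcing m z0 \<omega> \<le> v} = emeasure (distr M borel (picard k f forcing m z0)) {u..v}"
    using m1 by (subst emeasure_distr) (auto simp: vimage_def Int_def conj_commute)
  also have "\<dots> = emeasure (distr P2 borel ?P) {u..v}" by (simp add: picard_law_eq)
  also have "\<dots> = emeasure P2 {p \<in> space P2. u \<le> ?P p \<and> ?P p \<le> v}"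
    by (subst emeasure_distr) (auto simp: vimage_def Int_def conj_commute)
  also have "\<dots> = (\<integral>\<^sup>+\<omega>. emeasure std_normal_distribution (Pair \<omega> -` {p \<in> space P2. u \<le> ?P p \<and> ?P p \<le> v}) \<partial>M)"
    unfolding P2_def by (rule Q.emeasure_pair_measure_alt) (unfold P2_def[symmetric], measurable)
  also have "\<dots> \<le> (\<integral>\<^sup>+\<omega>. ennreal ((v - u) / \<sigma>) \<partial>M)"
  proof (rule nn_integral_mono)
    fix \<omega> assume \<omega>: "\<omega> \<in> space M"
    let ?A = "Pair \<omega> -` {p \<in> space P2. u \<le> ?P p \<and> ?P p \<le> v}"
    have A: "?A = {x. u \<le> ?P (\<omega>, x) \<and> ?P (\<omega>, x) \<le> v}" using \<omega> by (auto simp: P2_def space_pair_measure)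
    have mA: "?A \<in> sets borel"
    proof -
      have "?A \<in> sets std_normal_distribution"
        by (rule sets_Pair1[of _ M]) (unfold P2_def[symmetric], measurable)
      then show ?thesis by simp
    qed
    have "measure std_normal_distribution ?A \<le> (v - u) / \<sigma>"
    proof (cases "?A = {}")
      case True
      show ?thesis unfolding True using uv sigma_pos by simp
    next
      case False
      have diam: "y - x \<le> 2 * (v - u) / \<sigma>" if "x \<in> ?A" "y \<in> ?A" for x y
      proof (cases "x \<le> y")
        case True
        have "\<sigma> / 2 * (y - x) \<le> v - u" using picard_slope(2)[OF \<omega> True, of m] that unfolding A by auto
        then show ?thesis using sigma_pos by (simp add: field_simps)
      next
        case False
        moreover have "0 \<le> 2 * (v - u) / \<sigma>" using uv sigma_pos by simp
        ultimately show ?thesis by simp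
      qed
      obtain x0 where x0: "x0 \<in> ?A" using False by blast
      have bb: "bdd_below ?A" by (rule bdd_belowI[of _ "x0 - 2 * (v - u) / \<sigma>"]) (use diam[OF _ x0] in \<open>auto simp: algebra_simps\<close>)
      have sub: "?A \<subseteq> {Inf ?A..Inf ?A + 2 * (v - u) / \<sigma>}"
      proof
        fix y assume y: "y \<in> ?A"
        have "Inf ?A \<le> y" by (rule cInf_lower[OF y bb])
        moreover have "y - 2 * (v - u) / \<sigma> \<le> Inf ?A"
          by (rule cInf_greatest[OF False]) (use diam[OF _ y] in \<open>auto simp: algebra_simps\<close>)
        ultimately show "y \<in> {Inf ?A..Inf ?A + 2 * (v - u) / \<sigma>}" by simp
      qed
      have "measure std_normal_distribution ?A \<le> (Inf ?A + 2 * (v - u) / \<sigma> - Inf ?A) / 2"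
        by (rule std_normal_set_le[OF mA sub]) (use uv sigma_pos in simp)
      also have "\<dots> = (v - u) / \<sigma>"
      proof -
        have "(i + 2 * d / s - i) / 2 = d / s" for i d s :: real by (simp only: add_diff_cancel_left') simp
        then show ?thesis .
      qed
      finally show ?thesis .
    qed
    then show "emeasure std_normal_distribution ?A \<le> ennreal ((v - u) / \<sigma>)" by (simp add: Q.emeasure_eq_measure ennreal_leI)
  qed
  also have "\<dots> = ennreal ((v - u) / \<sigma>)" by (simp add: emeasure_space_1)
  finally show ?thesis using uv sigma_pos by (simp add: emeasure_eq_measure)
qed

text \<open>Equality in law was shown for the iterates. The uniform error \<open>E m\<close> between
  iterate and solution widens the interval on both sides and disappears in the limit.\<close>

lemma sol_prob_le:
  assumes uv: "u \<le> v"
  shows "measure M {\<omega> \<in> space M. u \<le> sol_at z0 \<omega> \<and> sol_at z0 \<omega> \<le> v} \<le> 1 / \<sigma> * (v - u)"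
proof -
  define E where "E m = T * F * (1 / 2) ^ m * exp (2 * (L + 1) * max 0 (fst z0))" for m
  have E0: "E \<longlonglongrightarrow> 0"
    unfolding E_def[abs_def] by (intro tendsto_mult_left_zero tendsto_mult_right_zero LIMSEQ_power_zero) auto
  have Enn: "E m \<ge> 0" for m using T_pos F_nonneg by (simp add: E_def)
  have m1[measurable]: "picard k f forcing m z0 \<in> borel_measurable M" for m
    using measurable_section[OF measurable_picard[OF kap_jm f_meas measurable_forcing], of z0] by simp
  have le: "measure M {\<omega> \<in> space M. u \<le> sol_at z0 \<omega> \<and> sol_at z0 \<omega> \<le> v} \<le> (v + E m - (u - E m)) / \<sigma>" for m
  proof -
    have "measure M {\<omega> \<in> space M. u \<le> sol_at z0 \<omega> \<and> sol_at z0 \<omega> \<le> v} \<le>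
      measure M {\<omega> \<in> space M. u - E m \<le> picard k f forcing m z0 \<omega> \<and> picard k f forcing m z0 \<omega> \<le> v + E m}"
    proof (rule finite_measure_mono)
      have "\<bar>sol_at z0 \<omega> - picard k f forcing m z0 \<omega>\<bar> \<le> E m" if "\<omega> \<in> space M" for \<omega>
        using picard_error[OF that, of z0 m] by (simp add: E_def)
      then show "{\<omega> \<in> space M. u \<le> sol_at z0 \<omega> \<and> sol_at z0 \<omega> \<le> v} \<subseteq>
        {\<omega> \<in> space M. u - E m \<le> picard k f forcing m z0 \<omega> \<and> picard k f forcing m z0 \<omega> \<le> v + E m}"
        by (fastforce simp: abs_le_iff)
    qed measurable
    also have "\<dots> \<le> (v + E m - (u - E m)) / \<sigma>" by (rule picard_prob_le) (use uv Enn[of m] in linarith)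
    finally show ?thesis .
  qed
  have "(\<lambda>m. (v + E m - (u - E m)) / \<sigma>) \<longlonglongrightarrow> (v + 0 - (u - 0)) / \<sigma>"
    by (intro tendsto_intros E0) (use sigma_pos in simp)
  then have "measure M {\<omega> \<in> space M. u \<le> sol_at z0 \<omega> \<and> sol_at z0 \<omega> \<le> v} \<le> (v + 0 - (u - 0)) / \<sigma>"
    by (rule LIMSEQ_le_const) (use le in auto)
  then show ?thesis by simp
qed

end

section \<open>Lipschitz test functions and a weak law of large numbers\<close>

text \<open>The data are given for \<open>lam \<ge> 1\<close>, while an arbitrary sequence tending
  to infinity may start below; \<open>max 1\<close> repairs these terms without affecting the
  limit.\<close>

lemma tendsto_at_top_via_sequences:
  fixes \<Phi> :: "real \<Rightarrow> real"
  assumes "\<And>l :: nat \<Rightarrow> real. (\<And>n. l n \<ge> 1) \<Longrightarrow> filterlim l at_top sequentially \<Longrightarrow> (\<lambda>n. \<Phi> (l n)) \<longlonglongrightarrow> c"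
  shows "(\<Phi> \<longlongrightarrow> c) at_top"
proof (rule tendsto_at_topI_sequentially)
  fix l :: "nat \<Rightarrow> real" assume l: "filterlim l at_top sequentially"
  have "filterlim (\<lambda>n. max 1 (l n)) at_top sequentially"
    by (rule filterlim_at_top_mono[OF l]) auto
  then have "(\<lambda>n. \<Phi> (max 1 (l n))) \<longlonglongrightarrow> c" by (intro assms) auto
  moreover have "\<forall>\<^sub>F n in sequentially. \<Phi> (max 1 (l n)) = \<Phi> (l n)"
  proof -
    have "\<forall>\<^sub>F n in sequentially. l n \<ge> 1" using l by (simp add: filterlim_at_top)
    then show ?thesis by eventually_elim (simp add: max_def)
  qed
  ultimately show "(\<lambda>n. \<Phi> (l n)) \<longlonglongrightarrow> c" by (rule Lim_transform_eventually)
qed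

text \<open>A trapezoid between the indicators of \<open>{u..v}\<close> and of its neighbourhood of
  width \<delta>, used to carry interval probabilities through a weak limit.\<close>

definition bump :: "real \<Rightarrow> real \<Rightarrow> real \<Rightarrow> real \<Rightarrow> real" where
  "bump u v \<delta> x = max 0 (1 - max 0 (max (u - x) (x - v)) / \<delta>)"

lemma bump_props:
  assumes "\<delta> > 0" "u \<le> v"
  shows "0 \<le> bump u v \<delta> x" "bump u v \<delta> x \<le> 1" "u \<le> x \<and> x \<le> v \<Longrightarrow> bump u v \<delta> x = 1"
    "bump u v \<delta> x \<noteq> 0 \<Longrightarrow> u - \<delta> \<le> x \<and> x \<le> v + \<delta>" "continuous_on UNIV (bump u v \<delta>)"
proof -
  have "0 \<le> max 0 (max (u - x) (x - v)) / \<delta>" using assms by simp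
  then show "0 \<le> bump u v \<delta> x" "bump u v \<delta> x \<le> 1" by (auto simp: bump_def)
  show "u \<le> x \<and> x \<le> v \<Longrightarrow> bump u v \<delta> x = 1" by (simp add: bump_def)
  show "u - \<delta> \<le> x \<and> x \<le> v + \<delta>" if "bump u v \<delta> x \<noteq> 0"
  proof -
    have "max 0 (max (u - x) (x - v)) / \<delta> < 1"
    proof (rule ccontr)
      assume "\<not> ?thesis"
      then have "1 - max 0 (max (u - x) (x - v)) / \<delta> \<le> 0" by linarith
      then show False using that unfolding bump_def by (simp only: max.absorb1)
    qed
    then have "max 0 (max (u - x) (x - v)) < \<delta>" using assms by (simp add: divide_less_eq)
    then show ?thesis by simp
  qed
  show "continuous_on UNIV (bump u v \<delta>)" unfolding bump_def using assms by (intro continuous_intros) auto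
qed

section \<open>Approximation of integrable functions by bounded Lipschitz functions\<close>

lemma infdist_lipschitz: "\<bar>infdist x A - infdist y A\<bar> \<le> dist x y"
  using infdist_triangle[of x A y] infdist_triangle[of y A x] by (simp add: dist_commute abs_le_iff)

definition lip_bdd :: "(real \<Rightarrow> real) \<Rightarrow> bool" where
  "lip_bdd \<phi> \<longleftrightarrow> (\<exists>G. \<forall>x. \<bar>\<phi> x\<bar> \<le> G) \<and> (\<exists>H. \<forall>x y. \<bar>\<phi> x - \<phi> y\<bar> \<le> H * \<bar>x - y\<bar>)"

lemma lip_bdd_add: assumes "lip_bdd \<phi>" "lip_bdd \<psi>" shows "lip_bdd (\<lambda>x. \<phi> x + \<psi> x)"
proof -
  obtain G H G' H' where "\<forall>x. \<bar>\<phi> x\<bar> \<le> G" "\<forall>x y. \<bar>\<phi> x - \<phi> y\<bar> \<le> H * \<bar>x - y\<bar>"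
    "\<forall>x. \<bar>\<psi> x\<bar> \<le> G'" "\<forall>x y. \<bar>\<psi> x - \<psi> y\<bar> \<le> H' * \<bar>x - y\<bar>"
    using assms unfolding lip_bdd_def by blast
  note b = this
  have "\<bar>\<phi> x + \<psi> x\<bar> \<le> G + G'" for x using b(1,3)[rule_format, of x] by linarith
  moreover have "\<bar>(\<phi> x + \<psi> x) - (\<phi> y + \<psi> y)\<bar> \<le> (H + H') * \<bar>x - y\<bar>" for x y
    using b(2)[rule_format, of x y] b(4)[rule_format, of x y] unfolding distrib_right by linarith
  ultimately show ?thesis unfolding lip_bdd_def by blast
qed

lemma lip_bdd_scale: assumes "lip_bdd \<phi>" shows "lip_bdd (\<lambda>x. \<phi> x * c)"
proof -
  obtain G H where b: "\<forall>x. \<bar>\<phi> x\<bar> \<le> G" "\<forall>x y. \<bar>\<phi> x - \<phi> y\<bar> \<le> H * \<bar>x - y\<bar>"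
    using assms unfolding lip_bdd_def by blast
  have "\<bar>\<phi> x * c\<bar> \<le> G * \<bar>c\<bar>" for x unfolding abs_mult by (rule mult_right_mono) (use b(1) in auto)
  moreover have "\<bar>\<phi> x * c - \<phi> y * c\<bar> \<le> (H * \<bar>c\<bar>) * \<bar>x - y\<bar>" for x y
  proof -
    have eq: "\<phi> x * c - \<phi> y * c = (\<phi> x - \<phi> y) * c" by (rule left_diff_distrib[symmetric])
    have "\<bar>\<phi> x - \<phi> y\<bar> * \<bar>c\<bar> \<le> (H * \<bar>x - y\<bar>) * \<bar>c\<bar>" by (rule mult_right_mono) (use b(2) in auto)
    then show ?thesis unfolding eq abs_mult by (simp add: mult_ac)
  qed
  ultimately show ?thesis unfolding lip_bdd_def by blast
qed

lemma lip_bdd_measurable: "lip_bdd \<phi> \<Longrightarrow> \<phi> \<in> borel_measurable borel"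
  unfolding lip_bdd_def using bounded_lipschitz_measurable(2) by blast

text \<open>Outer regularity gives an open set \<open>U\<close> of almost the same measure, and the
  truncated multiples of the distance to its complement increase to the indicator of
  \<open>U\<close>. The complement is nonempty because \<open>U\<close> has finite measure; for an
  empty set \<open>infdist\<close> would be 0.\<close>

lemma indicator_L1_lipschitz:
  fixes A :: "real set"
  assumes A: "A \<in> sets lborel" "emeasure lborel A < \<infinity>" and e: "e > 0"
  shows "\<exists>\<phi>. lip_bdd \<phi> \<and> integrable lborel \<phi> \<and> (\<integral>x. \<bar>indicator A x - \<phi> x\<bar> \<partial>lborel) \<le> e"
proof -
  obtain U where U: "open U" "A \<subseteq> U" "emeasure lborel (U - A) < ennreal (e / 2)"
    using outer_regular_lborel[of A "e / 2"] A e by auto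
  have [measurable]: "U \<in> sets borel" "A \<in> sets borel" using U A by auto
  have "emeasure lborel U = emeasure lborel (A \<union> (U - A))" using U by (simp add: Un_absorb1)
  also have "\<dots> \<le> emeasure lborel A + emeasure lborel (U - A)" by (rule emeasure_subadditive) auto
  also have "\<dots> < \<infinity>" using A U(3) by (auto simp: less_top[symmetric] dest: less_trans)
  finally have Uf: "emeasure lborel U < \<infinity>" .
  have iU: "integrable lborel (indicator U :: real \<Rightarrow> real)" and iA: "integrable lborel (indicator A :: real \<Rightarrow> real)"
    using Uf A by (auto intro!: integrable_real_indicator)
  have Uc: "- U \<noteq> {}"
  proof
    assume "- U = {}"
    then have "U = UNIV" by auto
    then show False using Uf by simp
  qed
  define \<phi> where "\<phi> k x = min 1 (real k * infdist x (- U))" for k :: nat and x :: real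
  have \<phi>01: "0 \<le> \<phi> k x" "\<phi> k x \<le> 1" for k x by (auto simp: \<phi>_def infdist_nonneg)
  have \<phi>U: "\<phi> k x = 0" if "x \<notin> U" for k x using that by (simp add: \<phi>_def)
  have lip: "\<bar>\<phi> k x - \<phi> k y\<bar> \<le> real k * \<bar>x - y\<bar>" for k x y
  proof -
    have "\<bar>\<phi> k x - \<phi> k y\<bar> \<le> \<bar>real k * infdist x (- U) - real k * infdist y (- U)\<bar>" by (auto simp: \<phi>_def min_def abs_if)
    also have "\<dots> = real k * \<bar>infdist x (- U) - infdist y (- U)\<bar>" by (simp add: right_diff_distrib[symmetric] abs_mult)
    also have "\<dots> \<le> real k * dist x y" by (intro mult_left_mono infdist_lipschitz) auto
    finally show ?thesis by (simp add: dist_real_def)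
  qed
  have lb: "lip_bdd (\<phi> k)" for k
    unfolding lip_bdd_def
  proof (intro conjI)
    show "\<exists>G. \<forall>x. \<bar>\<phi> k x\<bar> \<le> G" using \<phi>01[of k] by (intro exI[of _ 1]) (simp add: abs_of_nonneg)
    show "\<exists>H. \<forall>x y. \<bar>\<phi> k x - \<phi> k y\<bar> \<le> H * \<bar>x - y\<bar>" using lip[of k] by (intro exI[of _ "real k"]) blast
  qed
  have [measurable]: "\<phi> k \<in> borel_measurable borel" for k by (rule lip_bdd_measurable[OF lb])
  have i\<phi>: "integrable lborel (\<phi> k)" for k
  proof (rule Bochner_Integration.integrable_bound[OF iU])
    have "norm (\<phi> k x) \<le> norm (indicator U x :: real)" for x using \<phi>01[of k x] \<phi>U[of x k] by (auto split: split_indicator)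
    then show "AE x in lborel. norm (\<phi> k x) \<le> norm (indicator U x :: real)" by simp
  qed measurable
  have "(\<lambda>k. \<integral>x. \<bar>indicator U x - \<phi> k x\<bar> \<partial>lborel) \<longlonglongrightarrow> (\<integral>x. (0::real) \<partial>(lborel :: real measure))"
  proof (rule integral_dominated_convergence[where w="indicator U"])
    show "AE x in lborel. (\<lambda>k. \<bar>indicator U x - \<phi> k x\<bar>) \<longlonglongrightarrow> 0"
    proof (rule AE_I2)
      fix x :: real
      show "(\<lambda>k. \<bar>indicator U x - \<phi> k x\<bar>) \<longlonglongrightarrow> 0"
      proof (cases "x \<in> U")
        case True
        have d: "infdist x (- U) > 0"
          using True U(1) Uc in_closed_iff_infdist_zero[of "- U" x] infdist_nonneg[of x "- U"] by (auto simp: closed_Compl less_le)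
        obtain k0 :: nat where k0: "real k0 * infdist x (- U) > 1" using reals_Archimedean3[OF d] by blast
        have "\<bar>indicator U x - \<phi> k x\<bar> = 0" if "k \<ge> k0" for k
        proof -
          have "real k0 * infdist x (- U) \<le> real k * infdist x (- U)" using that d by (intro mult_right_mono) auto
          then show ?thesis using k0 True by (simp add: \<phi>_def)
        qed
        then show ?thesis by (intro tendsto_eventually) (auto simp: eventually_sequentially)
      qed (simp add: \<phi>U)
    qed
    have "norm \<bar>indicator U x - \<phi> k x\<bar> \<le> indicator U x" for k x using \<phi>01[of k x] \<phi>U[of x k] by (auto split: split_indicator)
    then show "AE x in lborel. norm \<bar>indicator U x - \<phi> k x\<bar> \<le> indicator U x" for k by simp
  qed (use iU in auto)
  then have "(\<lambda>k. \<integral>x. \<bar>indicator U x - \<phi> k x\<bar> \<partial>lborel) \<longlonglongrightarrow> 0" by simp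
  from order_tendstoD(2)[OF this half_gt_zero[OF e]]
  have "\<exists>k. (\<integral>x. \<bar>indicator U x - \<phi> k x\<bar> \<partial>lborel) < e / 2" by (rule eventually_happens'[OF sequentially_bot])
  then obtain k where k: "(\<integral>x. \<bar>indicator U x - \<phi> k x\<bar> \<partial>lborel) < e / 2" ..
  have AU: "(\<integral>x. \<bar>indicator A x - indicator U x :: real\<bar> \<partial>lborel) \<le> e / 2"
  proof -
    have "(\<integral>x. \<bar>indicator A x - indicator U x :: real\<bar> \<partial>lborel) = (\<integral>x. indicator (U - A) x \<partial>lborel)"
      using U(2) by (intro Bochner_Integration.integral_cong) (auto split: split_indicator)
    also have "\<dots> = measure lborel (U - A)" by simp
    also have "\<dots> \<le> e / 2" unfolding measure_def using U(3) e by (intro enn2real_leI) auto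
    finally show ?thesis .
  qed
  have "(\<integral>x. \<bar>indicator A x - \<phi> k x\<bar> \<partial>lborel) \<le> (\<integral>x. \<bar>indicator A x - indicator U x\<bar> + \<bar>indicator U x - \<phi> k x\<bar> \<partial>lborel)"
    using iA iU i\<phi>[of k] by (intro integral_mono Bochner_Integration.integrable_add integrable_abs Bochner_Integration.integrable_diff) auto
  also have "\<dots> = (\<integral>x. \<bar>indicator A x - indicator U x\<bar> \<partial>lborel) + (\<integral>x. \<bar>indicator U x - \<phi> k x\<bar> \<partial>lborel)"
    using iA iU i\<phi>[of k] by (intro Bochner_Integration.integral_add integrable_abs Bochner_Integration.integrable_diff) auto
  also have "\<dots> \<le> e" using AU k by simp
  finally show ?thesis using lb i\<phi> by blast
qed

text \<open>Bounded Lipschitz functions are those that the multiplier calculus admits. Induction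
  over integrable functions carries the approximation from indicators to sums and dominated
  limits.\<close>

lemma integrable_L1_lipschitz:
  fixes g :: "real \<Rightarrow> real"
  assumes "integrable lborel g"
  shows "\<forall>e>0. \<exists>\<phi>. lip_bdd \<phi> \<and> integrable lborel \<phi> \<and> (\<integral>x. \<bar>g x - \<phi> x\<bar> \<partial>lborel) \<le> e"
  using assms
proof (induction rule: integrable_induct)
  case (base A c)
  show ?case
  proof (intro allI impI)
    fix e :: real assume e: "e > 0"
    obtain \<phi> where \<phi>: "lip_bdd \<phi>" "integrable lborel \<phi>" "(\<integral>x. \<bar>indicator A x - \<phi> x\<bar> \<partial>lborel) \<le> e / (\<bar>c\<bar> + 1)"
      using indicator_L1_lipschitz[OF base, of "e / (\<bar>c\<bar> + 1)"] e by auto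
    have "(\<integral>x. \<bar>indicator A x *\<^sub>R c - \<phi> x * c\<bar> \<partial>lborel) = (\<integral>x. \<bar>indicator A x - \<phi> x\<bar> * \<bar>c\<bar> \<partial>lborel)"
      by (simp add: left_diff_distrib[symmetric] abs_mult)
    also have "\<dots> = (\<integral>x. \<bar>indicator A x - \<phi> x\<bar> \<partial>lborel) * \<bar>c\<bar>" by simp
    also have "\<dots> \<le> e / (\<bar>c\<bar> + 1) * \<bar>c\<bar>" using \<phi>(3) by (rule mult_right_mono) simp
    also have "\<dots> \<le> e" using e by (simp add: field_simps)
    finally show "\<exists>\<phi>. lip_bdd \<phi> \<and> integrable lborel \<phi> \<and> (\<integral>x. \<bar>indicator A x *\<^sub>R c - \<phi> x\<bar> \<partial>lborel) \<le> e"
      using \<phi>(1,2) lip_bdd_scale by (intro exI[of _ "\<lambda>x. \<phi> x * c"]) auto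
  qed
next
  case (add f g)
  show ?case
  proof (intro allI impI)
    fix e :: real assume e: "e > 0"
    obtain \<phi> where \<phi>: "lip_bdd \<phi>" "integrable lborel \<phi>" "(\<integral>x. \<bar>f x - \<phi> x\<bar> \<partial>lborel) \<le> e / 2" using add(3) e by (meson half_gt_zero)
    obtain \<psi> where \<psi>: "lip_bdd \<psi>" "integrable lborel \<psi>" "(\<integral>x. \<bar>g x - \<psi> x\<bar> \<partial>lborel) \<le> e / 2" using add(4) e by (meson half_gt_zero)
    have "(\<integral>x. \<bar>f x + g x - (\<phi> x + \<psi> x)\<bar> \<partial>lborel) \<le> (\<integral>x. \<bar>f x - \<phi> x\<bar> + \<bar>g x - \<psi> x\<bar> \<partial>lborel)"
      using add(1,2) \<phi>(2) \<psi>(2) by (intro integral_mono) auto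
    also have "\<dots> = (\<integral>x. \<bar>f x - \<phi> x\<bar> \<partial>lborel) + (\<integral>x. \<bar>g x - \<psi> x\<bar> \<partial>lborel)"
      using add(1,2) \<phi>(2) \<psi>(2) by (intro Bochner_Integration.integral_add) auto
    also have "\<dots> \<le> e" using \<phi>(3) \<psi>(3) by simp
    finally show "\<exists>\<phi>. lip_bdd \<phi> \<and> integrable lborel \<phi> \<and> (\<integral>x. \<bar>f x + g x - \<phi> x\<bar> \<partial>lborel) \<le> e"
      using \<phi>(1,2) \<psi>(1,2) lip_bdd_add by (intro exI[of _ "\<lambda>x. \<phi> x + \<psi> x"]) auto
  qed
next
  case (lim f s)
  show ?case
  proof (intro allI impI)
    fix e :: real assume e: "e > 0"
    have "(\<lambda>i. \<integral>x. \<bar>f x - s i x\<bar> \<partial>lborel) \<longlonglongrightarrow> (\<integral>x. (0::real) \<partial>(lborel :: real measure))"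
    proof (rule integral_dominated_convergence[where w="\<lambda>x. 3 * \<bar>f x\<bar>"])
      show "AE x in lborel. (\<lambda>i. \<bar>f x - s i x\<bar>) \<longlonglongrightarrow> 0"
      proof (rule AE_I2)
        fix x :: real
        have "(\<lambda>i. s i x) \<longlonglongrightarrow> f x" using lim(2) by simp
        from tendsto_rabs[OF tendsto_diff[OF tendsto_const this, of "f x"]]
        show "(\<lambda>i. \<bar>f x - s i x\<bar>) \<longlonglongrightarrow> 0" by simp
      qed
      show "AE x in lborel. norm \<bar>f x - s i x\<bar> \<le> 3 * \<bar>f x\<bar>" for i
      proof (rule AE_I2)
        fix x :: real
        have "norm (s i x) \<le> 2 * norm (f x)" using lim(3) by simp
        then show "norm \<bar>f x - s i x\<bar> \<le> 3 * \<bar>f x\<bar>" by simp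
      qed
    qed (use lim(1,4) borel_measurable_integrable in auto)
    then have "(\<lambda>i. \<integral>x. \<bar>f x - s i x\<bar> \<partial>lborel) \<longlonglongrightarrow> 0" by simp
    from order_tendstoD(2)[OF this half_gt_zero[OF e]]
    have "\<exists>i. (\<integral>x. \<bar>f x - s i x\<bar> \<partial>lborel) < e / 2" by (rule eventually_happens'[OF sequentially_bot])
    then obtain i where i: "(\<integral>x. \<bar>f x - s i x\<bar> \<partial>lborel) < e / 2" ..
    obtain \<phi> where \<phi>: "lip_bdd \<phi>" "integrable lborel \<phi>" "(\<integral>x. \<bar>s i x - \<phi> x\<bar> \<partial>lborel) \<le> e / 2" using lim(5) e by (meson half_gt_zero)
    have "(\<integral>x. \<bar>f x - \<phi> x\<bar> \<partial>lborel) \<le> (\<integral>x. \<bar>f x - s i x\<bar> + \<bar>s i x - \<phi> x\<bar> \<partial>lborel)"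
      using lim(1,4) \<phi>(2) by (intro integral_mono) auto
    also have "\<dots> = (\<integral>x. \<bar>f x - s i x\<bar> \<partial>lborel) + (\<integral>x. \<bar>s i x - \<phi> x\<bar> \<partial>lborel)"
      using lim(1,4) \<phi>(2) by (intro Bochner_Integration.integral_add) auto
    also have "\<dots> \<le> e" using \<phi>(3) i by simp
    finally show "\<exists>\<phi>. lip_bdd \<phi> \<and> integrable lborel \<phi> \<and> (\<integral>x. \<bar>f x - \<phi> x\<bar> \<partial>lborel) \<le> e" using \<phi>(1,2) by blast
  qed
qed

text \<open>The second moment of an average over \<nu> is the average of the pair products. If these
  tend to \<open>m x * m y\<close> for almost every pair, the variance tends to zero. Pairs at the
  same macroscopic position, for which there is no decorrelation, have to form a null set.\<close>

lemma mean_square_lln: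
  fixes \<xi> :: "nat \<Rightarrow> 'i \<Rightarrow> 'a \<Rightarrow> real" and m :: "'i \<Rightarrow> real"
  assumes \<nu>: "finite_measure \<nu>" and P: "\<And>n. prob_space (P n)"
    and \<xi>: "\<And>n. (\<lambda>q. \<xi> n (fst q) (snd q)) \<in> borel_measurable (\<nu> \<Otimes>\<^sub>M P n)" "\<And>n x \<omega>. \<bar>\<xi> n x \<omega>\<bar> \<le> G"
    and m: "m \<in> borel_measurable \<nu>" "\<And>x. x \<in> space \<nu> \<Longrightarrow> \<bar>m x\<bar> \<le> G"
    and single: "\<And>x. x \<in> space \<nu> \<Longrightarrow> (\<lambda>n. \<integral>\<omega>. \<xi> n x \<omega> \<partial>P n) \<longlonglongrightarrow> m x"
    and pair: "AE p in \<nu> \<Otimes>\<^sub>M \<nu>. (\<lambda>n. \<integral>\<omega>. \<xi> n (fst p) \<omega> * \<xi> n (snd p) \<omega> \<partial>P n) \<longlonglongrightarrow> m (fst p) * m (snd p)"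
  shows "(\<lambda>n. \<integral>\<omega>. \<bar>(\<integral>x. \<xi> n x \<omega> \<partial>\<nu>) - (\<integral>x. m x \<partial>\<nu>)\<bar> \<partial>P n) \<longlonglongrightarrow> 0"
proof -
  interpret \<nu>: finite_measure \<nu> by fact
  interpret P: prob_space "P n" for n by (rule P)
  interpret PP: pair_sigma_finite \<nu> "P n" for n ..
  interpret NN: pair_sigma_finite \<nu> \<nu> ..
  interpret NNf: finite_measure "\<nu> \<Otimes>\<^sub>M \<nu>" by (rule finite_measure_pair_measure) fact+
  interpret NNP: pair_sigma_finite "\<nu> \<Otimes>\<^sub>M \<nu>" "P n" for n ..
  interpret NPf: finite_measure "\<nu> \<Otimes>\<^sub>M P n" for n by (rule finite_measure_pair_measure) (rule P.finite_measure_axioms, rule \<nu>.finite_measure_axioms)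
  interpret NNPf: finite_measure "(\<nu> \<Otimes>\<^sub>M \<nu>) \<Otimes>\<^sub>M P n" for n by (rule finite_measure_pair_measure) (rule P.finite_measure_axioms, rule NNf.finite_measure_axioms)
  have G: "G \<ge> 0" using \<xi>(2)[of 0 undefined undefined] by linarith
  note [measurable] = \<xi>(1) m(1)
  have \<xi>s[measurable]: "\<xi> n x \<in> borel_measurable (P n)" if "x \<in> space \<nu>" for n x
    using measurable_section[OF \<xi>(1) that] .
  have \<xi>s': "(\<lambda>x. \<xi> n x \<omega>) \<in> borel_measurable \<nu>" if "\<omega> \<in> space (P n)" for n \<omega>
    using measurable_compose[OF measurable_Pair2'[OF that] \<xi>(1)] by simp
  have sw[measurable]: "(\<lambda>q. \<xi> n (snd q) (fst q)) \<in> borel_measurable (P n \<Otimes>\<^sub>M \<nu>)" for n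
    using measurable_compose[OF measurable_pair_swap' \<xi>(1)[of n]] by (simp add: case_prod_beta)
  have p1[measurable]: "(\<lambda>q. \<xi> n (fst (fst q)) (snd q)) \<in> borel_measurable ((\<nu> \<Otimes>\<^sub>M \<nu>) \<Otimes>\<^sub>M P n)" for n
    using measurable_compose[of "\<lambda>q. (fst (fst q), snd q)" "(\<nu> \<Otimes>\<^sub>M \<nu>) \<Otimes>\<^sub>M P n" "\<nu> \<Otimes>\<^sub>M P n", OF _ \<xi>(1)] by simp
  have p2[measurable]: "(\<lambda>q. \<xi> n (snd (fst q)) (snd q)) \<in> borel_measurable ((\<nu> \<Otimes>\<^sub>M \<nu>) \<Otimes>\<^sub>M P n)" for n
    using measurable_compose[of "\<lambda>q. (snd (fst q), snd q)" "(\<nu> \<Otimes>\<^sub>M \<nu>) \<Otimes>\<^sub>M P n" "\<nu> \<Otimes>\<^sub>M P n", OF _ \<xi>(1)] by simp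
  define Y where "Y n \<omega> = (\<integral>x. \<xi> n x \<omega> \<partial>\<nu>)" for n \<omega>
  define c where "c = (\<integral>x. m x \<partial>\<nu>)"
  have Ym[measurable]: "Y n \<in> borel_measurable (P n)" for n unfolding Y_def by measurable
  define B where "B = G * measure \<nu> (space \<nu>)"
  have Yb: "\<bar>Y n \<omega>\<bar> \<le> B" for n \<omega>
  proof -
    have "(\<integral>x. \<bar>\<xi> n x \<omega>\<bar> \<partial>\<nu>) \<le> (\<integral>x. G \<partial>\<nu>)" using \<xi>(2) G by (intro integral_mono') auto
    then show ?thesis unfolding Y_def B_def by (intro order_trans[OF integral_abs_bound]) (simp add: mult.commute)
  qed
  have iY: "integrable (P n) (Y n)" for n by (rule P.integrable_const_bound[where B=B]) (use Yb in auto)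
  have iY2: "integrable (P n) (\<lambda>\<omega>. (Y n \<omega>)\<^sup>2)" for n
  proof (rule P.integrable_const_bound[where B="B\<^sup>2"])
    have "norm ((Y n \<omega>)\<^sup>2) \<le> B\<^sup>2" for \<omega> using power_mono[OF Yb abs_ge_zero, of n \<omega> 2] by simp
    then show "AE \<omega> in P n. norm ((Y n \<omega>)\<^sup>2) \<le> B\<^sup>2" by (rule AE_I2)
  qed measurable
  have EY: "(\<integral>\<omega>. Y n \<omega> \<partial>P n) = (\<integral>x. (\<integral>\<omega>. \<xi> n x \<omega> \<partial>P n) \<partial>\<nu>)" for n
  proof -
    have i: "integrable (\<nu> \<Otimes>\<^sub>M P n) (\<lambda>q. \<xi> n (fst q) (snd q))"
      by (rule NPf.integrable_const_bound[where B=G]) (use \<xi>(2) in auto)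
    show ?thesis unfolding Y_def using PP.Fubini_integral[of n "\<xi> n"] i by (simp add: case_prod_unfold)
  qed
  have EY2: "(\<integral>\<omega>. (Y n \<omega>)\<^sup>2 \<partial>P n) = (\<integral>p. (\<integral>\<omega>. \<xi> n (fst p) \<omega> * \<xi> n (snd p) \<omega> \<partial>P n) \<partial>(\<nu> \<Otimes>\<^sub>M \<nu>))" for n
  proof -
    have b2: "\<bar>\<xi> n x \<omega> * \<xi> n y \<omega>\<bar> \<le> G * G" for x y \<omega> unfolding abs_mult by (intro mult_mono \<xi>(2)) (use G in auto)
    have i: "integrable ((\<nu> \<Otimes>\<^sub>M \<nu>) \<Otimes>\<^sub>M P n) (\<lambda>q. \<xi> n (fst (fst q)) (snd q) * \<xi> n (snd (fst q)) (snd q))"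
      by (rule NNPf.integrable_const_bound[where B="G * G"]) (use b2 in auto)
    have "(\<integral>p. (\<integral>\<omega>. \<xi> n (fst p) \<omega> * \<xi> n (snd p) \<omega> \<partial>P n) \<partial>(\<nu> \<Otimes>\<^sub>M \<nu>)) = (\<integral>\<omega>. (\<integral>p. \<xi> n (fst p) \<omega> * \<xi> n (snd p) \<omega> \<partial>(\<nu> \<Otimes>\<^sub>M \<nu>)) \<partial>P n)"
      using NNP.Fubini_integral[of n "\<lambda>p \<omega>. \<xi> n (fst p) \<omega> * \<xi> n (snd p) \<omega>"] i by (simp add: case_prod_unfold)
    also have "\<dots> = (\<integral>\<omega>. (Y n \<omega>)\<^sup>2 \<partial>P n)"
    proof (rule Bochner_Integration.integral_cong[OF refl])
      fix \<omega> assume \<omega>: "\<omega> \<in> space (P n)"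
      note [measurable] = \<xi>s'[OF \<omega>]
      have ii: "integrable (\<nu> \<Otimes>\<^sub>M \<nu>) (\<lambda>p. \<xi> n (fst p) \<omega> * \<xi> n (snd p) \<omega>)"
        by (rule NNf.integrable_const_bound[where B="G * G"]) (use b2 in auto)
      show "(\<integral>p. \<xi> n (fst p) \<omega> * \<xi> n (snd p) \<omega> \<partial>(\<nu> \<Otimes>\<^sub>M \<nu>)) = (Y n \<omega>)\<^sup>2"
        using NN.integral_fst'[OF ii] by (simp add: Y_def power2_eq_square)
    qed
    finally show ?thesis by simp
  qed
  have L1: "(\<lambda>n. \<integral>\<omega>. Y n \<omega> \<partial>P n) \<longlonglongrightarrow> c"
    unfolding EY c_def
  proof (rule integral_dominated_convergence[where w="\<lambda>_. G"])
    show "(\<lambda>x. \<integral>\<omega>. \<xi> n x \<omega> \<partial>P n) \<in> borel_measurable \<nu>" for n by measurable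
    show "AE x in \<nu>. norm (\<integral>\<omega>. \<xi> n x \<omega> \<partial>P n) \<le> G" for n
    proof (rule AE_I2)
      fix x
      have "(\<integral>\<omega>. \<bar>\<xi> n x \<omega>\<bar> \<partial>P n) \<le> (\<integral>\<omega>. G \<partial>P n)" using \<xi>(2) G by (intro integral_mono') auto
      then show "norm (\<integral>\<omega>. \<xi> n x \<omega> \<partial>P n) \<le> G" unfolding real_norm_def by (intro order_trans[OF integral_abs_bound]) (simp add: P.prob_space)
    qed
  qed (use single in auto)
  have L2: "(\<lambda>n. \<integral>\<omega>. (Y n \<omega>)\<^sup>2 \<partial>P n) \<longlonglongrightarrow> (\<integral>p. m (fst p) * m (snd p) \<partial>(\<nu> \<Otimes>\<^sub>M \<nu>))"
    unfolding EY2
  proof (rule integral_dominated_convergence[where w="\<lambda>_. G * G"])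
    show "(\<lambda>p. \<integral>\<omega>. \<xi> n (fst p) \<omega> * \<xi> n (snd p) \<omega> \<partial>P n) \<in> borel_measurable (\<nu> \<Otimes>\<^sub>M \<nu>)" for n by measurable
    show "AE p in \<nu> \<Otimes>\<^sub>M \<nu>. norm (\<integral>\<omega>. \<xi> n (fst p) \<omega> * \<xi> n (snd p) \<omega> \<partial>P n) \<le> G * G" for n
    proof (rule AE_I2)
      fix p
      have "\<bar>\<xi> n (fst p) \<omega> * \<xi> n (snd p) \<omega>\<bar> \<le> G * G" for \<omega> unfolding abs_mult by (intro mult_mono \<xi>(2)) (use G in auto)
      then have "(\<integral>\<omega>. \<bar>\<xi> n (fst p) \<omega> * \<xi> n (snd p) \<omega>\<bar> \<partial>P n) \<le> (\<integral>\<omega>. G * G \<partial>P n)" using G by (intro integral_mono') auto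
      then show "norm (\<integral>\<omega>. \<xi> n (fst p) \<omega> * \<xi> n (snd p) \<omega> \<partial>P n) \<le> G * G" unfolding real_norm_def by (intro order_trans[OF integral_abs_bound]) (simp add: P.prob_space)
    qed
  qed (use pair in auto)
  have mm: "(\<integral>p. m (fst p) * m (snd p) \<partial>(\<nu> \<Otimes>\<^sub>M \<nu>)) = c\<^sup>2"
  proof -
    have ii: "integrable (\<nu> \<Otimes>\<^sub>M \<nu>) (\<lambda>p. m (fst p) * m (snd p))"
    proof (rule NNf.integrable_const_bound[where B="G * G"])
      show "AE p in \<nu> \<Otimes>\<^sub>M \<nu>. norm (m (fst p) * m (snd p)) \<le> G * G"
        by (rule AE_I2) (auto simp: space_pair_measure abs_mult intro!: mult_mono m(2) G)
    qed measurable
    show ?thesis using NN.integral_fst'[OF ii] by (simp add: c_def power2_eq_square)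
  qed
  have sq: "(\<integral>\<omega>. (Y n \<omega> - c)\<^sup>2 \<partial>P n) = (\<integral>\<omega>. (Y n \<omega>)\<^sup>2 \<partial>P n) - 2 * c * (\<integral>\<omega>. Y n \<omega> \<partial>P n) + c\<^sup>2" for n
    using iY[of n] iY2[of n] by (simp add: power2_diff P.prob_space mult_ac)
  have "(\<lambda>n. (\<integral>\<omega>. (Y n \<omega>)\<^sup>2 \<partial>P n) - 2 * c * (\<integral>\<omega>. Y n \<omega> \<partial>P n) + c\<^sup>2) \<longlonglongrightarrow> c\<^sup>2 - 2 * c * c + c\<^sup>2"
    using L1 L2 unfolding mm by (intro tendsto_intros)
  then have L3: "(\<lambda>n. \<integral>\<omega>. (Y n \<omega> - c)\<^sup>2 \<partial>P n) \<longlonglongrightarrow> 0" unfolding sq by (simp add: power2_eq_square)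
  have L4: "(\<lambda>n. sqrt (\<integral>\<omega>. (Y n \<omega> - c)\<^sup>2 \<partial>P n)) \<longlonglongrightarrow> 0" using tendsto_real_sqrt[OF L3] by simp
  \<comment> \<open>Jensen's inequality, in the form that the variance of
    \<open>\<bar>Y n \<omega> - c\<bar>\<close> is nonnegative.\<close>
  have le: "(\<integral>\<omega>. \<bar>Y n \<omega> - c\<bar> \<partial>P n) \<le> sqrt (\<integral>\<omega>. (Y n \<omega> - c)\<^sup>2 \<partial>P n)" for n
  proof (rule real_le_rsqrt)
    have i1: "integrable (P n) (\<lambda>\<omega>. \<bar>Y n \<omega> - c\<bar>)" using iY[of n] by simp
    have i2: "integrable (P n) (\<lambda>\<omega>. \<bar>Y n \<omega> - c\<bar>\<^sup>2)" using iY[of n] iY2[of n] by (simp add: power2_diff)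
    show "(\<integral>\<omega>. \<bar>Y n \<omega> - c\<bar> \<partial>P n)\<^sup>2 \<le> (\<integral>\<omega>. (Y n \<omega> - c)\<^sup>2 \<partial>P n)"
      using P.variance_eq[OF i1 i2] P.variance_positive[of n "\<lambda>\<omega>. \<bar>Y n \<omega> - c\<bar>"] by simp
  qed
  show ?thesis
    unfolding Y_def[symmetric] c_def[symmetric]
    by (rule tendsto_sandwich[OF _ _ tendsto_const L4]) (use le in auto)
qed

section \<open>Laws at a single point\<close>

lemma integral_le_of_intervals:
  fixes Y :: "'a \<Rightarrow> real" and g :: "real \<Rightarrow> real"
  assumes P: "prob_space P" and Y[measurable]: "Y \<in> borel_measurable P" and K: "K \<ge> 0"
    and int: "\<And>u v. u \<le> v \<Longrightarrow> measure P {\<omega> \<in> space P. u \<le> Y \<omega> \<and> Y \<omega> \<le> v} \<le> K * (v - u)"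
    and g: "integrable lborel g"
  shows "integrable P (\<lambda>\<omega>. g (Y \<omega>))" "(\<integral>\<omega>. \<bar>g (Y \<omega>)\<bar> \<partial>P) \<le> K * (\<integral>x. \<bar>g x\<bar> \<partial>lborel)"
proof -
  have [measurable]: "g \<in> borel_measurable borel" using borel_measurable_integrable[OF g] by simp
  have ga: "integrable lborel (\<lambda>x. \<bar>g x\<bar>)" using g by (rule integrable_abs)
  have "(\<integral>\<^sup>+\<omega>. ennreal \<bar>g (Y \<omega>)\<bar> \<partial>P) \<le> ennreal K * (\<integral>\<^sup>+x. ennreal \<bar>g x\<bar> \<partial>lborel)"
    by (rule nn_integral_le_of_intervals[OF P Y K int, of "\<lambda>x. ennreal \<bar>g x\<bar>"]) measurable
  also have "\<dots> = ennreal (K * (\<integral>x. \<bar>g x\<bar> \<partial>lborel))"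
    using nn_integral_eq_integral[OF ga] K by (simp add: ennreal_mult)
  finally have le: "(\<integral>\<^sup>+\<omega>. ennreal \<bar>g (Y \<omega>)\<bar> \<partial>P) \<le> ennreal (K * (\<integral>x. \<bar>g x\<bar> \<partial>lborel))" .
  show i: "integrable P (\<lambda>\<omega>. g (Y \<omega>))"
    by (rule integrableI_bounded) (use le in \<open>auto simp: less_top[symmetric] dest!: neq_top_trans[rotated]\<close>)
  have "ennreal (\<integral>\<omega>. \<bar>g (Y \<omega>)\<bar> \<partial>P) = (\<integral>\<^sup>+\<omega>. ennreal \<bar>g (Y \<omega>)\<bar> \<partial>P)"
    by (rule nn_integral_eq_integral[symmetric]) (use integrable_abs[OF i] in auto)
  with le have "ennreal (\<integral>\<omega>. \<bar>g (Y \<omega>)\<bar> \<partial>P) \<le> ennreal (K * (\<integral>x. \<bar>g x\<bar> \<partial>lborel))" by simp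
  then show "(\<integral>\<omega>. \<bar>g (Y \<omega>)\<bar> \<partial>P) \<le> K * (\<integral>x. \<bar>g x\<bar> \<partial>lborel)"
    using K by (subst (asm) ennreal_le_iff) (auto intro!: mult_nonneg_nonneg integral_nonneg_AE)
qed

lemma tendsto_integral_of_char:
  fixes Y :: "nat \<Rightarrow> 'a \<Rightarrow> real" and Y' :: "'b \<Rightarrow> real" and h :: "real \<Rightarrow> real"
  assumes P: "\<And>n. prob_space (P n)" "prob_space Q"
    and Y[measurable]: "\<And>n. Y n \<in> borel_measurable (P n)" "Y' \<in> borel_measurable Q"
    and ch: "\<And>u. (\<lambda>n. \<integral>\<omega>. cis (u * Y n \<omega>) \<partial>P n) \<longlonglongrightarrow> (\<integral>\<omega>. cis (u * Y' \<omega>) \<partial>Q)"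
    and h: "continuous_on UNIV h" "bounded (range h)"
  shows "(\<lambda>n. \<integral>\<omega>. h (Y n \<omega>) \<partial>P n) \<longlonglongrightarrow> (\<integral>\<omega>. h (Y' \<omega>) \<partial>Q)"
proof -
  interpret P: prob_space "P n" for n by (rule P)
  interpret Q: prob_space Q by (rule P)
  interpret D: real_distribution "distr (P n) borel (Y n)" for n by (rule P.real_distribution_distr) simp
  interpret D': real_distribution "distr Q borel Y'" by (rule Q.real_distribution_distr) simp
  have [measurable]: "h \<in> borel_measurable borel" using h(1) by (rule borel_measurable_continuous_onI)
  have cm: "(\<lambda>x. cis (u * x)) \<in> borel_measurable borel" for u
    by (intro borel_measurable_continuous_onI continuous_intros)
  have c1: "char (distr (P n) borel (Y n)) u = (\<integral>\<omega>. cis (u * Y n \<omega>) \<partial>P n)" for n u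
    unfolding char_def cis_conv_exp[symmetric] using cm by (subst integral_distr) auto
  have c2: "char (distr Q borel Y') u = (\<integral>\<omega>. cis (u * Y' \<omega>) \<partial>Q)" for u
    unfolding char_def cis_conv_exp[symmetric] using cm by (subst integral_distr) auto
  have w: "weak_conv_m (\<lambda>n. distr (P n) borel (Y n)) (distr Q borel Y')"
    by (rule levy_continuity) (use ch in \<open>auto simp: c1 c2 intro: D.real_distribution_axioms D'.real_distribution_axioms\<close>)
  obtain b where b: "\<And>x. norm (h x) \<le> b" using h(2) by (auto simp: bounded_iff)
  have ic: "isCont h x" for x using h(1) by (simp add: continuous_on_eq_continuous_at)
  have "(\<lambda>n. integral\<^sup>L (distr (P n) borel (Y n)) h) \<longlonglongrightarrow> integral\<^sup>L (distr Q borel Y') h"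
    by (rule weak_conv_imp_integral_bdd_continuous_conv[OF _ _ w ic b]) (rule D.real_distribution_axioms D'.real_distribution_axioms)+
  then show ?thesis by (simp add: integral_distr)
qed

context setting
begin

lemma L_nonneg: "L \<ge> 0" using f_lip[of 0 1] by simp

text \<open>A window length that meets the three smallness conditions of
  \<open>density_setup\<close>, with \<open>L + 1\<close> in place of \<open>L\<close> to avoid
  division by zero. It is the same for all \<open>lam\<close>.\<close>

definition "tmax = min (1 / 4) (min (1 / (2 * (L + 1))) (window_const / (4 * (L + 1) * (sqrt T + 1))))"
text \<open>Bounds \<open>1 / \<sigma>\<close> for the window length \<open>min t tmax\<close>. The
  crude estimate \<open>1 / \<sigma> \<le> 1 + 1 / s\<close>, where \<open>s\<close> is a lower
  bound for \<sigma>^2, turns the order t^(-1/4) into t^(-1/2), which is still integrable at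
  0.\<close>

definition "dens t = 1 + (1 / sqrt t + 1 / sqrt tmax) / (2 * window_const)"

lemma tmax_pos: "tmax > 0"
  using window_const_pos L_nonneg T_pos by (auto simp: tmax_def intro!: divide_pos_pos mult_pos_pos add_nonneg_pos)

lemma dens_nonneg: "t \<ge> 0 \<Longrightarrow> dens t \<ge> 0"
  using window_const_pos tmax_pos by (auto simp: dens_def intro!: add_nonneg_nonneg divide_nonneg_pos)

lemma measurable_X:
  assumes "lam \<ge> 1"
  shows "X lam t y \<in> borel_measurable (M lam)"
proof -
  interpret XF: mild_field T "sqrt T + 1" "{lam * a<..<lam * a + lam}" "neumann_kernel (lam * a) (lam * a + lam)" "M lam"
     "\<lambda>y. chi (y / lam)" f F L "W lam" "X lam" by (rule mild_field_X[OF assms])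
  show ?thesis using XF.measurable_at(1)[of "(t, y)"] unfolding XF.sol_at_def[abs_def] by simp
qed

lemma measurable_Z:
  assumes "yb \<in> {a<..<a + 1}"
  shows "Z yb t y \<in> borel_measurable (N yb)"
proof -
  interpret ZF: mild_field T 1 UNIV heat_kernel "N yb" "\<lambda>_. chi yb" f F L "V yb" "Z yb" by (rule mild_field_Z[OF assms])
  show ?thesis using ZF.measurable_at(1)[of "(t, y)"] unfolding ZF.sol_at_def[abs_def] by simp
qed

lemma X_prob_le:
  assumes lam: "lam \<ge> 1" and t: "t \<in> {0<..T}" and yb: "yb \<in> {a<..<a + 1}" and uv: "u \<le> v"
  shows "measure (M lam) {\<omega> \<in> space (M lam). u \<le> X lam t (lam * yb) \<omega> \<and> X lam t (lam * yb) \<omega> \<le> v} \<le> dens t * (v - u)"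
proof -
  interpret XF: mild_field T "sqrt T + 1" "{lam * a<..<lam * a + lam}" "neumann_kernel (lam * a) (lam * a + lam)" "M lam"
     "\<lambda>y. chi (y / lam)" f F L "W lam" "X lam" by (rule mild_field_X[OF lam])
  let ?\<tau> = "min t tmax"
  have \<tau>: "0 < ?\<tau>" using t tmax_pos by simp
  have "tmax \<le> 1 / 4" unfolding tmax_def by (rule min.cobounded1)
  then have \<tau>4: "?\<tau> \<le> 1 / 4" by simp
  have s: "sqrt T + 1 > 0" using T_pos by (simp add: add_nonneg_pos)
  have L1: "L + 1 > 0" using L_nonneg by simp
  have "?\<tau> \<le> 1 / (2 * (L + 1))" by (simp add: tmax_def)
  then have "(L + 1) * ?\<tau> \<le> 1 / 2" using L1 by (simp add: field_simps)
  moreover have "L * ?\<tau> \<le> (L + 1) * ?\<tau>" using \<tau> by (intro mult_right_mono) auto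
  ultimately have \<tau>2: "L * ?\<tau> \<le> 1 / 2" by linarith
  have "?\<tau> \<le> window_const / (4 * (L + 1) * (sqrt T + 1))" by (simp add: tmax_def)
  then have "4 * (L + 1) * ?\<tau> * (sqrt T + 1) \<le> window_const" using L1 s by (simp add: pos_le_divide_eq mult_ac)
  moreover have "4 * L * ?\<tau> * (sqrt T + 1) \<le> 4 * (L + 1) * ?\<tau> * (sqrt T + 1)"
    using \<tau> s by (intro mult_right_mono) auto
  ultimately have \<tau>3: "4 * L * ?\<tau> * (sqrt T + 1) \<le> window_const" by linarith
  have in_J: "lam * yb \<in> {lam * a<..<lam * a + lam}"
    using yb lam mult_strict_left_mono[of yb "a + 1" lam] by (auto simp: distrib_left)
  interpret D: density_setup T "sqrt T + 1" "{lam * a<..<lam * a + lam}" "neumann_kernel (lam * a) (lam * a + lam)" "M lam"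
     "\<lambda>y. chi (y / lam)" f F L "W lam" "X lam" "(t, lam * yb)" ?\<tau>
  proof unfold_locales
    show "(t, lam * yb) \<in> XF.pts" using t in_J by (simp add: XF.pts_def)
    show "0 < ?\<tau>" "?\<tau> \<le> fst (t, lam * yb)" "?\<tau> \<le> 1 / 4" using \<tau> \<tau>4 by auto
    show "L * ?\<tau> \<le> 1 / 2" "4 * L * ?\<tau> * (sqrt T + 1) \<le> window_const" by (rule \<tau>2 \<tau>3)+
    show "heat_kernel t y \<eta> \<le> neumann_kernel (lam * a) (lam * a + lam) t y \<eta>"
      if "y \<in> {lam * a<..<lam * a + lam}" "\<eta> \<in> {lam * a<..<lam * a + lam}" for t y \<eta>
      by (rule heat_kernel_le_neumann_kernel[OF that])
    \<comment> \<open>In an interval of length at least 1 every point has room 1/2 on at least one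
      side.\<close>
    show "{snd (t, lam * yb)<..<snd (t, lam * yb) + 1 / 2} \<subseteq> {lam * a<..<lam * a + lam} \<or>
       {snd (t, lam * yb) - 1 / 2<..<snd (t, lam * yb)} \<subseteq> {lam * a<..<lam * a + lam}"
    proof (cases "lam * yb + 1 / 2 \<le> lam * a + lam")
      case True
      then show ?thesis using in_J by (intro disjI1) auto
    next
      case False
      then show ?thesis using in_J lam by (intro disjI2) auto
    qed
  qed
  define s2 where "s2 = 2 * window_const * sqrt ?\<tau>"
  have s2: "s2 > 0" using \<tau> window_const_pos by (simp add: s2_def)
  have "1 / D.\<sigma> \<le> 1 + 1 / s2"
  proof (cases "D.\<sigma> \<ge> 1")
    case True
    then have "1 / D.\<sigma> \<le> 1" by simp
    moreover have "0 < 1 / s2" using s2 by simp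
    ultimately show ?thesis by linarith
  next
    case False
    have "s2 \<le> D.\<sigma>\<^sup>2" unfolding s2_def by (rule D.sigma_ge)
    also have "D.\<sigma>\<^sup>2 \<le> D.\<sigma> * 1" unfolding power2_eq_square using False D.sigma_pos by (intro mult_left_mono) auto
    finally have "1 / D.\<sigma> \<le> 1 / s2" using s2 by (intro divide_left_mono mult_pos_pos D.sigma_pos) auto
    then show ?thesis by simp
  qed
  also have "1 / s2 = (1 / sqrt ?\<tau>) / (2 * window_const)" using \<tau> window_const_pos by (simp add: s2_def field_simps)
  also have "1 / sqrt ?\<tau> \<le> 1 / sqrt t + 1 / sqrt tmax"
    using t tmax_pos by (cases "t \<le> tmax") (auto simp: min_def)
  finally have "1 / D.\<sigma> \<le> dens t" using window_const_pos by (simp add: dens_def divide_right_mono)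
  then have "1 / D.\<sigma> * (v - u) \<le> dens t * (v - u)" using uv by (intro mult_right_mono) auto
  then show ?thesis using D.sol_prob_le[OF uv] by (simp add: XF.sol_at_def)
qed

lemma sequence_two_points:
  assumes "\<And>n. l n \<ge> 1" "filterlim l at_top sequentially" "y0 \<in> {a<..<a + 1}" "y1 \<in> {a<..<a + 1}" "y0 \<noteq> y1"
  shows "two_points T a chi f F L B M W X N V Z l (\<lambda>b. if b then y1 else y0)"
  by unfold_locales (use assms in auto)

text \<open>For positive times the point is treated as one of a pair, with an arbitrary different
  point \<open>y1\<close> as companion. At time 0 both laws are the point mass at
  \<open>chi yb\<close>, which follows from the initial condition directly.\<close>

lemma weak_limit:
  fixes h :: "real \<Rightarrow> real"
  assumes l: "\<And>n. l n \<ge> 1" "filterlim l at_top sequentially" and yb: "yb \<in> {a<..<a + 1}" and t: "t \<in> {0..T}"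
    and h: "continuous_on UNIV h" "bounded (range h)"
  shows "(\<lambda>n. \<integral>\<omega>. h (X (l n) t (l n * yb) \<omega>) \<partial>M (l n)) \<longlonglongrightarrow> (\<integral>\<omega>. h (Z yb t 0 \<omega>) \<partial>N yb)"
proof (cases "t = 0")
  case False
  obtain y1 where y1: "y1 \<in> {a<..<a + 1}" "yb \<noteq> y1"
  proof (cases "yb = a + 1 / 2")
    case True
    then show ?thesis using that[of "a + 1 / 4"] by auto
  next
    case False
    then show ?thesis using that[of "a + 1 / 2"] by auto
  qed
  interpret TP: two_points T a chi f F L B M W X N V Z l "\<lambda>b. if b then y1 else yb"
    by (rule sequence_two_points[OF l yb y1])
  show ?thesis
  proof (rule tendsto_integral_of_char[OF _ _ _ measurable_Z[OF yb] _ h])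
    show "X (l n) t (l n * yb) \<in> borel_measurable (M (l n))" for n by (rule measurable_X[OF l(1)])
    show "prob_space (M (l n))" for n using X_sol[OF l(1)] by blast
    show "prob_space (N yb)" using Z_sol[OF yb] by blast
    show "(\<lambda>n. \<integral>\<omega>. cis (u * X (l n) t (l n * yb) \<omega>) \<partial>M (l n)) \<longlonglongrightarrow> (\<integral>\<omega>. cis (u * Z yb t 0 \<omega>) \<partial>N yb)" for u
      using TP.cis_lim[of t u False] t False by simp
  qed
next
  case True
  have hm[measurable]: "h \<in> borel_measurable borel" using h(1) by (rule borel_measurable_continuous_onI)
  have x: "(\<integral>\<omega>. h (X (l n) t (l n * yb) \<omega>) \<partial>M (l n)) = h (chi yb)" for n
  proof -
    interpret prob_space "M (l n)" using X_sol[OF l(1)] by blast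
    note [measurable] = measurable_X[OF l(1)]
    have in_J: "l n * yb \<in> {l n * a<..<l n * a + l n}"
      using yb l(1)[of n] mult_strict_left_mono[of yb "a + 1" "l n"] by (auto simp: distrib_left)
    have l0: "l n \<noteq> 0" using l(1)[of n] by simp
    have "AE \<omega> in M (l n). X (l n) 0 (l n * yb) \<omega> = chi (l n * yb / l n)"
      using X_sol[OF l(1)] in_J unfolding mild_solution_def by blast
    then have "(\<integral>\<omega>. h (X (l n) t (l n * yb) \<omega>) \<partial>M (l n)) = (\<integral>\<omega>. h (chi yb) \<partial>M (l n))"
      using True l0 by (intro integral_cong_AE) auto
    then show ?thesis by (simp add: prob_space)
  qed
  have z: "(\<integral>\<omega>. h (Z yb t 0 \<omega>) \<partial>N yb) = h (chi yb)"
  proof -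
    interpret prob_space "N yb" using Z_sol[OF yb] by blast
    note [measurable] = measurable_Z[OF yb]
    have "AE \<omega> in N yb. Z yb 0 0 \<omega> = chi yb"
      using Z_sol[OF yb] unfolding mild_solution_def by blast
    then have "(\<integral>\<omega>. h (Z yb t 0 \<omega>) \<partial>N yb) = (\<integral>\<omega>. h (chi yb) \<partial>N yb)"
      using True by (intro integral_cong_AE) auto
    then show ?thesis by (simp add: prob_space)
  qed
  show ?thesis unfolding x z by simp
qed

text \<open>The bound for the line is inherited from the intervals through the weak limit. An atom
  at an endpoint is not excluded beforehand, hence the trapezoid and the margin \<delta>, which is
  sent to 0 at the end.\<close>

lemma Z_prob_le:
  assumes t: "t \<in> {0<..T}" and yb: "yb \<in> {a<..<a + 1}" and uv: "u \<le> v"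
  shows "measure (N yb) {\<omega> \<in> space (N yb). u \<le> Z yb t 0 \<omega> \<and> Z yb t 0 \<omega> \<le> v} \<le> dens t * (v - u)"
proof -
  interpret N: prob_space "N yb" using Z_sol[OF yb] by blast
  note [measurable] = measurable_Z[OF yb]
  let ?p = "measure (N yb) {\<omega> \<in> space (N yb). u \<le> Z yb t 0 \<omega> \<and> Z yb t 0 \<omega> \<le> v}"
  have "?p \<le> dens t * (v - u + 2 * \<delta>)" if \<delta>: "\<delta> > 0" for \<delta>
  proof -
    have hb: "bounded (range (bump u v \<delta>))"
      using bump_props(1,2)[OF \<delta> uv] by (intro boundedI[of _ 1]) auto
    have [measurable]: "bump u v \<delta> \<in> borel_measurable borel" using bump_props(5)[OF \<delta> uv] by (rule borel_measurable_continuous_onI)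
    have "?p = (\<integral>\<omega>. indicator {\<omega> \<in> space (N yb). u \<le> Z yb t 0 \<omega> \<and> Z yb t 0 \<omega> \<le> v} \<omega> \<partial>N yb)" by simp
    also have "\<dots> \<le> (\<integral>\<omega>. bump u v \<delta> (Z yb t 0 \<omega>) \<partial>N yb)"
    proof (rule integral_mono)
      show "integrable (N yb) (\<lambda>\<omega>. bump u v \<delta> (Z yb t 0 \<omega>))"
        by (rule N.integrable_const_bound[where B=1]) (use bump_props(1,2)[OF \<delta> uv] in auto)
      show "indicator {\<omega> \<in> space (N yb). u \<le> Z yb t 0 \<omega> \<and> Z yb t 0 \<omega> \<le> v} \<omega> \<le> bump u v \<delta> (Z yb t 0 \<omega>)" for \<omega>
        using bump_props(1,3)[OF \<delta> uv, of "Z yb t 0 \<omega>"] by (auto split: split_indicator)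
    qed (auto intro!: integrable_real_indicator simp: less_top[symmetric])
    also have "\<dots> \<le> dens t * (v - u + 2 * \<delta>)"
    proof (rule LIMSEQ_le_const2)
      have f1: "filterlim (\<lambda>n. real (Suc n)) at_top sequentially"
        by (rule filterlim_compose[OF filterlim_real_sequentially filterlim_Suc])
      show "(\<lambda>n. \<integral>\<omega>. bump u v \<delta> (X (real (Suc n)) t (real (Suc n) * yb) \<omega>) \<partial>M (real (Suc n))) \<longlonglongrightarrow> (\<integral>\<omega>. bump u v \<delta> (Z yb t 0 \<omega>) \<partial>N yb)"
        by (rule weak_limit[OF _ f1 yb _ bump_props(5)[OF \<delta> uv] hb]) (use t in auto)
      have "(\<integral>\<omega>. bump u v \<delta> (X (real (Suc n)) t (real (Suc n) * yb) \<omega>) \<partial>M (real (Suc n))) \<le> dens t * (v - u + 2 * \<delta>)" for n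
      proof -
        define lam where "lam = real (Suc n)"
        have lam: "lam \<ge> 1" by (simp add: lam_def)
        interpret P: prob_space "M lam" using X_sol[OF lam] by blast
        note [measurable] = measurable_X[OF lam]
        have "(\<integral>\<omega>. bump u v \<delta> (X lam t (lam * yb) \<omega>) \<partial>M lam) \<le>
          (\<integral>\<omega>. indicator {\<omega> \<in> space (M lam). u - \<delta> \<le> X lam t (lam * yb) \<omega> \<and> X lam t (lam * yb) \<omega> \<le> v + \<delta>} \<omega> \<partial>M lam)"
        proof (rule integral_mono)
          show "integrable (M lam) (\<lambda>\<omega>. bump u v \<delta> (X lam t (lam * yb) \<omega>))"
            by (rule P.integrable_const_bound[where B=1]) (use bump_props(1,2)[OF \<delta> uv] in auto)
          show "bump u v \<delta> (X lam t (lam * yb) \<omega>) \<le> indicator {\<omega> \<in> space (M lam). u - \<delta> \<le> X lam t (lam * yb) \<omega> \<and> X lam t (lam * yb) \<omega> \<le> v + \<delta>} \<omega>"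
            if "\<omega> \<in> space (M lam)" for \<omega>
            using that bump_props(2,4)[OF \<delta> uv, of "X lam t (lam * yb) \<omega>"] by (cases "bump u v \<delta> (X lam t (lam * yb) \<omega>) = 0") (auto split: split_indicator)
        qed (auto intro!: integrable_real_indicator simp: less_top[symmetric])
        also have "\<dots> \<le> dens t * (v + \<delta> - (u - \<delta>))"
          using X_prob_le[OF lam t yb, of "u - \<delta>" "v + \<delta>"] uv \<delta> by simp
        finally show ?thesis by (simp add: lam_def algebra_simps)
      qed
      then show "\<exists>N. \<forall>n\<ge>N. (\<integral>\<omega>. bump u v \<delta> (X (real (Suc n)) t (real (Suc n) * yb) \<omega>) \<partial>M (real (Suc n))) \<le> dens t * (v - u + 2 * \<delta>)" by blast
    qed
    finally show ?thesis .
  qed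
  note le = this
  have "((\<lambda>\<delta>. dens t * (v - u + 2 * \<delta>)) \<longlongrightarrow> dens t * (v - u + 2 * 0)) (at_right 0)"
    by (intro tendsto_intros)
  then have "?p \<le> dens t * (v - u + 2 * 0)"
    by (rule tendsto_lowerbound) (use le in \<open>auto simp: eventually_at_filter\<close>)
  then show ?thesis by simp
qed

lemma X_L1:
  assumes "lam \<ge> 1" "t \<in> {0<..T}" "yb \<in> {a<..<a + 1}" "integrable lborel g"
  shows "integrable (M lam) (\<lambda>\<omega>. g (X lam t (lam * yb) \<omega>))"
    "(\<integral>\<omega>. \<bar>g (X lam t (lam * yb) \<omega>)\<bar> \<partial>M lam) \<le> dens t * (\<integral>x. \<bar>g x\<bar> \<partial>lborel)"
proof -
  have P: "prob_space (M lam)" and D: "dens t \<ge> 0" using X_sol[OF assms(1)] dens_nonneg[of t] assms(2) by auto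
  note r = integral_le_of_intervals[OF P measurable_X[OF assms(1)] D X_prob_le[OF assms(1-3)] assms(4)]
  show "integrable (M lam) (\<lambda>\<omega>. g (X lam t (lam * yb) \<omega>))"
    "(\<integral>\<omega>. \<bar>g (X lam t (lam * yb) \<omega>)\<bar> \<partial>M lam) \<le> dens t * (\<integral>x. \<bar>g x\<bar> \<partial>lborel)"
    by (rule r; assumption)+
qed

lemma Z_L1:
  assumes "t \<in> {0<..T}" "yb \<in> {a<..<a + 1}" "integrable lborel g"
  shows "integrable (N yb) (\<lambda>\<omega>. g (Z yb t 0 \<omega>))"
    "(\<integral>\<omega>. \<bar>g (Z yb t 0 \<omega>)\<bar> \<partial>N yb) \<le> dens t * (\<integral>x. \<bar>g x\<bar> \<partial>lborel)"
proof -
  have P: "prob_space (N yb)" and D: "dens t \<ge> 0" using Z_sol[OF assms(2)] dens_nonneg[of t] assms(1) by auto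
  note r = integral_le_of_intervals[OF P measurable_Z[OF assms(2)] D Z_prob_le[OF assms(1,2)] assms(3)]
  show "integrable (N yb) (\<lambda>\<omega>. g (Z yb t 0 \<omega>))"
    "(\<integral>\<omega>. \<bar>g (Z yb t 0 \<omega>)\<bar> \<partial>N yb) \<le> dens t * (\<integral>x. \<bar>g x\<bar> \<partial>lborel)"
    by (rule r; assumption)+
qed

end

section \<open>Spatial averages\<close>

lemma finite_measure_restrict_lborel:
  assumes "A \<in> sets lborel" "emeasure lborel A < \<infinity>"
  shows "finite_measure (restrict_space lborel A)"
  by (rule finite_measureI) (use assms in \<open>auto simp: emeasure_restrict_space space_restrict_space\<close>)

context setting
begin

abbreviation "nuT \<equiv> restrict_space (lborel :: real measure) {0<..T}"
abbreviation "nuY \<equiv> restrict_space (lborel :: real measure) {a<..<a + 1}"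
text \<open>Positions are macroscopic, so that the measure is the same for all \<open>lam\<close>.
  Time 0 is left out because the law of the solution there is a point mass and has no
  density.\<close>

definition "nu = nuT \<Otimes>\<^sub>M nuY"
definition "mZ g x = (\<integral>\<omega>. g (Z (snd x) (fst x) 0 \<omega>) \<partial>N (snd x))" for g :: "real \<Rightarrow> real"
definition "dens_total = (\<integral>x. dens (fst x) \<partial>nu)"

lemma finite_nuT: "finite_measure nuT" and finite_nuY: "finite_measure nuY"
  using T_pos by (auto intro!: finite_measure_restrict_lborel)

lemma finite_nu: "finite_measure nu"
  unfolding nu_def by (rule finite_measure_pair_measure[OF finite_nuY finite_nuT])

lemma pair_nu: "pair_sigma_finite nuT nuY"
  using finite_measure.axioms(1)[OF finite_nuT] finite_measure.axioms(1)[OF finite_nuY] by (rule pair_sigma_finite.intro)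

lemma space_nu: "space nu = {0<..T} \<times> {a<..<a + 1}"
  by (simp add: nu_def space_pair_measure space_restrict_space)

lemma measurable_nu: "fst \<in> borel_measurable nu" "snd \<in> borel_measurable nu"
proof -
  have r: "(\<lambda>x. x) \<in> borel_measurable (restrict_space lborel A)" for A :: "real set"
    by (rule measurable_restrict_space1) simp
  show "fst \<in> borel_measurable nu" unfolding nu_def by (rule measurable_compose[OF measurable_fst r])
  show "snd \<in> borel_measurable nu" unfolding nu_def by (rule measurable_compose[OF measurable_snd r])
qed

lemma measurable_X_nu:
  assumes lam: "lam \<ge> 1"
  shows "(\<lambda>q. X lam (fst (fst q)) (lam * snd (fst q)) (snd q)) \<in> borel_measurable (nu \<Otimes>\<^sub>M M lam)"
proof -
  interpret XF: mild_field T "sqrt T + 1" "{lam * a<..<lam * a + lam}" "neumann_kernel (lam * a) (lam * a + lam)" "M lam"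
     "\<lambda>y. chi (y / lam)" f F L "W lam" "X lam" by (rule mild_field_X[OF lam])
  note [measurable] = measurable_nu
  have "(\<lambda>q. (fst (fst q), lam * snd (fst q))) \<in> borel_measurable (nu \<Otimes>\<^sub>M M lam)"
    by (intro borel_measurable_Pair) measurable
  then have "(\<lambda>q. ((fst (fst q), lam * snd (fst q)), snd q)) \<in> measurable (nu \<Otimes>\<^sub>M M lam) (lborel \<Otimes>\<^sub>M M lam)"
    by (intro measurable_Pair) auto
  from measurable_compose[OF this XF.measurable_sol] show ?thesis by (simp add: XF.sol_at_def)
qed

lemma integral_nu:
  fixes h :: "real \<times> real \<Rightarrow> real"
  assumes h: "integrable nu h"
  shows "(\<integral>x. h x \<partial>nu) = (LBINT t:{0..T}. (LBINT y:{a<..<a + 1}. h (t, y)))"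
proof -
  interpret pair_sigma_finite nuT nuY by (rule pair_nu)
  define G where "G t = (LBINT y:{a<..<a + 1}. h (t, y))" for t
  have G: "(\<integral>y. h (t, y) \<partial>nuY) = G t" for t
    unfolding G_def set_lebesgue_integral_def by (rule integral_restrict_space) simp
  have i: "integrable (nuT \<Otimes>\<^sub>M nuY) h" using h by (simp add: nu_def)
  have Gi: "integrable nuT G" using integrable_fst'[OF i] by (simp add: G)
  have Gm: "integrable lborel (\<lambda>t. indicator {0<..T} t *\<^sub>R G t)"
    using Gi by (subst (asm) integrable_restrict_space) auto
  have [measurable]: "(\<lambda>t. indicator {0<..T} t *\<^sub>R G t) \<in> borel_measurable borel"
    using borel_measurable_integrable[OF Gm] by simp
  have eq: "indicator {0..T} t *\<^sub>R G t = (if t = 0 then G 0 else indicator {0<..T} t *\<^sub>R G t)" for t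
    using T_pos by (auto split: split_indicator)
  have "(\<integral>x. h x \<partial>nu) = (\<integral>t. G t \<partial>nuT)" using integral_fst'[OF i] by (simp add: G nu_def)
  also have "\<dots> = (\<integral>t. indicator {0<..T} t *\<^sub>R G t \<partial>lborel)" by (rule integral_restrict_space) simp
  also have "\<dots> = (\<integral>t. indicator {0..T} t *\<^sub>R G t \<partial>lborel)"
  proof (rule integral_cong_AE)
    show "AE t in lborel. indicator {0<..T} t *\<^sub>R G t = indicator {0..T} t *\<^sub>R G t"
      using AE_lborel_singleton[of "0::real"] by eventually_elim (auto split: split_indicator)
    show "(\<lambda>t. indicator {0..T} t *\<^sub>R G t) \<in> borel_measurable lborel" unfolding eq by measurable
  qed measurable
  finally show ?thesis unfolding G_def set_lebesgue_integral_def .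
qed

text \<open>The singular part \<open>1 / sqrt t\<close> is the time reversal of the singularity
  integrated in \<open>inverse_sqrt_integral\<close>.\<close>

lemma integrable_dens: "integrable nu (\<lambda>x. dens (fst x))"
proof -
  interpret pair_sigma_finite nuT nuY by (rule pair_nu)
  interpret Y: finite_measure nuY by (rule finite_nuY)
  interpret Tm: finite_measure nuT by (rule finite_nuT)
  have "integrable lborel (\<lambda>s. indicator {0..<T} s *\<^sub>R (1 / sqrt (T - s)))"
    using inverse_sqrt_integral(1)[of 0 T] T_pos unfolding set_integrable_def by simp
  from lborel_integrable_real_affine[OF this, of "-1" T]
  have "integrable lborel (\<lambda>t. indicator {0..<T} (T - t) *\<^sub>R (1 / sqrt t))" by simp
  moreover have "indicator {0..<T} (T - t) = (indicator {0<..T} t :: real)" for t by (auto split: split_indicator)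
  ultimately have "integrable nuT (\<lambda>t. 1 / sqrt t)" by (subst integrable_restrict_space) auto
  then have i: "integrable nuT dens" unfolding dens_def[abs_def] by auto
  have [measurable]: "(\<lambda>x. dens (fst x)) \<in> borel_measurable nu"
    using measurable_compose[OF measurable_fst borel_measurable_integrable[OF i], of nuY] by (simp add: nu_def)
  show ?thesis unfolding nu_def
  proof (rule Fubini_integrable)
    show "(\<lambda>x. dens (fst x)) \<in> borel_measurable (nuT \<Otimes>\<^sub>M nuY)" unfolding nu_def[symmetric] by measurable
    show "integrable nuT (\<lambda>x. \<integral>y. norm (dens (fst (x, y))) \<partial>nuY)" using i by simp
  qed simp
qed

text \<open>The density bound at single points is integrated in time by means of
  \<open>integrable_dens\<close>. The constant \<open>dens_total\<close> is the same for all
  \<open>lam\<close>, which later allows \<open>g\<close> to be exchanged for an approximant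
  uniformly in \<open>lam\<close>.\<close>

lemma X_nu_L1:
  assumes lam: "lam \<ge> 1" and g: "integrable lborel g"
  shows "integrable (nu \<Otimes>\<^sub>M M lam) (\<lambda>q. g (X lam (fst (fst q)) (lam * snd (fst q)) (snd q)))"
    "(\<integral>q. \<bar>g (X lam (fst (fst q)) (lam * snd (fst q)) (snd q))\<bar> \<partial>(nu \<Otimes>\<^sub>M M lam)) \<le> dens_total * (\<integral>x. \<bar>g x\<bar> \<partial>lborel)"
proof -
  interpret P: prob_space "M lam" using X_sol[OF lam] by blast
  interpret nu: finite_measure nu by (rule finite_nu)
  interpret pair_sigma_finite nu "M lam" ..
  have [measurable]: "g \<in> borel_measurable borel" using borel_measurable_integrable[OF g] by simp
  note [measurable] = measurable_X_nu[OF lam]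
  have gm[measurable]: "(\<lambda>q. g (X lam (fst (fst q)) (lam * snd (fst q)) (snd q))) \<in> borel_measurable (nu \<Otimes>\<^sub>M M lam)" by measurable
  have b: "(\<integral>\<omega>. \<bar>g (X lam (fst x) (lam * snd x) \<omega>)\<bar> \<partial>M lam) \<le> dens (fst x) * (\<integral>x. \<bar>g x\<bar> \<partial>lborel)"
    and i1: "integrable (M lam) (\<lambda>\<omega>. g (X lam (fst x) (lam * snd x) \<omega>))" if "x \<in> space nu" for x
    using X_L1[OF lam _ _ g, of "fst x" "snd x"] that by (auto simp: space_nu)
  have id: "integrable nu (\<lambda>x. dens (fst x) * (\<integral>x. \<bar>g x\<bar> \<partial>lborel))" using integrable_dens by simp
  have i2: "integrable nu (\<lambda>x. \<integral>\<omega>. \<bar>g (X lam (fst x) (lam * snd x) \<omega>)\<bar> \<partial>M lam)"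
  proof (rule Bochner_Integration.integrable_bound[OF id])
    show "(\<lambda>x. \<integral>\<omega>. \<bar>g (X lam (fst x) (lam * snd x) \<omega>)\<bar> \<partial>M lam) \<in> borel_measurable nu" by measurable
    show "AE x in nu. norm (\<integral>\<omega>. \<bar>g (X lam (fst x) (lam * snd x) \<omega>)\<bar> \<partial>M lam) \<le> norm (dens (fst x) * (\<integral>x. \<bar>g x\<bar> \<partial>lborel))"
    proof (rule AE_I2)
      fix x assume x: "x \<in> space nu"
      have "0 \<le> (\<integral>\<omega>. \<bar>g (X lam (fst x) (lam * snd x) \<omega>)\<bar> \<partial>M lam)" by (rule integral_nonneg_AE) simp
      with b[OF x] show "norm (\<integral>\<omega>. \<bar>g (X lam (fst x) (lam * snd x) \<omega>)\<bar> \<partial>M lam) \<le> norm (dens (fst x) * (\<integral>x. \<bar>g x\<bar> \<partial>lborel))"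
        unfolding real_norm_def by linarith
    qed
  qed
  show i: "integrable (nu \<Otimes>\<^sub>M M lam) (\<lambda>q. g (X lam (fst (fst q)) (lam * snd (fst q)) (snd q)))"
    by (rule Fubini_integrable[OF gm]) (use i1 i2 in auto)
  have "(\<integral>q. \<bar>g (X lam (fst (fst q)) (lam * snd (fst q)) (snd q))\<bar> \<partial>(nu \<Otimes>\<^sub>M M lam))
     = (\<integral>x. (\<integral>\<omega>. \<bar>g (X lam (fst x) (lam * snd x) \<omega>)\<bar> \<partial>M lam) \<partial>nu)"
    using integral_fst'[OF integrable_abs[OF i]] by simp
  also have "\<dots> \<le> (\<integral>x. dens (fst x) * (\<integral>x. \<bar>g x\<bar> \<partial>lborel) \<partial>nu)" by (rule integral_mono[OF i2 id b])
  also have "\<dots> = dens_total * (\<integral>x. \<bar>g x\<bar> \<partial>lborel)" by (simp add: dens_total_def)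
  finally show "(\<integral>q. \<bar>g (X lam (fst (fst q)) (lam * snd (fst q)) (snd q))\<bar> \<partial>(nu \<Otimes>\<^sub>M M lam)) \<le> dens_total * (\<integral>x. \<bar>g x\<bar> \<partial>lborel)" .
qed

lemma mZ_diff:
  assumes x: "x \<in> space nu" and g: "integrable lborel g" "integrable lborel g'"
  shows "\<bar>mZ g x - mZ g' x\<bar> \<le> dens (fst x) * (\<integral>x. \<bar>g x - g' x\<bar> \<partial>lborel)"
proof -
  have x': "fst x \<in> {0<..T}" "snd x \<in> {a<..<a + 1}" using x by (auto simp: space_nu)
  have "mZ g x - mZ g' x = (\<integral>\<omega>. g (Z (snd x) (fst x) 0 \<omega>) - g' (Z (snd x) (fst x) 0 \<omega>) \<partial>N (snd x))"
    unfolding mZ_def by (rule Bochner_Integration.integral_diff[symmetric]) (rule Z_L1(1)[OF x'] g)+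
  then have "\<bar>mZ g x - mZ g' x\<bar> \<le> (\<integral>\<omega>. \<bar>g (Z (snd x) (fst x) 0 \<omega>) - g' (Z (snd x) (fst x) 0 \<omega>)\<bar> \<partial>N (snd x))"
    by (metis integral_abs_bound)
  also have "\<dots> \<le> dens (fst x) * (\<integral>x. \<bar>g x - g' x\<bar> \<partial>lborel)"
    by (rule Z_L1(2)[OF x', of "\<lambda>x. g x - g' x"]) (use g in simp)
  finally show ?thesis .
qed

lemma lip_bdd_continuous: assumes "lip_bdd \<phi>" shows "continuous_on UNIV \<phi>" "bounded (range \<phi>)"
  using assms bounded_lipschitz_measurable(1)[of \<phi> _ UNIV] unfolding lip_bdd_def bounded_iff by auto

text \<open>The spaces \<open>N yb\<close> for different \<open>yb\<close> are unrelated, so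
  measurability in \<open>yb\<close> cannot come from a joint construction. It is inherited from the
  expectations over \<open>X\<close> at \<open>lam = n + 1\<close>, which are measurable in time and
  position and converge pointwise.\<close>

lemma measurable_mZ_lip:
  assumes \<phi>: "lip_bdd \<phi>"
  shows "mZ \<phi> \<in> borel_measurable nu"
proof (rule borel_measurable_LIMSEQ_metric)
  fix n :: nat
  have lam: "real (Suc n) \<ge> 1" by simp
  interpret P: prob_space "M (real (Suc n))" using X_sol[OF lam] by blast
  note [measurable] = measurable_X_nu[OF lam] lip_bdd_measurable[OF \<phi>]
  show "(\<lambda>x. \<integral>\<omega>. \<phi> (X (real (Suc n)) (fst x) (real (Suc n) * snd x) \<omega>) \<partial>M (real (Suc n))) \<in> borel_measurable nu" by measurable
next
  fix x assume x: "x \<in> space nu"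
  have f1: "filterlim (\<lambda>n. real (Suc n)) at_top sequentially"
    by (rule filterlim_compose[OF filterlim_real_sequentially filterlim_Suc])
  show "(\<lambda>n. \<integral>\<omega>. \<phi> (X (real (Suc n)) (fst x) (real (Suc n) * snd x) \<omega>) \<partial>M (real (Suc n))) \<longlonglongrightarrow> mZ \<phi> x"
    unfolding mZ_def by (rule weak_limit[OF _ f1 _ _ lip_bdd_continuous[OF \<phi>]]) (use x in \<open>auto simp: space_nu\<close>)
qed

text \<open>Measurability passes from Lipschitz approximants to \<open>g\<close>, since at each
  point the error is at most \<open>dens\<close> times the L1 error; the bound by a multiple of
  \<open>dens\<close> gives integrability.\<close>

lemma integrable_mZ:
  assumes g: "integrable lborel g"
  shows "integrable nu (mZ g)"
proof -
  have "\<forall>k. \<exists>\<phi>. lip_bdd \<phi> \<and> integrable lborel \<phi> \<and> (\<integral>x. \<bar>g x - \<phi> x\<bar> \<partial>lborel) \<le> 1 / real (Suc k)"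
    using integrable_L1_lipschitz[OF g] by simp
  then obtain \<phi> where \<phi>: "\<And>k. lip_bdd (\<phi> k)" "\<And>k. integrable lborel (\<phi> k)" "\<And>k. (\<integral>x. \<bar>g x - \<phi> k x\<bar> \<partial>lborel) \<le> 1 / real (Suc k)"
    by metis
  have m[measurable]: "mZ g \<in> borel_measurable nu"
  proof (rule borel_measurable_LIMSEQ_metric[OF measurable_mZ_lip[OF \<phi>(1)]])
    fix x assume x: "x \<in> space nu"
    have d: "dens (fst x) \<ge> 0" using x by (intro dens_nonneg) (auto simp: space_nu)
    have le: "\<bar>mZ (\<phi> k) x - mZ g x\<bar> \<le> dens (fst x) * (1 / real (Suc k))" for k
      using order_trans[OF mZ_diff[OF x g \<phi>(2)] mult_left_mono[OF \<phi>(3) d]] by (simp add: abs_minus_commute)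
    have z: "(\<lambda>k. dens (fst x) * (1 / real (Suc k))) \<longlonglongrightarrow> 0"
      using tendsto_mult[OF tendsto_const[of "dens (fst x)"] LIMSEQ_inverse_real_of_nat] by (simp add: inverse_eq_divide)
    have "(\<lambda>k. mZ (\<phi> k) x - mZ g x) \<longlonglongrightarrow> 0"
      by (rule Lim_null_comparison[OF _ z]) (use le in simp)
    then show "(\<lambda>k. mZ (\<phi> k) x) \<longlonglongrightarrow> mZ g x" by (rule LIM_zero_cancel)
  qed
  have id: "integrable nu (\<lambda>x. dens (fst x) * (\<integral>x. \<bar>g x\<bar> \<partial>lborel))" using integrable_dens by simp
  show ?thesis
  proof (rule Bochner_Integration.integrable_bound[OF id m], rule AE_I2)
    fix x assume x: "x \<in> space nu"
    have "\<bar>mZ g x\<bar> \<le> dens (fst x) * (\<integral>x. \<bar>g x\<bar> \<partial>lborel)"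
      using mZ_diff[OF x g, of "\<lambda>_. 0"] by (simp add: mZ_def)
    then show "norm (mZ g x) \<le> norm (dens (fst x) * (\<integral>x. \<bar>g x\<bar> \<partial>lborel))" by simp
  qed
qed

lemma AE_nu_distinct: "AE p in nu \<Otimes>\<^sub>M nu. snd (fst p) \<noteq> snd (snd p)"
proof -
  interpret nu: finite_measure nu by (rule finite_nu)
  interpret NN: pair_sigma_finite nu nu ..
  interpret TY: pair_sigma_finite nuT nuY by (rule pair_nu)
  note [measurable] = measurable_nu
  have s: "AE q in nu. c \<noteq> snd q" for c :: real
    unfolding nu_def
  proof (rule TY.AE_pair_measure)
    show "{x \<in> space (nuT \<Otimes>\<^sub>M nuY). c \<noteq> snd x} \<in> sets (nuT \<Otimes>\<^sub>M nuY)" unfolding nu_def[symmetric] by measurable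
    have "AE y in nuY. c \<noteq> y" using AE_lborel_singleton[of c] by (subst AE_restrict_space_iff) auto
    then show "AE x in nuT. AE y in nuY. c \<noteq> snd (x, y)" by simp
  qed
  show ?thesis
  proof (rule NN.AE_pair_measure)
    show "{x \<in> space (nu \<Otimes>\<^sub>M nu). snd (fst x) \<noteq> snd (snd x)} \<in> sets (nu \<Otimes>\<^sub>M nu)" by measurable
    show "AE x in nu. AE y in nu. snd (fst (x, y)) \<noteq> snd (snd (x, y))" using s by simp
  qed
qed

lemma lip_average:
  assumes l: "\<And>n. l n \<ge> 1" "filterlim l at_top sequentially" and \<phi>: "lip_bdd \<phi>"
  shows "(\<lambda>n. \<integral>\<omega>. \<bar>(\<integral>x. \<phi> (X (l n) (fst x) (l n * snd x) \<omega>) \<partial>nu) - (\<integral>x. mZ \<phi> x \<partial>nu)\<bar> \<partial>M (l n)) \<longlonglongrightarrow> 0"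
proof -
  obtain G H where GH: "\<And>x. \<bar>\<phi> x\<bar> \<le> G" "\<And>x y. \<bar>\<phi> x - \<phi> y\<bar> \<le> H * \<bar>x - y\<bar>" using \<phi> unfolding lip_bdd_def by blast
  note [measurable] = lip_bdd_measurable[OF \<phi>] measurable_X_nu[OF l(1)]
  show ?thesis
  proof (rule mean_square_lln[where \<xi>="\<lambda>n x \<omega>. \<phi> (X (l n) (fst x) (l n * snd x) \<omega>)" and G=G, OF finite_nu])
    show "prob_space (M (l n))" for n using X_sol[OF l(1)] by blast
    show "(\<lambda>q. \<phi> (X (l n) (fst (fst q)) (l n * snd (fst q)) (snd q))) \<in> borel_measurable (nu \<Otimes>\<^sub>M M (l n))" for n by measurable
    show "\<bar>\<phi> (X (l n) (fst x) (l n * snd x) \<omega>)\<bar> \<le> G" for n x \<omega> by (rule GH)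
    show "mZ \<phi> \<in> borel_measurable nu" by (rule measurable_mZ_lip[OF \<phi>])
    show "\<bar>mZ \<phi> x\<bar> \<le> G" if x: "x \<in> space nu" for x
    proof -
      interpret prob_space "N (snd x)" using Z_sol x by (auto simp: space_nu)
      have "(\<integral>\<omega>. \<bar>\<phi> (Z (snd x) (fst x) 0 \<omega>)\<bar> \<partial>N (snd x)) \<le> (\<integral>\<omega>. G \<partial>N (snd x))"
        using GH(1) order_trans[OF abs_ge_zero GH(1)] by (intro integral_mono') auto
      then show ?thesis unfolding mZ_def by (intro order_trans[OF integral_abs_bound]) (simp add: prob_space)
    qed
    show "(\<lambda>n. \<integral>\<omega>. \<phi> (X (l n) (fst x) (l n * snd x) \<omega>) \<partial>M (l n)) \<longlonglongrightarrow> mZ \<phi> x" if x: "x \<in> space nu" for x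
      unfolding mZ_def by (rule weak_limit[OF l _ _ lip_bdd_continuous[OF \<phi>]]) (use x in \<open>auto simp: space_nu\<close>)
    show "AE p in nu \<Otimes>\<^sub>M nu. (\<lambda>n. \<integral>\<omega>. \<phi> (X (l n) (fst (fst p)) (l n * snd (fst p)) \<omega>) * \<phi> (X (l n) (fst (snd p)) (l n * snd (snd p)) \<omega>) \<partial>M (l n))
        \<longlonglongrightarrow> mZ \<phi> (fst p) * mZ \<phi> (snd p)"
      using AE_nu_distinct AE_space
    proof eventually_elim
      case (elim p)
      have p: "fst (fst p) \<in> {0<..T}" "fst (snd p) \<in> {0<..T}" "snd (fst p) \<in> {a<..<a + 1}" "snd (snd p) \<in> {a<..<a + 1}"
        using elim(2) by (auto simp: space_pair_measure space_nu)
      interpret TP: two_points T a chi f F L B M W X N V Z l "\<lambda>b. if b then snd (snd p) else snd (fst p)"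
        by (rule sequence_two_points[OF l p(3,4) elim(1)])
      show ?case using TP.expectation_product_lim[OF p(1,2) GH] by (simp add: mZ_def)
    qed
  qed
qed

text \<open>Replacing \<open>g\<close> by a Lipschitz function costs at most
  \<open>dens_total\<close> times their L1 distance, once in the average over \<open>X\<close> and
  once in the limit, uniformly in \<open>n\<close>. For the Lipschitz function the law of large
  numbers applies.\<close>

lemma average_L1:
  assumes l: "\<And>n. l n \<ge> 1" "filterlim l at_top sequentially" and g: "integrable lborel g"
  shows "(\<lambda>n. \<integral>\<omega>. \<bar>(\<integral>x. g (X (l n) (fst x) (l n * snd x) \<omega>) \<partial>nu) - (\<integral>x. mZ g x \<partial>nu)\<bar> \<partial>M (l n)) \<longlonglongrightarrow> 0"
    (is "?E g \<longlonglongrightarrow> 0")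
proof (rule LIMSEQ_I)
  fix r :: real assume r: "r > 0"
  have d0: "dens_total \<ge> 0" unfolding dens_total_def
    by (rule integral_nonneg_AE) (auto intro!: AE_I2 dens_nonneg simp: space_nu)
  define e where "e = r / (4 * (dens_total + 1))"
  have e: "e > 0" using r d0 by (simp add: e_def)
  obtain \<phi> where \<phi>: "lip_bdd \<phi>" "integrable lborel \<phi>" "(\<integral>x. \<bar>g x - \<phi> x\<bar> \<partial>lborel) \<le> e"
    using integrable_L1_lipschitz[OF g] e by blast
  let ?D = "\<integral>x. \<bar>g x - \<phi> x\<bar> \<partial>lborel"
  have D: "dens_total * ?D \<le> r / 4"
  proof -
    have "dens_total * ?D \<le> (dens_total + 1) * e" using \<phi>(3) d0 e by (intro mult_mono) (auto intro: integral_nonneg_AE)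
    also have "\<dots> = r / 4"
    proof -
      have "k * (r / (4 * k)) = r / 4" if "k > 0" for k :: real using that by simp
      from this[of "dens_total + 1"] show ?thesis unfolding e_def using d0 by linarith
    qed
    finally show ?thesis .
  qed
  have gd: "integrable lborel (\<lambda>x. g x - \<phi> x)" using g \<phi>(2) by simp
  have c: "\<bar>(\<integral>x. mZ g x \<partial>nu) - (\<integral>x. mZ \<phi> x \<partial>nu)\<bar> \<le> dens_total * ?D"
  proof -
    have i: "integrable nu (mZ g)" "integrable nu (mZ \<phi>)" by (rule integrable_mZ g \<phi>(2))+
    have id: "integrable nu (\<lambda>x. dens (fst x) * ?D)" using integrable_dens by simp
    have "(\<integral>x. mZ g x \<partial>nu) - (\<integral>x. mZ \<phi> x \<partial>nu) = (\<integral>x. mZ g x - mZ \<phi> x \<partial>nu)"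
      using i by (rule Bochner_Integration.integral_diff[symmetric])
    then have "\<bar>(\<integral>x. mZ g x \<partial>nu) - (\<integral>x. mZ \<phi> x \<partial>nu)\<bar> \<le> (\<integral>x. \<bar>mZ g x - mZ \<phi> x\<bar> \<partial>nu)" by (metis integral_abs_bound)
    also have "\<dots> \<le> (\<integral>x. dens (fst x) * ?D \<partial>nu)"
      by (rule integral_mono[OF integrable_abs[OF Bochner_Integration.integrable_diff[OF i]] id mZ_diff[OF _ g \<phi>(2)]])
    finally show ?thesis by (simp add: dens_total_def)
  qed
  have le: "?E g n \<le> ?E \<phi> n + 2 * (dens_total * ?D)" for n
  proof -
    interpret P: prob_space "M (l n)" using X_sol[OF l(1)] by blast
    interpret nu: finite_measure nu by (rule finite_nu)
    interpret pair_sigma_finite nu "M (l n)" ..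
    define Y where "Y h \<omega> = (\<integral>x. h (X (l n) (fst x) (l n * snd x) \<omega>) \<partial>nu)" for h :: "real \<Rightarrow> real" and \<omega>
    have cp: "integrable (nu \<Otimes>\<^sub>M M (l n)) (\<lambda>(x, \<omega>). h (X (l n) (fst x) (l n * snd x) \<omega>))" if "integrable lborel h" for h :: "real \<Rightarrow> real"
      using X_nu_L1(1)[OF l(1) that] by (simp add: case_prod_unfold)
    have Yi: "integrable (M (l n)) (Y h)" if "integrable lborel h" for h :: "real \<Rightarrow> real"
      unfolding Y_def[abs_def] by (rule integrable_snd[OF cp[OF that]])
    have A: "AE \<omega> in M (l n). integrable nu (\<lambda>x. h (X (l n) (fst x) (l n * snd x) \<omega>))" if "integrable lborel h" for h :: "real \<Rightarrow> real"
      by (rule AE_integrable_snd[OF cp[OF that]])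
    have abs_i: "integrable lborel (\<lambda>x. \<bar>g x - \<phi> x\<bar>)" by (rule integrable_abs[OF gd])
    have Yabs: "(\<integral>\<omega>. Y (\<lambda>x. \<bar>g x - \<phi> x\<bar>) \<omega> \<partial>M (l n)) \<le> dens_total * ?D"
      unfolding Y_def using integral_snd[OF cp[OF abs_i]] X_nu_L1(2)[OF l(1) abs_i] by (simp add: case_prod_unfold)
    have "(\<integral>\<omega>. \<bar>Y g \<omega> - (\<integral>x. mZ g x \<partial>nu)\<bar> \<partial>M (l n)) \<le>
      (\<integral>\<omega>. \<bar>Y \<phi> \<omega> - (\<integral>x. mZ \<phi> x \<partial>nu)\<bar> + Y (\<lambda>x. \<bar>g x - \<phi> x\<bar>) \<omega> + dens_total * ?D \<partial>M (l n))"
    proof (rule integral_mono_AE)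
      show "integrable (M (l n)) (\<lambda>\<omega>. \<bar>Y g \<omega> - (\<integral>x. mZ g x \<partial>nu)\<bar>)" using Yi[OF g] by simp
      show "integrable (M (l n)) (\<lambda>\<omega>. \<bar>Y \<phi> \<omega> - (\<integral>x. mZ \<phi> x \<partial>nu)\<bar> + Y (\<lambda>x. \<bar>g x - \<phi> x\<bar>) \<omega> + dens_total * ?D)"
        using Yi[OF \<phi>(2)] Yi[OF abs_i] by simp
      show "AE \<omega> in M (l n). \<bar>Y g \<omega> - (\<integral>x. mZ g x \<partial>nu)\<bar> \<le> \<bar>Y \<phi> \<omega> - (\<integral>x. mZ \<phi> x \<partial>nu)\<bar> + Y (\<lambda>x. \<bar>g x - \<phi> x\<bar>) \<omega> + dens_total * ?D"
        using A[OF g] A[OF \<phi>(2)]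
      proof eventually_elim
        case (elim \<omega>)
        have d: "Y g \<omega> - Y \<phi> \<omega> = (\<integral>x. g (X (l n) (fst x) (l n * snd x) \<omega>) - \<phi> (X (l n) (fst x) (l n * snd x) \<omega>) \<partial>nu)"
          unfolding Y_def using elim by (rule Bochner_Integration.integral_diff[symmetric])
        have "\<bar>Y g \<omega> - Y \<phi> \<omega>\<bar> \<le> Y (\<lambda>x. \<bar>g x - \<phi> x\<bar>) \<omega>" unfolding d unfolding Y_def by (rule integral_abs_bound)
        then show ?case using c by linarith
      qed
    qed
    also have "\<dots> = (\<integral>\<omega>. \<bar>Y \<phi> \<omega> - (\<integral>x. mZ \<phi> x \<partial>nu)\<bar> \<partial>M (l n)) + (\<integral>\<omega>. Y (\<lambda>x. \<bar>g x - \<phi> x\<bar>) \<omega> \<partial>M (l n)) + dens_total * ?D"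
      using Yi[OF \<phi>(2)] Yi[OF abs_i] by (simp add: P.prob_space)
    also have "\<dots> \<le> (\<integral>\<omega>. \<bar>Y \<phi> \<omega> - (\<integral>x. mZ \<phi> x \<partial>nu)\<bar> \<partial>M (l n)) + 2 * (dens_total * ?D)" using Yabs by simp
    finally show ?thesis unfolding Y_def .
  qed
  have "\<forall>\<^sub>F n in sequentially. ?E \<phi> n < r / 2"
    using order_tendstoD(2)[OF lip_average[OF l \<phi>(1)], of "r / 2"] r by simp
  then obtain n0 where n0: "\<And>n. n \<ge> n0 \<Longrightarrow> ?E \<phi> n < r / 2" unfolding eventually_sequentially by blast
  have "norm (?E g n - 0) < r" if "n \<ge> n0" for n
  proof -
    have "?E g n < r" using le[of n] n0[OF that] D by linarith
    moreover have "?E g n \<ge> 0" by (rule integral_nonneg_AE) simp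
    ultimately show ?thesis by simp
  qed
  then show "\<exists>n0. \<forall>n\<ge>n0. norm (?E g n - 0) < r" by blast
qed

lemma rescaled_average:
  fixes G :: "real \<Rightarrow> real"
  assumes lam: "lam \<ge> 1"
  shows "1 / lam * (LBINT y:{lam * a<..<lam * a + lam}. G y) = (LBINT y:{a<..<a + 1}. G (lam * y))"
proof -
  have iff: "lam * y \<in> {lam * a<..<lam * a + lam} \<longleftrightarrow> y \<in> {a<..<a + 1}" for y
  proof -
    have "lam * a + lam = lam * (a + 1)" by (simp add: distrib_left)
    then show ?thesis using lam by (simp add: mult_less_cancel_left_pos)
  qed
  have "(LBINT y:{lam * a<..<lam * a + lam}. G y) = \<bar>lam\<bar> *\<^sub>R (\<integral>y. indicator {lam * a<..<lam * a + lam} (0 + lam * y) *\<^sub>R G (0 + lam * y) \<partial>lborel)"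
    unfolding set_lebesgue_integral_def by (rule lborel_integral_real_affine) (use lam in simp)
  also have "(\<integral>y. indicator {lam * a<..<lam * a + lam} (0 + lam * y) *\<^sub>R G (0 + lam * y) \<partial>lborel) = (LBINT y:{a<..<a + 1}. G (lam * y))"
    unfolding set_lebesgue_integral_def by (intro Bochner_Integration.integral_cong) (auto simp: indicator_def iff simp del: greaterThanLessThan_iff)
  finally show ?thesis using lam by simp
qed

text \<open>Markov's inequality applied to the L1 convergence. The iterated integral of the
  statement agrees with the integral over \<open>nu\<close> for those outcomes for which the latter
  is integrable, and these are almost all.\<close>

lemma convergence_in_probability:
  assumes l: "\<And>n. l n \<ge> 1" "filterlim l at_top sequentially" and g: "integrable lborel g" and \<epsilon>: "\<epsilon> > 0"
  shows "(\<lambda>n. measure (M (l n)) {\<omega> \<in> space (M (l n)).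
            \<bar>(LBINT t:{0..T}. 1 / l n * (LBINT y:{l n * a<..<l n * a + l n}. g (X (l n) t y \<omega>)))
             - (LBINT t:{0..T}. (LBINT yb:{a<..<a + 1}. \<integral>\<omega>'. g (Z yb t 0 \<omega>') \<partial>N yb))\<bar> > \<epsilon>}) \<longlonglongrightarrow> 0"
proof -
  define c where "c = (\<integral>x. mZ g x \<partial>nu)"
  have c: "(LBINT t:{0..T}. (LBINT yb:{a<..<a + 1}. \<integral>\<omega>'. g (Z yb t 0 \<omega>') \<partial>N yb)) = c"
    unfolding c_def integral_nu[OF integrable_mZ[OF g]] by (simp add: mZ_def)
  let ?Y = "\<lambda>n \<omega>. \<integral>x. g (X (l n) (fst x) (l n * snd x) \<omega>) \<partial>nu"
  have le: "measure (M (l n)) {\<omega> \<in> space (M (l n)).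
            \<bar>(LBINT t:{0..T}. 1 / l n * (LBINT y:{l n * a<..<l n * a + l n}. g (X (l n) t y \<omega>))) - c\<bar> > \<epsilon>}
       \<le> (\<integral>\<omega>. \<bar>?Y n \<omega> - c\<bar> \<partial>M (l n)) / \<epsilon>" for n
  proof -
    interpret P: prob_space "M (l n)" using X_sol[OF l(1)] by blast
    interpret nu: finite_measure nu by (rule finite_nu)
    interpret pair_sigma_finite nu "M (l n)" ..
    have cp: "integrable (nu \<Otimes>\<^sub>M M (l n)) (\<lambda>(x, \<omega>). g (X (l n) (fst x) (l n * snd x) \<omega>))"
      using X_nu_L1(1)[OF l(1) g] by (simp add: case_prod_unfold)
    have Yi: "integrable (M (l n)) (?Y n)" by (rule integrable_snd[OF cp])
    note [measurable] = borel_measurable_integrable[OF Yi]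
    have "measure (M (l n)) {\<omega> \<in> space (M (l n)).
            \<bar>(LBINT t:{0..T}. 1 / l n * (LBINT y:{l n * a<..<l n * a + l n}. g (X (l n) t y \<omega>))) - c\<bar> > \<epsilon>}
       \<le> measure (M (l n)) {\<omega> \<in> space (M (l n)). \<bar>?Y n \<omega> - c\<bar> \<ge> \<epsilon>}"
    proof (rule P.finite_measure_mono_AE) \<comment> \<open>the event on the left need not be measurable\<close>
      show "AE \<omega> in M (l n). \<omega> \<in> {\<omega> \<in> space (M (l n)).
            \<bar>(LBINT t:{0..T}. 1 / l n * (LBINT y:{l n * a<..<l n * a + l n}. g (X (l n) t y \<omega>))) - c\<bar> > \<epsilon>} \<longrightarrow>
          \<omega> \<in> {\<omega> \<in> space (M (l n)). \<bar>?Y n \<omega> - c\<bar> \<ge> \<epsilon>}"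
        using AE_integrable_snd[OF cp]
      proof eventually_elim
        case (elim \<omega>)
        have "?Y n \<omega> = (LBINT t:{0..T}. 1 / l n * (LBINT y:{l n * a<..<l n * a + l n}. g (X (l n) t y \<omega>)))"
          unfolding integral_nu[OF elim] by (simp only: rescaled_average[OF l(1)] fst_conv snd_conv)
        then show ?case by auto
      qed
    qed measurable
    also have "\<dots> \<le> (\<integral>\<omega>. \<bar>?Y n \<omega> - c\<bar> \<partial>M (l n)) / \<epsilon>"
      by (rule integral_Markov_inequality_measure[where A="space (M (l n))"]) (use Yi \<epsilon> in auto)
    finally show ?thesis .
  qed
  have lim: "(\<lambda>n. (\<integral>\<omega>. \<bar>?Y n \<omega> - c\<bar> \<partial>M (l n)) / \<epsilon>) \<longlonglongrightarrow> 0"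
    using tendsto_divide[OF average_L1[OF l g] tendsto_const, of \<epsilon>] \<epsilon> unfolding c_def by simp
  show ?thesis unfolding c
    by (rule tendsto_sandwich[OF _ _ tendsto_const lim]) (use le in \<open>auto simp: measure_nonneg\<close>)
qed

end

section \<open>The data of the equation\<close>

lemma C3_bounded_lipschitz:
  assumes "C3 f"
  shows "\<exists>F L. (\<forall>x. \<bar>f x\<bar> \<le> F) \<and> (\<forall>x y. \<bar>f x - f y\<bar> \<le> L * \<bar>x - y\<bar>)"
proof -
  obtain f' where f': "\<And>x. (f has_real_derivative f' x) (at x)" and bd: "bounded (range f)" "bounded (range f')"
    using assms unfolding C3_def by blast
  obtain F L where F: "\<And>x. \<bar>f x\<bar> \<le> F" and L: "\<And>x. \<bar>f' x\<bar> \<le> L" using bd by (auto simp: bounded_iff)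
  have "norm (f x - f y) \<le> L * norm (x - y)" for x y
    by (rule field_differentiable_bound[of UNIV f f' L]) (use f' L in auto)
  then show ?thesis using F by auto
qed

text \<open>For \<open>s \<ge> 1\<close> there is a first derivative in L2, hence in L1 because the
  interval is bounded. As an indefinite integral of it, \<open>chi\<close> is bounded, and it is
  continuous by dominated convergence.\<close>

lemma sobolev_H_bounded_continuous:
  assumes chi: "sobolev_H s a b chi" and s: "s \<ge> 1"
  shows "\<exists>B. \<forall>y\<in>{a<..<b}. \<bar>chi y\<bar> \<le> B" "continuous_on {a<..<b} chi"
proof -
  define m where "m = nat \<lfloor>s\<rfloor>"
  define c where "c = (a + b) / 2"
  have m: "m \<ge> 1" using s by (simp add: m_def le_nat_iff)
  have ab: "a < b" using chi by (simp add: sobolev_H_def)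
  obtain d :: "nat \<Rightarrow> real \<Rightarrow> real" where d0: "\<And>x. x \<in> {a<..<b} \<Longrightarrow> d 0 x = chi x"
    and dm: "\<And>k. k \<le> m \<Longrightarrow> set_borel_measurable lborel {a<..<b} (d k) \<and> set_integrable lborel {a<..<b} (\<lambda>x. (d k x)^2)"
    and ac: "\<And>k x. k < m \<Longrightarrow> x \<in> {a<..<b} \<Longrightarrow> d k x = d k c + (LBINT y=c..x. d (Suc k) y)"
    using chi unfolding sobolev_H_def Let_def m_def c_def by blast
  define g where "g y = indicator {a<..<b} y *\<^sub>R d 1 y" for y
  have c: "c \<in> {a<..<b}" using ab by (simp add: c_def)
  have [measurable]: "g \<in> borel_measurable borel" using dm[of 1] m unfolding set_borel_measurable_def g_def[abs_def] by simp
  have gi: "integrable lborel g"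
  proof (rule Bochner_Integration.integrable_bound)
    show "integrable lborel (\<lambda>y. indicator {a<..<b} y + indicator {a<..<b} y *\<^sub>R (d 1 y)^2)"
      using dm[of 1] m ab unfolding set_integrable_def by (intro Bochner_Integration.integrable_add) auto
    have "\<bar>d 1 y\<bar> \<le> 1 + (d 1 y)\<^sup>2" for y
      using sum_squares_bound[of "\<bar>d 1 y\<bar>" 1] by simp
    then show "AE y in lborel. norm (g y) \<le> norm (indicator {a<..<b} y + indicator {a<..<b} y *\<^sub>R (d 1 y)^2 :: real)"
      by (auto simp: g_def split: split_indicator)
  qed measurable
  \<comment> \<open>Integration of the zero extension \<open>g\<close> from minus infinity gives one
    primitive for both orders of \<open>c\<close> and \<open>x\<close>, free of the orientation of
    the interval integral.\<close>
  define Gf where "Gf x = (\<integral>y. indicator {..x} y *\<^sub>R g y \<partial>lborel)" for x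
  have ii: "integrable lborel (\<lambda>y. indicator {..x} y *\<^sub>R g y)" for x
    using integrable_mult_indicator[OF _ gi, of "{..x}"] by simp
  have chi_eq: "chi x = chi c + (Gf x - Gf c)" if x: "x \<in> {a<..<b}" for x
  proof -
    have "(LBINT y=c..x. d 1 y) = Gf x - Gf c"
    proof (cases "c \<le> x")
      case True
      have "(LBINT y=c..x. d 1 y) = (\<integral>y. indicator {c<..<x} y *\<^sub>R d 1 y \<partial>lborel)"
        using True by (simp add: interval_lebesgue_integral_def set_lebesgue_integral_def)
      also have "\<dots> = (\<integral>y. indicator {..x} y *\<^sub>R g y - indicator {..c} y *\<^sub>R g y \<partial>lborel)"
      proof (rule integral_cong_AE)
        have eq: "indicator {c<..<x} y *\<^sub>R d 1 y = indicator {c<..<x} y *\<^sub>R g y" for y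
          using c x by (auto simp: g_def split: split_indicator)
        show "(\<lambda>y. indicator {c<..<x} y *\<^sub>R d 1 y) \<in> borel_measurable lborel" unfolding eq by measurable
        show "AE y in lborel. indicator {c<..<x} y *\<^sub>R d 1 y = indicator {..x} y *\<^sub>R g y - indicator {..c} y *\<^sub>R g y"
          unfolding eq using AE_lborel_singleton[of x] by eventually_elim (use True in \<open>auto split: split_indicator\<close>)
      qed measurable
      also have "\<dots> = Gf x - Gf c" unfolding Gf_def by (rule Bochner_Integration.integral_diff[OF ii ii])
      finally show ?thesis .
    next
      case False
      have "(LBINT y=c..x. d 1 y) = - (\<integral>y. indicator {x<..<c} y *\<^sub>R d 1 y \<partial>lborel)"
        using False by (simp add: interval_lebesgue_integral_def set_lebesgue_integral_def)
      also have "(\<integral>y. indicator {x<..<c} y *\<^sub>R d 1 y \<partial>lborel) = (\<integral>y. indicator {..c} y *\<^sub>R g y - indicator {..x} y *\<^sub>R g y \<partial>lborel)"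
      proof (rule integral_cong_AE)
        have eq: "indicator {x<..<c} y *\<^sub>R d 1 y = indicator {x<..<c} y *\<^sub>R g y" for y
          using c x by (auto simp: g_def split: split_indicator)
        show "(\<lambda>y. indicator {x<..<c} y *\<^sub>R d 1 y) \<in> borel_measurable lborel" unfolding eq by measurable
        show "AE y in lborel. indicator {x<..<c} y *\<^sub>R d 1 y = indicator {..c} y *\<^sub>R g y - indicator {..x} y *\<^sub>R g y"
          unfolding eq using AE_lborel_singleton[of c] by eventually_elim (use False in \<open>auto split: split_indicator\<close>)
      qed measurable
      also have "\<dots> = Gf c - Gf x" unfolding Gf_def by (rule Bochner_Integration.integral_diff[OF ii ii])
      finally show ?thesis by simp
    qed
    then show ?thesis using ac[of 0 x] m x d0[OF x] d0[OF c] by simp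
  qed
  have Gb: "\<bar>Gf x\<bar> \<le> (\<integral>y. \<bar>g y\<bar> \<partial>lborel)" for x
  proof -
    have "\<bar>Gf x\<bar> \<le> (\<integral>y. \<bar>indicator {..x} y *\<^sub>R g y\<bar> \<partial>lborel)" unfolding Gf_def by (rule integral_abs_bound)
    also have "\<dots> \<le> (\<integral>y. \<bar>g y\<bar> \<partial>lborel)"
      by (rule integral_mono[OF integrable_abs[OF ii] integrable_abs[OF gi]]) (auto split: split_indicator)
    finally show ?thesis .
  qed
  have "\<bar>chi y\<bar> \<le> \<bar>chi c\<bar> + 2 * (\<integral>y. \<bar>g y\<bar> \<partial>lborel)" if "y \<in> {a<..<b}" for y
    using chi_eq[OF that] Gb[of y] Gb[of c] by linarith
  then show "\<exists>B. \<forall>y\<in>{a<..<b}. \<bar>chi y\<bar> \<le> B" by blast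
  have Gc: "isCont Gf x" for x
    unfolding isCont_def tendsto_at_iff_sequentially comp_def
  proof (intro allI impI)
    fix X :: "nat \<Rightarrow> real" assume X: "X \<longlonglongrightarrow> x"
    show "(\<lambda>n. Gf (X n)) \<longlonglongrightarrow> Gf x"
      unfolding Gf_def
    proof (rule integral_dominated_convergence[where w="\<lambda>y. \<bar>g y\<bar>"])
      show "AE y in lborel. (\<lambda>n. indicator {..X n} y *\<^sub>R g y) \<longlonglongrightarrow> indicator {..x} y *\<^sub>R g y"
        using AE_lborel_singleton[of x]
      proof eventually_elim
        case (elim y)
        have "\<forall>\<^sub>F n in sequentially. indicator {..X n} y = (indicator {..x} y :: real)"
        proof (cases "y < x")
          case True
          show ?thesis using order_tendstoD(1)[OF X True] by eventually_elim (use True in \<open>auto split: split_indicator\<close>)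
        next
          case False
          then have "x < y" using elim by simp
          from order_tendstoD(2)[OF X this] show ?thesis by eventually_elim (use \<open>x < y\<close> in \<open>auto split: split_indicator\<close>)
        qed
        then have "\<forall>\<^sub>F n in sequentially. indicator {..X n} y *\<^sub>R g y = indicator {..x} y *\<^sub>R g y"
          by eventually_elim simp
        then show ?case by (rule tendsto_eventually)
      qed
      show "AE y in lborel. norm (indicator {..X n} y *\<^sub>R g y) \<le> \<bar>g y\<bar>" for n
        by (rule AE_I2) (auto split: split_indicator)
    qed (use gi in auto)
  qed
  have "continuous_on {a<..<b} (\<lambda>x. chi c + (Gf x - Gf c))"
    by (intro continuous_intros continuous_at_imp_continuous_on ballI Gc)
  then show "continuous_on {a<..<b} chi"
    by (rule continuous_on_cong[THEN iffD2, OF refl, rotated]) (rule chi_eq)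
qed

theorem mainTheorem1:
  fixes T a s\<^sub>0 :: real
    and chi f\<^sub>0 :: "real \<Rightarrow> real"
    and M :: "real \<Rightarrow> 'a measure"
    and W :: "real \<Rightarrow> (real \<times> real \<Rightarrow> real) \<Rightarrow> 'a \<Rightarrow> real"
    and X :: "real \<Rightarrow> real \<Rightarrow> real \<Rightarrow> 'a \<Rightarrow> real"
    and N :: "real \<Rightarrow> 'b measure"
    and V :: "real \<Rightarrow> (real \<times> real \<Rightarrow> real) \<Rightarrow> 'b \<Rightarrow> real"
    and Z :: "real \<Rightarrow> real \<Rightarrow> real \<Rightarrow> 'b \<Rightarrow> real"
  assumes T_pos: "T > 0"
    and s0: "s\<^sub>0 > 3 / 2"
    and chi: "sobolev_H s\<^sub>0 a (a + 1) chi"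
    and f0: "C3 f\<^sub>0"
    and X_sol: "\<And>lam. lam \<ge> 1 \<Longrightarrow>
       prob_space (M lam) \<and>
       isonormal (M lam) ({0..T} \<times> {lam * a<..<lam * a + lam}) (W lam) \<and>
       mild_solution (M lam) T {lam * a<..<lam * a + lam} (neumann_kernel (lam * a) (lam * a + lam))
         (\<lambda>y. chi (y / lam)) f\<^sub>0 (W lam) (X lam)"
    and Z_sol: "\<And>yb. yb \<in> {a<..<a + 1} \<Longrightarrow>
       prob_space (N yb) \<and>
       isonormal (N yb) ({0..T} \<times> UNIV) (V yb) \<and>
       mild_solution (N yb) T UNIV heat_kernel (\<lambda>_. chi yb) f\<^sub>0 (V yb) (Z yb)"
  shows
    "(\<forall>yb\<in>{a<..<a + 1}. \<forall>t\<in>{0..T}. \<forall>h :: real \<Rightarrow> real.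
        continuous_on UNIV h \<and> bounded (range h) \<longrightarrow>
        ((\<lambda>lam. \<integral>\<omega>. h (X lam t (lam * yb) \<omega>) \<partial>(M lam))
           \<longlongrightarrow> (\<integral>\<omega>. h (Z yb t 0 \<omega>) \<partial>(N yb))) at_top)
     \<and>
     (\<forall>g :: real \<Rightarrow> real. integrable lborel g \<longrightarrow>
        (\<forall>\<epsilon>>0. ((\<lambda>lam. measure (M lam) {\<omega> \<in> space (M lam).
            \<bar>set_lebesgue_integral lborel {0..T} (\<lambda>t.
                 1 / lam * set_lebesgue_integral lborel {lam * a<..<lam * a + lam} (\<lambda>y. g (X lam t y \<omega>)))
             - set_lebesgue_integral lborel {0..T} (\<lambda>t.
                 set_lebesgue_integral lborel {a<..<a + 1} (\<lambda>yb.
                   \<integral>\<omega>'. g (Z yb t 0 \<omega>') \<partial>(N yb)))\<bar> > \<epsilon>})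
          \<longlongrightarrow> 0) at_top))"
proof -
  have s1: "s\<^sub>0 \<ge> 1" using s0 by simp
  obtain F L where FL: "\<And>x. \<bar>f\<^sub>0 x\<bar> \<le> F" "\<And>x y. \<bar>f\<^sub>0 x - f\<^sub>0 y\<bar> \<le> L * \<bar>x - y\<bar>"
    using C3_bounded_lipschitz[OF f0] by blast
  obtain B where B: "\<And>y. y \<in> {a<..<a + 1} \<Longrightarrow> \<bar>chi y\<bar> \<le> B"
    using sobolev_H_bounded_continuous(1)[OF chi s1] by blast
  interpret setting T a chi f\<^sub>0 F L B M W X N V Z
    by (rule setting.intro) (fact T_pos FL B sobolev_H_bounded_continuous(2)[OF chi s1] X_sol Z_sol)+
  show ?thesis
  proof (intro conjI ballI allI impI)
    fix yb t and h :: "real \<Rightarrow> real"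
    assume "yb \<in> {a<..<a + 1}" "t \<in> {0..T}" "continuous_on UNIV h \<and> bounded (range h)"
    then show "((\<lambda>lam. \<integral>\<omega>. h (X lam t (lam * yb) \<omega>) \<partial>M lam) \<longlongrightarrow> (\<integral>\<omega>. h (Z yb t 0 \<omega>) \<partial>N yb)) at_top"
      by (intro tendsto_at_top_via_sequences weak_limit) auto
  next
    fix g :: "real \<Rightarrow> real" and \<epsilon> :: real
    assume "integrable lborel g" "\<epsilon> > 0"
    then show "((\<lambda>lam. measure (M lam) {\<omega> \<in> space (M lam).
            \<bar>set_lebesgue_integral lborel {0..T} (\<lambda>t.
                 1 / lam * set_lebesgue_integral lborel {lam * a<..<lam * a + lam} (\<lambda>y. g (X lam t y \<omega>)))
             - set_lebesgue_integral lborel {0..T} (\<lambda>t.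
                 set_lebesgue_integral lborel {a<..<a + 1} (\<lambda>yb.
                   \<integral>\<omega>'. g (Z yb t 0 \<omega>') \<partial>(N yb)))\<bar> > \<epsilon>}) \<longlongrightarrow> 0) at_top"
      by (intro tendsto_at_top_via_sequences convergence_in_probability)
  qed
qed

end
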